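(* Let $n\in\mathbb Z$, let $X\subset\mathbb R$ be locally finite and bi-infinite and satisfy condition (X$n$), and let $V:\mathbb R\to\mathbb R$ satisfy conditions (V1) and (V2) (all conditions and notation are spelled out in the context). Then the following holds: (a) $\mathcal G_n$ contains a single Gibbs measure $\mu_n$. (b) $\mu_n$-almost every permutation has exactly $|n|$ infinite cycles. (c) For any $\eta\in\Omega_X$ with $F(\eta)=n$ and any increasing sequence of finite subsets $\Lambda\uparrow X$ (i.e. with union $X$), $\mu_n$ is the weak limit of the specifications $\gamma_\Lambda(\cdot|\eta)$. In particular, if $X$ (locally finite and bi-infinite) satisfies (X$n$) for every $n\in\mathbb Z$ and $V$ satisfies (V1) and (V2), then $$\mathcal G=\Bigl\{\sum_{n\in\mathbb Z}c_n\mu_n:\ c_n\ge 0,\ \sum_{n\in\mathbb Z}c_n=1\Bigr\}.$$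
   Context: Point sets. $X\subset\mathbb R$ is locally finite if every bounded subset of $X$ is finite, and bi-infinite if it is unbounded above and below. For $a\in\mathbb R$ and $n\ge1$, $a_n$ and $a_{-n}$ denote the $n$-th point of $X$ lying strictly to the right, respectively strictly to the left, of $a$; if $a\in X$ then $a_0:=a$. $X^\star:=\{\frac{x+x_1}{2}: x\in X\}$ is the set of midpoints of consecutive points of $X$. $\Lambda\Subset X$ means $\Lambda$ is a finite subset of $X$; $\Lambda^c:=X\setminus\Lambda$. Conditions on $X$. For $n\in\mathbb Z$ and $a\in X^\star$ let $\Lambda(a,n):=\{a_{-|n|-1},\dots,a_{|n|+1}\}$, let $c_s(a,n)$ be the minimal $c\ge1$ such that consecutive points of $\Lambda(a,n)$ have distances in $[c^{-1},c]$, and let $c_g(a):=\inf\{c\ge0:\ \#\{x\in X:0<|x-a|\le t\}\le ct\text{ for all }t>0\}$ ($\inf\emptyset=\infty$). Condition (X$n$): there is $c_n<\infty$ such that the set of $a\in X^\star$ with $c_s(a,n)\le c_n$ and $c_g(a)\le c_n$ is bi-infinite (unbounded above and below). Conditions on $V$. (V1): $V$ is symmetric ($V(x)=V(-x)$) and strictly convex. (V2): for every $d>0$, $\psi_d(x):=\frac{V(x)+V(0)-2V((x+d)/2)}{x\log x}\to\infty$ as $x\to\infty$. Permutations and flow. $\Omega_X$ is the set of all bijections $\sigma:X\to X$. For $a\in X^\star$ let $F_a^+(\sigma):=\#\{x\in X: x<a<\sigma(x)\}$, $F_a^-(\sigma):=\#\{x\in X:\sigma(x)<a<x\}$, and $F_a(\sigma):=F_a^+(\sigma)-F_a^-(\sigma)$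 if both are finite, $F_a(\sigma):=\infty$ otherwise. The value $F_a(\sigma)$ does not depend on $a\in X^\star$; the common value is the flow $F(\sigma)\in\mathbb Z\cup\{\infty\}$. An infinite cycle of $\sigma$ is an infinite orbit $\{\sigma^k(x):k\in\mathbb Z\}$. Gibbs measures. $\Omega_X$ carries the smallest topology making all maps $\sigma\mapsto\sigma(x)$ and $\sigma\mapsto\sigma^{-1}(x)$, $x\in X$, continuous ($X$ discrete), and $\mathcal F_X$ is its Borel $\sigma$-algebra. For $\Lambda\Subset X$: $\sigma\sim_\Lambda\eta$ iff $\sigma(x)=\eta(x)$ and $\sigma^{-1}(x)=\eta^{-1}(x)$ for all $x\in\Lambda^c$; $H_\Lambda(\sigma):=\sum_{x\in\Lambda\cap\sigma^{-1}(\Lambda)}V(\sigma(x)-x)$; and $\gamma_\Lambda(\cdot|\eta)$ is the discrete probability measure on $\Omega_X$ with $\gamma_\Lambda(\{\sigma\}|\eta)=\frac1{Z_\Lambda(\eta)}e^{-H_\Lambda(\sigma)}1_{\{\sigma\sim_\Lambda\eta\}}$, $Z_\Lambda(\eta):=\sum_{\sigma\sim_\Lambda\eta}e^{-H_\Lambda(\sigma)}$. A Gibbs measure is a probability measure $\mu$ on $(\Omega_X,\mathcal F_X)$ with $E_\mu(\gamma_\Lambda(A|\cdot))=\mu(A)$ for all $A\in\mathcal F_X$ and $\Lambda\Subset X$. $\mathcal G$ is the set of Gibbs measures and $\mathcal G_n:=\{\mu\in\mathcal G:\mu(F=n)=1\}$. *)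

theory Defs
  imports "HOL-Probability.Probability" "HOL-Library.Extended"
begin

definition locally_finite_set :: "real set \<Rightarrow> bool" where
  "locally_finite_set X \<longleftrightarrow> (\<forall>B. B \<subseteq> X \<longrightarrow> bounded B \<longrightarrow> finite B)"

definition bi_infinite :: "real set \<Rightarrow> bool" where
  "bi_infinite X \<longleftrightarrow> \<not> bdd_above X \<and> \<not> bdd_below X"

text \<open>\<open>nbr X a k\<close> is the point written $a_k$. It is only meaningful for \<open>k = 0\<close> if \<open>a \<in> X\<close>.\<close>

definition nbr :: "real set \<Rightarrow> real \<Rightarrow> int \<Rightarrow> real" where
  "nbr X a k =
     (if k > 0 then (THE y. y \<in> X \<and> a < y \<and> card {x \<in> X. a < x \<and> x \<le> y} = nat k)
      else if k < 0 then (THE y. y \<in> X \<and> y < a \<and> card {x \<in> X. y \<le> x \<and> x < a} = nat (- k))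
      else a)"

definition midpoints :: "real set \<Rightarrow> real set" where
  "midpoints X = {(x + nbr X x 1) / 2 | x. x \<in> X}"

text \<open>The index 0 is left out, since a midpoint \<open>a\<close> is not itself a point of \<open>X\<close>.\<close>

definition window :: "real set \<Rightarrow> real \<Rightarrow> int \<Rightarrow> real set" where
  "window X a n = nbr X a ` ({- \<bar>n\<bar> - 1 .. \<bar>n\<bar> + 1} - {0})"

definition consecutive :: "real set \<Rightarrow> real \<Rightarrow> real \<Rightarrow> bool" where
  "consecutive A x y \<longleftrightarrow> x \<in> A \<and> y \<in> A \<and> x < y \<and> (\<forall>z\<in>A. \<not> (x < z \<and> z < y))"

definition c_s :: "real set \<Rightarrow> real \<Rightarrow> int \<Rightarrow> real" where
  "c_s X a n =
     (LEAST c. 1 \<le> c \<and> (\<forall>x y. consecutive (window X a n) x y \<longrightarrow> y - x \<in> {inverse c .. c}))"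

definition c_g :: "real set \<Rightarrow> real \<Rightarrow> ereal" where
  "c_g X a =
     Inf {ereal c | c. 0 \<le> c \<and> (\<forall>t>0. real (card {x \<in> X. 0 < \<bar>x - a\<bar> \<and> \<bar>x - a\<bar> \<le> t}) \<le> c * t)}"

definition condX :: "real set \<Rightarrow> int \<Rightarrow> bool" where
  "condX X n \<longleftrightarrow> (\<exists>c::real. bi_infinite {a \<in> midpoints X. c_s X a n \<le> c \<and> c_g X a \<le> ereal c})"

definition strictly_convex :: "(real \<Rightarrow> real) \<Rightarrow> bool" where
  "strictly_convex V \<longleftrightarrow>
     (\<forall>x y t. x \<noteq> y \<longrightarrow> 0 < t \<longrightarrow> t < 1 \<longrightarrow>
        V ((1 - t) * x + t * y) < (1 - t) * V x + t * V y)"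

definition condV1 :: "(real \<Rightarrow> real) \<Rightarrow> bool" where
  "condV1 V \<longleftrightarrow> (\<forall>x. V (- x) = V x) \<and> strictly_convex V"

definition psi :: "(real \<Rightarrow> real) \<Rightarrow> real \<Rightarrow> real \<Rightarrow> real" where
  "psi V d x = (V x + V 0 - 2 * V ((x + d) / 2)) / (x * ln x)"

definition condV2 :: "(real \<Rightarrow> real) \<Rightarrow> bool" where
  "condV2 V \<longleftrightarrow> (\<forall>d>0. filterlim (psi V d) at_top at_top)"

text \<open>A bijection of \<open>X\<close> is represented by its extension to the real line by the identity,
  so that \<open>inv\<close> is the inverse bijection.\<close>

definition Perms :: "real set \<Rightarrow> (real \<Rightarrow> real) set" where
  "Perms X = {\<sigma>. \<sigma> permutes X}"

definition flow_pos :: "real set \<Rightarrow> real \<Rightarrow> (real \<Rightarrow> real) \<Rightarrow> real set" where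
  "flow_pos X a \<sigma> = {x \<in> X. x < a \<and> a < \<sigma> x}"

definition flow_neg :: "real set \<Rightarrow> real \<Rightarrow> (real \<Rightarrow> real) \<Rightarrow> real set" where
  "flow_neg X a \<sigma> = {x \<in> X. \<sigma> x < a \<and> a < x}"

definition flow_at :: "real set \<Rightarrow> real \<Rightarrow> (real \<Rightarrow> real) \<Rightarrow> int extended" where
  "flow_at X a \<sigma> =
     (if finite (flow_pos X a \<sigma>) \<and> finite (flow_neg X a \<sigma>)
      then Fin (int (card (flow_pos X a \<sigma>)) - int (card (flow_neg X a \<sigma>)))
      else Pinf)"

definition flow :: "real set \<Rightarrow> (real \<Rightarrow> real) \<Rightarrow> int extended" where
  "flow X \<sigma> = (THE v. \<forall>a\<in>midpoints X. flow_at X a \<sigma> = v)"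

text \<open>The two-sided orbit; the \<open>orbit\<close> of the library is only the forward one.\<close>

definition full_orbit :: "(real \<Rightarrow> real) \<Rightarrow> real \<Rightarrow> real set" where
  "full_orbit \<sigma> x = {(\<sigma> ^^ k) x | k. True} \<union> {(inv \<sigma> ^^ k) x | k. True}"

definition infinite_cycles :: "real set \<Rightarrow> (real \<Rightarrow> real) \<Rightarrow> real set set" where
  "infinite_cycles X \<sigma> = {C. \<exists>x\<in>X. C = full_orbit \<sigma> x \<and> infinite C}"

text \<open>The subbasis consists of the preimages of the open, that is arbitrary, subsets of the
  discrete space \<open>X\<close>.\<close>

definition perm_topology :: "real set \<Rightarrow> (real \<Rightarrow> real) topology" where
  "perm_topology X = topology_generated_by
     ({{\<sigma> \<in> Perms X. \<sigma> x \<in> U} | x U. x \<in> X \<and> U \<subseteq> X} \<union>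
      {{\<sigma> \<in> Perms X. inv \<sigma> x \<in> U} | x U. x \<in> X \<and> U \<subseteq> X})"

definition perm_borel :: "real set \<Rightarrow> (real \<Rightarrow> real) measure" where
  "perm_borel X = sigma (Perms X) {U. openin (perm_topology X) U}"

definition agree_outside ::
    "real set \<Rightarrow> real set \<Rightarrow> (real \<Rightarrow> real) \<Rightarrow> (real \<Rightarrow> real) \<Rightarrow> bool" where
  "agree_outside X \<Lambda> \<sigma> \<eta> \<longleftrightarrow> (\<forall>x \<in> X - \<Lambda>. \<sigma> x = \<eta> x \<and> inv \<sigma> x = inv \<eta> x)"

definition hamiltonian :: "(real \<Rightarrow> real) \<Rightarrow> real set \<Rightarrow> (real \<Rightarrow> real) \<Rightarrow> real" where
  "hamiltonian V \<Lambda> \<sigma> = (\<Sum>x \<in> {x \<in> \<Lambda>. \<sigma> x \<in> \<Lambda>}. V (\<sigma> x - x))"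

text \<open>A sum over a finite set: for finite \<open>\<Lambda>\<close> only finitely many permutations agree with
  \<open>\<eta>\<close> outside \<open>\<Lambda>\<close>.\<close>

definition partition_function ::
    "real set \<Rightarrow> (real \<Rightarrow> real) \<Rightarrow> real set \<Rightarrow> (real \<Rightarrow> real) \<Rightarrow> real" where
  "partition_function X V \<Lambda> \<eta> =
     (\<Sum>\<sigma> \<in> {\<sigma> \<in> Perms X. agree_outside X \<Lambda> \<sigma> \<eta>}. exp (- hamiltonian V \<Lambda> \<sigma>))"

text \<open>The discrete measure with the stated point masses, restricted (by \<open>distr\<close> along the
  identity) from all subsets of \<open>Perms X\<close> to the Borel sets.\<close>

definition spec ::
    "real set \<Rightarrow> (real \<Rightarrow> real) \<Rightarrow> real set \<Rightarrow> (real \<Rightarrow> real) \<Rightarrow> (real \<Rightarrow> real) measure" where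
  "spec X V \<Lambda> \<eta> =
     distr
       (point_measure (Perms X)
          (\<lambda>\<sigma>. ennreal (1 / partition_function X V \<Lambda> \<eta> * exp (- hamiltonian V \<Lambda> \<sigma>)
                          * (if agree_outside X \<Lambda> \<sigma> \<eta> then 1 else 0))))
       (perm_borel X) (\<lambda>\<sigma>. \<sigma>)"

definition gibbs :: "real set \<Rightarrow> (real \<Rightarrow> real) \<Rightarrow> (real \<Rightarrow> real) measure set" where
  "gibbs X V = {\<mu>. sets \<mu> = sets (perm_borel X) \<and> prob_space \<mu> \<and>
     (\<forall>A \<in> sets (perm_borel X). \<forall>\<Lambda>. finite \<Lambda> \<longrightarrow> \<Lambda> \<subseteq> X \<longrightarrow>
        (\<integral>\<^sup>+ \<eta>. emeasure (spec X V \<Lambda> \<eta>) A \<partial>\<mu>) = emeasure \<mu> A)}"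

definition gibbs_flow ::
    "real set \<Rightarrow> (real \<Rightarrow> real) \<Rightarrow> int \<Rightarrow> (real \<Rightarrow> real) measure set" where
  "gibbs_flow X V n =
     {\<mu> \<in> gibbs X V. emeasure \<mu> {\<sigma> \<in> Perms X. flow X \<sigma> = Fin n} = 1}"

text \<open>The measure $\mu_n$, meaningful when \<open>gibbs_flow X V n\<close> is a singleton.\<close>

definition mu :: "real set \<Rightarrow> (real \<Rightarrow> real) \<Rightarrow> int \<Rightarrow> (real \<Rightarrow> real) measure" where
  "mu X V n = (THE \<mu>. \<mu> \<in> gibbs_flow X V n)"

definition weak_limit ::
    "'a topology \<Rightarrow> (nat \<Rightarrow> 'a measure) \<Rightarrow> 'a measure \<Rightarrow> bool" where
  "weak_limit T N M \<longleftrightarrow>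
     (\<forall>f :: 'a \<Rightarrow> real. continuous_map T euclideanreal f \<longrightarrow> bounded (f ` topspace T) \<longrightarrow>
        (\<lambda>k. integral\<^sup>L (N k) f) \<longlonglongrightarrow> integral\<^sup>L M f)"

definition mixture ::
    "real set \<Rightarrow> (int \<Rightarrow> real) \<Rightarrow> (int \<Rightarrow> (real \<Rightarrow> real) measure) \<Rightarrow> (real \<Rightarrow> real) measure" where
  "mixture X c M =
     measure_of (Perms X) (sets (perm_borel X))
       (\<lambda>A. \<Sum>\<^sub>\<infinity>n\<in>UNIV. ennreal (c n) * emeasure (M n) A)"

end

theory Submission
  imports Defs "HOL-Library.Diagonal_Subsequence"
begin

text \<open>
  The whole theorem comes out of one elementary move. If two points \<open>x < y\<close> are sent to \<open>u\<close> and
  \<open>v\<close> with \<open>v < u\<close>, then exchanging the two targets lowers the energy, because \<open>V\<close> is strictly convex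
  (\<open>uncross_less\<close>). If moreover \<open>u\<close> lies to the right and \<open>v\<close> to the left of a midpoint \<open>a\<close>, at a
  distance bounded from below, then the gain is at least \<open>gap (a - x) + gap (y - a)\<close>, where \<open>gap t\<close> is an increment of \<open>V\<close> over an interval
  of fixed length around \<open>t\<close> (\<open>uncross_gain\<close>). By (V2) it outgrows every multiple of \<open>ln t\<close>, of which
  \<open>3 * ln t\<close> is used (\<open>gap_growth\<close>), whereas the points of \<open>X\<close> around a good midpoint grow at most
  linearly in number. Hence the sums over possible exchanges that appear below converge.

  Tightness. Let the flow be \<open>n\<close> and let \<open>a\<close> be a midpoint that is good in the sense of condition
  (X\<open>n\<close>). A jump across \<open>a\<close> that starts very far from \<open>a\<close> always has a partner, landing on the side
  that the jump leaves, with which it can be exchanged: otherwise the flow would exceed \<open>\<bar>n\<bar>\<close> in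
  absolute value (\<open>exists_partner\<close>). Comparing weights before and after the exchange shows that, up to a small
  probability, all jumps across \<open>a\<close> begin and end in a window around \<open>a\<close>, uniformly in \<open>a\<close>, in the
  finite volume and in the boundary condition (\<open>gibbs_prob_not_tight_le\<close>).

  Cuts. Call \<open>a\<close> a cut of \<open>\<sigma>\<close> if \<open>\<sigma>\<close> jumps across \<open>a\<close> exactly as the shift \<open>theta n\<close> by \<open>n\<close> places.
  If all jumps across \<open>a\<close> stay in the window, then rearranging the jumps that start or end in the
  window so as to minimise the energy makes the permutation increasing there, and an increasing
  permutation with flow \<open>n\<close> has a cut at \<open>a\<close>. As only boundedly many configurations have the same
  rearrangement, a cut at \<open>a\<close> has probability at least some \<open>\<delta> > 0\<close> (\<open>gibbs_prob_cut_ge\<close>). To have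
  only finitely many cuts is a tail event, and on a tail event of positive probability the bound
  \<open>\<delta>\<close> persists; so a Gibbs measure with flow \<open>n\<close> has infinitely many cuts in every infinite set of
  good midpoints (\<open>infinitely_many_cuts\<close>).

  Consequences. At a cut all \<open>\<bar>n\<bar>\<close> crossing jumps go the same way, so every infinite cycle uses exactly
  one of them (\<open>card_infinite_cycles\<close>). Between two cuts the permutation is independent of the
  outside, with a law that depends on the position of the cuts only (\<open>gibbs_prob_between_cuts\<close>). Two
  independent samples have common cuts arbitrarily far out on both sides, and between the outermost
  of them they have the same law; thus two Gibbs measures are proportional on the event that the flow
  is \<open>n\<close> (\<open>gibbs_proportional\<close>). By tightness the specifications have subsequential limits, which are
  Gibbs measures with flow \<open>n\<close> (\<open>spec_subsequence_limit\<close>), and uniqueness turns this into convergence.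

  Finally the flow of a Gibbs measure is almost surely finite: if a jump from \<open>x\<close> to \<open>y\<close> is enclosed
  by \<open>m\<close> longer jumps, then \<open>m\<close> different exchanges lower the energy, and each of them can be undone
  knowing only \<open>x\<close> and \<open>y\<close>, so this has probability at most \<open>1 / m\<close> (\<open>gibbs_prob_enclosing_le\<close>).
  Decomposing a Gibbs measure according to its flow therefore exhibits it as a mixture.
\<close>

section \<open>Enumerating the point set\<close>

abbreviation swap :: "real \<Rightarrow> real \<Rightarrow> real \<Rightarrow> real" where
  "swap \<equiv> Transposition.transpose"

locale point_set =
  fixes X :: "real set"
  assumes loc_fin: "locally_finite_set X" and bi_inf: "bi_infinite X"
begin

lemma finite_bounded: "B \<subseteq> X \<Longrightarrow> bounded B \<Longrightarrow> finite B"
  using loc_fin unfolding locally_finite_set_def by blast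

lemma finite_Int: "bounded B \<Longrightarrow> finite (X \<inter> B)"
  by (rule finite_bounded) (auto intro: bounded_subset)

lemma finite_Icc: "finite (X \<inter> {l..r})"
  by (rule finite_Int) simp

lemma ex_gt: "\<exists>y\<in>X. y > t"
  using bi_inf unfolding bi_infinite_def bdd_above_def by (meson not_le_imp_less)

lemma ex_lt: "\<exists>y\<in>X. y < t"
  using bi_inf unfolding bi_infinite_def bdd_below_def by (meson not_le_imp_less)

text \<open>Up to a constant, \<open>height x\<close> is the number of points below \<open>x\<close>; the two
  terms make it finite.\<close>

definition height :: "real \<Rightarrow> int" where
  "height x = int (card (X \<inter> {0..<x})) - int (card (X \<inter> {x..<0}))"

lemma finite_Ico: "finite (X \<inter> {l..<r})"
  by (rule finite_Int) simp

lemma height_diff: assumes "x \<le> y" shows "height y - height x = int (card (X \<inter> {x..<y}))"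
proof -
  have split: "card (X \<inter> {p..<r}) = card (X \<inter> {p..<q}) + card (X \<inter> {q..<r})" if "p \<le> q" "q \<le> r" for p q r
  proof -
    have "X \<inter> {p..<r} = (X \<inter> {p..<q}) \<union> (X \<inter> {q..<r})" using that by auto
    thus ?thesis by (simp add: card_Un_disjoint finite_Ico disjoint_iff)
  qed
  have e: "X \<inter> {p..<q} = {}" if "q \<le> p" for p q using that by auto
  consider "0 \<le> x" | "x < 0" "0 \<le> y" | "y < 0" by linarith
  thus ?thesis
  proof cases
    case 1 thus ?thesis using split[of 0 x y] assms by (simp add: height_def e)
  next
    case 2 thus ?thesis using split[of x 0 y] assms by (simp add: height_def e)
  next
    case 3 thus ?thesis using split[of x y 0] assms by (simp add: height_def e)
  qed
qed

lemma height_less: assumes "x \<in> X" "x < y" shows "height x < height y"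
proof -
  have "x \<in> X \<inter> {x..<y}" using assms by auto
  hence "card (X \<inter> {x..<y}) > 0" using finite_Ico card_gt_0_iff by blast
  thus ?thesis using height_diff[of x y] assms by simp
qed

text \<open>The successor and the predecessor of a point in \<open>X\<close> exist by local finiteness and
  differ from it by one in height, so every integer is reached from any given point.\<close>

lemma height_surj: "\<exists>x\<in>X. height x = k"
proof -
  obtain x0 where x0: "x0 \<in> X" using ex_gt by blast
  show ?thesis
  proof (induction k rule: int_induct[where k = "height x0"])
    case base show ?case using x0 by blast
  next
    case (step1 i)
    then obtain x where x: "x \<in> X" "height x = i" by blast
    obtain z where z: "z \<in> X" "z > x" using ex_gt by blast
    define y where "y = Min (X \<inter> {x<..z})"
    have fin: "finite (X \<inter> {x<..z})" by (rule finite_Int) simp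
    have ne: "X \<inter> {x<..z} \<noteq> {}" using z by auto
    have y: "y \<in> X \<inter> {x<..z}" unfolding y_def using fin ne by (rule Min_in)
    have "X \<inter> {x..<y} = {x}"
    proof (intro equalityI subsetI)
      fix w assume w: "w \<in> X \<inter> {x..<y}"
      show "w \<in> {x}"
      proof (rule ccontr)
        assume "w \<notin> {x}"
        hence "w \<in> X \<inter> {x<..z}" using w y by auto
        hence "y \<le> w" unfolding y_def using fin by simp
        thus False using w by auto
      qed
    qed (use x y in auto)
    hence "height y = i + 1" using height_diff[of x y] x y by auto
    thus ?case using y by blast
  next
    case (step2 i)
    then obtain x where x: "x \<in> X" "height x = i" by blast
    obtain z where z: "z \<in> X" "z < x" using ex_lt by blast
    define y where "y = Max (X \<inter> {z..<x})"
    have ne: "X \<inter> {z..<x} \<noteq> {}" using z by auto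
    have y: "y \<in> X \<inter> {z..<x}" unfolding y_def using finite_Ico ne by (rule Max_in)
    have "X \<inter> {y..<x} = {y}"
    proof (intro equalityI subsetI)
      fix w assume w: "w \<in> X \<inter> {y..<x}"
      hence "w \<in> X \<inter> {z..<x}" using y by auto
      hence "w \<le> y" unfolding y_def using finite_Ico by simp
      thus "w \<in> {y}" using w by auto
    qed (use x y in auto)
    hence "height y = i - 1" using height_diff[of y x] x y by auto
    thus ?case using y by blast
  qed
qed

text \<open>The increasing enumeration of \<open>X\<close> by the integers. The points \<open>a\<^sub>k\<close>
  around a midpoint then become \<open>pt\<close> of shifted indices, and combinatorics on
  \<open>X\<close> becomes combinatorics on the integers.\<close>

definition pt :: "int \<Rightarrow> real" where "pt k = (THE x. x \<in> X \<and> height x = k)"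

lemma height_inj: "x \<in> X \<Longrightarrow> y \<in> X \<Longrightarrow> height x = height y \<Longrightarrow> x = y"
  by (metis height_less less_irrefl linorder_neqE)

lemma pt: "pt k \<in> X" "height (pt k) = k"
proof -
  have "\<exists>!x. x \<in> X \<and> height x = k" using height_surj height_inj by blast
  from theI'[OF this] show "pt k \<in> X" "height (pt k) = k" unfolding pt_def by auto
qed

lemma pt_height: "x \<in> X \<Longrightarrow> pt (height x) = x"
  using height_inj pt by blast

lemma pt_less_iff: "pt i < pt j \<longleftrightarrow> i < j"
  by (metis height_less less_asym linorder_neqE pt)

lemma pt_le_iff: "pt i \<le> pt j \<longleftrightarrow> i \<le> j"
  by (meson linorder_not_less pt_less_iff)

lemma pt_eq_iff [simp]: "pt i = pt j \<longleftrightarrow> i = j"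
  by (metis pt(2))

lemma pt_lessI: "i < j \<Longrightarrow> pt i < pt j" and pt_leI: "i \<le> j \<Longrightarrow> pt i \<le> pt j"
  by (simp_all add: pt_less_iff pt_le_iff)

lemma inj_pt: "inj pt" by (rule injI) simp

lemma range_pt: "range pt = X"
  using pt pt_height by (metis image_subset_iff rangeI subsetI subset_antisym)

lemma in_X_iff: "x \<in> X \<longleftrightarrow> (\<exists>i. x = pt i)" using range_pt by auto

lemma card_pt_image: "card (pt ` A) = card A" by (rule card_image) (rule inj_on_subset[OF inj_pt], simp)

lemma nbr_pos:
  assumes "pt i \<le> a" "a < pt (i + 1)" "k > 0" shows "nbr X a k = pt (i + k)"
proof -
  have s: "{x \<in> X. a < x \<and> x \<le> pt j} = pt ` {i + 1..j}" for j
  proof (intro equalityI subsetI)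
    fix x assume x: "x \<in> {x \<in> X. a < x \<and> x \<le> pt j}"
    then obtain l where l: "x = pt l" using in_X_iff by auto
    have "a < pt l" using x l by simp
    hence "pt i < pt l" using assms(1) by linarith
    hence "i < l" by (simp only: pt_less_iff)
    thus "x \<in> pt ` {i + 1..j}" using x l by (auto simp: pt_le_iff)
  next
    fix x assume "x \<in> pt ` {i + 1..j}"
    then obtain l where l: "x = pt l" "l \<in> {i+1..j}" by auto
    hence "pt (i+1) \<le> pt l" by (simp add: pt_less_iff pt_le_iff)
    thus "x \<in> {x \<in> X. a < x \<and> x \<le> pt j}"
      using l pt(1) assms pt_leI[of l j] by auto
  qed
  have "(THE y. y \<in> X \<and> a < y \<and> card {x \<in> X. a < x \<and> x \<le> y} = nat k) = pt (i + k)"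
  proof (rule the_equality)
    have "pt (i+1) \<le> pt (i + k)" using assms by (simp add: pt_le_iff)
    thus "pt (i + k) \<in> X \<and> a < pt (i + k) \<and> card {x \<in> X. a < x \<and> x \<le> pt (i + k)} = nat k"
      unfolding s card_pt_image using pt assms by auto
  next
    fix y assume y: "y \<in> X \<and> a < y \<and> card {x \<in> X. a < x \<and> x \<le> y} = nat k"
    then obtain j where j: "y = pt j" using in_X_iff by auto
    have "nat (j - i) = nat k" using y unfolding j s card_pt_image by auto
    thus "y = pt (i + k)" using j assms by auto
  qed
  thus ?thesis using assms by (simp add: nbr_def)
qed

lemma nbr_neg:
  assumes "pt i < a" "a \<le> pt (i + 1)" "k > 0" shows "nbr X a (- k) = pt (i + 1 - k)"
proof -
  have s: "{x \<in> X. pt j \<le> x \<and> x < a} = pt ` {j..i}" for j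
  proof (intro equalityI subsetI)
    fix x assume x: "x \<in> {x \<in> X. pt j \<le> x \<and> x < a}"
    then obtain l where l: "x = pt l" using in_X_iff by auto
    have "pt l < a" using x l by simp
    hence "pt l < pt (i + 1)" using assms(2) by linarith
    hence "l < i + 1" by (simp only: pt_less_iff)
    thus "x \<in> pt ` {j..i}" using x l by (auto simp: pt_le_iff)
  next
    fix x assume "x \<in> pt ` {j..i}"
    then obtain l where l: "x = pt l" "l \<in> {j..i}" by auto
    hence "pt l \<le> pt i" by (simp add: pt_less_iff pt_le_iff)
    thus "x \<in> {x \<in> X. pt j \<le> x \<and> x < a}"
      using l pt(1) assms pt_leI[of j l] by auto
  qed
  have "(THE y. y \<in> X \<and> y < a \<and> card {x \<in> X. y \<le> x \<and> x < a} = nat k) = pt (i + 1 - k)"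
  proof (rule the_equality)
    have "pt (i + 1 - k) \<le> pt i" using assms by (simp add: pt_le_iff)
    thus "pt (i + 1 - k) \<in> X \<and> pt (i + 1 - k) < a \<and> card {x \<in> X. pt (i + 1 - k) \<le> x \<and> x < a} = nat k"
      unfolding s card_pt_image using pt assms by auto
  next
    fix y assume y: "y \<in> X \<and> y < a \<and> card {x \<in> X. y \<le> x \<and> x < a} = nat k"
    then obtain j where j: "y = pt j" using in_X_iff by auto
    have "nat (i + 1 - j) = nat k" using y unfolding j s card_pt_image by auto
    thus "y = pt (i + 1 - k)" using j assms by auto
  qed
  thus ?thesis using assms by (simp add: nbr_def)
qed

definition mid :: "int \<Rightarrow> real" where "mid i = (pt i + pt (i + 1)) / 2"

lemma mid_gt: "pt i < mid i"
  using pt_lessI[of i "i + 1"] by (simp add: mid_def field_simps)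

lemma mid_lt: "mid i < pt (i + 1)"
  using pt_lessI[of i "i + 1"] by (simp add: mid_def field_simps)

lemma midpoints_eq: "midpoints X = range mid"
proof -
  have "midpoints X = (\<lambda>x. (x + nbr X x 1) / 2) ` range pt"
    unfolding midpoints_def range_pt by auto
  also have "\<dots> = range mid" unfolding image_image
    by (rule image_cong) (simp_all add: nbr_pos pt_less_iff mid_def)
  finally show ?thesis .
qed

lemma pt_less_mid_iff: "pt j < mid i \<longleftrightarrow> j \<le> i"
proof (cases "j \<le> i")
  case True
  hence "pt j \<le> pt i" by (simp add: pt_less_iff pt_le_iff)
  thus ?thesis using mid_gt[of i] True by linarith
next
  case False
  hence "pt (i + 1) \<le> pt j" by (simp add: pt_less_iff pt_le_iff)
  thus ?thesis using mid_lt[of i] False by linarith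
qed

lemma mid_less_pt_iff: "mid i < pt j \<longleftrightarrow> i < j"
proof (cases "j \<le> i")
  case True
  hence "pt j \<le> pt i" by (simp add: pt_less_iff pt_le_iff)
  thus ?thesis using mid_gt[of i] True by linarith
next
  case False
  hence "pt (i + 1) \<le> pt j" by (simp add: pt_less_iff pt_le_iff)
  thus ?thesis using mid_lt[of i] False by linarith
qed

lemma midpoint_notin: "a \<in> midpoints X \<Longrightarrow> a \<notin> X"
proof
  assume "a \<in> midpoints X" "a \<in> X"
  then obtain i j where "a = mid i" "a = pt j" unfolding midpoints_eq in_X_iff by (elim rangeE exE)
  thus False using pt_less_mid_iff[of j i] mid_less_pt_iff[of i j] by auto
qed

lemma ex_midpoint: "midpoints X \<noteq> {}" unfolding midpoints_eq by auto

end

section \<open>Jumps across a point and the flow\<close>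

definition crosses :: "real \<Rightarrow> real \<Rightarrow> real \<Rightarrow> bool" where
  "crosses a x y \<longleftrightarrow> (x < a \<and> a < y) \<or> (y < a \<and> a < x)"

lemma crosses_sym: "crosses a x y \<longleftrightarrow> crosses a y x" by (auto simp: crosses_def)

text \<open>Since \<open>left_of a x - left_of a (\<sigma> x)\<close> is \<open>1\<close>, \<open>- 1\<close> or
  \<open>0\<close> according to whether \<open>x\<close> jumps over \<open>a\<close> to the right,
  to the left or not at all, the flow is the sum of these differences. In this form it can be
  computed over any finite superset of the crossing points, and the two indicators can be summed
  separately.\<close>

definition left_of :: "real \<Rightarrow> real \<Rightarrow> int" where
  "left_of a x = (if x < a then 1 else 0)"

definition crossers :: "real set \<Rightarrow> real \<Rightarrow> (real \<Rightarrow> real) \<Rightarrow> real set" where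
  "crossers X a \<sigma> = {x \<in> X. crosses a x (\<sigma> x)}"

lemma left_of_diff_eq_0:
  "a \<noteq> x \<Longrightarrow> a \<noteq> y \<Longrightarrow> left_of a x - left_of a y = 0 \<longleftrightarrow> \<not> crosses a x y"
  by (auto simp: left_of_def crosses_def)

lemma PermsD: 
  assumes "\<sigma> \<in> Perms X"
  shows Perms_bij: "bij \<sigma>" and Perms_inj: "inj \<sigma>" and Perms_mem: "\<sigma> x \<in> X \<longleftrightarrow> x \<in> X"
    and Perms_out: "x \<notin> X \<Longrightarrow> \<sigma> x = x" and Perms_inv_l: "inv \<sigma> (\<sigma> x) = x"
    and Perms_inv_r: "\<sigma> (inv \<sigma> x) = x"
    and Perms_image: "\<sigma> ` X = X"
proof -
  have p: "\<sigma> permutes X" using assms by (simp add: Perms_def)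
  show "bij \<sigma>" using p by (rule permutes_bij)
  show "inj \<sigma>" using p by (rule permutes_inj)
  show "\<sigma> x \<in> X \<longleftrightarrow> x \<in> X" using p by (rule permutes_in_image)
  show "x \<notin> X \<Longrightarrow> \<sigma> x = x" using p by (simp add: permutes_not_in)
  show "inv \<sigma> (\<sigma> x) = x" "\<sigma> (inv \<sigma> x) = x" using p by (simp_all add: permutes_inverses)
  show "\<sigma> ` X = X" using p by (rule permutes_image)
qed

lemma Perms_inv: "\<sigma> \<in> Perms X \<Longrightarrow> inv \<sigma> \<in> Perms X"
  unfolding Perms_def using permutes_inv by blast

lemma Perms_inv_inv: "\<sigma> \<in> Perms X \<Longrightarrow> inv (inv \<sigma>) = \<sigma>"
  using Perms_bij inv_inv_eq by blast

lemma Perms_inv_eq_iff: "\<sigma> \<in> Perms X \<Longrightarrow> inv \<sigma> y = x \<longleftrightarrow> \<sigma> x = y"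
  using Perms_inv_l Perms_inv_r by metis

lemma Perms_comp: "\<sigma> \<in> Perms X \<Longrightarrow> \<tau> \<in> Perms X \<Longrightarrow> \<sigma> \<circ> \<tau> \<in> Perms X"
  unfolding Perms_def using permutes_compose by blast

context point_set
begin

lemma crossers_sum_superset:
  assumes "\<sigma> \<in> Perms X" "a \<notin> X" "finite B" "crossers X a \<sigma> \<subseteq> B" "B \<subseteq> X"
  shows "(\<Sum>x\<in>B. left_of a x - left_of a (\<sigma> x)) = (\<Sum>x\<in>crossers X a \<sigma>. left_of a x - left_of a (\<sigma> x))"
proof (rule sum.mono_neutral_right)
  show "\<forall>i\<in>B - crossers X a \<sigma>. left_of a i - left_of a (\<sigma> i) = 0"
  proof
    fix x assume x: "x \<in> B - crossers X a \<sigma>"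
    hence "x \<in> X" "\<sigma> x \<in> X" using assms Perms_mem by auto
    thus "left_of a x - left_of a (\<sigma> x) = 0"
      using x assms(2) by (subst left_of_diff_eq_0) (auto simp: crossers_def)
  qed
qed (use assms in auto)

lemma flow_at_eq:
  assumes "\<sigma> \<in> Perms X"
  shows "flow_at X a \<sigma> = (if finite (crossers X a \<sigma>)
    then Fin (\<Sum>x\<in>crossers X a \<sigma>. left_of a x - left_of a (\<sigma> x)) else Pinf)"
proof -
  have c: "crossers X a \<sigma> = flow_pos X a \<sigma> \<union> flow_neg X a \<sigma>"
    by (auto simp: crossers_def flow_pos_def flow_neg_def crosses_def)
  have d: "flow_pos X a \<sigma> \<inter> flow_neg X a \<sigma> = {}" by (auto simp: flow_pos_def flow_neg_def)
  show ?thesis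
  proof (cases "finite (crossers X a \<sigma>)")
    case True
    hence f: "finite (flow_pos X a \<sigma>)" "finite (flow_neg X a \<sigma>)" using c by auto
    have "(\<Sum>x\<in>crossers X a \<sigma>. left_of a x - left_of a (\<sigma> x))
      = (\<Sum>x\<in>flow_pos X a \<sigma>. 1) + (\<Sum>x\<in>flow_neg X a \<sigma>. - 1)"
      unfolding c by (subst sum.union_disjoint[OF f d], intro arg_cong2[where f="(+)"] sum.cong)
        (auto simp: flow_pos_def flow_neg_def left_of_def)
    thus ?thesis using f True by (simp add: flow_at_def)
  next
    case False
    thus ?thesis using c by (auto simp: flow_at_def)
  qed
qed

lemma finite_crossers_transfer:
  assumes "\<sigma> \<in> Perms X" "a \<notin> X" "b \<notin> X" "finite (crossers X a \<sigma>)"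
  shows "finite (crossers X b \<sigma>)"
proof -
  define W where "W = X \<inter> {min a b..max a b}"
  have W: "finite W" unfolding W_def by (rule finite_Icc)
  have "crossers X b \<sigma> \<subseteq> crossers X a \<sigma> \<union> W \<union> \<sigma> -` W"
  proof
    fix x assume x: "x \<in> crossers X b \<sigma>"
    hence "x \<in> X" "\<sigma> x \<in> X" using Perms_mem[OF assms(1)] by (auto simp: crossers_def)
    hence "x \<noteq> a" "\<sigma> x \<noteq> a" using assms by auto
    thus "x \<in> crossers X a \<sigma> \<union> W \<union> \<sigma> -` W" 
      using x Perms_mem[OF assms(1)] unfolding crossers_def crosses_def W_def by auto
  qed
  moreover have "finite (\<sigma> -` W)" using W Perms_inj[OF assms(1)] by (simp add: finite_vimageI)
  ultimately show ?thesis using assms(4) W by (meson finite_UnI finite_subset)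
qed

text \<open>Changing \<open>a\<close> to \<open>b\<close> changes \<open>left_of\<close> only on the finite set
  \<open>W\<close> of points between them. Its total over the points in \<open>W\<close> and its
  total over the jumps that land in \<open>W\<close> agree because \<open>\<sigma>\<close> is a
  bijection.\<close>

lemma flow_at_indep:
  assumes "\<sigma> \<in> Perms X" "a \<notin> X" "b \<notin> X"
  shows "flow_at X a \<sigma> = flow_at X b \<sigma>"
proof (cases "finite (crossers X a \<sigma>)")
  case True
  have fb: "finite (crossers X b \<sigma>)" using finite_crossers_transfer[OF assms True] .
  define W where "W = X \<inter> {min a b..max a b}"
  define B where "B = crossers X a \<sigma> \<union> crossers X b \<sigma> \<union> W \<union> \<sigma> -` W"
  have W: "finite W" unfolding W_def by (rule finite_Icc)
  have "finite (\<sigma> -` W)" using W Perms_inj[OF assms(1)] by (simp add: finite_vimageI)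
  hence B: "finite B" unfolding B_def using True fb W by auto
  have BX: "B \<subseteq> X" unfolding B_def crossers_def W_def using Perms_mem[OF assms(1)] by auto
  have eq: "(\<Sum>x\<in>B. left_of b x - left_of a x) = (\<Sum>x\<in>B. left_of b (\<sigma> x) - left_of a (\<sigma> x))"
  proof -
    have "(\<Sum>x\<in>B. left_of b x - left_of a x) = (\<Sum>x\<in>W. left_of b x - left_of a x)"
      by (rule sum.mono_neutral_right) (use B BX in \<open>auto simp: B_def W_def left_of_def\<close>)
    also have "\<dots> = (\<Sum>x\<in>\<sigma> -` W. left_of b (\<sigma> x) - left_of a (\<sigma> x))"
    proof (rule sum.reindex_cong[where l=\<sigma>])
      show "inj_on \<sigma> (\<sigma> -` W)" using Perms_inj[OF assms(1)] by (meson inj_on_subset subset_UNIV)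
      show "W = \<sigma> ` (\<sigma> -` W)" using Perms_inv_r[OF assms(1)] by (auto simp: image_iff) (metis)
    qed simp
    also have "\<dots> = (\<Sum>x\<in>B. left_of b (\<sigma> x) - left_of a (\<sigma> x))"
    proof (rule sum.mono_neutral_left)
      show "\<forall>i\<in>B - \<sigma> -` W. left_of b (\<sigma> i) - left_of a (\<sigma> i) = 0"
      proof
        fix x assume "x \<in> B - \<sigma> -` W"
        hence "\<sigma> x \<in> X" "\<sigma> x \<notin> W" using BX Perms_mem[OF assms(1)] by auto
        thus "left_of b (\<sigma> x) - left_of a (\<sigma> x) = 0" by (auto simp: left_of_def W_def)
      qed
    qed (use B in \<open>auto simp: B_def\<close>)
    finally show ?thesis .
  qed
  have "(\<Sum>x\<in>crossers X a \<sigma>. left_of a x - left_of a (\<sigma> x)) = (\<Sum>x\<in>B. left_of a x - left_of a (\<sigma> x))"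
    by (rule crossers_sum_superset[symmetric]) (use assms B BX in \<open>auto simp: B_def\<close>)
  also have "\<dots> = (\<Sum>x\<in>B. left_of b x - left_of b (\<sigma> x))"
    using eq by (simp add: sum_subtractf)
  also have "\<dots> = (\<Sum>x\<in>crossers X b \<sigma>. left_of b x - left_of b (\<sigma> x))"
    by (rule crossers_sum_superset) (use assms B BX in \<open>auto simp: B_def\<close>)
  finally show ?thesis using True fb by (simp add: flow_at_eq[OF assms(1)])
next
  case False
  hence "\<not> finite (crossers X b \<sigma>)" using finite_crossers_transfer[OF assms(1,3,2)] by blast
  thus ?thesis using False by (simp add: flow_at_eq[OF assms(1)])
qed

lemma flow_eq_flow_at:
  assumes "\<sigma> \<in> Perms X" "a \<in> midpoints X" shows "flow X \<sigma> = flow_at X a \<sigma>"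
  unfolding flow_def
proof (rule the_equality)
  show "\<forall>b\<in>midpoints X. flow_at X b \<sigma> = flow_at X a \<sigma>"
    using flow_at_indep[OF assms(1) midpoint_notin midpoint_notin] assms(2) by metis
qed (use assms(2) in metis)

lemma flow_Fin_iff:
  assumes "\<sigma> \<in> Perms X" "a \<in> midpoints X"
  shows "flow X \<sigma> = Fin n \<longleftrightarrow> finite (crossers X a \<sigma>) \<and>
    (\<Sum>x\<in>crossers X a \<sigma>. left_of a x - left_of a (\<sigma> x)) = n"
  unfolding flow_eq_flow_at[OF assms] flow_at_eq[OF assms(1)] by simp

lemma flow_Fin_sum:
  assumes "\<sigma> \<in> Perms X" "a \<in> midpoints X" "flow X \<sigma> = Fin n"
    "finite B" "crossers X a \<sigma> \<subseteq> B" "B \<subseteq> X"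
  shows "(\<Sum>x\<in>B. left_of a x - left_of a (\<sigma> x)) = n"
  using assms flow_Fin_iff[OF assms(1,2)] crossers_sum_superset[OF assms(1) midpoint_notin[OF assms(2)]] by auto

lemma flow_FinI:
  assumes "\<sigma> \<in> Perms X" "a \<in> midpoints X" "(\<Sum>x\<in>B. left_of a x - left_of a (\<sigma> x)) = n"
    "finite B" "crossers X a \<sigma> \<subseteq> B" "B \<subseteq> X"
  shows "flow X \<sigma> = Fin n"
  using assms flow_Fin_iff[OF assms(1,2)] crossers_sum_superset[OF assms(1) midpoint_notin[OF assms(2)]]
  by (auto intro: finite_subset)

lemma flow_cases:
  assumes "\<sigma> \<in> Perms X" "a \<in> midpoints X"
  shows "(\<exists>n. flow X \<sigma> = Fin n) \<longleftrightarrow> finite (crossers X a \<sigma>)"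
  unfolding flow_Fin_iff[OF assms] by auto

lemma crossers_inv:
  assumes "\<sigma> \<in> Perms X" shows "crossers X a (inv \<sigma>) = \<sigma> ` crossers X a \<sigma>"
proof (intro equalityI subsetI)
  fix y assume y: "y \<in> crossers X a (inv \<sigma>)"
  hence "inv \<sigma> y \<in> crossers X a \<sigma>"
    using assms by (auto simp: crossers_def crosses_sym Perms_inv_r Perms_mem[OF Perms_inv])
  thus "y \<in> \<sigma> ` crossers X a \<sigma>" using Perms_inv_r[OF assms] by (metis imageI)
qed (use assms in \<open>auto simp: crossers_def crosses_sym Perms_inv_l Perms_mem\<close>)

lemma flow_inv:
  assumes "\<sigma> \<in> Perms X" "flow X \<sigma> = Fin n" shows "flow X (inv \<sigma>) = Fin (- n)"
proof -
  obtain a where a: "a \<in> midpoints X" using ex_midpoint by blast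
  have 1: "finite (crossers X a \<sigma>)" "(\<Sum>x\<in>crossers X a \<sigma>. left_of a x - left_of a (\<sigma> x)) = n"
    using flow_Fin_iff[OF assms(1) a] assms(2) by auto
  have "(\<Sum>x\<in>crossers X a (inv \<sigma>). left_of a x - left_of a (inv \<sigma> x))
      = (\<Sum>x\<in>crossers X a \<sigma>. left_of a (\<sigma> x) - left_of a x)"
    unfolding crossers_inv[OF assms(1)] using Perms_inj[OF assms(1)]
    by (subst sum.reindex) (auto simp: Perms_inv_l[OF assms(1)] intro: inj_on_subset)
  also have "\<dots> = - n" using 1(2) by (simp add: sum_subtractf)
  finally show ?thesis
    using 1 flow_Fin_iff[OF Perms_inv[OF assms(1)] a] crossers_inv[OF assms(1)] by simp
qed

end

section \<open>Resampling inside a finite set\<close>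

text \<open>Agreeing with \<open>\<eta>\<close> outside \<open>\<Lambda>\<close>, both in the forward and in the
  backward direction, fixes every jump that starts or ends outside \<open>\<Lambda>\<close>. What
  remains free is the bijection from this set onto its image under \<open>\<eta>\<close>.\<close>

definition movable :: "real set \<Rightarrow> (real \<Rightarrow> real) \<Rightarrow> real set" where
  "movable \<Lambda> \<eta> = {x \<in> \<Lambda>. \<eta> x \<in> \<Lambda>}"

definition resample :: "real set \<Rightarrow> real set \<Rightarrow> (real \<Rightarrow> real) \<Rightarrow> (real \<Rightarrow> real) set" where
  "resample X \<Lambda> \<eta> = {\<sigma> \<in> Perms X. agree_outside X \<Lambda> \<sigma> \<eta>}"

lemma resample_iff:
  assumes "\<eta> \<in> Perms X" "\<Lambda> \<subseteq> X"
  shows "\<sigma> \<in> resample X \<Lambda> \<eta> \<longleftrightarrow> \<sigma> \<in> Perms X \<and> (\<forall>x. x \<notin> movable \<Lambda> \<eta> \<longrightarrow> \<sigma> x = \<eta> x)"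
proof (cases "\<sigma> \<in> Perms X")
  case True
  have "agree_outside X \<Lambda> \<sigma> \<eta> \<longleftrightarrow> (\<forall>x. x \<notin> movable \<Lambda> \<eta> \<longrightarrow> \<sigma> x = \<eta> x)"
  proof safe
    fix x assume ag: "agree_outside X \<Lambda> \<sigma> \<eta>" and x: "x \<notin> movable \<Lambda> \<eta>"
    consider "x \<notin> X" | "x \<in> X - \<Lambda>" | "\<eta> x \<in> X - \<Lambda>"
      using x Perms_mem[OF assms(1)] by (auto simp: movable_def)
    thus "\<sigma> x = \<eta> x"
    proof cases
      case 1 thus ?thesis using True assms by (simp add: Perms_out)
    next
      case 2 thus ?thesis using ag by (simp add: agree_outside_def)
    next
      case 3
      hence "inv \<sigma> (\<eta> x) = x" using ag by (simp add: agree_outside_def Perms_inv_l[OF assms(1)])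
      thus ?thesis using Perms_inv_eq_iff[OF True] by simp
    qed
  next
    assume *: "\<forall>x. x \<notin> movable \<Lambda> \<eta> \<longrightarrow> \<sigma> x = \<eta> x"
    show "agree_outside X \<Lambda> \<sigma> \<eta>" unfolding agree_outside_def
    proof safe
      fix x assume x: "x \<in> X" "x \<notin> \<Lambda>"
      show "\<sigma> x = \<eta> x" using * x by (simp add: movable_def)
      have "inv \<eta> x \<notin> movable \<Lambda> \<eta>" using x by (simp add: movable_def Perms_inv_r[OF assms(1)])
      hence "\<sigma> (inv \<eta> x) = x" using * Perms_inv_r[OF assms(1)] by simp
      thus "inv \<sigma> x = inv \<eta> x" using Perms_inv_eq_iff[OF True] by simp
    qed
  qed
  thus ?thesis using True by (simp add: resample_def)
qed (simp add: resample_def)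

lemma resample_Perms: "\<sigma> \<in> resample X \<Lambda> \<eta> \<Longrightarrow> \<sigma> \<in> Perms X" by (simp add: resample_def)

lemma resample_refl: "\<eta> \<in> Perms X \<Longrightarrow> \<eta> \<in> resample X \<Lambda> \<eta>"
  by (simp add: resample_def agree_outside_def)

lemma resample_eq: "\<sigma> \<in> resample X \<Lambda> \<eta> \<Longrightarrow> resample X \<Lambda> \<sigma> = resample X \<Lambda> \<eta>"
  by (auto simp: resample_def agree_outside_def)

lemma resample_sym: "\<sigma> \<in> resample X \<Lambda> \<eta> \<Longrightarrow> \<eta> \<in> Perms X \<Longrightarrow> \<eta> \<in> resample X \<Lambda> \<sigma>"
  by (auto simp: resample_def agree_outside_def)

lemma resample_mono: "\<Lambda> \<subseteq> \<Lambda>' \<Longrightarrow> \<sigma> \<in> resample X \<Lambda> \<eta> \<Longrightarrow> \<sigma> \<in> resample X \<Lambda>' \<eta>"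
  by (auto simp: resample_def agree_outside_def)

lemma resample_inv:
  assumes "\<sigma> \<in> resample X \<Lambda> \<eta>" "\<eta> \<in> Perms X" shows "inv \<sigma> \<in> resample X \<Lambda> (inv \<eta>)"
  using assms by (auto simp: resample_def agree_outside_def Perms_inv Perms_inv_inv)

lemma resample_movable_image:
  assumes "\<sigma> \<in> resample X \<Lambda> \<eta>" "\<eta> \<in> Perms X" "\<Lambda> \<subseteq> X"
  shows "\<sigma> ` movable \<Lambda> \<eta> = \<eta> ` movable \<Lambda> \<eta>"
proof -
  have o: "\<sigma> x = \<eta> x" if "x \<notin> movable \<Lambda> \<eta>" for x using assms(1) resample_iff[OF assms(2,3)] that by blast
  have i: "\<eta> ` movable \<Lambda> \<eta> = - \<eta> ` (- movable \<Lambda> \<eta>)" "\<sigma> ` movable \<Lambda> \<eta> = - \<sigma> ` (- movable \<Lambda> \<eta>)"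
    using Perms_bij[OF assms(2)] Perms_bij[OF resample_Perms[OF assms(1)]] by (simp_all add: bij_image_Compl_eq)
  have "\<sigma> ` (- movable \<Lambda> \<eta>) = \<eta> ` (- movable \<Lambda> \<eta>)" using o by (intro image_cong) auto
  thus ?thesis using i by simp
qed

lemma resample_movable:
  assumes "\<sigma> \<in> resample X \<Lambda> \<eta>" "\<eta> \<in> Perms X" "\<Lambda> \<subseteq> X"
  shows "movable \<Lambda> \<sigma> = movable \<Lambda> \<eta>"
proof -
  have o: "\<sigma> x = \<eta> x" if "x \<notin> movable \<Lambda> \<eta>" for x using assms(1) resample_iff[OF assms(2,3)] that by blast
  have "x \<in> movable \<Lambda> \<sigma>" if "x \<in> movable \<Lambda> \<eta>" for x
  proof -
    have "\<sigma> x \<in> \<eta> ` movable \<Lambda> \<eta>" using resample_movable_image[OF assms] that by blast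
    thus ?thesis using that by (auto simp: movable_def)
  qed
  moreover have "x \<in> movable \<Lambda> \<eta>" if "x \<in> movable \<Lambda> \<sigma>" for x
    using o[of x] that by (cases "\<eta> x \<in> \<Lambda>") (auto simp: movable_def)
  ultimately show ?thesis by blast
qed

lemma resample_swap:
  assumes "\<sigma> \<in> resample X \<Lambda> \<eta>" "\<eta> \<in> Perms X" "\<Lambda> \<subseteq> X" "p permutes movable \<Lambda> \<eta>"
  shows "\<sigma> \<circ> p \<in> resample X \<Lambda> \<eta>"
proof -
  have f: "movable \<Lambda> \<eta> \<subseteq> X" using assms(3) by (auto simp: movable_def)
  have "p \<in> Perms X" unfolding Perms_def using permutes_subset[OF assms(4) f] by simp
  hence "\<sigma> \<circ> p \<in> Perms X" using Perms_comp resample_Perms[OF assms(1)] by blast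
  moreover have "(\<sigma> \<circ> p) x = \<eta> x" if "x \<notin> movable \<Lambda> \<eta>" for x
    using that assms(1) resample_iff[OF assms(2,3)] permutes_not_in[OF assms(4)] by simp
  ultimately show ?thesis using resample_iff[OF assms(2,3)] by blast
qed

lemma resample_eq_image:
  assumes "\<eta> \<in> Perms X" "\<Lambda> \<subseteq> X"
  shows "resample X \<Lambda> \<eta> = (\<lambda>p. \<eta> \<circ> p) ` {p. p permutes movable \<Lambda> \<eta>}"
proof (intro equalityI subsetI)
  fix \<sigma> assume s: "\<sigma> \<in> resample X \<Lambda> \<eta>"
  have "inv \<eta> \<circ> \<sigma> permutes movable \<Lambda> \<eta>"
  proof (rule bij_imp_permutes)
    have "bij_betw \<sigma> (movable \<Lambda> \<eta>) (\<eta> ` movable \<Lambda> \<eta>)"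
      using resample_movable_image[OF s assms] Perms_inj[OF resample_Perms[OF s]]
      by (metis bij_betw_def inj_on_subset subset_UNIV)
    moreover have "bij_betw (inv \<eta>) (\<eta> ` movable \<Lambda> \<eta>) (movable \<Lambda> \<eta>)"
      using Perms_inj[OF assms(1)]
      by (intro bij_betw_byWitness[where f'=\<eta>]) (auto simp: Perms_inv_l[OF assms(1)])
    ultimately show "bij_betw (inv \<eta> \<circ> \<sigma>) (movable \<Lambda> \<eta>) (movable \<Lambda> \<eta>)" by (rule bij_betw_trans)
  next
    fix x assume "x \<notin> movable \<Lambda> \<eta>"
    thus "(inv \<eta> \<circ> \<sigma>) x = x" using s resample_iff[OF assms] Perms_inv_l[OF assms(1)] by simp
  qed
  moreover have "\<sigma> = \<eta> \<circ> (inv \<eta> \<circ> \<sigma>)" using Perms_inv_r[OF assms(1)] by (simp add: fun_eq_iff)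
  ultimately show "\<sigma> \<in> (\<lambda>p. \<eta> \<circ> p) ` {p. p permutes movable \<Lambda> \<eta>}" by blast
next
  fix \<sigma> assume "\<sigma> \<in> (\<lambda>p. \<eta> \<circ> p) ` {p. p permutes movable \<Lambda> \<eta>}"
  thus "\<sigma> \<in> resample X \<Lambda> \<eta>" using resample_swap[OF resample_refl[OF assms(1)] assms] by auto
qed

lemma finite_resample:
  assumes "\<eta> \<in> Perms X" "\<Lambda> \<subseteq> X" "finite \<Lambda>" shows "finite (resample X \<Lambda> \<eta>)"
  unfolding resample_eq_image[OF assms(1,2)] using assms(3)
  by (intro finite_imageI finite_permutations) (simp add: movable_def)

lemma hamiltonian_movable: "hamiltonian V \<Lambda> \<sigma> = (\<Sum>x\<in>movable \<Lambda> \<sigma>. V (\<sigma> x - x))"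
  by (simp add: hamiltonian_def movable_def)

text \<open>Reversing all jumps keeps their lengths. Statements about targets of jumps can therefore be obtained
  from statements about sources by passing to the inverse, which turns flow \<open>n\<close> into
  flow \<open>- n\<close>.\<close>

lemma hamiltonian_inv:
  assumes "\<sigma> \<in> Perms X" "\<And>x. V (- x) = V x"
  shows "hamiltonian V \<Lambda> (inv \<sigma>) = hamiltonian V \<Lambda> \<sigma>"
  unfolding hamiltonian_movable
proof (rule sum.reindex_cong[where l=\<sigma>])
  show "inj_on \<sigma> (movable \<Lambda> \<sigma>)" using Perms_inj[OF assms(1)] by (meson inj_on_subset subset_UNIV)
  show "movable \<Lambda> (inv \<sigma>) = \<sigma> ` movable \<Lambda> \<sigma>"
    using Perms_inv_l[OF assms(1)] Perms_inv_r[OF assms(1)] by (auto simp: movable_def image_iff) metis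
  fix x show "V (inv \<sigma> (\<sigma> x) - \<sigma> x) = V (\<sigma> x - x)"
    using assms(2)[of "\<sigma> x - x"] by (simp add: Perms_inv_l[OF assms(1)])
qed

lemma hamiltonian_swap:
  assumes "\<sigma> \<in> resample X \<Lambda> \<eta>" "\<eta> \<in> Perms X" "\<Lambda> \<subseteq> X" "finite \<Lambda>" "x \<in> movable \<Lambda> \<eta>" "y \<in> movable \<Lambda> \<eta>" "x \<noteq> y"
  shows "hamiltonian V \<Lambda> (\<sigma> \<circ> swap x y) =
    hamiltonian V \<Lambda> \<sigma> - V (\<sigma> x - x) - V (\<sigma> y - y) + V (\<sigma> y - x) + V (\<sigma> x - y)"
proof -
  let ?F = "movable \<Lambda> \<eta>"
  have "swap x y permutes ?F" using assms(5,6) by (rule permutes_swap_id)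
  hence s: "\<sigma> \<circ> swap x y \<in> resample X \<Lambda> \<eta>" using resample_swap[OF assms(1-3)] by blast
  have fin: "finite ?F" using assms(4) by (simp add: movable_def)
  have F: "?F = insert x (insert y (?F - {x, y}))" using assms by auto
  have r: "(\<Sum>z\<in>?F - {x,y}. V ((\<sigma> \<circ> swap x y) z - z)) = (\<Sum>z\<in>?F - {x,y}. V (\<sigma> z - z))"
    by (rule sum.cong) (auto simp: Transposition.transpose_def)
  have "hamiltonian V \<Lambda> (\<sigma> \<circ> swap x y) = (\<Sum>z\<in>?F. V ((\<sigma> \<circ> swap x y) z - z))"
    unfolding hamiltonian_movable resample_movable[OF s assms(2,3)] ..
  also have "\<dots> = V (\<sigma> y - x) + V (\<sigma> x - y) + (\<Sum>z\<in>?F - {x,y}. V (\<sigma> z - z))"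
    unfolding r[symmetric] using fin assms(7) by (subst F) (simp add: Transposition.transpose_def)
  finally have 1: "hamiltonian V \<Lambda> (\<sigma> \<circ> swap x y) = \<dots>" .
  have "hamiltonian V \<Lambda> \<sigma> = (\<Sum>z\<in>?F. V (\<sigma> z - z))"
    unfolding hamiltonian_movable resample_movable[OF assms(1-3)] ..
  also have "\<dots> = V (\<sigma> x - x) + V (\<sigma> y - y) + (\<Sum>z\<in>?F - {x,y}. V (\<sigma> z - z))"
    using fin assms(7) by (subst F) simp
  finally show ?thesis using 1 by simp
qed

section \<open>Convexity and the gain from uncrossing\<close>

locale permutation_gas = point_set +
  fixes V :: "real \<Rightarrow> real"
  assumes V1: "condV1 V" and V2: "condV2 V"
begin

lemma V_sym: "V (- x) = V x" using V1 by (simp add: condV1_def)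

lemma V_swap: "V (x - y) = V (y - x)" using V_sym[of "y - x"] by simp

text \<open>The displacements \<open>u - y\<close> and \<open>v - x\<close> have the same sum as \<open>u -
  x\<close> and \<open>v - y\<close> and lie strictly between them, so they are the two convex
  combinations of the latter with weights \<open>t\<close> and \<open>1 - t\<close>.\<close>

lemma uncross_less:
  assumes "x < y" "v < u" shows "V (u - y) + V (v - x) < V (u - x) + V (v - y)"
proof -
  have sc: "V ((1 - t) * p + t * q) < (1 - t) * V p + t * V q" if "p \<noteq> q" "0 < t" "t < 1" for p q t
    using V1 that by (simp add: condV1_def strictly_convex_def)
  \<comment> \<open>The position of \<open>u - y\<close> on the segment from \<open>u - x\<close> to \<open>v -
    y\<close>.\<close>
  define t where "t = (y - x) / ((y - x) + (u - v))"
  have t: "0 < t" "t < 1" "t * ((y - x) + (u - v)) = y - x" using assms by (auto simp: t_def)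
  have "(1 - t) * (u - x) + t * (v - y) = (u - x) - t * ((y - x) + (u - v))" by (simp add: algebra_simps)
  hence 1: "(1 - t) * (u - x) + t * (v - y) = u - y" using t(3) by simp
  have "(1 - t) * (v - y) + t * (u - x) = (v - y) + t * ((y - x) + (u - v))" by (simp add: algebra_simps)
  hence 2: "(1 - t) * (v - y) + t * (u - x) = v - x" using t(3) by simp
  have ne: "u - x \<noteq> v - y" using assms by linarith
  have "V (u - y) < (1 - t) * V (u - x) + t * V (v - y)" using sc[OF ne t(1,2)] by (simp only: 1)
  moreover have "V (v - x) < (1 - t) * V (v - y) + t * V (u - x)" using sc[OF ne[symmetric] t(1,2)] by (simp only: 2)
  moreover have "((1 - t) * p + t * q) + ((1 - t) * q + t * p) = p + q" for p q :: real
    by (simp add: algebra_simps)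
  ultimately show ?thesis by (smt (verit))
qed

lemma uncross_le:
  assumes "x \<le> y" "v \<le> u" shows "V (u - y) + V (v - x) \<le> V (u - x) + V (v - y)"
  using uncross_less[of x y v u] assms by (cases "x = y \<or> v = u") auto

lemma V_ge: "V 0 \<le> V x"
  using uncross_le[of 0 x 0 x] uncross_le[of x 0 x 0] V_sym[of x] by (cases "0 \<le> x") auto

text \<open>The difference of the energies of a jump that overshoots a point at distance \<open>t\<close> by
  \<open>\<kappa>\<close> and of one that stops short of it by \<open>\<kappa>\<close>.\<close>

definition gap :: "real \<Rightarrow> real \<Rightarrow> real" where "gap \<kappa> t = V (t + \<kappa>) - V (t - \<kappa>)"

lemma gap_odd: "gap \<kappa> (- t) = - gap \<kappa> t"
proof -
  have "- t + \<kappa> = - (t - \<kappa>)" "- t - \<kappa> = - (t + \<kappa>)" by simp_all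
  thus ?thesis by (simp only: gap_def V_sym)
qed

lemma gap_mono: assumes "0 \<le> \<kappa>" "t \<le> t'" shows "gap \<kappa> t \<le> gap \<kappa> t'"
  using uncross_le[of "-\<kappa>" \<kappa> t t'] assms by (simp add: gap_def)

text \<open>The gain increases when \<open>u\<close> moves right and when \<open>v\<close> moves left, by
  \<open>uncross_le\<close>. So it is smallest at \<open>u = a + \<kappa>\<close> and \<open>v = a -
  \<kappa>\<close>, where it separates into a function of \<open>x\<close> and one of
  \<open>y\<close>. It is this separation that allows the sum over pairs \<open>(x, y)\<close> to be
  split into a product.\<close>

lemma uncross_gain1:
  assumes "\<kappa> \<ge> 0" "x - a < y - a" "\<kappa> \<le> u - a" "v - a \<le> - \<kappa>"
  shows "gap \<kappa> (a - x) + gap \<kappa> (y - a) \<le> V (u - x) + V (v - y) - V (u - y) - V (v - x)"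
proof -
  have "V (u - y) + V (a + \<kappa> - x) \<le> V (u - x) + V (a + \<kappa> - y)"
    by (rule uncross_le) (use assms in auto)
  moreover have "V (a - \<kappa> - y) + V (v - x) \<le> V (a - \<kappa> - x) + V (v - y)"
    by (rule uncross_le) (use assms in auto)
  moreover have "V (a + \<kappa> - y) = V (y - a - \<kappa>)" "V (a - \<kappa> - y) = V (y - a + \<kappa>)"
    using V_sym[of "a + \<kappa> - y"] V_sym[of "a - \<kappa> - y"] by (simp_all add: algebra_simps)
  moreover have "V (a + \<kappa> - x) = V (a - x + \<kappa>)" "V (a - \<kappa> - x) = V (a - x - \<kappa>)"
    by (simp_all add: algebra_simps)
  ultimately show ?thesis unfolding gap_def by linarith
qed

text \<open>Reflecting the line exchanges jumps to the right and jumps to the left, and with them the two values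
  of the sign \<open>s\<close>.\<close>

lemma uncross_gain:
  assumes "\<kappa> \<ge> 0" "s = 1 \<or> s = -1" "s * (x - a) < s * (y - a)" "\<kappa> \<le> s * (u - a)" "s * (v - a) \<le> - \<kappa>"
  shows "gap \<kappa> (s * (a - x)) + gap \<kappa> (s * (y - a)) \<le> V (u - x) + V (v - y) - V (u - y) - V (v - x)"
proof (cases "s = 1")
  case True thus ?thesis using uncross_gain1[of \<kappa> x a y u v] assms by simp
next
  case False
  hence s: "s = -1" using assms by simp
  have "V (x - u) = V (u - x)" "V (y - u) = V (u - y)" "V (y - v) = V (v - y)" "V (x - v) = V (v - x)"
    by (rule V_swap)+
  thus ?thesis using uncross_gain1[of \<kappa> "-x" "-a" "-y" "-u" "-v"] assms unfolding s by simp
qed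

text \<open>Since \<open>V\<close> is minimal at \<open>0\<close>, the subtracted term \<open>2 * V ((x + d) /
  2)\<close> in (V2) is at least \<open>2 * V 0\<close>, so (V2) forces \<open>V x - V 0\<close> to
  outgrow \<open>x * ln x\<close>.\<close>

lemma V_growth: "\<exists>t0>1. \<forall>x\<ge>t0. M * (x * ln x) \<le> V x - V 0"
proof -
  have "filterlim (psi V 1) at_top at_top" using V2 by (simp add: condV2_def)
  hence "eventually (\<lambda>x. psi V 1 x \<ge> M) at_top" by (simp add: filterlim_at_top)
  then obtain x0 where x0: "\<And>x. x \<ge> x0 \<Longrightarrow> psi V 1 x \<ge> M" by (auto simp: eventually_at_top_linorder)
  show ?thesis
  proof (intro exI[of _ "max x0 2"] conjI allI impI)
    fix x :: real assume x: "max x0 2 \<le> x"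
    have p: "x * ln x > 0" using x by simp
    have "M \<le> (V x + V 0 - 2 * V ((x + 1) / 2)) / (x * ln x)" using x0[of x] x by (simp add: psi_def)
    hence "M * (x * ln x) \<le> V x + V 0 - 2 * V ((x + 1) / 2)" using p by (simp add: pos_le_divide_eq)
    thus "M * (x * ln x) \<le> V x - V 0" using V_ge[of "(x + 1)/2"] by linarith
  qed simp
qed

text \<open>By convexity the slope of \<open>V\<close> on \<open>[t - \<kappa>, t + \<kappa>]\<close> is at
  least the slope of its chord from \<open>0\<close> to \<open>t - \<kappa>\<close>, which is
  bounded below by \<open>V_growth\<close>. The factor \<open>3\<close> makes \<open>exp (- gap
  \<kappa> t)\<close> at most \<open>1 / t^3\<close>, which is summable over a set with linearly
  many points at distance up to \<open>t\<close>.\<close>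

lemma gap_growth: assumes "\<kappa> > 0" shows "\<exists>t0\<ge>2. \<forall>t\<ge>t0. 3 * ln t \<le> gap \<kappa> t"
proof -
  obtain x0 where x0: "x0 > 1" "\<And>x. x \<ge> x0 \<Longrightarrow> (3 / \<kappa>) * (x * ln x) \<le> V x - V 0"
    \<comment> \<open>A chord of slope \<open>(3 / \<kappa>) * ln s\<close> over a length \<open>2 * \<kappa>\<close>
      gives \<open>6 * ln s\<close>, and \<open>2 * ln s\<close> dominates \<open>ln t\<close>.\<close>
    using V_growth[of "3/\<kappa>"] by blast
  show ?thesis
  proof (intro exI[of _ "max 4 (max (2 * \<kappa>) (x0 + \<kappa>))"] conjI allI impI)
    fix t assume t: "max 4 (max (2 * \<kappa>) (x0 + \<kappa>)) \<le> t"
    define s where "s = t - \<kappa>"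
    have s: "s \<ge> x0" "s > 1" "s \<ge> t / 2" "t \<ge> 4" using t x0 by (auto simp: s_def)
    define r where "r = 2 * \<kappa> / (s + 2 * \<kappa>)"
    have r: "0 < r" "r < 1" "r * (s + 2 * \<kappa>) = 2 * \<kappa>" using s assms by (auto simp: r_def)
    have "V ((1 - r) * (s + 2*\<kappa>) + r * 0) < (1 - r) * V (s + 2*\<kappa>) + r * V 0"
    proof -
      have "s + 2*\<kappa> \<noteq> 0" using s assms by linarith
      thus ?thesis using V1 r unfolding condV1_def strictly_convex_def by blast
    qed
    moreover have "(1 - r) * (s + 2*\<kappa>) + r * 0 = s" using r(3) by (simp add: algebra_simps)
    ultimately have "V s < (1 - r) * V (s + 2*\<kappa>) + r * V 0" by simp
    hence "(V s - V 0) * r \<le> (1 - r) * (V (s + 2*\<kappa>) - V s)" by (simp add: algebra_simps)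
    hence "(V s - V 0) * r * (s + 2*\<kappa>) \<le> (1 - r) * (V (s + 2*\<kappa>) - V s) * (s + 2*\<kappa>)"
      using s assms by (intro mult_right_mono) auto
    moreover have "(V s - V 0) * r * (s + 2*\<kappa>) = (V s - V 0) * (2 * \<kappa>)" using r(3) by (simp only: mult.assoc)
    moreover have "(1 - r) * (V (s + 2*\<kappa>) - V s) * (s + 2*\<kappa>) = ((s + 2*\<kappa>) - r * (s + 2 * \<kappa>)) * (V (s + 2*\<kappa>) - V s)"
      by (simp add: algebra_simps)
    ultimately have "(V s - V 0) * (2 * \<kappa>) \<le> s * (V (s + 2*\<kappa>) - V s)" using r(3) by simp
    moreover have "(3 / \<kappa>) * (s * ln s) * (2 * \<kappa>) \<le> (V s - V 0) * (2 * \<kappa>)"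
      using x0(2)[OF s(1)] assms by (intro mult_right_mono) auto
    moreover have "(3 / \<kappa>) * (s * ln s) * (2 * \<kappa>) = s * (6 * ln s)" using assms by simp
    ultimately have "s * (6 * ln s) \<le> s * (V (s + 2*\<kappa>) - V s)" by linarith
    hence "6 * ln s \<le> V (s + 2*\<kappa>) - V s" using s by simp
    moreover have "V (s + 2*\<kappa>) - V s = gap \<kappa> t" by (simp add: gap_def s_def add.commute)
    moreover have "ln t \<le> 2 * ln s"
    proof -
      have "t \<le> (t/2) * (t/2)" using s by (simp add: field_simps)
      also have "\<dots> \<le> s * s" using s by (intro mult_mono) auto
      finally have "ln t \<le> ln (s * s)" using s by simp
      also have "\<dots> = 2 * ln s" using s by (simp add: ln_mult)
      finally show ?thesis .
    qed
    ultimately show "3 * ln t \<le> gap \<kappa> t" by linarith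
  qed simp
qed

section \<open>Summing over sparse point sets\<close>

definition sparse_around :: "real \<Rightarrow> real \<Rightarrow> real set \<Rightarrow> bool" where
  "sparse_around c a Y \<longleftrightarrow> (\<forall>t>0. real (card {y \<in> Y. \<bar>y - a\<bar> \<le> t}) \<le> c * t)"

text \<open>There are at most \<open>c * (k + 1)\<close> points at a distance between \<open>k\<close> and
  \<open>k + 1\<close>, each contributing at most \<open>1 / k^3\<close>. The resulting bound by
  \<open>2 * c / k^2\<close> is replaced by a telescoping one.\<close>

lemma tail_sum:
  assumes "\<kappa> > 0" "c \<ge> 1"
  shows "\<exists>N0::nat. N0 \<ge> 2 \<and> (\<forall>N\<ge>N0. \<forall>a Y. finite Y \<longrightarrow> sparse_around c a Y \<longrightarrow>
    (\<Sum>y\<in>{y \<in> Y. \<bar>y - a\<bar> \<ge> real N}. exp (- gap \<kappa> \<bar>y - a\<bar>)) \<le> 2 * c / (real N - 1))"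
proof -
  obtain t0 where t0: "t0 \<ge> 2" "\<And>t. t \<ge> t0 \<Longrightarrow> 3 * ln t \<le> gap \<kappa> t" using gap_growth[OF assms(1)] by blast
  show ?thesis
  proof (intro exI[of _ "nat \<lceil>t0\<rceil>"] conjI allI impI)
    show "2 \<le> nat \<lceil>t0\<rceil>" using t0 by linarith
    fix N :: nat and a :: real and Y assume N: "nat \<lceil>t0\<rceil> \<le> N" and Y: "finite Y" "sparse_around c a Y"
    have N': "real N \<ge> t0" "N \<ge> 2" using N t0 by linarith+
    define S where "S = {y \<in> Y. \<bar>y - a\<bar> \<ge> real N}"
    define fl where "fl y = nat \<lfloor>\<bar>y - a\<bar>\<rfloor>" for y
    have fS: "finite S" using Y by (simp add: S_def)
    define K where "K = Max (insert N (fl ` S))"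
    have im: "fl ` S \<subseteq> {N..K}"
    proof
      fix k assume k: "k \<in> fl ` S"
      hence "k \<le> K" unfolding K_def using fS by auto
      moreover have "k \<ge> N" using k by (auto simp: S_def fl_def le_nat_iff le_floor_iff)
      ultimately show "k \<in> {N..K}" by simp
    qed
    have "(\<Sum>y\<in>S. exp (- gap \<kappa> \<bar>y - a\<bar>)) = (\<Sum>k\<in>fl ` S. \<Sum>y\<in>{y\<in>S. fl y = k}. exp (- gap \<kappa> \<bar>y - a\<bar>))"
      using fS by (rule sum.image_gen)
    also have "\<dots> \<le> (\<Sum>k\<in>fl ` S. 2 * c * (1 / (real k - 1) - 1 / real k))"
    proof (rule sum_mono)
      fix k assume k: "k \<in> fl ` S"
      hence kN: "k \<ge> N" using im by auto
      hence k2: "k \<ge> 2" "real k \<ge> t0" using N' by linarith+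
      have "(\<Sum>y\<in>{y\<in>S. fl y = k}. exp (- gap \<kappa> \<bar>y - a\<bar>)) \<le> (\<Sum>y\<in>{y\<in>S. fl y = k}. 1 / real k ^ 3)"
      proof (rule sum_mono)
        fix y assume y: "y \<in> {y\<in>S. fl y = k}"
        have "real k \<le> \<bar>y - a\<bar>" using y unfolding fl_def by (auto) 
        hence "3 * ln (real k) \<le> gap \<kappa> \<bar>y - a\<bar>" using t0(2)[of "\<bar>y - a\<bar>"] k2 
          by (smt (verit) ln_mono t0(1))
        hence "exp (- gap \<kappa> \<bar>y - a\<bar>) \<le> exp (- (3 * ln (real k)))" by simp
        also have "\<dots> = 1 / real k ^ 3"
        proof -
          have "exp (3 * ln (real k)) = exp (ln (real k)) ^ 3" by (metis exp_of_nat_mult of_nat_numeral)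
          thus ?thesis using k2 by (simp add: exp_minus inverse_eq_divide)
        qed
        finally show "exp (- gap \<kappa> \<bar>y - a\<bar>) \<le> 1 / real k ^ 3" .
      qed
      also have "\<dots> = real (card {y\<in>S. fl y = k}) * (1 / real k ^ 3)" by simp
      also have "\<dots> \<le> (c * (real k + 1)) * (1 / real k ^ 3)"
      proof (rule mult_right_mono)
        have "card {y\<in>S. fl y = k} \<le> card {y\<in>Y. \<bar>y - a\<bar> \<le> real k + 1}"
        proof (rule card_mono)
          show "{y\<in>S. fl y = k} \<subseteq> {y\<in>Y. \<bar>y - a\<bar> \<le> real k + 1}"
          proof
            fix y assume "y \<in> {y\<in>S. fl y = k}"
            moreover from this have "\<bar>y - a\<bar> \<le> real k + 1" unfolding fl_def by (simp, linarith)
            ultimately show "y \<in> {y\<in>Y. \<bar>y - a\<bar> \<le> real k + 1}" by (simp add: S_def)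
          qed
        qed (use Y in simp)
        also have "real \<dots> \<le> c * (real k + 1)" using Y(2) unfolding sparse_around_def by simp
        finally show "real (card {y\<in>S. fl y = k}) \<le> c * (real k + 1)" by simp
      qed simp
      also have "\<dots> \<le> 2 * c * (1 / (real k - 1) - 1 / real k)"
      proof -
        have "(real k + 1) * (real k - 1) \<le> 2 * real k ^ 2" by (simp add: algebra_simps power2_eq_square)
        \<comment> \<open>The right-hand side is \<open>2 / (k * (k - 1))\<close>; it telescopes.\<close>
        hence "(real k + 1) * (1 / real k ^ 3) \<le> 2 * (1 / (real k - 1) - 1 / real k)"
          using k2 by (simp add: field_simps power3_eq_cube power2_eq_square)
        hence "c * ((real k + 1) * (1 / real k ^ 3)) \<le> c * (2 * (1 / (real k - 1) - 1 / real k))"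
          using assms by (intro mult_left_mono) auto
        thus ?thesis by (simp add: algebra_simps)
      qed
      finally show "(\<Sum>y\<in>{y\<in>S. fl y = k}. exp (- gap \<kappa> \<bar>y - a\<bar>)) \<le> 2 * c * (1 / (real k - 1) - 1 / real k)" .
    qed
    also have "\<dots> \<le> (\<Sum>k\<in>{N..K}. 2 * c * (1 / (real k - 1) - 1 / real k))"
      by (rule sum_mono2) (use im assms N' in \<open>auto simp: field_simps\<close>)
    also have "\<dots> = 2 * c * (\<Sum>k\<in>{N..K}. (1 / (real k - 1) - 1 / real k))" by (simp add: sum_distrib_left)
    also have "\<dots> \<le> 2 * c * (1 / (real N - 1))"
    proof (rule mult_left_mono)
      have "N \<le> K" unfolding K_def using fS by auto
      hence "(\<Sum>k\<in>{N..K}. (1 / (real k - 1) - 1 / real k)) = 1 / (real N - 1) - 1 / real K"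
        by (induction K rule: dec_induct) simp_all
      thus "(\<Sum>k\<in>{N..K}. (1 / (real k - 1) - 1 / real k)) \<le> 1 / (real N - 1)" by simp
    qed (use assms in simp)
    finally show "(\<Sum>y\<in>{y \<in> Y. \<bar>y - a\<bar> \<ge> real N}. exp (- gap \<kappa> \<bar>y - a\<bar>)) \<le> 2 * c / (real N - 1)"
      by (simp add: S_def)
  qed
qed

text \<open>Since \<open>gap\<close> is odd, the terms with \<open>s * (y - a) < 0\<close> are larger than
  \<open>1\<close>, but they are bounded and bounded in number because these \<open>y\<close> are
  within \<open>\<omega>\<close> of \<open>a\<close>.\<close>

lemma half_line_sum:
  assumes "\<kappa> > 0" "c \<ge> 1"
  shows "\<exists>K>0. \<forall>a Y s. finite Y \<longrightarrow> sparse_around c a Y \<longrightarrow> (s = 1 \<or> s = -1) \<longrightarrow>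
    (\<Sum>y\<in>{y \<in> Y. s * (y - a) \<ge> - \<omega>}. exp (- gap \<kappa> (s * (y - a)))) \<le> K"
proof -
  obtain N0 :: nat where N0: "N0 \<ge> 2" "\<And>N a Y. N \<ge> N0 \<Longrightarrow> finite Y \<Longrightarrow> sparse_around c a Y \<Longrightarrow>
    (\<Sum>y\<in>{y \<in> Y. \<bar>y - a\<bar> \<ge> real N}. exp (- gap \<kappa> \<bar>y - a\<bar>)) \<le> 2 * c / (real N - 1)"
    using tail_sum[OF assms] by blast
  define N where "N = max N0 (nat \<lceil>\<omega>\<rceil> + 1)"
  have N: "N \<ge> N0" "real N > \<omega>" "N \<ge> 2" using N0 unfolding N_def by linarith+
  define K where "K = c * real N * exp (gap \<kappa> (real N)) + 2 * c / (real N - 1)"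
  have "K > 0" unfolding K_def using assms N by (intro add_pos_nonneg) auto
  moreover have "(\<Sum>y\<in>{y \<in> Y. s * (y - a) \<ge> - \<omega>}. exp (- gap \<kappa> (s * (y - a)))) \<le> K"
    if Y: "finite Y" "sparse_around c a Y" and s: "s = 1 \<or> s = -1" for a Y s
  proof -
    let ?A = "{y \<in> Y. \<bar>y - a\<bar> \<le> real N}" and ?B = "{y \<in> Y. \<bar>y - a\<bar> \<ge> real N \<and> s * (y - a) \<ge> - \<omega>}"
    have "(\<Sum>y\<in>{y \<in> Y. s * (y - a) \<ge> - \<omega>}. exp (- gap \<kappa> (s * (y - a)))) \<le> (\<Sum>y\<in>?A \<union> ?B. exp (- gap \<kappa> (s * (y - a))))"
      by (rule sum_mono2) (use Y in auto)
    also have "\<dots> \<le> (\<Sum>y\<in>?A. exp (- gap \<kappa> (s * (y - a)))) + (\<Sum>y\<in>?B. exp (- gap \<kappa> (s * (y - a))))"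
      using Y by (subst sum.union_inter[symmetric]) (auto intro!: sum_nonneg)
    also have "(\<Sum>y\<in>?A. exp (- gap \<kappa> (s * (y - a)))) \<le> (\<Sum>y\<in>?A. exp (gap \<kappa> (real N)))"
    proof (rule sum_mono)
      fix y assume "y \<in> ?A"
      hence "- real N \<le> s * (y - a)" using s by auto
      hence "gap \<kappa> (- real N) \<le> gap \<kappa> (s * (y - a))" using assms by (intro gap_mono) auto
      thus "exp (- gap \<kappa> (s * (y - a))) \<le> exp (gap \<kappa> (real N))" by (simp add: gap_odd)
    qed
    also have "\<dots> = real (card ?A) * exp (gap \<kappa> (real N))" by simp
    also have "\<dots> \<le> c * real N * exp (gap \<kappa> (real N))"
      using Y(2) N unfolding sparse_around_def by (intro mult_right_mono) auto
    also have "(\<Sum>y\<in>?B. exp (- gap \<kappa> (s * (y - a)))) = (\<Sum>y\<in>?B. exp (- gap \<kappa> \<bar>y - a\<bar>))"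
    proof (rule sum.cong[OF refl])
      fix y assume y: "y \<in> ?B"
      hence "s * (y - a) = \<bar>y - a\<bar>" using s N(2) by auto
      thus "exp (- gap \<kappa> (s * (y - a))) = exp (- gap \<kappa> \<bar>y - a\<bar>)" by simp
    qed
    also have "\<dots> \<le> (\<Sum>y\<in>{y \<in> Y. \<bar>y - a\<bar> \<ge> real N}. exp (- gap \<kappa> \<bar>y - a\<bar>))"
      by (rule sum_mono2) (use Y in auto)
    also have "\<dots> \<le> 2 * c / (real N - 1)" using N0(2)[OF N(1) Y] .
    finally show ?thesis by (simp add: K_def)
  qed
  ultimately show ?thesis by blast
qed

end

section \<open>Good midpoints\<close>

context point_set
begin

definition reach :: "real \<Rightarrow> int \<Rightarrow> real" where "reach c n = (real_of_int \<bar>n\<bar> + 1) * c"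

text \<open>What condition (X\<open>n\<close>) provides at a midpoint, expressed by counting points in intervals
  instead of by neighbours.\<close>

definition good_pt :: "real \<Rightarrow> int \<Rightarrow> real \<Rightarrow> bool" where
  "good_pt c n a \<longleftrightarrow> a \<in> midpoints X \<and> (\<forall>x\<in>X. 1 / (2 * c) \<le> \<bar>x - a\<bar>) \<and>
     \<bar>n\<bar> \<le> int (card {x \<in> X. a - reach c n \<le> x \<and> x < a}) \<and>
     \<bar>n\<bar> \<le> int (card {x \<in> X. a < x \<and> x \<le> a + reach c n}) \<and>
     (\<forall>t>0. real (card {x \<in> X. \<bar>x - a\<bar> \<le> t}) \<le> c * t)"

lemma window_mid: "window X (mid i) n = pt ` {i - \<bar>n\<bar>..i + 1 + \<bar>n\<bar>}"
proof -
  have 1: "nbr X (mid i) k = pt (i + k)" if "k > 0" for k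
    using nbr_pos[of i "mid i" k] mid_gt[of i] mid_lt[of i] that by simp
  have 2: "nbr X (mid i) k = pt (i + 1 + k)" if "k < 0" for k
    using nbr_neg[of i "mid i" "-k"] mid_gt[of i] mid_lt[of i] that by simp
  show ?thesis
  proof (intro equalityI subsetI)
    fix x assume "x \<in> window X (mid i) n"
    then obtain k where k: "x = nbr X (mid i) k" "k \<in> {- \<bar>n\<bar> - 1 .. \<bar>n\<bar> + 1} - {0}"
      unfolding window_def by (elim imageE)
    show "x \<in> pt ` {i - \<bar>n\<bar>..i + 1 + \<bar>n\<bar>}"
    proof (cases "k > 0")
      case True thus ?thesis using k 1[of k] by auto
    next
      case False thus ?thesis using k 2[of k] by auto
    qed
  next
    fix x assume "x \<in> pt ` {i - \<bar>n\<bar>..i + 1 + \<bar>n\<bar>}"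
    then obtain j where j: "x = pt j" "j \<in> {i - \<bar>n\<bar>..i + 1 + \<bar>n\<bar>}" by auto
    show "x \<in> window X (mid i) n"
    proof (cases "j > i")
      case True
      hence "x = nbr X (mid i) (j - i)" using 1[of "j - i"] j by simp
      thus ?thesis unfolding window_def using True j by (intro image_eqI[of _ _ "j - i"]) auto
    next
      case False
      hence "x = nbr X (mid i) (j - i - 1)" using 2[of "j - i - 1"] j by simp
      thus ?thesis unfolding window_def using False j by (intro image_eqI[of _ _ "j - i - 1"]) auto
    qed
  qed
qed

text \<open>The constants admitted in the definition of \<open>c_s\<close> form a closed half-line \<open>[m,
  \<infinity>)\<close>, since the window has finitely many gaps. So the least one exists, and every
  larger constant bounds the gaps as well.\<close>

lemma c_s_spacing:
  assumes "c_s X (mid i) n \<le> c" "i - \<bar>n\<bar> \<le> j" "j \<le> i + \<bar>n\<bar>"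
  shows "c \<ge> 1" "1 / c \<le> pt (j + 1) - pt j" "pt (j + 1) - pt j \<le> c"
proof -
  define W where "W = window X (mid i) n"
  define D where "D = {y - x | x y. consecutive W x y}"
  have fW: "finite W" unfolding W_def window_mid by simp
  have "D \<subseteq> (\<lambda>(x,y). y - x) ` (W \<times> W)" by (auto simp: D_def consecutive_def)
  hence fD: "finite D" using fW by (meson finite_SigmaI finite_imageI finite_subset)
  have Dpos: "d > 0" if "d \<in> D" for d using that by (auto simp: D_def consecutive_def)
  define m where "m = Max (insert 1 (D \<union> inverse ` D))"
  have P: "(1 \<le> c \<and> (\<forall>x y. consecutive W x y \<longrightarrow> y - x \<in> {inverse c .. c})) \<longleftrightarrow> m \<le> c" for c
  proof -
    have "(\<forall>x y. consecutive W x y \<longrightarrow> y - x \<in> {inverse c .. c}) \<longleftrightarrow> (\<forall>d\<in>D. inverse c \<le> d \<and> d \<le> c)"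
      by (auto simp: D_def)
    moreover have "m \<le> c \<longleftrightarrow> 1 \<le> c \<and> (\<forall>d\<in>D. d \<le> c \<and> inverse d \<le> c)"
      unfolding m_def using fD by (subst Max_le_iff) auto
    moreover have "inverse d \<le> c \<longleftrightarrow> inverse c \<le> d" if "1 \<le> c" "d \<in> D" for d
    proof -
      have "0 < d" "0 < c" using Dpos[OF that(2)] that(1) by auto
      thus ?thesis by (auto simp: inverse_eq_divide field_simps)
    qed
    ultimately show ?thesis by blast
  qed
  have "c_s X (mid i) n = m"
    unfolding c_s_def W_def[symmetric] P by (rule Least_equality) auto
  hence "m \<le> c" using assms by simp
  hence c: "1 \<le> c" "\<And>x y. consecutive W x y \<Longrightarrow> y - x \<in> {inverse c .. c}" using P[of c] by auto
  have "consecutive W (pt j) (pt (j + 1))"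
    unfolding consecutive_def W_def window_mid using assms
    by (auto simp: pt_less_iff)
  hence "pt (j + 1) - pt j \<in> {inverse c .. c}" by (rule c(2))
  thus "c \<ge> 1" "1 / c \<le> pt (j + 1) - pt j" "pt (j + 1) - pt j \<le> c"
    using c(1) by (auto simp: inverse_eq_divide)
qed

text \<open>The infimum in \<open>c_g\<close> is approached from above; passing to \<open>c + 1\<close> yields
  an admitted constant.\<close>

lemma c_g_sparse:
  assumes "c_g X a \<le> ereal c" "a \<notin> X" "t > 0"
  shows "real (card {x \<in> X. \<bar>x - a\<bar> \<le> t}) \<le> (c + 1) * t"
proof -
  have "c_g X a < ereal (c + 1)" using assms(1) by (metis ereal_less_eq(3) less_add_one not_le order_trans)
  then obtain c' where c': "c' < c + 1"
    "real (card {x \<in> X. 0 < \<bar>x - a\<bar> \<and> \<bar>x - a\<bar> \<le> t}) \<le> c' * t"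
    unfolding c_g_def Inf_less_iff using assms(3) by auto
  have "{x \<in> X. 0 < \<bar>x - a\<bar> \<and> \<bar>x - a\<bar> \<le> t} = {x \<in> X. \<bar>x - a\<bar> \<le> t}" using assms(2) by auto
  moreover have "c' * t \<le> (c + 1) * t" using c' assms by (intro mult_right_mono) auto
  ultimately show ?thesis using c'(2) by simp
qed

lemma good_ptI:
  assumes "c_s X (mid i) n \<le> c" "c_g X (mid i) \<le> ereal c"
  shows "good_pt (c + 1) n (mid i)"
proof -
  have c1: "c \<ge> 1" using c_s_spacing(1)[OF assms(1), of i] by simp
  have sp: "1 / c \<le> pt (j + 1) - pt j" "pt (j + 1) - pt j \<le> c" if "i - \<bar>n\<bar> \<le> j" "j \<le> i + \<bar>n\<bar>" for j
    using c_s_spacing(2,3)[OF assms(1) that] .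
  have m: "mid i \<in> midpoints X" by (simp add: midpoints_eq)
  have k: "1 / (2 * (c + 1)) \<le> \<bar>x - mid i\<bar>" if "x \<in> X" for x
  proof -
    obtain j where j: "x = pt j" using \<open>x \<in> X\<close> unfolding in_X_iff by (elim exE)
    have "1 / (2 * (c + 1)) \<le> (1 / c) / 2" using c1 by (simp add: field_simps)
    also have "\<dots> \<le> (pt (i + 1) - pt i) / 2" using sp[of i] by simp
    also have "\<dots> \<le> \<bar>pt j - mid i\<bar>"
    proof (cases "j \<le> i")
      case True
      hence "pt j \<le> pt i" by (rule pt_leI)
      hence "(pt (i + 1) - pt i) / 2 \<le> mid i - pt j" unfolding mid_def by (simp add: field_simps)
      thus ?thesis by linarith
    next
      case False
      hence "pt (i + 1) \<le> pt j" by (intro pt_leI) simp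
      hence "(pt (i + 1) - pt i) / 2 \<le> pt j - mid i" unfolding mid_def by (simp add: field_simps)
      thus ?thesis by linarith
    qed
    finally show ?thesis by (simp add: j)
  qed
  have R: "pt (i + 1 + int k) \<le> mid i + (real k + 1) * c" if "int k \<le> \<bar>n\<bar>" for k :: nat
    using that
  proof (induction k)
    case 0
    have "pt (i + 1) - pt i \<le> c" using sp[of i] by simp
    thus ?case using mid_gt[of i] by simp
  next
    case (Suc k)
    have "pt (i + 1 + int k + 1) - pt (i + 1 + int k) \<le> c" using Suc by (intro sp) auto
    thus ?case using Suc by (simp add: algebra_simps)
  qed
  have L: "mid i - (real k + 1) * c \<le> pt (i - int k)" if "int k \<le> \<bar>n\<bar>" for k :: nat
    using that
  proof (induction k)
    case 0
    have "pt (i + 1) - pt i \<le> c" using sp[of i] by simp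
    thus ?case using mid_lt[of i] by simp
  next
    case (Suc k)
    have "pt (i - int (Suc k) + 1) - pt (i - int (Suc k)) \<le> c" using Suc by (intro sp) auto
    thus ?case using Suc by (simp add: algebra_simps)
  qed
  have rc: "(real_of_int \<bar>n\<bar> + 1) * c \<le> reach (c + 1) n" unfolding reach_def by (intro mult_left_mono) auto
  have "pt ` {i - \<bar>n\<bar>..i} \<subseteq> {x \<in> X. mid i - reach (c + 1) n \<le> x \<and> x < mid i}"
  proof
    fix x assume "x \<in> pt ` {i - \<bar>n\<bar>..i}"
    then obtain j where j: "x = pt j" "i - \<bar>n\<bar> \<le> j" "j \<le> i" by auto
    have "pt (i - \<bar>n\<bar>) \<le> pt j" using j by (intro pt_leI) auto
    hence "mid i - reach (c + 1) n \<le> pt j" using L[of "nat \<bar>n\<bar>"] rc by simp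
    thus "x \<in> {x \<in> X. mid i - reach (c + 1) n \<le> x \<and> x < mid i}" using j pt(1) by (auto simp: pt_less_mid_iff)
  qed
  hence "card (pt ` {i - \<bar>n\<bar>..i}) \<le> card {x \<in> X. mid i - reach (c + 1) n \<le> x \<and> x < mid i}"
    by (intro card_mono finite_subset[OF _ finite_Icc[of "mid i - reach (c + 1) n" "mid i"]]) auto
  hence cl: "\<bar>n\<bar> \<le> int (card {x \<in> X. mid i - reach (c + 1) n \<le> x \<and> x < mid i})"
    unfolding card_pt_image by simp
  have "pt ` {i + 1..i + 1 + \<bar>n\<bar>} \<subseteq> {x \<in> X. mid i < x \<and> x \<le> mid i + reach (c + 1) n}"
  proof
    fix x assume "x \<in> pt ` {i + 1..i + 1 + \<bar>n\<bar>}"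
    then obtain j where j: "x = pt j" "i + 1 \<le> j" "j \<le> i + 1 + \<bar>n\<bar>" by auto
    have "pt j \<le> pt (i + 1 + \<bar>n\<bar>)" using j by (intro pt_leI) auto
    hence "pt j \<le> mid i + reach (c + 1) n" using R[of "nat \<bar>n\<bar>"] rc by simp
    thus "x \<in> {x \<in> X. mid i < x \<and> x \<le> mid i + reach (c + 1) n}" using j pt(1) by (auto simp: mid_less_pt_iff)
  qed
  hence "card (pt ` {i + 1..i + 1 + \<bar>n\<bar>}) \<le> card {x \<in> X. mid i < x \<and> x \<le> mid i + reach (c + 1) n}"
    by (intro card_mono finite_subset[OF _ finite_Icc[of "mid i" "mid i + reach (c + 1) n"]]) auto
  hence cr: "\<bar>n\<bar> \<le> int (card {x \<in> X. mid i < x \<and> x \<le> mid i + reach (c + 1) n})"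
    unfolding card_pt_image by simp
  show ?thesis unfolding good_pt_def
    using m k cl cr c_g_sparse[OF assms(2) midpoint_notin[OF m]] by (intro conjI ballI allI impI) assumption+
qed

lemma condX_good:
  assumes "condX X n" shows "\<exists>c\<ge>1. bi_infinite {a. good_pt c n a}"
proof -
  obtain c where c: "bi_infinite {a \<in> midpoints X. c_s X a n \<le> c \<and> c_g X a \<le> ereal c}"
    using assms by (auto simp: condX_def)
  have sub: "{a \<in> midpoints X. c_s X a n \<le> c \<and> c_g X a \<le> ereal c} \<subseteq> {a. good_pt (c + 1) n a}"
    unfolding midpoints_eq using good_ptI by auto
  have "bi_infinite {a. good_pt (c + 1) n a}"
    using c sub unfolding bi_infinite_def by (meson bdd_above_mono bdd_below_mono)
  moreover have "c + 1 \<ge> 1"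
  proof -
    have "{a \<in> midpoints X. c_s X a n \<le> c \<and> c_g X a \<le> ereal c} \<noteq> {}" using c by (auto simp: bi_infinite_def)
    then obtain i where "c_s X (mid i) n \<le> c" unfolding midpoints_eq by auto
    from c_s_spacing(1)[OF this, of i] show ?thesis by simp
  qed
  ultimately show ?thesis by blast
qed

end

section \<open>Jumps across a midpoint in a finite volume\<close>

context point_set
begin

lemma finite_crossers_resample:
  assumes "\<eta> \<in> Perms X" "\<Lambda> \<subseteq> X" "finite \<Lambda>" "\<sigma> \<in> resample X \<Lambda> \<eta>" "finite (crossers X a \<eta>)"
  shows "finite (crossers X a \<sigma>)"
proof (rule finite_subset)
  show "crossers X a \<sigma> \<subseteq> crossers X a \<eta> \<union> \<Lambda>"
    using assms(4) resample_iff[OF assms(1,2)] by (auto simp: crossers_def movable_def)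
qed (use assms in simp)

text \<open>Resampling permutes the targets of the movable points, so it does not change how many of these
  targets are left of \<open>a\<close>.\<close>

lemma flow_resample:
  assumes "\<eta> \<in> Perms X" "\<Lambda> \<subseteq> X" "finite \<Lambda>" "\<sigma> \<in> resample X \<Lambda> \<eta>"
  shows "flow X \<sigma> = flow X \<eta>"
proof -
  obtain a where a: "a \<in> midpoints X" using ex_midpoint by blast
  have s: "\<sigma> \<in> Perms X" using assms(4) by (rule resample_Perms)
  show ?thesis
  proof (cases "finite (crossers X a \<eta>)")
    case True
    hence fs: "finite (crossers X a \<sigma>)" by (rule finite_crossers_resample[OF assms])
    define B where "B = crossers X a \<sigma> \<union> crossers X a \<eta> \<union> movable \<Lambda> \<eta>"
    have B: "finite B" "B \<subseteq> X" using True fs assms by (auto simp: B_def movable_def crossers_def)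
    have im: "(\<Sum>x\<in>movable \<Lambda> \<eta>. left_of a (\<tau> x)) = (\<Sum>y\<in>\<tau> ` movable \<Lambda> \<eta>. left_of a y)" if "\<tau> \<in> Perms X" for \<tau>
      using Perms_inj[OF that] by (subst sum.reindex) (auto intro: inj_on_subset)
    have "(\<Sum>x\<in>B. left_of a (\<sigma> x)) = (\<Sum>x\<in>B - movable \<Lambda> \<eta>. left_of a (\<sigma> x)) + (\<Sum>x\<in>movable \<Lambda> \<eta>. left_of a (\<sigma> x))"
      by (rule sum.subset_diff) (use B in \<open>auto simp: B_def\<close>)
    also have "(\<Sum>x\<in>movable \<Lambda> \<eta>. left_of a (\<sigma> x)) = (\<Sum>x\<in>movable \<Lambda> \<eta>. left_of a (\<eta> x))"
      unfolding im[OF s] im[OF assms(1)] resample_movable_image[OF assms(4,1,2)] ..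
    also have "(\<Sum>x\<in>B - movable \<Lambda> \<eta>. left_of a (\<sigma> x)) = (\<Sum>x\<in>B - movable \<Lambda> \<eta>. left_of a (\<eta> x))"
      using assms(4) resample_iff[OF assms(1,2)] by (intro sum.cong) auto
    also have "\<dots> + (\<Sum>x\<in>movable \<Lambda> \<eta>. left_of a (\<eta> x)) = (\<Sum>x\<in>B. left_of a (\<eta> x))"
      by (rule sum.subset_diff[symmetric]) (use B in \<open>auto simp: B_def\<close>)
    finally have e: "(\<Sum>x\<in>B. left_of a x - left_of a (\<sigma> x)) = (\<Sum>x\<in>B. left_of a x - left_of a (\<eta> x))"
      by (simp add: sum_subtractf)
    have sub: "crossers X a \<sigma> \<subseteq> B" "crossers X a \<eta> \<subseteq> B" by (auto simp: B_def)
    show ?thesis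
      using flow_FinI[OF s a refl B(1) sub(1) B(2)] flow_FinI[OF assms(1) a refl B(1) sub(2) B(2)] e
      by simp
  next
    case False
    have "\<not> finite (crossers X a \<sigma>)"
      using False finite_crossers_resample[OF s assms(2,3) resample_sym[OF assms(4,1)]] by blast
    thus ?thesis using False s assms a by (simp add: flow_eq_flow_at flow_at_eq)
  qed
qed

text \<open>The volume \<open>\<Lambda>\<close> is so large that every jump of \<open>\<eta>\<close> across
  \<open>a\<close>, and every jump that starts or ends within \<open>T\<close> of \<open>a\<close>,
  is movable. For fixed \<open>\<eta>\<close> with finite flow this holds for all large
  \<open>\<Lambda>\<close>.\<close>

definition suitable :: "real \<Rightarrow> real \<Rightarrow> real set \<Rightarrow> (real \<Rightarrow> real) \<Rightarrow> bool" where
  "suitable a T \<Lambda> \<eta> \<longleftrightarrow> (\<forall>x\<in>crossers X a \<eta>. x \<in> \<Lambda> \<and> \<eta> x \<in> \<Lambda>) \<and>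
     (\<forall>x\<in>X. \<bar>x - a\<bar> \<le> T \<longrightarrow> x \<in> \<Lambda> \<and> \<eta> x \<in> \<Lambda> \<and> inv \<eta> x \<in> \<Lambda>)"

lemma suitable_mono: "suitable a T \<Lambda> \<eta> \<Longrightarrow> T' \<le> T \<Longrightarrow> suitable a T' \<Lambda> \<eta>"
  by (auto simp: suitable_def)

lemma suitable_inv: "\<eta> \<in> Perms X \<Longrightarrow> suitable a T \<Lambda> \<eta> \<Longrightarrow> suitable a T \<Lambda> (inv \<eta>)"
  unfolding suitable_def crossers_inv by (auto simp: Perms_inv_l Perms_inv_inv)

lemma suitable_crosser:
  assumes "suitable a T \<Lambda> \<eta>" "\<eta> \<in> Perms X" "\<Lambda> \<subseteq> X" "\<sigma> \<in> resample X \<Lambda> \<eta>" "x \<in> crossers X a \<sigma>"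
  shows "x \<in> movable \<Lambda> \<eta>"
proof (rule ccontr)
  assume n: "x \<notin> movable \<Lambda> \<eta>"
  hence "\<sigma> x = \<eta> x" using assms resample_iff by blast
  hence "x \<in> crossers X a \<eta>" using assms(5) by (simp add: crossers_def)
  thus False using n assms(1) by (auto simp: suitable_def movable_def)
qed

lemma suitable_near:
  assumes "suitable a T \<Lambda> \<eta>" "\<eta> \<in> Perms X" "\<Lambda> \<subseteq> X" "\<sigma> \<in> resample X \<Lambda> \<eta>" "x \<in> X" "\<bar>x - a\<bar> \<le> T"
  shows "x \<in> movable \<Lambda> \<eta>" "inv \<sigma> x \<in> movable \<Lambda> \<eta>"
proof -
  show "x \<in> movable \<Lambda> \<eta>" using assms by (auto simp: suitable_def movable_def)
  have i: "inv \<eta> x \<in> movable \<Lambda> \<eta>" using assms by (auto simp: suitable_def movable_def Perms_inv_r)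
  have s: "\<sigma> \<in> Perms X" using assms(4) by (rule resample_Perms)
  have "x \<in> \<eta> ` movable \<Lambda> \<eta>" using i Perms_inv_r[OF assms(2)] by (metis imageI)
  hence "x \<in> \<sigma> ` movable \<Lambda> \<eta>" using resample_movable_image[OF assms(4,2,3)] by simp
  thus "inv \<sigma> x \<in> movable \<Lambda> \<eta>" using Perms_inv_l[OF s] by auto
qed

definition tight :: "real \<Rightarrow> real \<Rightarrow> (real \<Rightarrow> real) \<Rightarrow> bool" where
  "tight a T \<sigma> \<longleftrightarrow> (\<forall>x\<in>crossers X a \<sigma>. \<bar>x - a\<bar> \<le> T \<and> \<bar>\<sigma> x - a\<bar> \<le> T)"

definition far_jump :: "real \<Rightarrow> real \<Rightarrow> real \<Rightarrow> (real \<Rightarrow> real) \<Rightarrow> bool" where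
  "far_jump s a T \<sigma> \<longleftrightarrow> (\<exists>x\<in>X. s * (x - a) < - T \<and> s * (\<sigma> x - a) > 0)"

text \<open>A jump to the right whose target is far is, read backwards, a jump to the left whose source is far.
  So four cases of far sources cover all jumps that leave the window.\<close>

lemma not_tight_far_jump:
  assumes "\<sigma> \<in> Perms X" "\<not> tight a T \<sigma>" "T \<ge> 0"
  shows "far_jump 1 a T \<sigma> \<or> far_jump (-1) a T \<sigma> \<or> far_jump 1 a T (inv \<sigma>) \<or> far_jump (-1) a T (inv \<sigma>)"
proof -
  obtain x where x: "x \<in> X" "crosses a x (\<sigma> x)" "\<bar>x - a\<bar> > T \<or> \<bar>\<sigma> x - a\<bar> > T"
    using assms(2) by (force simp: tight_def crossers_def)
  have sx: "\<sigma> x \<in> X" "inv \<sigma> (\<sigma> x) = x" using x assms by (simp_all add: Perms_mem Perms_inv_l)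
  from x(3) show ?thesis
  proof
    assume "\<bar>x - a\<bar> > T"
    hence "far_jump 1 a T \<sigma> \<or> far_jump (-1) a T \<sigma>" using x assms(3) unfolding far_jump_def crosses_def by force
    thus ?thesis by blast
  next
    assume h: "\<bar>\<sigma> x - a\<bar> > T"
    have "far_jump 1 a T (inv \<sigma>) \<or> far_jump (-1) a T (inv \<sigma>)"
    proof (cases "\<sigma> x < a")
      case True
      hence "far_jump 1 a T (inv \<sigma>)" unfolding far_jump_def using h x sx by (intro bexI[of _ "\<sigma> x"]) (auto simp: crosses_def)
      thus ?thesis by blast
    next
      case False
      hence "far_jump (-1) a T (inv \<sigma>)" unfolding far_jump_def using h x sx by (intro bexI[of _ "\<sigma> x"]) (auto simp: crosses_def)
      thus ?thesis by blast
    qed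
    thus ?thesis by blast
  qed
qed

lemma good_pt_minus: "good_pt c n a \<Longrightarrow> good_pt c (- n) a"
  by (simp add: good_pt_def reach_def)

lemma good_ptD:
  assumes "good_pt c n a"
  shows "a \<in> midpoints X" "a \<notin> X" "\<And>x. x \<in> X \<Longrightarrow> 1 / (2 * c) \<le> \<bar>x - a\<bar>"
    "\<And>Y. finite Y \<Longrightarrow> Y \<subseteq> X \<Longrightarrow> t > 0 \<Longrightarrow> real (card {y \<in> Y. \<bar>y - a\<bar> \<le> t}) \<le> c * t"
proof -
  show "a \<in> midpoints X" "\<And>x. x \<in> X \<Longrightarrow> 1 / (2 * c) \<le> \<bar>x - a\<bar>" using assms by (auto simp: good_pt_def)
  thus "a \<notin> X" using midpoint_notin by blast
  fix Y assume Y: "finite Y" "Y \<subseteq> X" and t: "t > 0"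
  have "{x \<in> X. \<bar>x - a\<bar> \<le> t} \<subseteq> X \<inter> {a - t..a + t}" by auto
  hence "finite {x \<in> X. \<bar>x - a\<bar> \<le> t}" using finite_Icc finite_subset by blast
  hence "card {y \<in> Y. \<bar>y - a\<bar> \<le> t} \<le> card {x \<in> X. \<bar>x - a\<bar> \<le> t}"
    using Y by (intro card_mono) auto
  also have "real \<dots> \<le> c * t" using assms t by (auto simp: good_pt_def)
  finally show "real (card {y \<in> Y. \<bar>y - a\<bar> \<le> t}) \<le> c * t" by simp
qed

text \<open>If no such partner existed, then all \<open>\<bar>n\<bar>\<close> points close to \<open>a\<close>
  on the side of \<open>x\<close>, and also \<open>x\<close> itself, would jump over
  \<open>a\<close> in direction \<open>s\<close>, and no point would jump back. The flow in
  direction \<open>s\<close> would be at least \<open>\<bar>n\<bar> + 1\<close>.\<close>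

lemma exists_partner:
  assumes "good_pt c n a" "\<sigma> \<in> Perms X" "flow X \<sigma> = Fin n" "s = 1 \<or> s = -1"
    "x \<in> X" "s * (x - a) < - reach c n" "s * (\<sigma> x - a) > 0" "c \<ge> 1"
  shows "\<exists>y\<in>X. - reach c n \<le> s * (y - a) \<and> s * (\<sigma> y - a) < 0"
proof (rule ccontr)
  assume c: "\<not> ?thesis"
  have am: "a \<in> midpoints X" "a \<notin> X" using good_ptD[OF assms(1)] by auto
  have w: "reach c n \<ge> 0" using assms by (simp add: reach_def)
  define W where "W = {y \<in> X. - reach c n \<le> s * (y - a) \<and> s * (y - a) < 0}"
  have cW: "\<bar>n\<bar> \<le> int (card W)"
  proof (cases "s = 1")
    case True
    have "W = {x \<in> X. a - reach c n \<le> x \<and> x < a}" unfolding W_def True by auto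
    thus ?thesis using assms(1) by (simp add: good_pt_def)
  next
    case False
    hence "s = -1" using assms by simp
    hence "W = {x \<in> X. a < x \<and> x \<le> a + reach c n}" unfolding W_def by auto
    thus ?thesis using assms(1) by (simp add: good_pt_def)
  qed
  have "W \<subseteq> X \<inter> {a - reach c n..a + reach c n}" using assms(4) by (auto simp: W_def)
  hence fW: "finite W" using finite_Icc finite_subset by blast
  define B where "B = crossers X a \<sigma> \<union> insert x W"
  have fc: "finite (crossers X a \<sigma>)" using flow_Fin_iff[OF assms(2) am(1)] assms(3) by blast
  have B: "finite B" "B \<subseteq> X" using fc fW assms(5) by (auto simp: B_def W_def crossers_def)
  have n: "(\<Sum>y\<in>B. left_of a y - left_of a (\<sigma> y)) = n"
    by (rule flow_Fin_sum[OF assms(2) am(1) assms(3) B(1) _ B(2)]) (auto simp: B_def)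
  define g where "g y = s * of_int (left_of a y - left_of a (\<sigma> y))" for y
  have ne: "y \<noteq> a" "\<sigma> y \<noteq> a" if "y \<in> X" for y using that am Perms_mem[OF assms(2)] by auto
  have g1: "g y = 1" if "y \<in> insert x W" for y
  proof -
    have y: "y \<in> X" "s * (y - a) < 0" using that assms w by (auto simp: W_def)
    have "\<not> s * (\<sigma> y - a) < 0" using c that assms y by (cases "y = x") (auto simp: W_def)
    hence "s * (\<sigma> y - a) > 0" using ne[OF y(1)] assms(4) by auto
    thus ?thesis using y assms(4) by (auto simp: g_def left_of_def)
  qed
  have g0: "g y \<ge> 0" if "y \<in> B" for y
  proof (rule ccontr)
    assume "\<not> ?thesis"
    moreover have "y \<noteq> a" "\<sigma> y \<noteq> a" using ne B(2) that by auto
    ultimately have "s * (y - a) > 0" "s * (\<sigma> y - a) < 0" using assms(4)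
      by (auto simp: g_def left_of_def split: if_splits)
    thus False using c that B(2) w by force
  qed
  have "real (card (insert x W)) = (\<Sum>y\<in>insert x W. g y)" using g1 by simp
  also have "\<dots> \<le> (\<Sum>y\<in>B. g y)" by (rule sum_mono2) (use B g0 in \<open>auto simp: B_def\<close>)
  also have "\<dots> = s * of_int n" unfolding n[symmetric] g_def by (simp add: sum_distrib_left)
  also have "\<dots> \<le> of_int \<bar>n\<bar>" using assms(4) by auto
  finally have "int (card (insert x W)) \<le> \<bar>n\<bar>" by linarith
  moreover have "x \<notin> W" using assms(6) by (auto simp: W_def)
  ultimately show False using cW fW by simp
qed

section \<open>Shifts and cuts\<close>

definition theta :: "int \<Rightarrow> real \<Rightarrow> real" where
  "theta n x = (if x \<in> X then pt (height x + n) else x)"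

lemma theta_pt [simp]: "theta n (pt j) = pt (j + n)" by (simp add: theta_def pt)

lemma theta_Perms: "theta n \<in> Perms X"
proof -
  have "bij (theta n)"
  proof (rule o_bij[of "theta (- n)"])
    show "theta (- n) \<circ> theta n = id" "theta n \<circ> theta (- n) = id"
      by (auto simp: fun_eq_iff theta_def pt pt_height)
  qed
  hence "bij_betw (theta n) X X"
    using bij_betw_subset[OF \<open>bij (theta n)\<close>, of X "theta n ` X"]
    by (rule_tac bij_betw_byWitness[where f' = "theta (- n)"]) (auto simp: theta_def pt pt_height)
  thus ?thesis unfolding Perms_def by (auto intro!: bij_imp_permutes simp: theta_def pt)
qed

lemma inv_theta: "inv (theta n) = theta (- n)"
  by (rule inv_unique_comp) (auto simp: fun_eq_iff theta_def pt pt_height)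

text \<open>The crossing jumps at \<open>a\<close> are those of the shift by \<open>n\<close>: for \<open>n
  \<ge> 0\<close> the last \<open>n\<close> points before \<open>a\<close> jump, in order, to the
  first \<open>n\<close> points after \<open>a\<close>, and nothing jumps back.\<close>

definition cut :: "int \<Rightarrow> real \<Rightarrow> (real \<Rightarrow> real) \<Rightarrow> bool" where
  "cut n a \<sigma> \<longleftrightarrow> (\<forall>x\<in>X. crosses a x (\<sigma> x) \<or> crosses a x (theta n x) \<longrightarrow> \<sigma> x = theta n x)"

lemma crosses_pt: "crosses (mid i) (pt j) (pt k) \<longleftrightarrow> (j \<le> i) \<noteq> (k \<le> i)"
  by (auto simp: crosses_def pt_less_mid_iff mid_less_pt_iff)

text \<open>An increasing integer sequence grows by at least \<open>1\<close> at every step. Counted from the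
  left end this bounds \<open>f i\<close> from below, counted from the right end it bounds it from
  above.\<close>

lemma increasing_shift:
  fixes f :: "int \<Rightarrow> int"
  assumes "\<And>i j. p \<le> i \<Longrightarrow> i < j \<Longrightarrow> j \<le> q \<Longrightarrow> f i < f j"
    "\<And>i. p \<le> i \<Longrightarrow> i \<le> q \<Longrightarrow> p + n \<le> f i \<and> f i \<le> q + n" "p \<le> i" "i \<le> q"
  shows "f i = i + n"
proof (rule antisym)
  have "p + k \<le> q \<longrightarrow> p + k + n \<le> f (p + k)" if "k \<ge> 0" for k
    using that
  proof (induction k rule: int_ge_induct)
    case base thus ?case using assms(2)[of p] by auto
  next
    case (step k) thus ?case using assms(1)[of "p + k" "p + (k + 1)"] by auto
  qed
  from this[of "i - p"] show "i + n \<le> f i" using assms by simp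
  have "p \<le> q - k \<longrightarrow> f (q - k) \<le> q - k + n" if "k \<ge> 0" for k
    using that
  proof (induction k rule: int_ge_induct)
    case base thus ?case using assms(2)[of q] by auto
  next
    case (step k) thus ?case using assms(1)[of "q - (k + 1)" "q - k"] by auto
  qed
  from this[of "q - i"] show "f i \<le> i + n" using assms by simp
qed

lemma downset_eq:
  fixes A B L :: "int set"
  assumes "finite L" "A \<subseteq> L" "B \<subseteq> L" "card A = card B"
    "\<And>i j. i \<in> L \<Longrightarrow> j \<in> A \<Longrightarrow> i < j \<Longrightarrow> i \<in> A" "\<And>i j. i \<in> L \<Longrightarrow> j \<in> B \<Longrightarrow> i < j \<Longrightarrow> i \<in> B"
  shows "A = B"
proof -
  have "A \<subseteq> B \<or> B \<subseteq> A"
  proof (rule ccontr)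
    assume "\<not> ?thesis"
    then obtain i j where "i \<in> A" "i \<notin> B" "j \<in> B" "j \<notin> A" by blast
    thus False using assms(2,3,5,6) by (metis linorder_neqE subsetD)
  qed
  thus ?thesis using assms by (metis card_subset_eq finite_subset)
qed

text \<open>On the window \<open>L\<close>, the points that \<open>\<sigma>\<close> sends to the left of the
  midpoint form an initial segment, and by the flow it has \<open>n\<close> points fewer than the
  initial segment of points left of the midpoint.\<close>

lemma sorted_threshold:
  assumes "\<sigma> \<in> Perms X" "flow X \<sigma> = Fin n" "tight (mid i) T \<sigma>"
    "L = {j. \<bar>pt j - mid i\<bar> \<le> T}" "{i - \<bar>n\<bar> + 1..i + \<bar>n\<bar>} \<subseteq> L"
    "\<And>x y. x \<in> pt ` L \<Longrightarrow> y \<in> pt ` L \<Longrightarrow> x < y \<Longrightarrow> \<sigma> x < \<sigma> y" "j \<in> L"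
  shows "\<sigma> (pt j) < mid i \<longleftrightarrow> j \<le> i - n"
proof -
  have am: "mid i \<in> midpoints X" by (simp add: midpoints_eq)
  have "pt ` L \<subseteq> X \<inter> {mid i - T..mid i + T}" using assms(4) pt(1) by auto
  hence "finite (pt ` L)" using finite_Icc finite_subset by blast
  hence fL: "finite L" using inj_pt by (meson finite_imageD inj_on_subset subset_UNIV)
  have cr: "crossers X (mid i) \<sigma> \<subseteq> pt ` L"
  proof
    fix x assume x: "x \<in> crossers X (mid i) \<sigma>"
    then obtain j where j: "x = pt j" unfolding crossers_def in_X_iff by auto
    show "x \<in> pt ` L" using x assms(3,4) unfolding j tight_def by auto
  qed
  have "(\<Sum>x\<in>pt ` L. left_of (mid i) x - left_of (mid i) (\<sigma> x)) = n"
    by (rule flow_Fin_sum[OF assms(1) am assms(2) _ cr]) (use fL pt(1) in auto)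
  hence n: "(\<Sum>j\<in>L. left_of (mid i) (pt j) - left_of (mid i) (\<sigma> (pt j))) = n"
    by (subst (asm) sum.reindex) (auto intro: inj_on_subset[OF inj_pt])
  have c: "(\<Sum>j\<in>L. left_of (mid i) (f j)) = int (card {j\<in>L. f j < mid i})" for f
    using fL by (simp add: left_of_def[abs_def] sum.If_cases Int_def conj_commute)
  have "int (card {j\<in>L. \<sigma> (pt j) < mid i}) = int (card {j\<in>L. j \<le> i}) - n"
    using n unfolding sum_subtractf c pt_less_mid_iff by simp
  also have "\<dots> = int (card {j\<in>L. j \<le> i - n})"
  proof (cases "n \<ge> 0")
    case True
    have "{j\<in>L. j \<le> i} = {j\<in>L. j \<le> i - n} \<union> {i - n + 1..i}" using True assms(5) by auto
    also have "card \<dots> = card {j\<in>L. j \<le> i - n} + card {i - n + 1..i}"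
      using fL by (intro card_Un_disjoint) auto
    finally show ?thesis using True by simp
  next
    case False
    have "{j\<in>L. j \<le> i - n} = {j\<in>L. j \<le> i} \<union> {i + 1..i - n}" using False assms(5) by auto
    also have "card \<dots> = card {j\<in>L. j \<le> i} + card {i + 1..i - n}"
      using fL by (intro card_Un_disjoint) auto
    finally show ?thesis using False by simp
  qed
  finally have "card {j\<in>L. \<sigma> (pt j) < mid i} = card {j\<in>L. j \<le> i - n}" by simp
  hence "{j\<in>L. \<sigma> (pt j) < mid i} = {j\<in>L. j \<le> i - n}"
  proof (rule downset_eq[OF fL, rotated 2])
    fix k j assume "k \<in> L" "j \<in> {j\<in>L. \<sigma> (pt j) < mid i}" "k < j"
    thus "k \<in> {j\<in>L. \<sigma> (pt j) < mid i}" using assms(6)[of "pt k" "pt j"] by (auto simp: pt_less_iff)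
  qed auto
  thus ?thesis using assms(7) by blast
qed

lemma good_window:
  assumes "good_pt c n (mid i)" "reach c n \<le> T"
  shows "{i - \<bar>n\<bar> + 1..i + \<bar>n\<bar>} \<subseteq> {j. \<bar>pt j - mid i\<bar> \<le> T}"
proof
  fix j assume j: "j \<in> {i - \<bar>n\<bar> + 1..i + \<bar>n\<bar>}"
  show "j \<in> {j. \<bar>pt j - mid i\<bar> \<le> T}"
  proof (rule ccontr)
    assume "j \<notin> {j. \<bar>pt j - mid i\<bar> \<le> T}"
    hence f: "\<bar>pt j - mid i\<bar> > T" by simp
    show False
    proof (cases "j \<le> i")
      case True
      hence lt: "pt j < mid i - reach c n" using f assms(2) by (simp add: pt_less_mid_iff[symmetric])
      have "{x \<in> X. mid i - reach c n \<le> x \<and> x < mid i} \<subseteq> pt ` {j + 1..i}"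
      proof
        fix x assume x: "x \<in> {x \<in> X. mid i - reach c n \<le> x \<and> x < mid i}"
        then obtain k where k: "x = pt k" unfolding in_X_iff by auto
        have "pt j < pt k" using lt x k by auto
        thus "x \<in> pt ` {j + 1..i}" using x k by (auto simp: pt_less_iff pt_less_mid_iff)
      qed
      hence "card {x \<in> X. mid i - reach c n \<le> x \<and> x < mid i} \<le> card (pt ` {j + 1..i})"
        by (intro card_mono) auto
      thus False using j True assms(1) unfolding card_pt_image good_pt_def by auto
    next
      case False
      hence "mid i < pt j" by (simp add: mid_less_pt_iff)
      hence lt: "mid i + reach c n < pt j" using f assms(2) by simp
      have "{x \<in> X. mid i < x \<and> x \<le> mid i + reach c n} \<subseteq> pt ` {i + 1..j - 1}"
      proof
        fix x assume x: "x \<in> {x \<in> X. mid i < x \<and> x \<le> mid i + reach c n}"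
        then obtain k where k: "x = pt k" unfolding in_X_iff by auto
        have "pt k < pt j" using lt x k by auto
        thus "x \<in> pt ` {i + 1..j - 1}" using x k by (auto simp: pt_less_iff mid_less_pt_iff)
      qed
      hence "card {x \<in> X. mid i < x \<and> x \<le> mid i + reach c n} \<le> card (pt ` {i + 1..j - 1})"
        by (intro card_mono) auto
      thus False using j False assms(1) unfolding card_pt_image good_pt_def by auto
    qed
  qed
qed

lemma tight_inv: "\<sigma> \<in> Perms X \<Longrightarrow> tight a T \<sigma> \<Longrightarrow> tight a T (inv \<sigma>)"
  unfolding tight_def crossers_inv by (auto simp: Perms_inv_l)

text \<open>Apply \<open>sorted_threshold\<close> to \<open>\<sigma>\<close> and to its inverse: the sources and
  the targets of the crossing jumps are the two intervals of \<open>\<bar>n\<bar>\<close> points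
  adjacent to \<open>a\<close>, and \<open>\<sigma>\<close> maps the first increasingly onto the
  second.\<close>

lemma sorted_imp_cut:
  assumes "\<sigma> \<in> Perms X" "flow X \<sigma> = Fin n" "tight a T \<sigma>" "good_pt c n a" "reach c n \<le> T"
    "\<And>x y. x \<in> X \<Longrightarrow> y \<in> X \<Longrightarrow> \<bar>x - a\<bar> \<le> T \<Longrightarrow> \<bar>y - a\<bar> \<le> T \<Longrightarrow> x < y \<Longrightarrow> \<sigma> x < \<sigma> y"
    "\<And>x y. x \<in> X \<Longrightarrow> y \<in> X \<Longrightarrow> \<bar>x - a\<bar> \<le> T \<Longrightarrow> \<bar>y - a\<bar> \<le> T \<Longrightarrow> x < y \<Longrightarrow> inv \<sigma> x < inv \<sigma> y"
  shows "cut n a \<sigma>"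
proof -
  obtain i where i: "a = mid i" using good_ptD(1)[OF assms(4)] unfolding midpoints_eq by auto
  define L where "L = {j. \<bar>pt j - mid i\<bar> \<le> T}"
  have win: "{i - \<bar>n\<bar> + 1..i + \<bar>n\<bar>} \<subseteq> L" unfolding L_def using good_window assms(4,5) i by blast
  have th1: "\<sigma> (pt j) < mid i \<longleftrightarrow> j \<le> i - n" if "j \<in> L" for j
    by (rule sorted_threshold[OF assms(1,2) assms(3)[unfolded i] L_def win _ that])
      (use assms(6) pt(1) in \<open>auto simp: L_def i\<close>)
  have th2: "inv \<sigma> (pt j) < mid i \<longleftrightarrow> j \<le> i + n" if "j \<in> L" for j
    using sorted_threshold[OF Perms_inv[OF assms(1)] flow_inv[OF assms(1,2)]
        tight_inv[OF assms(1) assms(3)[unfolded i]] L_def _ _ that] win assms(7) pt(1) 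
    by (auto simp: L_def i)
  define f where "f j = height (\<sigma> (pt j))" for j
  have f: "\<sigma> (pt j) = pt (f j)" for j
    using pt_height Perms_mem[OF assms(1)] pt(1) by (simp add: f_def)
  have src: "j \<in> L \<and> (j \<le> i) \<noteq> (j \<le> i - n)" if "crosses a (pt j) (\<sigma> (pt j)) \<or> crosses a (pt j) (pt (j + n))" for j
  proof -
    have "(j \<le> i) \<noteq> (j \<le> i - n) \<Longrightarrow> j \<in> L" using win by (auto simp: subset_iff)
    moreover have "(j \<le> i) \<noteq> (j \<le> i - n)" if "crosses a (pt j) (pt (j + n))"
      using that unfolding i crosses_pt by (simp add: algebra_simps)
    moreover have "(j \<le> i) \<noteq> (j \<le> i - n)" if "crosses a (pt j) (\<sigma> (pt j))"
    proof -
      have "pt j \<in> crossers X a \<sigma>" using that pt(1) by (simp add: crossers_def)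
      hence "j \<in> L" using assms(3) by (auto simp: tight_def L_def i)
      thus ?thesis using th1[of j] that unfolding i f crosses_pt pt_less_mid_iff by blast
    qed
    ultimately show ?thesis using that by blast
  qed
  have tgt: "(f j \<le> i) \<noteq> (f j \<le> i + n)" if "(j \<le> i) \<noteq> (j \<le> i - n)" for j
  proof -
    have j: "j \<in> L" using win that by (auto simp: subset_iff)
    hence "crosses a (pt j) (\<sigma> (pt j))" unfolding i f crosses_pt using th1[of j] that unfolding f pt_less_mid_iff by blast
    hence "pt j \<in> crossers X a \<sigma>" using pt(1) by (simp add: crossers_def)
    hence "\<bar>pt (f j) - mid i\<bar> \<le> T" using assms(3) unfolding tight_def i f[symmetric] by blast
    hence fL: "f j \<in> L" by (simp add: L_def)
    have "inv \<sigma> (pt (f j)) = pt j" unfolding f[symmetric] by (rule Perms_inv_l[OF assms(1)])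
    hence "j \<le> i \<longleftrightarrow> f j \<le> i + n" using th2[OF fL] by (simp add: pt_less_mid_iff)
    moreover have "f j \<le> i \<longleftrightarrow> j \<le> i - n" using th1[OF j] unfolding f pt_less_mid_iff .
    ultimately show ?thesis using that by blast
  qed
  have mono: "f j < f k" if "j \<in> L" "k \<in> L" "j < k" for j k
    using assms(6)[of "pt j" "pt k"] that pt(1) unfolding f by (auto simp: L_def i pt_less_iff)
  have sh: "f j = j + n" if j: "(j \<le> i) \<noteq> (j \<le> i - n)" for j
  proof (cases "n \<ge> 0")
    case True
    show ?thesis
    proof (rule increasing_shift[where p = "i - n + 1" and q = i])
      fix k assume "i - n + 1 \<le> k" "k \<le> i"
      thus "i - n + 1 + n \<le> f k \<and> f k \<le> i + n" using tgt[of k] True by auto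
    next
      fix k l assume "i - n + 1 \<le> k" "k < l" "l \<le> i"
      thus "f k < f l" using mono[of k l] win True by (auto simp: subset_iff)
    qed (use j True in auto)
  next
    case False
    show ?thesis
    proof (rule increasing_shift[where p = "i + 1" and q = "i - n"])
      fix k assume "i + 1 \<le> k" "k \<le> i - n"
      thus "i + 1 + n \<le> f k \<and> f k \<le> i - n + n" using tgt[of k] False by auto
    next
      fix k l assume "i + 1 \<le> k" "k < l" "l \<le> i - n"
      thus "f k < f l" using mono[of k l] win False by (auto simp: subset_iff)
    qed (use j False in auto)
  qed
  show ?thesis unfolding cut_def
  proof (intro ballI impI)
    fix x assume "x \<in> X" and c: "crosses a x (\<sigma> x) \<or> crosses a x (theta n x)"
    then obtain j where j: "x = pt j" unfolding in_X_iff by auto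
    show "\<sigma> x = theta n x" using sh[of j] src[of j] c unfolding j theta_pt f by simp
  qed
qed

end

section \<open>Finite-volume Gibbs probabilities\<close>

context permutation_gas
begin

definition weight :: "real set \<Rightarrow> (real \<Rightarrow> real) \<Rightarrow> real" where
  "weight \<Lambda> \<sigma> = exp (- hamiltonian V \<Lambda> \<sigma>)"

definition gibbs_prob :: "real set \<Rightarrow> (real \<Rightarrow> real) \<Rightarrow> (real \<Rightarrow> real) set \<Rightarrow> real" where
  "gibbs_prob \<Lambda> \<eta> E = (\<Sum>\<sigma>\<in>resample X \<Lambda> \<eta> \<inter> E. weight \<Lambda> \<sigma>) / (\<Sum>\<sigma>\<in>resample X \<Lambda> \<eta>. weight \<Lambda> \<sigma>)"

lemma weight_pos: "weight \<Lambda> \<sigma> > 0" by (simp add: weight_def)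

definition admissible :: "real set \<Rightarrow> (real \<Rightarrow> real) \<Rightarrow> bool" where
  "admissible \<Lambda> \<eta> \<longleftrightarrow> \<eta> \<in> Perms X \<and> \<Lambda> \<subseteq> X \<and> finite \<Lambda>"

lemma Z_pos: assumes "admissible \<Lambda> \<eta>" shows "(\<Sum>\<sigma>\<in>resample X \<Lambda> \<eta>. weight \<Lambda> \<sigma>) > 0"
  using assms resample_refl[of \<eta> X \<Lambda>] weight_pos by (intro sum_pos finite_resample) (auto simp: admissible_def)

lemma fin_resample: "admissible \<Lambda> \<eta> \<Longrightarrow> finite (resample X \<Lambda> \<eta>)"
  using finite_resample by (simp add: admissible_def)

lemma gibbs_prob_mono: 
  assumes "admissible \<Lambda> \<eta>" "resample X \<Lambda> \<eta> \<inter> E \<subseteq> E'" shows "gibbs_prob \<Lambda> \<eta> E \<le> gibbs_prob \<Lambda> \<eta> E'"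
  unfolding gibbs_prob_def
  by (intro divide_right_mono sum_mono2)
    (use assms fin_resample weight_pos Z_pos[OF assms(1)] in \<open>auto intro: less_imp_le\<close>)

lemma gibbs_prob_nonneg: "admissible \<Lambda> \<eta> \<Longrightarrow> gibbs_prob \<Lambda> \<eta> E \<ge> 0"
  unfolding gibbs_prob_def by (intro divide_nonneg_nonneg sum_nonneg) (auto intro: less_imp_le weight_pos)

lemma gibbs_prob_Un: assumes "admissible \<Lambda> \<eta>" shows "gibbs_prob \<Lambda> \<eta> (E \<union> E') \<le> gibbs_prob \<Lambda> \<eta> E + gibbs_prob \<Lambda> \<eta> E'"
proof -
  have "(\<Sum>\<sigma>\<in>resample X \<Lambda> \<eta> \<inter> (E \<union> E'). weight \<Lambda> \<sigma>) \<le> (\<Sum>\<sigma>\<in>resample X \<Lambda> \<eta> \<inter> E. weight \<Lambda> \<sigma>) + (\<Sum>\<sigma>\<in>resample X \<Lambda> \<eta> \<inter> E'. weight \<Lambda> \<sigma>)"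
    unfolding Int_Un_distrib using fin_resample[OF assms]
      sum.union_inter[of "resample X \<Lambda> \<eta> \<inter> E" "resample X \<Lambda> \<eta> \<inter> E'" "weight \<Lambda>"]
      sum_nonneg[of "(resample X \<Lambda> \<eta> \<inter> E) \<inter> (resample X \<Lambda> \<eta> \<inter> E')" "weight \<Lambda>"] less_imp_le[OF weight_pos] by auto
  thus ?thesis using Z_pos[OF assms] unfolding gibbs_prob_def by (simp add: add_divide_distrib[symmetric] divide_right_mono)
qed

lemma gibbs_prob_compl: assumes "admissible \<Lambda> \<eta>" shows "gibbs_prob \<Lambda> \<eta> E + gibbs_prob \<Lambda> \<eta> (- E) = 1"
proof -
  have "(\<Sum>\<sigma>\<in>resample X \<Lambda> \<eta>. weight \<Lambda> \<sigma>) = (\<Sum>\<sigma>\<in>resample X \<Lambda> \<eta> \<inter> E. weight \<Lambda> \<sigma>) + (\<Sum>\<sigma>\<in>resample X \<Lambda> \<eta> \<inter> - E. weight \<Lambda> \<sigma>)"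
    using fin_resample[OF assms] by (subst sum.union_disjoint[symmetric]) (auto intro!: sum.cong)
  thus ?thesis using Z_pos[OF assms] unfolding gibbs_prob_def by (simp add: add_divide_distrib[symmetric])
qed

lemma admissible_inv: "admissible \<Lambda> \<eta> \<Longrightarrow> admissible \<Lambda> (inv \<eta>)" by (simp add: admissible_def Perms_inv)

lemma sum_weight_inv:
  assumes "admissible \<Lambda> \<eta>"
  shows "(\<Sum>\<sigma>\<in>resample X \<Lambda> \<eta> \<inter> {\<sigma>. P (inv \<sigma>)}. weight \<Lambda> \<sigma>) = (\<Sum>\<sigma>\<in>resample X \<Lambda> (inv \<eta>) \<inter> {\<sigma>. P \<sigma>}. weight \<Lambda> \<sigma>)"
proof (rule sum.reindex_bij_witness[where i=inv and j=inv])
  have e: "\<eta> \<in> Perms X" using assms by (simp add: admissible_def)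
  fix \<sigma> assume s: "\<sigma> \<in> resample X \<Lambda> \<eta> \<inter> {\<sigma>. P (inv \<sigma>)}"
  show "inv (inv \<sigma>) = \<sigma>" using s by (auto intro: Perms_inv_inv resample_Perms)
  show "inv \<sigma> \<in> resample X \<Lambda> (inv \<eta>) \<inter> {\<sigma>. P \<sigma>}" using s resample_inv[OF _ e] by auto
  show "weight \<Lambda> (inv \<sigma>) = weight \<Lambda> \<sigma>" using s hamiltonian_inv[of \<sigma> X V \<Lambda>] V_sym resample_Perms by (auto simp: weight_def)
next
  have e: "\<eta> \<in> Perms X" using assms by (simp add: admissible_def)
  fix \<sigma> assume s: "\<sigma> \<in> resample X \<Lambda> (inv \<eta>) \<inter> {\<sigma>. P \<sigma>}"
  show i: "inv (inv \<sigma>) = \<sigma>" using s by (auto intro: Perms_inv_inv resample_Perms)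
  show "inv \<sigma> \<in> resample X \<Lambda> \<eta> \<inter> {\<sigma>. P (inv \<sigma>)}"
    using s resample_inv[OF _ Perms_inv[OF e]] i Perms_inv_inv[OF e] by auto
qed

lemma gibbs_prob_inv: assumes "admissible \<Lambda> \<eta>" shows "gibbs_prob \<Lambda> \<eta> {\<sigma>. P (inv \<sigma>)} = gibbs_prob \<Lambda> (inv \<eta>) {\<sigma>. P \<sigma>}"
  unfolding gibbs_prob_def sum_weight_inv[OF assms] using sum_weight_inv[OF assms, of "\<lambda>_. True"] by simp

section \<open>Jumps across a good midpoint are short\<close>

text \<open>If every configuration of \<open>E\<close> admits an exchange from \<open>P\<close> that gains the
  energy \<open>r x y\<close>, then its weight is at most \<open>exp (- r x y)\<close> times that of
  the exchanged configuration. For a fixed pair the exchange is injective, so the exchanged weights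
  sum to at most the partition function.\<close>

lemma gibbs_prob_swap_bound:
  assumes "admissible \<Lambda> \<eta>" "finite P" "P \<subseteq> movable \<Lambda> \<eta> \<times> movable \<Lambda> \<eta>"
    "\<And>\<sigma>. \<sigma> \<in> resample X \<Lambda> \<eta> \<inter> E \<Longrightarrow> \<exists>(x,y)\<in>P. hamiltonian V \<Lambda> (\<sigma> \<circ> swap x y) \<le> hamiltonian V \<Lambda> \<sigma> - r x y"
  shows "gibbs_prob \<Lambda> \<eta> E \<le> (\<Sum>(x,y)\<in>P. exp (- r x y))"
proof -
  let ?S = "resample X \<Lambda> \<eta>"
  have c: "\<eta> \<in> Perms X" "\<Lambda> \<subseteq> X" using assms(1) by (auto simp: admissible_def)
  have "(\<Sum>\<sigma>\<in>?S \<inter> E. weight \<Lambda> \<sigma>) \<le> (\<Sum>\<sigma>\<in>?S \<inter> E. \<Sum>(x,y)\<in>P. exp (- r x y) * weight \<Lambda> (\<sigma> \<circ> swap x y))"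
  proof (rule sum_mono)
    fix \<sigma> assume s: "\<sigma> \<in> ?S \<inter> E"
    obtain x y where xy: "(x,y) \<in> P" "hamiltonian V \<Lambda> (\<sigma> \<circ> swap x y) \<le> hamiltonian V \<Lambda> \<sigma> - r x y"
      using assms(4)[OF s] by auto
    have "weight \<Lambda> \<sigma> \<le> exp (- r x y) * weight \<Lambda> (\<sigma> \<circ> swap x y)"
      using xy(2) by (simp add: weight_def exp_add[symmetric])
    also have "\<dots> = (\<lambda>(x,y). exp (- r x y) * weight \<Lambda> (\<sigma> \<circ> swap x y)) (x,y)" by simp
    also have "\<dots> \<le> (\<Sum>(x,y)\<in>P. exp (- r x y) * weight \<Lambda> (\<sigma> \<circ> swap x y))"
      by (rule member_le_sum) (use xy assms(2) weight_pos in \<open>auto intro: less_imp_le\<close>)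
    finally show "weight \<Lambda> \<sigma> \<le> (\<Sum>(x,y)\<in>P. exp (- r x y) * weight \<Lambda> (\<sigma> \<circ> swap x y))" .
  qed
  also have "\<dots> = (\<Sum>(x,y)\<in>P. exp (- r x y) * (\<Sum>\<sigma>\<in>?S \<inter> E. weight \<Lambda> (\<sigma> \<circ> swap x y)))"
    by (subst sum.swap) (simp add: sum_distrib_left split_def)
  also have "\<dots> \<le> (\<Sum>(x,y)\<in>P. exp (- r x y) * (\<Sum>\<sigma>\<in>?S. weight \<Lambda> \<sigma>))"
  proof (rule sum_mono)
    fix p assume p: "p \<in> P"
    obtain x y where xy: "p = (x,y)" by force
    have t: "swap x y permutes movable \<Lambda> \<eta>" using p xy assms(3) by (auto intro: permutes_swap_id)
    let ?f = "\<lambda>\<sigma>::real\<Rightarrow>real. \<sigma> \<circ> swap x y"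
    have inj: "inj_on ?f (?S \<inter> E)"
      by (rule inj_on_inverseI[of _ ?f]) (simp add: comp_assoc)
    have "(\<Sum>\<sigma>\<in>?S \<inter> E. weight \<Lambda> (?f \<sigma>)) = (\<Sum>\<tau>\<in>?f ` (?S \<inter> E). weight \<Lambda> \<tau>)"
      by (subst sum.reindex[OF inj]) simp
    also have "\<dots> \<le> (\<Sum>\<tau>\<in>?S. weight \<Lambda> \<tau>)"
      by (rule sum_mono2) (use fin_resample[OF assms(1)] resample_swap[OF _ c t] weight_pos in \<open>auto intro: less_imp_le\<close>)
    finally show "(case p of (x,y) \<Rightarrow> exp (- r x y) * (\<Sum>\<sigma>\<in>?S \<inter> E. weight \<Lambda> (\<sigma> \<circ> swap x y)))
        \<le> (case p of (x,y) \<Rightarrow> exp (- r x y) * (\<Sum>\<sigma>\<in>?S. weight \<Lambda> \<sigma>))"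
      by (simp add: xy)
  qed
  also have "\<dots> = (\<Sum>(x,y)\<in>P. exp (- r x y)) * (\<Sum>\<sigma>\<in>?S. weight \<Lambda> \<sigma>)"
    by (simp add: sum_distrib_right split_def)
  finally show ?thesis using Z_pos[OF assms(1)] by (simp add: gibbs_prob_def pos_divide_le_eq)
qed

text \<open>Exchange the far jump with the partner given by \<open>exists_partner\<close>. By
  \<open>uncross_gain\<close> the gain splits into a part that depends on the far source and a part
  that depends on the partner.\<close>

lemma gibbs_prob_far_jump_le:
  assumes "admissible \<Lambda> \<eta>" "good_pt c n a" "flow X \<eta> = Fin n" "suitable a (reach c n) \<Lambda> \<eta>"
    "s = 1 \<or> s = -1" "T \<ge> reach c n" "c \<ge> 1" "\<kappa> = 1 / (2 * c)"
  shows "gibbs_prob \<Lambda> \<eta> {\<sigma>. far_jump s a T \<sigma>} \<le>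
    (\<Sum>x\<in>{x\<in>\<Lambda>. \<bar>x - a\<bar> \<ge> T}. exp (- gap \<kappa> \<bar>x - a\<bar>)) *
    (\<Sum>y\<in>{y\<in>\<Lambda>. s * (y - a) \<ge> - reach c n}. exp (- gap \<kappa> (s * (y - a))))"
proof -
  have C: "\<eta> \<in> Perms X" "\<Lambda> \<subseteq> X" "finite \<Lambda>" using assms(1) by (auto simp: admissible_def)
  have k0: "\<kappa> > 0" using assms by simp
  have w0: "reach c n \<ge> 0" using assms(7) by (simp add: reach_def)
  let ?A = "{x\<in>\<Lambda>. \<bar>x - a\<bar> \<ge> T}" and ?B = "{y\<in>\<Lambda>. s * (y - a) \<ge> - reach c n}"
  let ?P = "{(x,y). x \<in> ?A \<and> y \<in> ?B \<and> x \<in> movable \<Lambda> \<eta> \<and> y \<in> movable \<Lambda> \<eta>}"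
  have PAB: "?P \<subseteq> ?A \<times> ?B" by auto
  have fP: "finite ?P" by (rule finite_subset[OF PAB]) (use C in auto)
  have "gibbs_prob \<Lambda> \<eta> {\<sigma>. far_jump s a T \<sigma>} \<le> (\<Sum>(x,y)\<in>?P. exp (- (gap \<kappa> \<bar>x - a\<bar> + gap \<kappa> (s * (y - a)))))"
  proof (rule gibbs_prob_swap_bound[OF assms(1) fP])
    fix \<sigma> assume s: "\<sigma> \<in> resample X \<Lambda> \<eta> \<inter> {\<sigma>. far_jump s a T \<sigma>}"
    hence sA: "\<sigma> \<in> resample X \<Lambda> \<eta>" and sP: "\<sigma> \<in> Perms X" using resample_Perms by auto
    obtain x where x: "x \<in> X" "s * (x - a) < - T" "s * (\<sigma> x - a) > 0" using s by (auto simp: far_jump_def)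
    have fl: "flow X \<sigma> = Fin n" using flow_resample[OF C sA] assms(3) by simp
    obtain y where y: "y \<in> X" "- reach c n \<le> s * (y - a)" "s * (\<sigma> y - a) < 0"
      using exists_partner[OF assms(2) sP fl assms(5) x(1) _ x(3) assms(7)] x(2) assms(6) by auto
    have "s * (x - a) < 0" using x(2) assms(6) w0 by linarith
    hence "x \<in> crossers X a \<sigma>" using x assms(5) by (auto simp: crossers_def crosses_def)
    hence xf: "x \<in> movable \<Lambda> \<eta>" by (rule suitable_crosser[OF assms(4) C(1,2) sA])
    \<comment> \<open>The partner is movable either because it is close to \<open>a\<close> or because it jumps across
      \<open>a\<close> itself.\<close>
    have yf: "y \<in> movable \<Lambda> \<eta>"
    proof (cases "\<bar>y - a\<bar> \<le> reach c n")
      case True thus ?thesis using suitable_near(1)[OF assms(4) C(1,2) sA y(1)] by blast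
    next
      case False
      hence "s * (y - a) > 0" using y(2) assms(5) by auto
      hence "y \<in> crossers X a \<sigma>" using y assms(5) by (auto simp: crossers_def crosses_def)
      thus ?thesis by (rule suitable_crosser[OF assms(4) C(1,2) sA])
    qed
    have xa: "\<bar>x - a\<bar> = s * (a - x)" "\<bar>x - a\<bar> \<ge> T" using x(2) assms(5,6) w0 by auto
    have sxy: "s * (x - a) < s * (y - a)" using x(2) y(2) assms(6) by linarith
    hence ne: "x \<noteq> y" by auto
    have sk: "\<kappa> \<le> s * (\<sigma> x - a)" "s * (\<sigma> y - a) \<le> - \<kappa>"
      using x y good_ptD(3)[OF assms(2), of "\<sigma> x"] good_ptD(3)[OF assms(2), of "\<sigma> y"] Perms_mem[OF sP] assms(5,8) by auto
    have "gap \<kappa> (s * (a - x)) + gap \<kappa> (s * (y - a)) \<le> V (\<sigma> x - x) + V (\<sigma> y - y) - V (\<sigma> x - y) - V (\<sigma> y - x)"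
      by (rule uncross_gain) (use k0 assms(5) sxy sk in auto)
    hence "hamiltonian V \<Lambda> (\<sigma> \<circ> swap x y) \<le> hamiltonian V \<Lambda> \<sigma> - (gap \<kappa> \<bar>x - a\<bar> + gap \<kappa> (s * (y - a)))"
      using hamiltonian_swap[OF sA C xf yf ne, of V] xa by simp
    moreover have "(x, y) \<in> ?P" using xf yf xa y(2) by (auto simp: movable_def)
    ultimately show "\<exists>(x,y)\<in>?P. hamiltonian V \<Lambda> (\<sigma> \<circ> swap x y) \<le> hamiltonian V \<Lambda> \<sigma> - (gap \<kappa> \<bar>x - a\<bar> + gap \<kappa> (s * (y - a)))"
      by blast
  qed auto
  also have "\<dots> \<le> (\<Sum>(x,y)\<in>?A \<times> ?B. exp (- (gap \<kappa> \<bar>x - a\<bar> + gap \<kappa> (s * (y - a)))))"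
    by (rule sum_mono2) (use PAB C in auto)
  also have "\<dots> = (\<Sum>x\<in>?A. exp (- gap \<kappa> \<bar>x - a\<bar>)) * (\<Sum>y\<in>?B. exp (- gap \<kappa> (s * (y - a))))"
    unfolding sum_product sum.cartesian_product[symmetric] by (simp add: exp_add[symmetric])
  finally show ?thesis .
qed

text \<open>The sum over far sources is a tail of a convergent series, the sum over partners is bounded, both
  uniformly over all good midpoints. The product of the two is made at most \<open>\<epsilon> /
  4\<close>, since \<open>gibbs_prob_far_jump_le\<close> is applied to the two directions, for
  \<open>\<eta>\<close> and for its inverse.\<close>

lemma gibbs_prob_not_tight_le:
  assumes "c \<ge> 1" "\<epsilon> > 0"
  shows "\<exists>T \<ge> reach c n. \<forall>a \<Lambda> \<eta>. admissible \<Lambda> \<eta> \<longrightarrow> good_pt c n a \<longrightarrow> flow X \<eta> = Fin n \<longrightarrow>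
    suitable a (reach c n) \<Lambda> \<eta> \<longrightarrow> gibbs_prob \<Lambda> \<eta> {\<sigma>. \<not> tight a T \<sigma>} \<le> \<epsilon>"
proof -
  define \<kappa> where "\<kappa> = 1 / (2 * c)"
  have k0: "\<kappa> > 0" using assms by (simp add: \<kappa>_def)
  have w0: "reach c n \<ge> 0" using assms(1) by (simp add: reach_def)
  obtain N0 :: nat where N0: "N0 \<ge> 2" "\<And>N a Y. N \<ge> N0 \<Longrightarrow> finite Y \<Longrightarrow> sparse_around c a Y \<Longrightarrow>
    (\<Sum>y\<in>{y \<in> Y. \<bar>y - a\<bar> \<ge> real N}. exp (- gap \<kappa> \<bar>y - a\<bar>)) \<le> 2 * c / (real N - 1)"
    using tail_sum[OF k0 assms(1)] by blast
  obtain K where K: "K > 0" "\<And>a Y s. finite Y \<Longrightarrow> sparse_around c a Y \<Longrightarrow> s = 1 \<or> s = -1 \<Longrightarrow>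
    (\<Sum>y\<in>{y \<in> Y. s * (y - a) \<ge> - reach c n}. exp (- gap \<kappa> (s * (y - a)))) \<le> K"
    using half_line_sum[OF k0 assms(1), of "reach c n"] by blast
  define N where "N = max N0 (max (nat \<lceil>reach c n\<rceil>) (nat \<lceil>8 * c * K / \<epsilon> + 1\<rceil> + 1))"
  have N: "N \<ge> N0" "real N \<ge> reach c n" "real N - 1 \<ge> 8 * c * K / \<epsilon>" "real N - 1 > 0"
  proof -
    have "N \<ge> nat \<lceil>reach c n\<rceil>" "N \<ge> nat \<lceil>8 * c * K / \<epsilon> + 1\<rceil> + 1"
      unfolding N_def by (meson max.cobounded1 max.cobounded2 order_trans)+
    moreover have "8 * c * K / \<epsilon> \<ge> 0" using assms K by simp
    ultimately show "real N \<ge> reach c n" "real N - 1 \<ge> 8 * c * K / \<epsilon>" "real N - 1 > 0" by linarith+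
    show "N \<ge> N0" by (simp add: N_def)
  qed
  show ?thesis
  proof (intro exI[of _ "real N"] conjI allI impI N(2))
    fix a \<Lambda> \<eta> assume H: "admissible \<Lambda> \<eta>" "good_pt c n a" "flow X \<eta> = Fin n" "suitable a (reach c n) \<Lambda> \<eta>"
    have C: "\<eta> \<in> Perms X" "\<Lambda> \<subseteq> X" "finite \<Lambda>" using H(1) by (auto simp: admissible_def)
    have sp: "sparse_around c a \<Lambda>" unfolding sparse_around_def using good_ptD(4)[OF H(2) C(3,2)] by blast
    have one: "gibbs_prob \<Lambda> \<eta>' {\<sigma>. far_jump s a (real N) \<sigma>} \<le> \<epsilon> / 4"
      if H': "admissible \<Lambda> \<eta>'" "good_pt c m a" "flow X \<eta>' = Fin m" "suitable a (reach c m) \<Lambda> \<eta>'" "reach c m = reach c n"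
        and s: "s = 1 \<or> s = -1" for s \<eta>' m
    proof -
      have "gibbs_prob \<Lambda> \<eta>' {\<sigma>. far_jump s a (real N) \<sigma>} \<le>
        (\<Sum>x\<in>{x\<in>\<Lambda>. \<bar>x - a\<bar> \<ge> real N}. exp (- gap \<kappa> \<bar>x - a\<bar>)) *
        (\<Sum>y\<in>{y\<in>\<Lambda>. s * (y - a) \<ge> - reach c n}. exp (- gap \<kappa> (s * (y - a))))"
        using gibbs_prob_far_jump_le[OF H'(1-4) s _ assms(1) \<kappa>_def, of "real N"] N(2) H'(5) by simp
      also have "\<dots> \<le> 2 * c / (real N - 1) * K"
        by (intro mult_mono N0(2) K(2) sum_nonneg) (use N C sp s assms in auto)
      also have "\<dots> \<le> \<epsilon> / 4" using N assms K by (simp add: field_simps)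
      finally show ?thesis .
    qed
    have o1: "gibbs_prob \<Lambda> \<eta> {\<sigma>. far_jump s a (real N) \<sigma>} \<le> \<epsilon> / 4" if "s = 1 \<or> s = -1" for s
      using one[OF H refl that] .
    have o2: "gibbs_prob \<Lambda> \<eta> {\<sigma>. far_jump s a (real N) (inv \<sigma>)} \<le> \<epsilon> / 4" if "s = 1 \<or> s = -1" for s
      unfolding gibbs_prob_inv[OF H(1)]
      by (rule one[OF admissible_inv[OF H(1)] good_pt_minus[OF H(2)] flow_inv[OF C(1) H(3)] _ _ that])
        (use suitable_inv[OF C(1) H(4)] in \<open>auto simp: reach_def\<close>)
    have "gibbs_prob \<Lambda> \<eta> {\<sigma>. \<not> tight a (real N) \<sigma>} \<le> gibbs_prob \<Lambda> \<eta> (({\<sigma>. far_jump 1 a (real N) \<sigma>} \<union> {\<sigma>. far_jump (-1) a (real N) \<sigma>})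
      \<union> ({\<sigma>. far_jump 1 a (real N) (inv \<sigma>)} \<union> {\<sigma>. far_jump (-1) a (real N) (inv \<sigma>)}))"
      by (rule gibbs_prob_mono[OF H(1)]) (use not_tight_far_jump resample_Perms in fastforce)
    also have "\<dots> \<le> (\<epsilon> / 4 + \<epsilon> / 4) + (\<epsilon> / 4 + \<epsilon> / 4)"
      by (intro order_trans[OF gibbs_prob_Un[OF H(1)]] add_mono o1 o2) auto
    finally show "gibbs_prob \<Lambda> \<eta> {\<sigma>. \<not> tight a (real N) \<sigma>} \<le> \<epsilon>" by simp
  qed
qed

end

section \<open>Cuts have uniformly positive probability\<close>

context permutation_gas
begin

definition near :: "real \<Rightarrow> real \<Rightarrow> real set" where "near a T = {x \<in> X. \<bar>x - a\<bar> \<le> T}"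

lemma finite_near: "finite (near a T)"
proof (rule finite_subset)
  show "near a T \<subseteq> X \<inter> {a - T..a + T}" by (auto simp: near_def)
qed (rule finite_Icc)

lemma swap_lowers:
  assumes "admissible \<Lambda> \<eta>" "\<sigma> \<in> resample X \<Lambda> \<eta>" "x \<in> movable \<Lambda> \<eta>" "y \<in> movable \<Lambda> \<eta>" "x < y" "\<sigma> y < \<sigma> x"
  shows "\<sigma> \<circ> swap x y \<in> resample X \<Lambda> \<eta>"
    "hamiltonian V \<Lambda> (\<sigma> \<circ> swap x y) < hamiltonian V \<Lambda> \<sigma>"
proof -
  have C: "\<eta> \<in> Perms X" "\<Lambda> \<subseteq> X" "finite \<Lambda>" using assms(1) by (auto simp: admissible_def)
  show "\<sigma> \<circ> swap x y \<in> resample X \<Lambda> \<eta>"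
    using resample_swap[OF assms(2) C(1,2) permutes_swap_id[OF assms(3,4)]] .
  show "hamiltonian V \<Lambda> (\<sigma> \<circ> swap x y) < hamiltonian V \<Lambda> \<sigma>"
    using hamiltonian_swap[OF assms(2) C assms(3,4), of V] uncross_less[OF assms(5,6)] assms(5) by simp
qed

lemma tight_swap:
  assumes "tight a T \<sigma>" "x \<in> X" "y \<in> X" "x \<noteq> y"
    "crosses a x (\<sigma> y) \<Longrightarrow> \<bar>x - a\<bar> \<le> T \<and> \<bar>\<sigma> y - a\<bar> \<le> T"
    "crosses a y (\<sigma> x) \<Longrightarrow> \<bar>y - a\<bar> \<le> T \<and> \<bar>\<sigma> x - a\<bar> \<le> T"
  shows "tight a T (\<sigma> \<circ> swap x y)"
  unfolding tight_def
proof
  fix z assume z: "z \<in> crossers X a (\<sigma> \<circ> swap x y)"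
  consider "z = x" | "z = y" | "z \<noteq> x" "z \<noteq> y" by blast
  thus "\<bar>z - a\<bar> \<le> T \<and> \<bar>(\<sigma> \<circ> swap x y) z - a\<bar> \<le> T"
  proof cases
    case 1 thus ?thesis using z assms(5) by (simp add: crossers_def)
  next
    case 2 thus ?thesis using z assms(6) by (simp add: crossers_def)
  next
    case 3
    hence e: "(\<sigma> \<circ> swap x y) z = \<sigma> z" by simp
    have "z \<in> crossers X a \<sigma>" using z unfolding crossers_def mem_Collect_eq e .
    thus ?thesis unfolding e using assms(1) by (auto simp: tight_def)
  qed
qed

lemma tightD:
  assumes "tight a T \<sigma>" "x \<in> X" "crosses a x (\<sigma> x)"
  shows "\<bar>x - a\<bar> \<le> T" "\<bar>\<sigma> x - a\<bar> \<le> T"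
  using assms by (auto simp: tight_def crossers_def)

text \<open>Among the configurations that arise by permuting sources and targets inside the window, and whose
  jumps across \<open>a\<close> stay in the window, take one of least energy. If two of its jumps
  with sources, or with targets, in the window were crossed, uncrossing them would lower the energy.
  Uncrossing does not create jumps across \<open>a\<close> that leave the window: if one of the new
  jumps did, then already one of the two old ones would.\<close>

lemma minimizer:
  assumes "admissible \<Lambda> \<eta>" "suitable a T \<Lambda> \<eta>" "\<sigma> \<in> resample X \<Lambda> \<eta>" "tight a T \<sigma>" "a \<notin> X"
  shows "\<exists>\<upsilon> p q. \<upsilon> = q \<circ> \<sigma> \<circ> p \<and> p permutes near a T \<and> q permutes near a T \<and> \<upsilon> \<in> resample X \<Lambda> \<eta> \<and>
    hamiltonian V \<Lambda> \<upsilon> \<le> hamiltonian V \<Lambda> \<sigma> \<and> tight a T \<upsilon> \<and>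
    (\<forall>x\<in>near a T. \<forall>y\<in>near a T. x < y \<longrightarrow> \<upsilon> x < \<upsilon> y) \<and>
    (\<forall>x\<in>near a T. \<forall>y\<in>near a T. x < y \<longrightarrow> inv \<upsilon> x < inv \<upsilon> y)"
proof -
  have C: "\<eta> \<in> Perms X" "\<Lambda> \<subseteq> X" "finite \<Lambda>" using assms(1) by (auto simp: admissible_def)
  let ?W = "near a T"
  define Orb where "Orb = {\<upsilon> \<in> resample X \<Lambda> \<eta>. tight a T \<upsilon> \<and> (\<exists>p q. \<upsilon> = q \<circ> \<sigma> \<circ> p \<and> p permutes ?W \<and> q permutes ?W)}"
  have "\<exists>p q. \<sigma> = q \<circ> \<sigma> \<circ> p \<and> p permutes ?W \<and> q permutes ?W"
    using permutes_id[of ?W] by (intro exI[of _ id]) simp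
  hence s: "\<sigma> \<in> Orb" unfolding Orb_def using assms(3,4) by blast
  have fO: "finite Orb" unfolding Orb_def using fin_resample[OF assms(1)] by simp
  obtain \<upsilon> where u: "\<upsilon> \<in> Orb" and min: "\<And>\<tau>. \<tau> \<in> Orb \<Longrightarrow> hamiltonian V \<Lambda> \<upsilon> \<le> hamiltonian V \<Lambda> \<tau>"
    using arg_min_if_finite[OF fO, of "hamiltonian V \<Lambda>"] s by (metis empty_iff not_le)
  obtain p q where pq: "\<upsilon> = q \<circ> \<sigma> \<circ> p" "p permutes ?W" "q permutes ?W" and uA: "\<upsilon> \<in> resample X \<Lambda> \<eta>" and ut: "tight a T \<upsilon>"
    using u by (auto simp: Orb_def)
  have uP: "\<upsilon> \<in> Perms X" using uA by (rule resample_Perms)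
  have mem: "\<upsilon> z \<in> X \<longleftrightarrow> z \<in> X" for z by (rule Perms_mem[OF uP])
  have na: "z \<noteq> a" if "z \<in> X" for z using that assms(5) by auto
  have contra: False
    if xy: "x \<in> movable \<Lambda> \<eta>" "y \<in> movable \<Lambda> \<eta>" "x < y" "\<upsilon> y < \<upsilon> x"
      "(x \<in> ?W \<and> y \<in> ?W) \<or> (\<upsilon> x \<in> ?W \<and> \<upsilon> y \<in> ?W)" for x y
  proof -
    let ?t = "swap x y"
    have X: "x \<in> X" "y \<in> X" using xy C by (auto simp: movable_def)
    have nx: "x \<noteq> a" "y \<noteq> a" "\<upsilon> x \<noteq> a" "\<upsilon> y \<noteq> a" using X na mem by auto
    note tx = tightD[OF ut X(1)] and ty = tightD[OF ut X(2)]
    have t: "tight a T (\<upsilon> \<circ> ?t)"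
    proof (rule tight_swap[OF ut X])
      show "x \<noteq> y" using xy by simp
      show "\<bar>x - a\<bar> \<le> T \<and> \<bar>\<upsilon> y - a\<bar> \<le> T" if "crosses a x (\<upsilon> y)"
        using that tx ty xy(3-5) nx unfolding crosses_def near_def
        by (auto simp: abs_if split: if_splits)
      show "\<bar>y - a\<bar> \<le> T \<and> \<bar>\<upsilon> x - a\<bar> \<le> T" if "crosses a y (\<upsilon> x)"
        using that tx ty xy(3-5) nx unfolding crosses_def near_def
        by (auto simp: abs_if split: if_splits)
    qed
    have "\<exists>p q. \<upsilon> \<circ> ?t = q \<circ> \<sigma> \<circ> p \<and> p permutes ?W \<and> q permutes ?W"
      using xy(5)
    proof
      assume w: "x \<in> ?W \<and> y \<in> ?W"
      hence "p \<circ> ?t permutes ?W" using permutes_compose[OF permutes_swap_id pq(2)] by blast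
      moreover have "\<upsilon> \<circ> ?t = q \<circ> \<sigma> \<circ> (p \<circ> ?t)" unfolding pq(1) by (simp add: comp_assoc)
      ultimately show ?thesis using pq(3) by blast
    next
      assume w: "\<upsilon> x \<in> ?W \<and> \<upsilon> y \<in> ?W"
      let ?s = "swap (\<upsilon> x) (\<upsilon> y)"
      have "?s \<circ> q permutes ?W" using w permutes_compose[OF pq(3) permutes_swap_id] by blast
      moreover have "\<upsilon> \<circ> ?t = ?s \<circ> \<upsilon>"
        using Perms_inj[OF uP] by (auto simp: fun_eq_iff Transposition.transpose_def inj_eq)
      hence "\<upsilon> \<circ> ?t = ?s \<circ> q \<circ> \<sigma> \<circ> p" unfolding pq(1) by (simp add: comp_assoc)
      ultimately show ?thesis using pq(2) by blast
    qed
    hence "\<upsilon> \<circ> ?t \<in> Orb" unfolding Orb_def using t swap_lowers(1)[OF assms(1) uA xy(1-4)] by blast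
    from min[OF this] swap_lowers(2)[OF assms(1) uA xy(1-4)] show False by simp
  qed
  have i1: "\<upsilon> x < \<upsilon> y" if "x \<in> ?W" "y \<in> ?W" "x < y" for x y
  proof (rule ccontr)
    assume n: "\<not> ?thesis"
    have "\<upsilon> x \<noteq> \<upsilon> y" using Perms_inj[OF uP] that by (simp add: inj_eq)
    hence "\<upsilon> y < \<upsilon> x" using n by simp
    moreover have "x \<in> movable \<Lambda> \<eta>" "y \<in> movable \<Lambda> \<eta>"
      using suitable_near(1)[OF assms(2) C(1,2) uA] that by (auto simp: near_def)
    ultimately show False using contra[of x y] that by blast
  qed
  have i2: "inv \<upsilon> x < inv \<upsilon> y" if "x \<in> ?W" "y \<in> ?W" "x < y" for x y
  proof (rule ccontr)
    assume n: "\<not> ?thesis"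
    have r: "\<upsilon> (inv \<upsilon> x) = x" "\<upsilon> (inv \<upsilon> y) = y" by (rule Perms_inv_r[OF uP])+
    hence "inv \<upsilon> x \<noteq> inv \<upsilon> y" using that by auto
    hence "inv \<upsilon> y < inv \<upsilon> x" using n by simp
    moreover have "inv \<upsilon> x \<in> movable \<Lambda> \<eta>" "inv \<upsilon> y \<in> movable \<Lambda> \<eta>"
      using suitable_near(2)[OF assms(2) C(1,2) uA] that by (auto simp: near_def)
    ultimately show False using contra[of "inv \<upsilon> y" "inv \<upsilon> x"] that unfolding r by blast
  qed
  show ?thesis
    by (intro exI[of _ \<upsilon>] exI[of _ p] exI[of _ q] conjI ballI impI i1 i2 min s pq uA ut)
qed

text \<open>A configuration \<open>\<sigma>\<close> is recovered from its minimiser \<open>q \<circ> \<sigma>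
  \<circ> p\<close> together with the permutations \<open>p\<close> and \<open>q\<close> of the
  window.\<close>

lemma gibbs_prob_tight_le_cut:
  assumes "admissible \<Lambda> \<eta>" "good_pt c n a" "flow X \<eta> = Fin n" "suitable a T \<Lambda> \<eta>" "reach c n \<le> T"
  shows "gibbs_prob \<Lambda> \<eta> {\<sigma>. tight a T \<sigma>} \<le> (fact (card (near a T)))\<^sup>2 * gibbs_prob \<Lambda> \<eta> {\<sigma>. cut n a \<sigma>}"
proof -
  have C: "\<eta> \<in> Perms X" "\<Lambda> \<subseteq> X" "finite \<Lambda>" using assms(1) by (auto simp: admissible_def)
  let ?W = "near a T" and ?S = "resample X \<Lambda> \<eta>"
  let ?A = "?S \<inter> {\<sigma>. tight a T \<sigma>}" and ?B = "?S \<inter> {\<sigma>. cut n a \<sigma>}" and ?P = "{p. p permutes ?W}"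
  have an: "a \<notin> X" using good_ptD(2)[OF assms(2)] .
  have "\<exists>u p q. u = q \<circ> \<sigma> \<circ> p \<and> p \<in> ?P \<and> q \<in> ?P \<and> u \<in> ?B \<and> weight \<Lambda> \<sigma> \<le> weight \<Lambda> u" if s: "\<sigma> \<in> ?A" for \<sigma>
  proof -
    obtain u p q where u: "u = q \<circ> \<sigma> \<circ> p" "p permutes ?W" "q permutes ?W" "u \<in> ?S"
      "hamiltonian V \<Lambda> u \<le> hamiltonian V \<Lambda> \<sigma>" "tight a T u"
      "\<forall>x\<in>near a T. \<forall>y\<in>near a T. x < y \<longrightarrow> u x < u y"
      "\<forall>x\<in>near a T. \<forall>y\<in>near a T. x < y \<longrightarrow> inv u x < inv u y"
      using minimizer[OF assms(1,4) _ _ an, of \<sigma>] s by auto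
    have "cut n a u"
      by (rule sorted_imp_cut[OF resample_Perms[OF u(4)] _ u(6) assms(2,5)])
        (use flow_resample[OF C u(4)] assms(3) u(7,8) in \<open>auto simp: near_def\<close>)
    thus ?thesis using u by (auto simp: weight_def)
  qed
  hence "\<forall>\<sigma>\<in>?A. \<exists>t. fst t = snd (snd t) \<circ> \<sigma> \<circ> fst (snd t) \<and> fst (snd t) \<in> ?P \<and> snd (snd t) \<in> ?P \<and> fst t \<in> ?B \<and> weight \<Lambda> \<sigma> \<le> weight \<Lambda> (fst t)"
    by (metis (no_types, lifting) fst_conv snd_conv)
  from bchoice[OF this] obtain g where g: "\<forall>\<sigma>\<in>?A. fst (g \<sigma>) = snd (snd (g \<sigma>)) \<circ> \<sigma> \<circ> fst (snd (g \<sigma>)) \<and>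
    fst (snd (g \<sigma>)) \<in> ?P \<and> snd (snd (g \<sigma>)) \<in> ?P \<and> fst (g \<sigma>) \<in> ?B \<and> weight \<Lambda> \<sigma> \<le> weight \<Lambda> (fst (g \<sigma>))" ..
  define f p q where "f \<sigma> = fst (g \<sigma>)" and "p \<sigma> = fst (snd (g \<sigma>))" and "q \<sigma> = snd (snd (g \<sigma>))" for \<sigma>
  have f: "f \<sigma> = q \<sigma> \<circ> \<sigma> \<circ> p \<sigma> \<and> p \<sigma> \<in> ?P \<and> q \<sigma> \<in> ?P \<and> f \<sigma> \<in> ?B \<and> weight \<Lambda> \<sigma> \<le> weight \<Lambda> (f \<sigma>)"
    if "\<sigma> \<in> ?A" for \<sigma> using bspec[OF g that] unfolding f_def p_def q_def .
  have fA: "finite ?A" "finite ?B" using fin_resample[OF assms(1)] by auto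
  have fP: "finite ?P" by (rule finite_permutations[OF finite_near])
  let ?h = "\<lambda>\<sigma>. (p \<sigma>, q \<sigma>, f \<sigma>)"
  have inj: "inj_on ?h ?A"
  proof (rule inj_onI)
    fix \<sigma> \<tau> assume st: "\<sigma> \<in> ?A" "\<tau> \<in> ?A" "?h \<sigma> = ?h \<tau>"
    have P: "bij (p \<sigma>)" "bij (q \<sigma>)" using f[OF st(1)] permutes_bij by blast+
    have h: "p \<tau> = p \<sigma>" "q \<tau> = q \<sigma>" "f \<tau> = f \<sigma>" using st(3) by auto
    have fs: "f \<sigma> = q \<sigma> \<circ> \<sigma> \<circ> p \<sigma>" "f \<tau> = q \<tau> \<circ> \<tau> \<circ> p \<tau>" using f[OF st(1)] f[OF st(2)] by blast+
    have e: "q \<sigma> \<circ> \<sigma> \<circ> p \<sigma> = q \<sigma> \<circ> \<tau> \<circ> p \<sigma>" using fs unfolding h by simp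
    show "\<sigma> = \<tau>"
    proof
      fix x
      obtain y where y: "x = p \<sigma> y" using bij_is_surj[OF P(1)] by (elim surjE)
      have "q \<sigma> (\<sigma> x) = q \<sigma> (\<tau> x)" using fun_cong[OF e, of y] unfolding y by simp
      thus "\<sigma> x = \<tau> x" by (rule injD[OF bij_is_inj[OF P(2)]])
    qed
  qed
  have "(\<Sum>\<sigma>\<in>?A. weight \<Lambda> \<sigma>) \<le> (\<Sum>\<sigma>\<in>?A. weight \<Lambda> (f \<sigma>))" by (rule sum_mono) (use f in blast)
  also have "\<dots> = (\<Sum>(p,q,u)\<in>?h ` ?A. weight \<Lambda> u)" by (subst sum.reindex[OF inj]) simp
  also have "\<dots> \<le> (\<Sum>(p,q,u)\<in>?P \<times> ?P \<times> ?B. weight \<Lambda> u)"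
  proof (rule sum_mono2)
    show "?h ` ?A \<subseteq> ?P \<times> ?P \<times> ?B" using f by blast
  qed (use fP fA weight_pos in \<open>auto intro: less_imp_le\<close>)
  also have "\<dots> = real (card ?P) * (real (card ?P) * (\<Sum>u\<in>?B. weight \<Lambda> u))"
    by (simp add: sum.cartesian_product[symmetric])
  also have "card ?P = fact (card ?W)" by (rule card_permutations[OF refl finite_near])
  finally have "(\<Sum>\<sigma>\<in>?A. weight \<Lambda> \<sigma>) \<le> (fact (card ?W))\<^sup>2 * (\<Sum>u\<in>?B. weight \<Lambda> u)" by (simp add: power2_eq_square mult.assoc)
  thus ?thesis using Z_pos[OF assms(1)] unfolding gibbs_prob_def by (simp add: divide_right_mono)
qed

text \<open>The window is chosen so wide that all jumps across \<open>a\<close> stay in it with probability at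
  least \<open>1 / 2\<close>; then \<open>gibbs_prob_tight_le_cut\<close> applies.\<close>

lemma gibbs_prob_cut_ge:
  assumes "c \<ge> 1"
  shows "\<exists>T \<delta>. \<delta> > 0 \<and> (\<forall>a \<Lambda> \<eta>. admissible \<Lambda> \<eta> \<longrightarrow> good_pt c n a \<longrightarrow> flow X \<eta> = Fin n \<longrightarrow>
    suitable a T \<Lambda> \<eta> \<longrightarrow> \<delta> \<le> gibbs_prob \<Lambda> \<eta> {\<sigma>. cut n a \<sigma>})"
proof -
  obtain T where T: "T \<ge> reach c n" "\<And>a \<Lambda> \<eta>. admissible \<Lambda> \<eta> \<Longrightarrow> good_pt c n a \<Longrightarrow> flow X \<eta> = Fin n \<Longrightarrow>
    suitable a (reach c n) \<Lambda> \<eta> \<Longrightarrow> gibbs_prob \<Lambda> \<eta> {\<sigma>. \<not> tight a T \<sigma>} \<le> 1/2"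
    using gibbs_prob_not_tight_le[OF assms, of "1/2" n] by auto
  have T0: "T > 0" 
  proof -
    have "reach c n > 0" unfolding reach_def using assms by (intro mult_pos_pos) auto
    thus ?thesis using T(1) by simp
  qed
  \<comment> \<open>The window contains at most \<open>c * T\<close> points, so \<open>M\<close> bounds the number of
    its permutations.\<close>
  define M where "M = (fact (nat \<lfloor>c * T\<rfloor>) :: real)"
  have M: "M \<ge> 1" unfolding M_def by (rule fact_ge_1)
  show ?thesis
  proof (rule exI[of _ T], rule exI[of _ "1 / (2 * M\<^sup>2)"], intro conjI allI impI)
    fix a \<Lambda> \<eta> assume H: "admissible \<Lambda> \<eta>" "good_pt c n a" "flow X \<eta> = Fin n" "suitable a T \<Lambda> \<eta>"
    have "1/2 \<le> gibbs_prob \<Lambda> \<eta> {\<sigma>. tight a T \<sigma>}"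
      using T(2)[OF H(1-3) suitable_mono[OF H(4) T(1)]] gibbs_prob_compl[OF H(1), of "{\<sigma>. tight a T \<sigma>}"]
      by (simp add: Compl_eq)
    also have "\<dots> \<le> (fact (card (near a T)))\<^sup>2 * gibbs_prob \<Lambda> \<eta> {\<sigma>. cut n a \<sigma>}"
      by (rule gibbs_prob_tight_le_cut[OF H T(1)])
    also have "\<dots> \<le> M\<^sup>2 * gibbs_prob \<Lambda> \<eta> {\<sigma>. cut n a \<sigma>}"
    proof (intro mult_right_mono power_mono gibbs_prob_nonneg[OF H(1)])
      have "real (card (near a T)) \<le> c * T" unfolding near_def using H(2) T0 by (simp add: good_pt_def)
      hence "card (near a T) \<le> nat \<lfloor>c * T\<rfloor>" by (simp add: le_nat_floor)
      thus "fact (card (near a T)) \<le> M" unfolding M_def by (rule fact_mono)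
    qed simp
    finally show "1 / (2 * M\<^sup>2) \<le> gibbs_prob \<Lambda> \<eta> {\<sigma>. cut n a \<sigma>}" using M by (simp add: field_simps)
  qed (use M in simp)
qed

lemma ex_suitable:
  assumes "\<eta> \<in> Perms X" "flow X \<eta> = Fin n" "a \<in> midpoints X"
  shows "\<exists>\<Lambda>0. finite \<Lambda>0 \<and> \<Lambda>0 \<subseteq> X \<and> (\<forall>\<Lambda>. \<Lambda>0 \<subseteq> \<Lambda> \<longrightarrow> suitable a T \<Lambda> \<eta>)"
proof -
  define \<Lambda>0 where "\<Lambda>0 = crossers X a \<eta> \<union> \<eta> ` crossers X a \<eta> \<union> near a T \<union> \<eta> ` near a T \<union> inv \<eta> ` near a T"
  have "finite (crossers X a \<eta>)" using flow_Fin_iff[OF assms(1,3)] assms(2) by blast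
  hence "finite \<Lambda>0" unfolding \<Lambda>0_def using finite_near by simp
  moreover have "\<Lambda>0 \<subseteq> X" unfolding \<Lambda>0_def
    using Perms_mem[OF assms(1)] Perms_mem[OF Perms_inv[OF assms(1)]] by (auto simp: crossers_def near_def)
  moreover have "\<forall>\<Lambda>. \<Lambda>0 \<subseteq> \<Lambda> \<longrightarrow> suitable a T \<Lambda> \<eta>"
    unfolding suitable_def \<Lambda>0_def near_def by blast
  ultimately show ?thesis by blast
qed

lemma theta_flow: "flow X (theta n) = Fin n"
proof -
  have am: "mid 0 \<in> midpoints X" by (simp add: midpoints_eq)
  define J where "J = {-\<bar>n\<bar>..\<bar>n\<bar>}"
  have "(\<Sum>x\<in>pt ` J. left_of (mid 0) x - left_of (mid 0) (theta n x)) =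
    (\<Sum>j\<in>J. left_of (mid 0) (pt j) - left_of (mid 0) (pt (j + n)))"
    by (subst sum.reindex) (auto intro: inj_on_subset[OF inj_pt])
  also have "\<dots> = (\<Sum>j\<in>J. (if j \<le> 0 then 1 else 0) - (if j \<le> - n then 1 else 0))"
    by (rule sum.cong) (auto simp: left_of_def pt_less_mid_iff)
  also have "\<dots> = int (card {j\<in>J. j \<le> 0}) - int (card {j\<in>J. j \<le> - n})"
    unfolding sum_subtractf by (simp add: sum.If_cases J_def Int_def)
  also have "{j\<in>J. j \<le> 0} = {-\<bar>n\<bar>..0}" by (auto simp: J_def)
  also have "{j\<in>J. j \<le> - n} = {-\<bar>n\<bar>..-n}" by (auto simp: J_def)
  also have "int (card {-\<bar>n\<bar>..0}) - int (card {-\<bar>n\<bar>..-n}) = n" by auto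
  finally show ?thesis
  proof (rule flow_FinI[OF theta_Perms am])
    show "crossers X (mid 0) (theta n) \<subseteq> pt ` J"
    proof
      fix x assume x: "x \<in> crossers X (mid 0) (theta n)"
      then obtain j where j: "x = pt j" unfolding crossers_def in_X_iff by auto
      thus "x \<in> pt ` J" using x by (auto simp: crossers_def crosses_pt J_def)
    qed
  qed (use pt(1) in \<open>auto simp: J_def\<close>)
qed

end

section \<open>Local events\<close>

lemma pred_Ball_countable:
  assumes "countable I" "\<And>i. i \<in> I \<Longrightarrow> Measurable.pred M (P i)"
  shows "Measurable.pred M (\<lambda>x. \<forall>i\<in>I. P i x)"
  using sets.sets_Collect_countable_All'[of I M "\<lambda>i x. P i x"] assms by (simp add: pred_def)

lemma pred_Bex_countable:
  assumes "countable I" "\<And>i. i \<in> I \<Longrightarrow> Measurable.pred M (P i)"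
  shows "Measurable.pred M (\<lambda>x. \<exists>i\<in>I. P i x)"
proof -
  have "Measurable.pred M (\<lambda>x. \<not> (\<forall>i\<in>I. \<not> P i x))"
    by (intro pred_intros_logic pred_Ball_countable assms)
  thus ?thesis by simp
qed

context point_set
begin

lemma countable_X: "countable X"
  using range_pt by (metis countableI_type countable_image)

definition cell :: "(real \<times> real) set \<Rightarrow> (real \<times> real) set \<Rightarrow> (real \<Rightarrow> real) set" where
  "cell Q R = {\<sigma> \<in> Perms X. \<forall>(x,y)\<in>Q. \<sigma> x = y \<longleftrightarrow> (x,y) \<in> R}"

text \<open>The pairs of \<open>Q\<close> are questions whether \<open>\<sigma> x = y\<close>; these are the
  ones that are answered in the affirmative.\<close>

definition hits :: "(real \<times> real) set \<Rightarrow> (real \<Rightarrow> real) \<Rightarrow> (real \<times> real) set" where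
  "hits Q \<sigma> = {(x,y) \<in> Q. \<sigma> x = y}"

definition determined :: "(real \<times> real) set \<Rightarrow> (real \<Rightarrow> real) set \<Rightarrow> bool" where
  "determined Q E \<longleftrightarrow> (\<forall>\<sigma>\<in>Perms X. \<forall>\<tau>\<in>Perms X. hits Q \<sigma> = hits Q \<tau> \<longrightarrow> (\<sigma> \<in> E \<longleftrightarrow> \<tau> \<in> E))"

text \<open>As \<open>\<sigma> x\<close> takes infinitely many values, these are fewer than the events that
  depend on \<open>\<sigma>\<close> on a finite set. In return there are only countably many of
  them, which makes a diagonal argument possible, and still they form an algebra that generates the
  Borel sets.\<close>

definition local_events :: "(real \<Rightarrow> real) set set" where
  "local_events = {E. E \<subseteq> Perms X \<and> (\<exists>Q. finite Q \<and> Q \<subseteq> X \<times> X \<and> determined Q E)}"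

lemma hits_mono: "Q \<subseteq> Q' \<Longrightarrow> hits Q' \<sigma> = hits Q' \<tau> \<Longrightarrow> hits Q \<sigma> = hits Q \<tau>"
  unfolding hits_def by (auto simp: set_eq_iff)

lemma determined_mono: "determined Q E \<Longrightarrow> Q \<subseteq> Q' \<Longrightarrow> determined Q' E"
  unfolding determined_def using hits_mono by blast

lemma cell_eq: "cell Q (hits Q \<sigma>) = {\<tau> \<in> Perms X. hits Q \<tau> = hits Q \<sigma>}"
  by (auto simp: cell_def hits_def set_eq_iff)

lemma hits_cell: "\<sigma> \<in> cell Q R \<Longrightarrow> R \<subseteq> Q \<Longrightarrow> hits Q \<sigma> = R"
  by (auto simp: cell_def hits_def)

lemma determined_cell: "determined Q (cell Q R)"
proof -
  have "(\<forall>(x,y)\<in>Q. \<sigma> x = y \<longleftrightarrow> (x,y) \<in> R) \<longleftrightarrow> hits Q \<sigma> = Q \<inter> R" for \<sigma>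
    unfolding hits_def by (auto simp: set_eq_iff)
  thus ?thesis unfolding determined_def cell_def by simp
qed

lemma determined_eq_Union:
  assumes "E \<subseteq> Perms X" "determined Q E" shows "E = (\<Union>R\<in>hits Q ` E. cell Q R)"
proof (intro equalityI subsetI)
  fix \<sigma> assume s: "\<sigma> \<in> E"
  hence "\<sigma> \<in> cell Q (hits Q \<sigma>)" using assms(1) unfolding cell_eq by auto
  thus "\<sigma> \<in> (\<Union>R\<in>hits Q ` E. cell Q R)" using s by blast
next
  fix \<sigma> assume "\<sigma> \<in> (\<Union>R\<in>hits Q ` E. cell Q R)"
  then obtain \<tau> where t: "\<tau> \<in> E" "\<sigma> \<in> cell Q (hits Q \<tau>)" by auto
  hence "\<sigma> \<in> Perms X" "hits Q \<sigma> = hits Q \<tau>" unfolding cell_eq by auto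
  thus "\<sigma> \<in> E" using t(1) assms unfolding determined_def by blast
qed

lemma hits_image_Pow: "hits Q ` E \<subseteq> Pow Q" by (auto simp: hits_def)

lemma cell_local_events: "finite Q \<Longrightarrow> Q \<subseteq> X \<times> X \<Longrightarrow> cell Q R \<in> local_events"
  using determined_cell by (auto simp: local_events_def cell_def)

lemma algebra_local_events: "algebra (Perms X) local_events"
  unfolding algebra_iff_Un
proof (intro conjI ballI)
  show "local_events \<subseteq> Pow (Perms X)" by (auto simp: local_events_def)
  show "{} \<in> local_events" by (auto simp: local_events_def determined_def intro!: exI[of _ "{}"])
  fix E assume E: "E \<in> local_events"
  then obtain Q where Q: "finite Q" "Q \<subseteq> X \<times> X" "determined Q E" "E \<subseteq> Perms X" by (auto simp: local_events_def)
  have "determined Q (Perms X - E)" using Q(3) unfolding determined_def by blast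
  thus "Perms X - E \<in> local_events" using Q by (auto simp: local_events_def)
  fix F assume F: "F \<in> local_events"
  then obtain Q' where Q': "finite Q'" "Q' \<subseteq> X \<times> X" "determined Q' F" "F \<subseteq> Perms X" by (auto simp: local_events_def)
  have "determined (Q \<union> Q') E" "determined (Q \<union> Q') F"
    by (rule determined_mono[OF Q(3)], simp, rule determined_mono[OF Q'(3)], simp)
  hence "determined (Q \<union> Q') (E \<union> F)" unfolding determined_def by blast
  thus "E \<union> F \<in> local_events" unfolding local_events_def using Q Q' by (intro CollectI conjI exI[of _ "Q \<union> Q'"]) auto
qed

lemma local_events_Int: "E \<in> local_events \<Longrightarrow> F \<in> local_events \<Longrightarrow> E \<inter> F \<in> local_events"
  using algebra_local_events by (auto simp: algebra_iff_Int)

lemma local_events_Perms: "Perms X \<in> local_events"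
  using algebra.top[OF algebra_local_events] .

lemma countable_local_events: "countable local_events"
proof -
  define \<F> where "\<F> = {Q. finite Q \<and> Q \<subseteq> X \<times> X}"
  have cF: "countable \<F>" unfolding \<F>_def
    using countable_Collect_finite_subset[of "X \<times> X"] countable_X by (simp add: conj_commute)
  have "local_events \<subseteq> (\<Union>Q\<in>\<F>. (\<lambda>\<R>. \<Union>R\<in>\<R>. cell Q R) ` Pow (Pow Q))"
  proof
    fix E assume "E \<in> local_events"
    then obtain Q where Q: "Q \<in> \<F>" "determined Q E" "E \<subseteq> Perms X" by (auto simp: local_events_def \<F>_def)
    have "E = (\<Union>R\<in>hits Q ` E. cell Q R)" using determined_eq_Union Q by blast
    thus "E \<in> (\<Union>Q\<in>\<F>. (\<lambda>\<R>. \<Union>R\<in>\<R>. cell Q R) ` Pow (Pow Q))"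
    proof (intro UN_I[OF Q(1)] image_eqI[of _ _ "hits Q ` E"])
      show "hits Q ` E \<in> Pow (Pow Q)" using hits_image_Pow by (rule PowI)
    qed
  qed
  moreover have "countable (\<Union>Q\<in>\<F>. (\<lambda>\<R>. \<Union>R\<in>\<R>. cell Q R) ` Pow (Pow Q))"
    using cF by (intro countable_UN countable_image) (auto simp: \<F>_def intro: countable_finite)
  ultimately show ?thesis by (rule countable_subset)
qed

lemma hit_local_events: "x \<in> X \<Longrightarrow> y \<in> X \<Longrightarrow> {\<sigma> \<in> Perms X. \<sigma> x = y} \<in> local_events"
  unfolding local_events_def determined_def hits_def by (auto simp: set_eq_iff intro!: exI[of _ "{(x,y)}"])

section \<open>Topology and Borel sets of the permutation space\<close>

lemma openin_subbasis:
  "x \<in> X \<Longrightarrow> U \<subseteq> X \<Longrightarrow> openin (perm_topology X) {\<sigma> \<in> Perms X. \<sigma> x \<in> U}"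
  unfolding perm_topology_def openin_topology_generated_by_iff by (rule generate_topology_on.Basis) blast

lemma openin_perm_subset: "openin (perm_topology X) U \<Longrightarrow> U \<subseteq> Perms X"
  unfolding perm_topology_def openin_topology_generated_by_iff
  by (induction rule: generate_topology_on.induct) auto

lemma topspace_perm: "topspace (perm_topology X) = Perms X"
proof -
  obtain x where x: "x \<in> X" using ex_gt by blast
  have "Perms X = {\<sigma> \<in> Perms X. \<sigma> x \<in> X}" using x Perms_mem by auto
  hence "openin (perm_topology X) (Perms X)" using openin_subbasis[OF x, of X] by simp
  thus ?thesis using openin_perm_subset by (meson openin_subset openin_topspace subset_antisym)
qed

lemma openin_local_events: assumes "E \<in> local_events" shows "openin (perm_topology X) E"
proof -
  obtain Q where Q: "finite Q" "Q \<subseteq> X \<times> X" "determined Q E" "E \<subseteq> Perms X" using assms by (auto simp: local_events_def)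
  have "openin (perm_topology X) (cell Q R)" if "finite Q" "Q \<subseteq> X \<times> X" for Q R
    using that
  proof (induction Q rule: finite_induct)
    case empty
    have "cell {} R = Perms X" by (simp add: cell_def)
    thus ?case using openin_topspace[of "perm_topology X"] by (simp add: topspace_perm)
  next
    case (insert p Q)
    obtain x y where p: "p = (x,y)" by force
    define U where "U = (if (x,y) \<in> R then {y} else X - {y})"
    have xy: "x \<in> X" "U \<subseteq> X" using insert.prems p by (auto simp: U_def)
    have "cell (insert p Q) R = {\<sigma> \<in> Perms X. \<sigma> x \<in> U} \<inter> cell Q R"
      using xy(1) Perms_mem by (auto simp: cell_def p U_def)
    thus ?case using insert openin_subbasis[OF xy] by auto
  qed
  hence "openin (perm_topology X) (\<Union>R\<in>hits Q ` E. cell Q R)" using Q by blast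
  thus ?thesis using determined_eq_Union[OF Q(4,3)] by simp
qed

text \<open>Only the subbasic sets given by the inverse need care: \<open>inv \<sigma> x = z\<close> is the same
  as \<open>\<sigma> z = x\<close>.\<close>

lemma open_basis:
  assumes "openin (perm_topology X) U" "\<sigma> \<in> U" shows "\<exists>E\<in>local_events. \<sigma> \<in> E \<and> E \<subseteq> U"
proof -
  have "generate_topology_on ({{\<sigma> \<in> Perms X. \<sigma> x \<in> U} | x U. x \<in> X \<and> U \<subseteq> X} \<union>
      {{\<sigma> \<in> Perms X. inv \<sigma> x \<in> U} | x U. x \<in> X \<and> U \<subseteq> X}) U"
    using assms(1) unfolding perm_topology_def openin_topology_generated_by_iff .
  thus ?thesis using assms(2)
  proof (induction rule: generate_topology_on.induct)
    case Empty thus ?case by simp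
  next
    case (Int a b)
    obtain A where A: "A \<in> local_events" "\<sigma> \<in> A" "A \<subseteq> a" using Int by auto
    obtain B where B: "B \<in> local_events" "\<sigma> \<in> B" "B \<subseteq> b" using Int by auto
    show ?case using local_events_Int[OF A(1) B(1)] A B by (intro bexI[of _ "A \<inter> B"] conjI) auto
  next
    case (UN K)
    then obtain k where k: "k \<in> K" "\<sigma> \<in> k" by auto
    obtain E where E: "E \<in> local_events" "\<sigma> \<in> E" "E \<subseteq> k" using UN.IH[OF k] by auto
    show ?case by (rule bexI[OF _ E(1)]) (use E k(1) in auto)
  next
    case (Basis s)
    from Basis(1) consider x U where "s = {\<sigma> \<in> Perms X. \<sigma> x \<in> U}" "x \<in> X" "U \<subseteq> X"
      | x U where "s = {\<sigma> \<in> Perms X. inv \<sigma> x \<in> U}" "x \<in> X" "U \<subseteq> X" by blast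
    thus ?case
    proof cases
      case 1
      hence "{\<tau> \<in> Perms X. \<tau> x = \<sigma> x} \<in> local_events" using Basis(2) Perms_mem by (intro hit_local_events) auto
      thus ?thesis using 1 Basis(2) by (intro bexI[of _ "{\<tau> \<in> Perms X. \<tau> x = \<sigma> x}"]) auto
    next
      case 2
      have s: "\<sigma> \<in> Perms X" using 2 Basis(2) by auto
      have "{\<tau> \<in> Perms X. \<tau> (inv \<sigma> x) = x} \<in> local_events"
        using 2 Perms_mem[OF Perms_inv[OF s]] by (intro hit_local_events) auto
      moreover have "{\<tau> \<in> Perms X. \<tau> (inv \<sigma> x) = x} \<subseteq> s"
        using 2 Basis(2) Perms_inv_eq_iff by force
      ultimately show ?thesis using s Perms_inv_r[OF s] by (intro bexI[of _ "{\<tau> \<in> Perms X. \<tau> (inv \<sigma> x) = x}"]) auto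
    qed
  qed
qed

lemma space_perm [simp]: "space (perm_borel X) = Perms X"
  unfolding perm_borel_def by (rule space_measure_of) (use openin_perm_subset in auto)

lemma sets_perm: "sets (perm_borel X) = sigma_sets (Perms X) local_events"
proof -
  have "sets (perm_borel X) = sigma_sets (Perms X) {U. openin (perm_topology X) U}"
    unfolding perm_borel_def by (rule sets_measure_of) (use openin_perm_subset in auto)
  also have "\<dots> = sigma_sets (Perms X) local_events"
  proof (rule sigma_sets_eqI)
    fix U assume "U \<in> {U. openin (perm_topology X) U}"
    hence U: "openin (perm_topology X) U" by simp
    have "U = \<Union>{E \<in> local_events. E \<subseteq> U}" using open_basis[OF U] by blast
    moreover have "\<Union>{E \<in> local_events. E \<subseteq> U} \<in> sigma_sets (Perms X) local_events"
      using countable_local_events algebra_local_events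
      by (intro sigma_sets_UNION) (auto intro: countable_subset sigma_sets.Basic)
    ultimately show "U \<in> sigma_sets (Perms X) local_events" by simp
  next
    fix E assume "E \<in> local_events"
    thus "E \<in> sigma_sets (Perms X) {U. openin (perm_topology X) U}"
      using openin_local_events by (intro sigma_sets.Basic) simp
  qed
  finally show ?thesis .
qed

lemma local_events_sets: "E \<in> local_events \<Longrightarrow> E \<in> sets (perm_borel X)"
  unfolding sets_perm by (rule sigma_sets.Basic)

lemma open_sets: "openin (perm_topology X) U \<Longrightarrow> U \<in> sets (perm_borel X)"
  unfolding perm_borel_def by (subst sets_measure_of) (use openin_perm_subset in auto)

lemma measurable_eval [measurable]: "(\<lambda>\<sigma>. \<sigma> x) \<in> perm_borel X \<rightarrow>\<^sub>M count_space UNIV"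
proof (cases "x \<in> X")
  case True
  show ?thesis
  proof (rule measurableI)
    fix A :: "real set"
    have "(\<lambda>\<sigma>. \<sigma> x) -` A \<inter> space (perm_borel X) = (\<Union>y\<in>X \<inter> A. {\<sigma> \<in> Perms X. \<sigma> x = y})"
      using True Perms_mem by auto
    also have "\<dots> \<in> sets (perm_borel X)"
      using countable_X True by (intro sets.countable_UN'' local_events_sets hit_local_events) auto
    finally show "(\<lambda>\<sigma>. \<sigma> x) -` A \<inter> space (perm_borel X) \<in> sets (perm_borel X)" .
  qed simp
next
  case False
  hence "(\<lambda>\<sigma>. \<sigma> x) \<in> perm_borel X \<rightarrow>\<^sub>M count_space UNIV \<longleftrightarrow> (\<lambda>\<sigma>. x) \<in> perm_borel X \<rightarrow>\<^sub>M count_space UNIV"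
    by (intro measurable_cong) (simp add: Perms_out)
  thus ?thesis by simp
qed

lemma measurable_eval_fun: "g \<in> count_space UNIV \<rightarrow>\<^sub>M N \<Longrightarrow> (\<lambda>\<sigma>. g (\<sigma> x)) \<in> perm_borel X \<rightarrow>\<^sub>M N"
  using measurable_compose[OF measurable_eval] by blast

lemma pred_eval: "Measurable.pred (perm_borel X) (\<lambda>\<sigma>. P (\<sigma> x))"
  by (rule measurable_eval_fun) simp

lemma borel_eval: "(\<lambda>\<sigma>. g (\<sigma> x)) \<in> borel_measurable (perm_borel X)"
  by (rule measurable_eval_fun) simp

lemma measurable_into_perm:
  assumes "\<And>w. w \<in> space M \<Longrightarrow> f w \<in> Perms X" "\<And>x. x \<in> X \<Longrightarrow> (\<lambda>w. f w x) \<in> M \<rightarrow>\<^sub>M count_space UNIV"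
  shows "f \<in> M \<rightarrow>\<^sub>M perm_borel X"
proof (rule measurable_sigma_sets[OF sets_perm])
  show "local_events \<subseteq> Pow (Perms X)" by (auto simp: local_events_def)
  show "f \<in> space M \<rightarrow> Perms X" using assms(1) by auto
  fix E assume "E \<in> local_events"
  then obtain Q where Q: "finite Q" "Q \<subseteq> X \<times> X" "determined Q E" "E \<subseteq> Perms X" by (auto simp: local_events_def)
  have c: "f -` cell Q R \<inter> space M \<in> sets M" for R
  proof -
    have "f -` cell Q R \<inter> space M = {w \<in> space M. \<forall>p\<in>Q. (f w (fst p) = snd p) = (p \<in> R)}"
      using assms(1) by (auto simp: cell_def)
    also have "\<dots> \<in> sets M"
    proof (rule sets.sets_Collect_countable_All'[OF _ countable_finite[OF Q(1)]])
      fix p assume "p \<in> Q"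
      hence "(\<lambda>w. f w (fst p)) \<in> M \<rightarrow>\<^sub>M count_space UNIV" using Q(2) by (intro assms(2)) auto
      from measurable_compose[OF this, of "\<lambda>y. (y = snd p) = (p \<in> R)" "count_space UNIV"]
      show "{w \<in> space M. (f w (fst p) = snd p) = (p \<in> R)} \<in> sets M" by (simp add: pred_def)
    qed
    finally show ?thesis .
  qed
  have "f -` E \<inter> space M = f -` (\<Union>R\<in>hits Q ` E. cell Q R) \<inter> space M"
    using determined_eq_Union[OF Q(4,3)] by simp
  also have "\<dots> = (\<Union>R\<in>hits Q ` E. f -` cell Q R \<inter> space M)" by auto
  also have "\<dots> \<in> sets M"
    using finite_subset[OF hits_image_Pow] Q(1) by (intro sets.finite_UN c) auto
  finally show "f -` E \<inter> space M \<in> sets M" .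
qed

lemma measurable_comp_perm:
  assumes "p \<in> Perms X" shows "(\<lambda>\<sigma>. \<sigma> \<circ> p) \<in> perm_borel X \<rightarrow>\<^sub>M perm_borel X"
  by (rule measurable_into_perm) (use Perms_comp assms measurable_eval in auto)

lemma pred_cut: "Measurable.pred (perm_borel X) (cut n a)"
  unfolding cut_def
proof (rule pred_Ball_countable[OF countable_X])
  fix x
  show "Measurable.pred (perm_borel X) (\<lambda>\<sigma>. crosses a x (\<sigma> x) \<or> crosses a x (theta n x) \<longrightarrow> \<sigma> x = theta n x)"
    using pred_eval[of "\<lambda>y. crosses a x y \<or> crosses a x (theta n x) \<longrightarrow> y = theta n x" x] .
qed

lemma cut_sets: "{\<sigma> \<in> Perms X. cut n a \<sigma>} \<in> sets (perm_borel X)"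
  using pred_cut unfolding pred_def by simp

text \<open>Finite flow means that all crossing points lie in some finite set, and there are only countably many
  finite subsets of \<open>X\<close>.\<close>

lemma flow_sets: "{\<sigma> \<in> Perms X. flow X \<sigma> = Fin n} \<in> sets (perm_borel X)"
proof -
  obtain a where a: "a \<in> midpoints X" using ex_midpoint by blast
  define \<F> where "\<F> = {B. B \<subseteq> X \<and> finite B}"
  have cF: "countable \<F>" unfolding \<F>_def
    using countable_Collect_finite_subset[of "X"] countable_X by (simp add: conj_commute)
  have e: "flow X \<sigma> = Fin n \<longleftrightarrow> (\<exists>B\<in>\<F>. (\<forall>x\<in>X - B. \<not> crosses a x (\<sigma> x)) \<and>
    (\<Sum>x\<in>B. real_of_int (left_of a x - left_of a (\<sigma> x))) = of_int n)" if s: "\<sigma> \<in> Perms X" for \<sigma>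
  proof
    assume f: "flow X \<sigma> = Fin n"
    show "\<exists>B\<in>\<F>. (\<forall>x\<in>X - B. \<not> crosses a x (\<sigma> x)) \<and>
      (\<Sum>x\<in>B. real_of_int (left_of a x - left_of a (\<sigma> x))) = of_int n"
    proof (intro bexI[of _ "crossers X a \<sigma>"] conjI)
      show "(\<Sum>x\<in>crossers X a \<sigma>. real_of_int (left_of a x - left_of a (\<sigma> x))) = of_int n"
      proof -
        have k: "(\<Sum>x\<in>crossers X a \<sigma>. left_of a x - left_of a (\<sigma> x)) = n"
          using flow_Fin_iff[OF s a] f by blast
        show ?thesis unfolding k[symmetric] by simp
      qed
    qed (use flow_Fin_iff[OF s a] f in \<open>auto simp: \<F>_def crossers_def\<close>)
  next
    assume "\<exists>B\<in>\<F>. (\<forall>x\<in>X - B. \<not> crosses a x (\<sigma> x)) \<and>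
      (\<Sum>x\<in>B. real_of_int (left_of a x - left_of a (\<sigma> x))) = of_int n"
    then obtain B where B: "B \<in> \<F>" "\<forall>x\<in>X - B. \<not> crosses a x (\<sigma> x)"
      "(\<Sum>x\<in>B. real_of_int (left_of a x - left_of a (\<sigma> x))) = of_int n" by blast
    have "(\<Sum>x\<in>B. left_of a x - left_of a (\<sigma> x)) = n" using B(3) by (simp only: of_int_sum[symmetric] of_int_eq_iff)
    thus "flow X \<sigma> = Fin n" using B(1,2) by (intro flow_FinI[OF s a]) (auto simp: \<F>_def crossers_def)
  qed
  have "Measurable.pred (perm_borel X) (\<lambda>\<sigma>. \<exists>B\<in>\<F>. (\<forall>x\<in>X - B. \<not> crosses a x (\<sigma> x)) \<and>
    (\<Sum>x\<in>B. real_of_int (left_of a x - left_of a (\<sigma> x))) = of_int n)"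
  proof (intro pred_Bex_countable[OF cF] pred_intros_logic pred_Ball_countable)
    fix B
    show "countable (X - B)" using countable_X by simp
    show "Measurable.pred (perm_borel X) (\<lambda>\<sigma>. crosses a x (\<sigma> x))" for x
      using pred_eval[of "crosses a x" x] .
    have "(\<lambda>\<sigma>. \<Sum>x\<in>B. real_of_int (left_of a x - left_of a (\<sigma> x))) \<in> borel_measurable (perm_borel X)"
      by (intro borel_measurable_sum borel_eval)
    thus "Measurable.pred (perm_borel X) (\<lambda>\<sigma>. (\<Sum>x\<in>B. real_of_int (left_of a x - left_of a (\<sigma> x))) = of_int n)"
      by measurable
  qed
  hence "{\<sigma> \<in> Perms X. \<exists>B\<in>\<F>. (\<forall>x\<in>X - B. \<not> crosses a x (\<sigma> x)) \<and>
    (\<Sum>x\<in>B. real_of_int (left_of a x - left_of a (\<sigma> x))) = of_int n} \<in> sets (perm_borel X)"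
    unfolding pred_def by simp
  thus ?thesis using e by (simp cong: conj_cong)
qed

lemma perm_measure_eqI:
  assumes "sets \<mu> = sets (perm_borel X)" "sets \<nu> = sets (perm_borel X)" "emeasure \<mu> (Perms X) \<noteq> \<infinity>"
    "\<And>E. E \<in> local_events \<Longrightarrow> emeasure \<mu> E = emeasure \<nu> E"
  shows "\<mu> = \<nu>"
proof (rule measure_eqI_generator_eq[where E=local_events and \<Omega>="Perms X" and A="\<lambda>_. Perms X"])
  show "Int_stable local_events" using local_events_Int by (auto simp: Int_stable_def)
qed (use assms sets_perm local_events_Perms in \<open>auto simp: local_events_def\<close>)

end

section \<open>The specification as a probability kernel\<close>

context permutation_gas
begin

lemma spec_sets [simp]: "sets (spec X V \<Lambda> \<eta>) = sets (perm_borel X)" by (simp add: spec_def)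

lemma emeasure_spec:
  assumes "admissible \<Lambda> \<eta>" "E \<in> sets (perm_borel X)"
  shows "emeasure (spec X V \<Lambda> \<eta>) E = ennreal (gibbs_prob \<Lambda> \<eta> E)"
proof -
  define Z where "Z = (\<Sum>\<sigma>\<in>resample X \<Lambda> \<eta>. weight \<Lambda> \<sigma>)"
  have Z: "Z > 0" unfolding Z_def using Z_pos[OF assms(1)] .
  have pf: "partition_function X V \<Lambda> \<eta> = Z" by (simp add: Z_def partition_function_def resample_def weight_def)
  let ?f = "\<lambda>\<sigma>. ennreal (1 / Z * exp (- hamiltonian V \<Lambda> \<sigma>) * (if agree_outside X \<Lambda> \<sigma> \<eta> then 1 else 0))"
  have E: "E \<subseteq> Perms X" using sets.sets_into_space[OF assms(2)] by simp
  have supp: "{\<sigma>. \<sigma> \<in> E \<and> 0 < ?f \<sigma>} = resample X \<Lambda> \<eta> \<inter> E" using E Z by (auto simp: resample_def)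
  have "emeasure (spec X V \<Lambda> \<eta>) E = emeasure (point_measure (Perms X) ?f) E"
    unfolding spec_def pf
    by (subst emeasure_distr) (use assms(2) E in \<open>auto simp: measurable_def space_point_measure sets_point_measure Int_absorb2\<close>)
  also have "\<dots> = (\<Sum>\<sigma>\<in>{\<sigma>. \<sigma> \<in> E \<and> 0 < ?f \<sigma>}. ?f \<sigma>)"
  proof (rule emeasure_point_measure)
    show "finite {\<sigma> \<in> E. 0 < ?f \<sigma>}" unfolding supp using fin_resample[OF assms(1)] by simp
  qed (use E in simp)
  also have "\<dots> = (\<Sum>\<sigma>\<in>resample X \<Lambda> \<eta> \<inter> E. ennreal (weight \<Lambda> \<sigma> / Z))"
    unfolding supp by (rule sum.cong) (auto simp: resample_def weight_def)
  also have "\<dots> = ennreal (gibbs_prob \<Lambda> \<eta> E)"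
    unfolding gibbs_prob_def Z_def[symmetric] using Z
    by (subst sum_ennreal) (auto simp: sum_divide_distrib less_imp_le[OF weight_pos])
  finally show ?thesis .
qed

lemma prob_space_spec: assumes "admissible \<Lambda> \<eta>" shows "prob_space (spec X V \<Lambda> \<eta>)"
proof
  have sp: "space (spec X V \<Lambda> \<eta>) = Perms X" by (simp add: spec_def)
  have "resample X \<Lambda> \<eta> \<inter> Perms X = resample X \<Lambda> \<eta>" using resample_Perms by blast
  hence "gibbs_prob \<Lambda> \<eta> (Perms X) = 1" using Z_pos[OF assms] by (simp add: gibbs_prob_def)
  thus "emeasure (spec X V \<Lambda> \<eta>) (space (spec X V \<Lambda> \<eta>)) = 1"
    unfolding sp using emeasure_spec[OF assms, of "Perms X"] sets.top[of "perm_borel X"] by simp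
qed

lemma measure_spec:
  assumes "admissible \<Lambda> \<eta>" "E \<in> sets (perm_borel X)"
  shows "measure (spec X V \<Lambda> \<eta>) E = gibbs_prob \<Lambda> \<eta> E"
  using emeasure_spec[OF assms] gibbs_prob_nonneg[OF assms(1)] by (simp add: measure_def)

lemma hamiltonian_if:
  assumes "finite \<Lambda>" shows "hamiltonian V \<Lambda> \<sigma> = (\<Sum>x\<in>\<Lambda>. if \<sigma> x \<in> \<Lambda> then V (\<sigma> x - x) else 0)"
  unfolding hamiltonian_def using assms by (simp add: sum.If_cases Int_def)

lemma permutes_movable_iff:
  assumes "p permutes \<Lambda>" shows "p permutes movable \<Lambda> \<eta> \<longleftrightarrow> (\<forall>x\<in>\<Lambda>. p x \<noteq> x \<longrightarrow> \<eta> x \<in> \<Lambda>)"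
proof
  assume "p permutes movable \<Lambda> \<eta>"
  thus "\<forall>x\<in>\<Lambda>. p x \<noteq> x \<longrightarrow> \<eta> x \<in> \<Lambda>" using permutes_not_in by (fastforce simp: movable_def)
next
  assume *: "\<forall>x\<in>\<Lambda>. p x \<noteq> x \<longrightarrow> \<eta> x \<in> \<Lambda>"
  show "p permutes movable \<Lambda> \<eta>"
  proof (rule permutes_superset[OF assms])
    fix x assume "x \<in> \<Lambda> - movable \<Lambda> \<eta>"
    thus "p x = x" using * by (auto simp: movable_def)
  qed
qed

text \<open>This removes the dependence of the range of summation on \<open>\<eta>\<close>, so that
  measurability and locality in \<open>\<eta>\<close> can be read off.\<close>

lemma sum_resample_eq:
  assumes "admissible \<Lambda> \<eta>"
  shows "(\<Sum>\<sigma>\<in>resample X \<Lambda> \<eta> \<inter> E. weight \<Lambda> \<sigma>) = (\<Sum>p\<in>{p. p permutes \<Lambda>}.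
    if (\<forall>x\<in>\<Lambda>. p x \<noteq> x \<longrightarrow> \<eta> x \<in> \<Lambda>) \<and> \<eta> \<circ> p \<in> E then weight \<Lambda> (\<eta> \<circ> p) else 0)"
proof -
  have C: "\<eta> \<in> Perms X" "\<Lambda> \<subseteq> X" "finite \<Lambda>" using assms by (auto simp: admissible_def)
  let ?P = "{p. p permutes \<Lambda> \<and> (\<forall>x\<in>\<Lambda>. p x \<noteq> x \<longrightarrow> \<eta> x \<in> \<Lambda>) \<and> \<eta> \<circ> p \<in> E}"
  have sub: "p permutes \<Lambda>" if "p permutes movable \<Lambda> \<eta>" for p
    using permutes_subset[OF that] by (auto simp: movable_def)
  have im: "resample X \<Lambda> \<eta> \<inter> E = (\<lambda>p. \<eta> \<circ> p) ` ?P"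
  proof -
    have "?P = {p. p permutes movable \<Lambda> \<eta>} \<inter> {p. \<eta> \<circ> p \<in> E}" using permutes_movable_iff sub by blast
    thus ?thesis unfolding resample_eq_image[OF C(1,2)] by auto
  qed
  have inj: "inj_on (\<lambda>p. \<eta> \<circ> p) ?P"
  proof (rule inj_onI)
    fix p q assume e: "\<eta> \<circ> p = \<eta> \<circ> q"
    show "p = q" using fun_cong[OF e] injD[OF Perms_inj[OF C(1)]] by (intro ext) simp
  qed
  have fP: "finite {p. p permutes \<Lambda>}" by (rule finite_permutations[OF C(3)])
  show ?thesis unfolding im sum.reindex[OF inj] using fP
    by (simp add: sum.If_cases Int_def conj_ac)
qed

lemma measurable_gibbs_prob:
  assumes "finite \<Lambda>" "\<Lambda> \<subseteq> X" "E \<in> sets (perm_borel X)"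
  shows "(\<lambda>\<eta>. gibbs_prob \<Lambda> \<eta> E) \<in> borel_measurable (perm_borel X)"
proof -
  have H: "(\<lambda>\<eta>. weight \<Lambda> (\<eta> \<circ> p)) \<in> borel_measurable (perm_borel X)" for p
  proof -
    have "(\<lambda>\<eta>. \<Sum>x\<in>\<Lambda>. if \<eta> (p x) \<in> \<Lambda> then V (\<eta> (p x) - x) else 0) \<in> borel_measurable (perm_borel X)"
      by (intro borel_measurable_sum borel_eval)
    thus ?thesis unfolding weight_def hamiltonian_if[OF assms(1)] comp_def by simp
  qed
  have T: "(\<lambda>\<eta>. \<Sum>p\<in>{p. p permutes \<Lambda>}.
    if (\<forall>x\<in>\<Lambda>. p x \<noteq> x \<longrightarrow> \<eta> x \<in> \<Lambda>) \<and> \<eta> \<circ> p \<in> F then weight \<Lambda> (\<eta> \<circ> p) else 0) \<in> borel_measurable (perm_borel X)"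
    if F: "F \<in> sets (perm_borel X)" for F
  proof (intro borel_measurable_sum measurable_If H)
    fix p assume "p \<in> {p. p permutes \<Lambda>}"
    hence p: "p \<in> Perms X" unfolding Perms_def using permutes_subset[OF _ assms(2)] by simp
    have "Measurable.pred (perm_borel X) (\<lambda>\<eta>. \<forall>x\<in>\<Lambda>. p x \<noteq> x \<longrightarrow> \<eta> x \<in> \<Lambda>)"
    proof (rule pred_Ball_countable[OF countable_finite[OF assms(1)]])
      fix x show "Measurable.pred (perm_borel X) (\<lambda>\<eta>. p x \<noteq> x \<longrightarrow> \<eta> x \<in> \<Lambda>)"
        using pred_eval[of "\<lambda>y. p x \<noteq> x \<longrightarrow> y \<in> \<Lambda>" x] .
    qed
    moreover have "Measurable.pred (perm_borel X) (\<lambda>\<eta>. \<eta> \<circ> p \<in> F)"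
      using measurable_sets[OF measurable_comp_perm[OF p] F] unfolding pred_def
      by (rule back_subst[where P="\<lambda>A. A \<in> sets (perm_borel X)"]) auto
    ultimately have "Measurable.pred (perm_borel X) (\<lambda>\<eta>. (\<forall>x\<in>\<Lambda>. p x \<noteq> x \<longrightarrow> \<eta> x \<in> \<Lambda>) \<and> \<eta> \<circ> p \<in> F)"
      by (rule pred_intros_logic)
    thus "{\<eta> \<in> space (perm_borel X). (\<forall>x\<in>\<Lambda>. p x \<noteq> x \<longrightarrow> \<eta> x \<in> \<Lambda>) \<and> \<eta> \<circ> p \<in> F} \<in> sets (perm_borel X)"
      unfolding pred_def .
  qed simp
  have "(\<lambda>\<eta>. (\<Sum>p\<in>{p. p permutes \<Lambda>}.
    if (\<forall>x\<in>\<Lambda>. p x \<noteq> x \<longrightarrow> \<eta> x \<in> \<Lambda>) \<and> \<eta> \<circ> p \<in> E then weight \<Lambda> (\<eta> \<circ> p) else 0) /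
    (\<Sum>p\<in>{p. p permutes \<Lambda>}.
    if (\<forall>x\<in>\<Lambda>. p x \<noteq> x \<longrightarrow> \<eta> x \<in> \<Lambda>) \<and> \<eta> \<circ> p \<in> Perms X then weight \<Lambda> (\<eta> \<circ> p) else 0)) \<in> borel_measurable (perm_borel X)"
    using T[OF assms(3)] T[of "Perms X"] sets.top[of "perm_borel X"] by (intro borel_measurable_divide) auto
  moreover have "gibbs_prob \<Lambda> \<eta> E = (\<Sum>p\<in>{p. p permutes \<Lambda>}.
    if (\<forall>x\<in>\<Lambda>. p x \<noteq> x \<longrightarrow> \<eta> x \<in> \<Lambda>) \<and> \<eta> \<circ> p \<in> E then weight \<Lambda> (\<eta> \<circ> p) else 0) /
    (\<Sum>p\<in>{p. p permutes \<Lambda>}.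
    if (\<forall>x\<in>\<Lambda>. p x \<noteq> x \<longrightarrow> \<eta> x \<in> \<Lambda>) \<and> \<eta> \<circ> p \<in> Perms X then weight \<Lambda> (\<eta> \<circ> p) else 0)" if "\<eta> \<in> Perms X" for \<eta>
  proof -
    have c: "admissible \<Lambda> \<eta>" using that assms by (simp add: admissible_def)
    have "resample X \<Lambda> \<eta> \<inter> Perms X = resample X \<Lambda> \<eta>" using resample_Perms by blast
    thus ?thesis unfolding gibbs_prob_def using sum_resample_eq[OF c, of E] sum_resample_eq[OF c, of "Perms X"] by simp
  qed
  ultimately show ?thesis by (subst measurable_cong[where M = "perm_borel X"]) simp_all
qed

text \<open>Composing \<open>\<eta>\<close> with a permutation of \<open>\<Lambda>\<close> only changes which
  pairs are asked for, and the energy depends on \<open>\<eta>\<close> only through the jumps inside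
  \<open>\<Lambda>\<close>.\<close>

lemma gibbs_prob_local:
  assumes "finite \<Lambda>" "\<Lambda> \<subseteq> X" "E \<in> local_events"
  shows "\<exists>Q. finite Q \<and> Q \<subseteq> X \<times> X \<and> (\<forall>\<sigma>\<in>Perms X. \<forall>\<tau>\<in>Perms X. hits Q \<sigma> = hits Q \<tau> \<longrightarrow> gibbs_prob \<Lambda> \<sigma> E = gibbs_prob \<Lambda> \<tau> E)"
proof -
  obtain Q where Q: "finite Q" "Q \<subseteq> X \<times> X" "determined Q E" "E \<subseteq> Perms X" using assms(3) by (auto simp: local_events_def)
  \<comment> \<open>The questions inside \<open>\<Lambda>\<close> decide the movable points and the energies; the others
    decide whether \<open>\<eta> \<circ> p\<close> belongs to \<open>E\<close>.\<close>
  define Q' where "Q' = \<Lambda> \<times> \<Lambda> \<union> (\<Union>p\<in>{p. p permutes \<Lambda>}. (\<lambda>(x,y). (p x, y)) ` Q)"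
  have "finite Q'" unfolding Q'_def using finite_permutations[OF assms(1)] assms(1) Q by auto
  moreover have "Q' \<subseteq> X \<times> X"
  proof -
    have "p x \<in> X" if "p permutes \<Lambda>" "x \<in> X" for p x
      using permutes_in_image[OF permutes_subset[OF that(1) assms(2)]] that(2) by blast
    thus ?thesis unfolding Q'_def using assms(2) Q(2) by auto
  qed
  moreover have "gibbs_prob \<Lambda> \<sigma> E = gibbs_prob \<Lambda> \<tau> E" if st: "\<sigma> \<in> Perms X" "\<tau> \<in> Perms X" "hits Q' \<sigma> = hits Q' \<tau>" for \<sigma> \<tau>
  proof -
    have h: "\<sigma> x = y \<longleftrightarrow> \<tau> x = y" if "(x,y) \<in> Q'" for x y using st(3) that unfolding hits_def by (auto simp: set_eq_iff)
    have h1: "\<sigma> x \<in> \<Lambda> \<longleftrightarrow> \<tau> x \<in> \<Lambda>" "\<sigma> x \<in> \<Lambda> \<Longrightarrow> \<sigma> x = \<tau> x" if "x \<in> \<Lambda>" for x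
    proof -
      have e: "\<sigma> x = y \<longleftrightarrow> \<tau> x = y" if "y \<in> \<Lambda>" for y
        by (rule h) (simp add: Q'_def that \<open>x \<in> \<Lambda>\<close>)
      show "\<sigma> x \<in> \<Lambda> \<longleftrightarrow> \<tau> x \<in> \<Lambda>" "\<sigma> x \<in> \<Lambda> \<Longrightarrow> \<sigma> x = \<tau> x" using e by metis+
    qed
    have h2: "\<sigma> \<circ> p \<in> E \<longleftrightarrow> \<tau> \<circ> p \<in> E" if p: "p permutes \<Lambda>" for p
    proof -
      have pP: "p \<in> Perms X" unfolding Perms_def using permutes_subset[OF p assms(2)] by simp
      have "\<sigma> (p x) = y \<longleftrightarrow> \<tau> (p x) = y" if "(x,y) \<in> Q" for x y
      proof (rule h)
        show "(p x, y) \<in> Q'" unfolding Q'_def using that p by force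
      qed
      hence "hits Q (\<sigma> \<circ> p) = hits Q (\<tau> \<circ> p)" unfolding hits_def by fastforce
      thus ?thesis using Q(3) Perms_comp[OF _ pP] st(1,2) unfolding determined_def by blast
    qed
    have h3: "weight \<Lambda> (\<sigma> \<circ> p) = weight \<Lambda> (\<tau> \<circ> p)" if p: "p permutes \<Lambda>" for p
    proof -
      have "p x \<in> \<Lambda>" if "x \<in> \<Lambda>" for x using permutes_in_image[OF p] that by blast
      thus ?thesis unfolding weight_def hamiltonian_if[OF assms(1)]
        using h1 by (intro arg_cong[where f=exp] arg_cong[where f=uminus] sum.cong) auto
    qed
    have c: "admissible \<Lambda> \<sigma>" "admissible \<Lambda> \<tau>" using st assms by (auto simp: admissible_def)
    have S: "(\<Sum>\<rho>\<in>resample X \<Lambda> \<sigma> \<inter> F. weight \<Lambda> \<rho>) = (\<Sum>\<rho>\<in>resample X \<Lambda> \<tau> \<inter> F. weight \<Lambda> \<rho>)"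
      if "\<And>p. p permutes \<Lambda> \<Longrightarrow> \<sigma> \<circ> p \<in> F \<longleftrightarrow> \<tau> \<circ> p \<in> F" for F
      unfolding sum_resample_eq[OF c(1)] sum_resample_eq[OF c(2)]
    proof (rule sum.cong[OF refl])
      fix p assume "p \<in> {p. p permutes \<Lambda>}"
      hence p: "p permutes \<Lambda>" by simp
      have "(\<forall>x\<in>\<Lambda>. p x \<noteq> x \<longrightarrow> \<sigma> x \<in> \<Lambda>) \<longleftrightarrow> (\<forall>x\<in>\<Lambda>. p x \<noteq> x \<longrightarrow> \<tau> x \<in> \<Lambda>)" using h1(1) by blast
      thus "(if (\<forall>x\<in>\<Lambda>. p x \<noteq> x \<longrightarrow> \<sigma> x \<in> \<Lambda>) \<and> \<sigma> \<circ> p \<in> F then weight \<Lambda> (\<sigma> \<circ> p) else 0)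
        = (if (\<forall>x\<in>\<Lambda>. p x \<noteq> x \<longrightarrow> \<tau> x \<in> \<Lambda>) \<and> \<tau> \<circ> p \<in> F then weight \<Lambda> (\<tau> \<circ> p) else 0)"
        by (intro if_cong conj_cong that[OF p] h3[OF p] refl)
    qed
    have a: "(\<Sum>\<rho>\<in>resample X \<Lambda> \<sigma> \<inter> E. weight \<Lambda> \<rho>) = (\<Sum>\<rho>\<in>resample X \<Lambda> \<tau> \<inter> E. weight \<Lambda> \<rho>)"
      by (rule S[OF h2])
    have b: "(\<Sum>\<rho>\<in>resample X \<Lambda> \<sigma>. weight \<Lambda> \<rho>) = (\<Sum>\<rho>\<in>resample X \<Lambda> \<tau>. weight \<Lambda> \<rho>)"
      by (rule S[of UNIV, unfolded Int_UNIV_right]) simp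
    show ?thesis unfolding gibbs_prob_def a b ..
  qed
  ultimately show ?thesis by (intro exI[of _ Q'] conjI ballI impI)
qed

end

section \<open>Resampling leaves distant cuts alone\<close>

context point_set
begin

lemma finite_midpoints: "finite {a \<in> midpoints X. l \<le> a \<and> a \<le> r}"
proof -
  obtain p where p: "pt p < l" using ex_lt unfolding in_X_iff Bex_def by auto
  obtain q where q: "pt q > r" using ex_gt unfolding in_X_iff Bex_def by auto
  have "{a \<in> midpoints X. l \<le> a \<and> a \<le> r} \<subseteq> mid ` {p..q}"
  proof
    fix a assume a: "a \<in> {a \<in> midpoints X. l \<le> a \<and> a \<le> r}"
    then obtain i where i: "a = mid i" unfolding midpoints_eq by auto
    have "pt p < mid i" "mid i < pt q" using a p q unfolding i by auto
    thus "a \<in> mid ` {p..q}" unfolding i pt_less_mid_iff mid_less_pt_iff by auto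
  qed
  thus ?thesis by (rule finite_subset) simp
qed

text \<open>If \<open>\<Lambda>\<close> lies on one side of \<open>a\<close>, then resampling inside
  \<open>\<Lambda>\<close> touches no jump across \<open>a\<close>.\<close>

lemma cut_resample:
  assumes "\<eta> \<in> Perms X" "\<Lambda> \<subseteq> X" "\<sigma> \<in> resample X \<Lambda> \<eta>" "(\<forall>x\<in>\<Lambda>. x < a) \<or> (\<forall>x\<in>\<Lambda>. a < x)"
  shows "cut n a \<sigma> \<longleftrightarrow> cut n a \<eta>"
proof -
  have one: "cut n a \<sigma>" if c: "cut n a \<eta>" and h: "\<eta> \<in> Perms X" "\<sigma> \<in> resample X \<Lambda> \<eta>" for \<sigma> \<eta>
    unfolding cut_def
  proof (intro ballI impI)
    fix x assume x: "x \<in> X" "crosses a x (\<sigma> x) \<or> crosses a x (theta n x)"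
    show "\<sigma> x = theta n x"
    proof (cases "x \<in> movable \<Lambda> \<eta>")
      case False
      hence e: "\<sigma> x = \<eta> x" using h resample_iff[OF h(1) assms(2)] by blast
      show ?thesis using c x unfolding cut_def e by blast
    next
      case True
      hence "x \<in> \<Lambda>" "\<sigma> x \<in> \<Lambda>" "\<eta> x \<in> \<Lambda>" using resample_movable[OF h(2,1) assms(2)] by (auto simp: movable_def)
      hence n: "\<not> crosses a x (\<sigma> x)" "\<not> crosses a x (\<eta> x)" using assms(4) by (force simp: crosses_def)+
      hence "crosses a x (theta n x)" using x by blast
      moreover from this have "\<eta> x = theta n x" using c x(1) unfolding cut_def by blast
      ultimately show ?thesis using n by simp
    qed
  qed
  show ?thesis using one[OF _ assms(1,3)] one[OF _ resample_Perms[OF assms(3)] resample_sym[OF assms(3,1)]] by blast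
qed

text \<open>Membership in \<open>T\<close> is not affected by resampling inside \<open>\<Lambda>\<close>, so
  \<open>T\<close> can be pulled out of the specification like a constant.\<close>

definition invariant :: "real set \<Rightarrow> (real \<Rightarrow> real) set \<Rightarrow> bool" where
  "invariant \<Lambda> T \<longleftrightarrow> (\<forall>\<eta>\<in>Perms X. \<forall>\<sigma>\<in>resample X \<Lambda> \<eta>. \<sigma> \<in> T \<longleftrightarrow> \<eta> \<in> T)"

lemma invariantD: "invariant \<Lambda> T \<Longrightarrow> \<eta> \<in> Perms X \<Longrightarrow> \<sigma> \<in> resample X \<Lambda> \<eta> \<Longrightarrow> \<sigma> \<in> T \<longleftrightarrow> \<eta> \<in> T"
  by (auto simp: invariant_def)

lemma finite_cut_resample:
  assumes "\<eta> \<in> Perms X" "\<Lambda> \<subseteq> X" "finite \<Lambda>" "\<sigma> \<in> resample X \<Lambda> \<eta>" "S \<subseteq> midpoints X" "finite {a\<in>S. cut n a \<eta>}"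
  shows "finite {a\<in>S. cut n a \<sigma>}"
proof -
  obtain B where B: "\<And>x. x \<in> \<Lambda> \<Longrightarrow> \<bar>x\<bar> \<le> B" using finite_imp_bounded[OF assms(3)] by (auto simp: bounded_iff)
  have "{a\<in>S. cut n a \<sigma>} \<subseteq> {a\<in>S. cut n a \<eta>} \<union> {a \<in> midpoints X. - B \<le> a \<and> a \<le> B}"
  proof
    fix a assume a: "a \<in> {a\<in>S. cut n a \<sigma>}"
    show "a \<in> {a\<in>S. cut n a \<eta>} \<union> {a \<in> midpoints X. - B \<le> a \<and> a \<le> B}"
    proof (cases "- B \<le> a \<and> a \<le> B")
      case True thus ?thesis using a assms(5) by auto
    next
      case False
      hence "(\<forall>x\<in>\<Lambda>. x < a) \<or> (\<forall>x\<in>\<Lambda>. a < x)" using B by fastforce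
      thus ?thesis using cut_resample[OF assms(1,2,4)] a by auto
    qed
  qed
  thus ?thesis using assms(6) finite_midpoints finite_subset by blast
qed

definition Box :: "nat \<Rightarrow> real set" where "Box k = X \<inter> {- real k..real k}"

lemma Box: "finite (Box k)" "Box k \<subseteq> X" "incseq Box" "(\<Union>k. Box k) = X"
proof -
  show "finite (Box k)" unfolding Box_def by (rule finite_Icc)
  show "Box k \<subseteq> X" by (simp add: Box_def)
  show "incseq Box" by (rule monoI) (auto simp: Box_def)
  have "x \<in> (\<Union>k. Box k)" if x: "x \<in> X" for x
  proof -
    obtain k :: nat where "\<bar>x\<bar> \<le> real k" using real_arch_simple by blast
    thus ?thesis using x by (auto simp: Box_def intro!: exI[of _ k])
  qed
  thus "(\<Union>k. Box k) = X" by (auto simp: Box_def)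
qed

lemma eventually_superset:
  assumes "incseq (\<Lambda> :: nat \<Rightarrow> real set)" "finite B" "B \<subseteq> (\<Union>k. \<Lambda> k)"
  shows "eventually (\<lambda>k. B \<subseteq> \<Lambda> k) sequentially"
  using assms(2,3)
proof (induction B rule: finite_induct)
  case (insert x B)
  then obtain k where k: "x \<in> \<Lambda> k" by auto
  have "eventually (\<lambda>j. x \<in> \<Lambda> j) sequentially"
    using eventually_ge_at_top[of k] by eventually_elim (use k assms(1) in \<open>auto simp: incseq_def\<close>)
  moreover have "eventually (\<lambda>k. B \<subseteq> \<Lambda> k) sequentially" using insert by auto
  ultimately show ?case by eventually_elim auto
qed simp

end

context permutation_gas
begin

lemma eventually_suitable:
  assumes "incseq \<Lambda>" "(\<Union>k. \<Lambda> k) = X" "\<eta> \<in> Perms X" "flow X \<eta> = Fin n" "a \<in> midpoints X"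
  shows "eventually (\<lambda>k. suitable a T (\<Lambda> k) \<eta>) sequentially"
proof -
  obtain B where B: "finite B" "B \<subseteq> X" "\<forall>\<Lambda>. B \<subseteq> \<Lambda> \<longrightarrow> suitable a T \<Lambda> \<eta>"
    using ex_suitable[OF assms(3-5), of T] by (elim exE conjE)
  have "eventually (\<lambda>k. B \<subseteq> \<Lambda> k) sequentially" 
    by (rule eventually_superset[OF assms(1) B(1)]) (use assms(2) B(2) in simp)
  thus ?thesis
  proof eventually_elim
    case (elim k)
    show ?case by (rule B(3)[rule_format, OF elim])
  qed
qed

section \<open>Infinitely many cuts\<close>

lemma gibbsD:
  assumes "\<mu> \<in> gibbs X V"
  shows "sets \<mu> = sets (perm_borel X)" "prob_space \<mu>" "space \<mu> = Perms X"
    "\<And>A \<Lambda>. A \<in> sets (perm_borel X) \<Longrightarrow> finite \<Lambda> \<Longrightarrow> \<Lambda> \<subseteq> X \<Longrightarrow>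
      (\<integral>\<^sup>+\<eta>. ennreal (gibbs_prob \<Lambda> \<eta> A) \<partial>\<mu>) = emeasure \<mu> A"
proof -
  show s: "sets \<mu> = sets (perm_borel X)" "prob_space \<mu>" using assms by (auto simp: gibbs_def)
  show sp: "space \<mu> = Perms X" using sets_eq_imp_space_eq[OF s(1)] by simp
  fix A \<Lambda> assume A: "A \<in> sets (perm_borel X)" "finite \<Lambda>" "\<Lambda> \<subseteq> X"
  have "(\<integral>\<^sup>+\<eta>. ennreal (gibbs_prob \<Lambda> \<eta> A) \<partial>\<mu>) = (\<integral>\<^sup>+\<eta>. emeasure (spec X V \<Lambda> \<eta>) A \<partial>\<mu>)"
    by (rule nn_integral_cong) (use emeasure_spec A sp in \<open>auto simp: admissible_def\<close>)
  also have "\<dots> = emeasure \<mu> A" using assms A by (auto simp: gibbs_def)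
  finally show "(\<integral>\<^sup>+\<eta>. ennreal (gibbs_prob \<Lambda> \<eta> A) \<partial>\<mu>) = emeasure \<mu> A" .
qed

lemma gibbs_prob_invariant:
  assumes "admissible \<Lambda> \<eta>" "invariant \<Lambda> T"
  shows "gibbs_prob \<Lambda> \<eta> (A \<inter> T) = (if \<eta> \<in> T then gibbs_prob \<Lambda> \<eta> A else 0)"
proof -
  have "resample X \<Lambda> \<eta> \<inter> (A \<inter> T) = (if \<eta> \<in> T then resample X \<Lambda> \<eta> \<inter> A else {})"
    using invariantD[OF assms(2)] assms(1) by (auto simp: admissible_def)
  thus ?thesis by (simp add: gibbs_prob_def)
qed

text \<open>This is conditioning on an event that is decided outside \<open>\<Lambda>\<close>.\<close>

lemma gibbs_inter:
  assumes "\<mu> \<in> gibbs X V" "A \<in> sets (perm_borel X)" "T \<in> sets (perm_borel X)" "finite \<Lambda>" "\<Lambda> \<subseteq> X" "invariant \<Lambda> T"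
  shows "emeasure \<mu> (A \<inter> T) = (\<integral>\<^sup>+\<eta>. ennreal (gibbs_prob \<Lambda> \<eta> A) * indicator T \<eta> \<partial>\<mu>)"
proof -
  have "emeasure \<mu> (A \<inter> T) = (\<integral>\<^sup>+\<eta>. ennreal (gibbs_prob \<Lambda> \<eta> (A \<inter> T)) \<partial>\<mu>)"
    using gibbsD(4)[OF assms(1) _ assms(4,5), of "A \<inter> T"] assms(2,3) by auto
  also have "\<dots> = (\<integral>\<^sup>+\<eta>. ennreal (gibbs_prob \<Lambda> \<eta> A) * indicator T \<eta> \<partial>\<mu>)"
    by (rule nn_integral_cong)
      (use gibbs_prob_invariant[OF _ assms(6)] assms gibbsD(3)[OF assms(1)] in \<open>auto simp: admissible_def indicator_def\<close>)
  finally show ?thesis .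
qed

text \<open>For fixed \<open>\<eta>\<close> the bound of \<open>gibbs_prob_cut_ge\<close> holds in all large
  volumes. As \<open>T\<close> is invariant under resampling in every box, the box can be sent to
  infinity under the integral by the lemma of Fatou.\<close>

lemma cut_prob_ge:
  assumes "c \<ge> 1"
  shows "\<exists>\<delta>>0. \<forall>\<mu>\<in>gibbs X V. \<forall>a T. good_pt c n a \<longrightarrow> T \<in> sets (perm_borel X) \<longrightarrow>
    T \<subseteq> {\<sigma> \<in> Perms X. flow X \<sigma> = Fin n} \<longrightarrow> (\<forall>k. invariant (Box k) T) \<longrightarrow>
    ennreal \<delta> * emeasure \<mu> T \<le> emeasure \<mu> ({\<sigma> \<in> Perms X. cut n a \<sigma>} \<inter> T)"
proof -
  obtain \<delta> T0 where \<delta>: "\<delta> > 0" "\<And>a \<Lambda> \<eta>. admissible \<Lambda> \<eta> \<Longrightarrow> good_pt c n a \<Longrightarrow> flow X \<eta> = Fin n \<Longrightarrow>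
    suitable a T0 \<Lambda> \<eta> \<Longrightarrow> \<delta> \<le> gibbs_prob \<Lambda> \<eta> {\<sigma>. cut n a \<sigma>}" using gibbs_prob_cut_ge[OF assms, of n] by auto
  show ?thesis
  proof (intro exI[of _ \<delta>] conjI \<delta>(1) ballI allI impI)
    fix \<mu> a T assume H: "\<mu> \<in> gibbs X V" "good_pt c n a" "T \<in> sets (perm_borel X)"
      "T \<subseteq> {\<sigma> \<in> Perms X. flow X \<sigma> = Fin n}" "\<forall>k. invariant (Box k) T"
    note G = gibbsD[OF H(1)]
    let ?C = "{\<sigma> \<in> Perms X. cut n a \<sigma>}"
    have am: "a \<in> midpoints X" by (rule good_ptD(1)[OF H(2)])
    have cfg: "admissible (Box k) \<eta>" if "\<eta> \<in> Perms X" for \<eta> k using that Box by (simp add: admissible_def)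
    have e: "emeasure \<mu> (?C \<inter> T) = (\<integral>\<^sup>+\<eta>. ennreal (gibbs_prob (Box k) \<eta> ?C) * indicator T \<eta> \<partial>\<mu>)" for k
      by (rule gibbs_inter[OF H(1) cut_sets H(3) Box(1,2)]) (use H(5) in blast)
    have "ennreal \<delta> * emeasure \<mu> T = (\<integral>\<^sup>+\<eta>. ennreal \<delta> * indicator T \<eta> \<partial>\<mu>)"
      using H(3) G(1) by (subst nn_integral_cmult_indicator) auto
    also have "\<dots> \<le> (\<integral>\<^sup>+\<eta>. liminf (\<lambda>k. ennreal (gibbs_prob (Box k) \<eta> ?C) * indicator T \<eta>) \<partial>\<mu>)"
    proof (rule nn_integral_mono)
      fix \<eta> assume "\<eta> \<in> space \<mu>"
      hence \<eta>: "\<eta> \<in> Perms X" using G(3) by simp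
      show "ennreal \<delta> * indicator T \<eta> \<le> liminf (\<lambda>k. ennreal (gibbs_prob (Box k) \<eta> ?C) * indicator T \<eta>)"
      proof (cases "\<eta> \<in> T")
        case True
        hence fl: "flow X \<eta> = Fin n" using H(4) by auto
        have "eventually (\<lambda>k. suitable a T0 (Box k) \<eta>) sequentially"
          by (rule eventually_suitable[OF Box(3,4) \<eta> fl am])
        hence "eventually (\<lambda>k. ennreal \<delta> * indicator T \<eta> \<le> ennreal (gibbs_prob (Box k) \<eta> ?C) * indicator T \<eta>) sequentially"
        proof eventually_elim
          case (elim k)
          have "\<delta> \<le> gibbs_prob (Box k) \<eta> {\<sigma>. cut n a \<sigma>}" by (rule \<delta>(2)[OF cfg[OF \<eta>] H(2) fl elim])
          also have "\<dots> \<le> gibbs_prob (Box k) \<eta> ?C" by (rule gibbs_prob_mono[OF cfg[OF \<eta>]]) (use resample_Perms in auto)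
          finally show ?case by (intro mult_right_mono ennreal_leI) auto
        qed
        thus ?thesis by (rule Liminf_bounded)
      qed simp
    qed
    also have "\<dots> \<le> liminf (\<lambda>k. \<integral>\<^sup>+\<eta>. ennreal (gibbs_prob (Box k) \<eta> ?C) * indicator T \<eta> \<partial>\<mu>)"
    proof (rule nn_integral_liminf)
      fix k
      have "(\<lambda>\<eta>. gibbs_prob (Box k) \<eta> ?C) \<in> borel_measurable \<mu>"
        using measurable_gibbs_prob[OF Box(1,2) cut_sets] measurable_cong_sets[OF G(1) refl] by blast
      thus "(\<lambda>\<eta>. ennreal (gibbs_prob (Box k) \<eta> ?C) * indicator T \<eta>) \<in> borel_measurable \<mu>"
        using H(3) G(1) by (intro borel_measurable_times_ennreal borel_measurable_indicator measurable_compose[OF _ measurable_ennreal]) auto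
    qed
    also have "\<dots> = emeasure \<mu> (?C \<inter> T)" unfolding e[symmetric] by (simp add: Liminf_const)
    finally show "ennreal \<delta> * emeasure \<mu> T \<le> emeasure \<mu> (?C \<inter> T)" .
  qed
qed

lemma countable_midpoints: "countable (midpoints X)" unfolding midpoints_eq by simp

lemma few_cuts_sets:
  assumes "S \<subseteq> midpoints X"
  shows "{\<sigma> \<in> Perms X. finite {a\<in>S. cut n a \<sigma>}} \<in> sets (perm_borel X)"
proof -
  have cS: "countable S" using assms countable_midpoints countable_subset by blast
  have c: "countable {B. B \<subseteq> S \<and> finite B}"
    using countable_Collect_finite_subset[OF cS] by (simp add: conj_commute)
  have "Measurable.pred (perm_borel X) (\<lambda>\<sigma>. \<exists>B\<in>{B. B \<subseteq> S \<and> finite B}. \<forall>a\<in>S - B. \<not> cut n a \<sigma>)"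
    by (intro pred_Bex_countable[OF c] pred_Ball_countable pred_intros_logic pred_cut) (use cS in auto)
  moreover have "(\<exists>B\<in>{B. B \<subseteq> S \<and> finite B}. \<forall>a\<in>S - B. \<not> cut n a \<sigma>) \<longleftrightarrow> finite {a\<in>S. cut n a \<sigma>}" for \<sigma>
  proof
    assume "\<exists>B\<in>{B. B \<subseteq> S \<and> finite B}. \<forall>a\<in>S - B. \<not> cut n a \<sigma>"
    then obtain B where "finite B" "{a\<in>S. cut n a \<sigma>} \<subseteq> B" by auto
    thus "finite {a\<in>S. cut n a \<sigma>}" using finite_subset by blast
  next
    assume "finite {a\<in>S. cut n a \<sigma>}"
    thus "\<exists>B\<in>{B. B \<subseteq> S \<and> finite B}. \<forall>a\<in>S - B. \<not> cut n a \<sigma>"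
      by (intro bexI[of _ "{a\<in>S. cut n a \<sigma>}"]) auto
  qed
  ultimately show ?thesis unfolding pred_def by simp
qed

text \<open>Let \<open>T\<close> be the event of flow \<open>n\<close> and finitely many cuts in
  \<open>S\<close>. It is invariant under all resamplings. Along a sequence of distinct points of
  \<open>S\<close>, the probability of \<open>T\<close> together with a cut tends to
  \<open>0\<close> by the definition of \<open>T\<close>, but it is at least \<open>\<delta>\<close>
  times the probability of \<open>T\<close>.\<close>

lemma infinitely_many_cuts:
  assumes "\<mu> \<in> gibbs X V" "c \<ge> 1" "S \<subseteq> {a. good_pt c n a}" "infinite S"
  shows "AE \<sigma> in \<mu>. flow X \<sigma> = Fin n \<longrightarrow> infinite {a\<in>S. cut n a \<sigma>}"
proof -
  note G = gibbsD[OF assms(1)]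
  interpret prob_space \<mu> by (rule G(2))
  have Sm: "S \<subseteq> midpoints X" using assms(3) good_ptD(1) by blast
  define T where "T = {\<sigma> \<in> Perms X. flow X \<sigma> = Fin n} \<inter> {\<sigma> \<in> Perms X. finite {a\<in>S. cut n a \<sigma>}}"
  have T: "T \<in> sets (perm_borel X)" unfolding T_def by (intro sets.Int flow_sets few_cuts_sets[OF Sm])
  have inv: "invariant (Box k) T" for k unfolding invariant_def
  proof (intro ballI)
    fix \<eta> \<sigma> assume h: "\<eta> \<in> Perms X" "\<sigma> \<in> resample X (Box k) \<eta>"
    have "finite {a\<in>S. cut n a \<sigma>} \<longleftrightarrow> finite {a\<in>S. cut n a \<eta>}"
      using finite_cut_resample[OF h(1) Box(2,1) h(2) Sm, of n]
        finite_cut_resample[OF resample_Perms[OF h(2)] Box(2,1) resample_sym[OF h(2,1)] Sm, of n] by blast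
    thus "\<sigma> \<in> T \<longleftrightarrow> \<eta> \<in> T" unfolding T_def using flow_resample[OF h(1) Box(2,1) h(2)] h(1) resample_Perms[OF h(2)] by simp
  qed
  obtain \<delta> where \<delta>: "\<delta> > 0" and d: "\<forall>\<mu>\<in>gibbs X V. \<forall>a T. good_pt c n a \<longrightarrow> T \<in> sets (perm_borel X) \<longrightarrow>
    T \<subseteq> {\<sigma> \<in> Perms X. flow X \<sigma> = Fin n} \<longrightarrow> (\<forall>k. invariant (Box k) T) \<longrightarrow>
    ennreal \<delta> * emeasure \<mu> T \<le> emeasure \<mu> ({\<sigma> \<in> Perms X. cut n a \<sigma>} \<inter> T)"
    using cut_prob_ge[OF assms(2), of n] by (elim exE conjE)
  have \<delta>2: "ennreal \<delta> * emeasure \<mu> T \<le> emeasure \<mu> ({\<sigma> \<in> Perms X. cut n a \<sigma>} \<inter> T)" if "a \<in> S" for a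
  proof (rule d[rule_format, OF assms(1) _ T _ inv])
    show "good_pt c n a" using that assms(3) by auto
    show "T \<subseteq> {\<sigma> \<in> Perms X. flow X \<sigma> = Fin n}" by (simp add: T_def)
  qed
  obtain f :: "nat \<Rightarrow> real" where f: "inj f" "range f \<subseteq> S" using infinite_countable_subset[OF assms(4)] by blast
  define D where "D i = (\<Union>j\<in>{i..}. {\<sigma> \<in> Perms X. cut n (f j) \<sigma>} \<inter> T)" for i
  have D: "D i \<in> sets \<mu>" for i unfolding D_def G(1) by (intro sets.countable_UN'' sets.Int cut_sets T) auto
  have dec: "decseq D" unfolding D_def decseq_def by fastforce
  \<comment> \<open>A permutation in all \<open>D i\<close> would have a cut at infinitely many of the points \<open>f
    j\<close>.\<close>
  have "(\<Inter>i. D i) = {}"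
  proof (rule ccontr)
    assume "(\<Inter>i. D i) \<noteq> {}"
    then obtain \<sigma> where s: "\<And>i. \<sigma> \<in> D i" by blast
    have "finite {a\<in>S. cut n a \<sigma>}" using s[of 0] by (auto simp: D_def T_def)
    hence "finite (f -` {a\<in>S. cut n a \<sigma>})" using f(1) by (rule finite_vimageI)
    then obtain i where i: "\<And>j. j \<in> f -` {a\<in>S. cut n a \<sigma>} \<Longrightarrow> j < i" using finite_nat_set_iff_bounded by auto
    obtain j where "j \<ge> i" "cut n (f j) \<sigma>" using s[of i] by (auto simp: D_def)
    thus False using i[of j] f(2) by auto
  qed
  hence lim: "(\<lambda>i. emeasure \<mu> (D i)) \<longlonglongrightarrow> 0" using Lim_emeasure_decseq[of D \<mu>] D dec by auto
  have ge: "ennreal \<delta> * emeasure \<mu> T \<le> emeasure \<mu> (D i)" for i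
  proof -
    have "ennreal \<delta> * emeasure \<mu> T \<le> emeasure \<mu> ({\<sigma> \<in> Perms X. cut n (f i) \<sigma>} \<inter> T)"
      by (rule \<delta>2) (use f(2) in auto)
    also have "\<dots> \<le> emeasure \<mu> (D i)" using D by (intro emeasure_mono) (auto simp: D_def)
    finally show ?thesis .
  qed
  have "ennreal \<delta> * emeasure \<mu> T \<le> 0" by (rule LIMSEQ_le_const[OF lim]) (use ge in blast)
  hence "emeasure \<mu> T = 0" using \<delta> by simp
  hence "T \<in> null_sets \<mu>" using T G(1) by auto
  from AE_not_in[OF this] AE_space show ?thesis by eventually_elim (auto simp: T_def G(3))
qed

section \<open>Gibbs measures have finite flow\<close>

text \<open>For \<open>s = 1\<close>: the points left of \<open>x\<close> and of \<open>a\<close> whose image is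
  right of \<open>y\<close> and of \<open>a\<close>. If \<open>\<sigma> x = y\<close>, the jumps
  from these points are all crossed with the jump from \<open>x\<close>.\<close>

definition enclosing :: "real \<Rightarrow> real \<Rightarrow> real \<Rightarrow> real \<Rightarrow> (real \<Rightarrow> real) \<Rightarrow> real set" where
  "enclosing s a x y \<sigma> = {z \<in> X. s * z < s * x \<and> s * z < s * a \<and> s * y < s * \<sigma> z \<and> s * a < s * \<sigma> z}"

text \<open>Exchanging the target of \<open>x\<close> with that of an enclosing point \<open>z\<close> does not
  increase the energy. The pair \<open>(\<sigma>, z)\<close> is recovered from the result, because
  there \<open>z\<close> is the preimage of \<open>y\<close>. So \<open>m\<close> times the weight
  of the event is at most the partition function.\<close>

lemma gibbs_prob_enclosing_le:
  assumes "admissible \<Lambda> \<eta>" "s = 1 \<or> s = -1" "x \<in> \<Lambda>" "y \<in> \<Lambda>" "m > 0"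
  shows "gibbs_prob \<Lambda> \<eta> {\<sigma>. \<sigma> x = y \<and> m \<le> card {z\<in>\<Lambda>. z \<in> enclosing s a x y \<sigma> \<and> \<sigma> z \<in> \<Lambda>}} \<le> 1 / real m"
proof -
  have C: "\<eta> \<in> Perms X" "\<Lambda> \<subseteq> X" "finite \<Lambda>" using assms(1) by (auto simp: admissible_def)
  let ?N = "\<lambda>\<sigma>. {z\<in>\<Lambda>. z \<in> enclosing s a x y \<sigma> \<and> \<sigma> z \<in> \<Lambda>}"
  let ?A = "resample X \<Lambda> \<eta> \<inter> {\<sigma>. \<sigma> x = y \<and> m \<le> card (?N \<sigma>)}"
  let ?h = "\<lambda>(\<sigma>, z). \<sigma> \<circ> swap x z"
  let ?D = "Sigma ?A ?N"
  have fA: "finite ?A" using fin_resample[OF assms(1)] by simp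
  have fN: "finite (?N \<sigma>)" for \<sigma> using C(3) by simp
  have key: "?h (\<sigma>, z) \<in> resample X \<Lambda> \<eta> \<and> weight \<Lambda> \<sigma> \<le> weight \<Lambda> (?h (\<sigma>, z))" if "\<sigma> \<in> ?A" "z \<in> ?N \<sigma>" for \<sigma> z
  proof -
    have sA: "\<sigma> \<in> resample X \<Lambda> \<eta>" using that by simp
    have fl: "x \<in> movable \<Lambda> \<eta>" "z \<in> movable \<Lambda> \<eta>"
      unfolding resample_movable[OF sA C(1,2), symmetric] using that assms(3,4) by (auto simp: movable_def)
    show ?thesis
    proof (cases "s = 1")
      case True
      hence "z < x" "\<sigma> x < \<sigma> z" using that by (auto simp: enclosing_def)
      from swap_lowers[OF assms(1) sA fl(2,1) this] show ?thesis
        by (simp add: weight_def transpose_commute)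
    next
      case False
      hence "x < z" "\<sigma> z < \<sigma> x" using that assms(2) by (auto simp: enclosing_def)
      from swap_lowers[OF assms(1) sA fl this] show ?thesis by (simp add: weight_def)
    qed
  qed
  have inj: "inj_on ?h ?D"
  proof (rule inj_onI)
    fix p q assume pq: "p \<in> ?D" "q \<in> ?D" "?h p = ?h q"
    obtain \<sigma> z \<tau> w where e: "p = (\<sigma>, z)" "q = (\<tau>, w)" by force
    have st: "\<sigma> x = y" "\<tau> x = y" "inj \<sigma>" "inj \<tau>" "\<sigma> \<circ> swap x z = \<tau> \<circ> swap x w"
      using pq unfolding e by (auto intro: Perms_inj resample_Perms)
    have "\<tau> (swap x w z) = \<sigma> (swap x z z)" using fun_cong[OF st(5), of z] by simp
    also have "\<dots> = \<tau> x" using st by simp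
    finally have "swap x w z = x" by (rule injD[OF st(4)])
    hence zw: "z = w" by (metis transpose_apply_first transpose_involutory)
    have "\<sigma> \<circ> swap x z \<circ> swap x z = \<tau> \<circ> swap x z \<circ> swap x z"
      using st(5) zw by simp
    hence "\<sigma> = \<tau>" by (simp add: comp_assoc)
    thus "p = q" using zw e by simp
  qed
  have "real m * (\<Sum>\<sigma>\<in>?A. weight \<Lambda> \<sigma>) \<le> (\<Sum>\<sigma>\<in>?A. \<Sum>z\<in>?N \<sigma>. weight \<Lambda> \<sigma>)"
    unfolding sum_distrib_left using weight_pos by (intro sum_mono) (auto intro!: mult_right_mono less_imp_le)
  also have "\<dots> \<le> (\<Sum>\<sigma>\<in>?A. \<Sum>z\<in>?N \<sigma>. weight \<Lambda> (?h (\<sigma>, z)))" using key by (intro sum_mono) blast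
  also have "\<dots> = (\<Sum>p\<in>?D. weight \<Lambda> (?h p))" using fA fN by (subst sum.Sigma) (auto simp: split_def)
  also have "\<dots> = (\<Sum>\<tau>\<in>?h ` ?D. weight \<Lambda> \<tau>)" by (subst sum.reindex[OF inj]) simp
  also have "\<dots> \<le> (\<Sum>\<tau>\<in>resample X \<Lambda> \<eta>. weight \<Lambda> \<tau>)"
  proof (rule sum_mono2[OF fin_resample[OF assms(1)]])
    show "?h ` ?D \<subseteq> resample X \<Lambda> \<eta>"
    proof
      fix \<tau> assume "\<tau> \<in> ?h ` ?D"
      then obtain \<sigma> z where "\<tau> = ?h (\<sigma>, z)" "\<sigma> \<in> ?A" "z \<in> ?N \<sigma>" by blast
      thus "\<tau> \<in> resample X \<Lambda> \<eta>" using key by blast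
    qed
  qed (use weight_pos in \<open>auto intro: less_imp_le\<close>)
  finally show ?thesis using Z_pos[OF assms(1)] assms(5) unfolding gibbs_prob_def by (simp add: field_simps)
qed

text \<open>The count inside the box \<open>Box k\<close> increases with \<open>k\<close>, so the bound \<open>1
  / m\<close> survives the limit, for every \<open>m\<close>.\<close>

lemma enclosing_null:
  assumes "\<mu> \<in> gibbs X V" "s = 1 \<or> s = -1" "x \<in> X" "y \<in> X"
  shows "AE \<sigma> in \<mu>. \<sigma> x = y \<longrightarrow> finite (enclosing s a x y \<sigma>)"
proof -
  note G = gibbsD[OF assms(1)]
  interpret prob_space \<mu> by (rule G(2))
  define E where "E m k = {\<sigma> \<in> Perms X. \<sigma> x = y \<and> x \<in> Box k \<and> y \<in> Box k \<and> m \<le> card {z\<in>Box k. z \<in> enclosing s a x y \<sigma> \<and> \<sigma> z \<in> Box k}}" for m k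
  have Em: "E m k \<in> sets (perm_borel X)" for m k
  proof -
    let ?P = "\<lambda>z u. z \<in> X \<and> s * z < s * x \<and> s * z < s * a \<and> s * y < s * u \<and> s * a < s * u \<and> u \<in> Box k"
    have "Measurable.pred (perm_borel X) (\<lambda>\<sigma>. \<sigma> x = y \<and> x \<in> Box k \<and> y \<in> Box k \<and> 
      real m \<le> (\<Sum>z\<in>Box k. if ?P z (\<sigma> z) then 1 else 0))"
    proof (intro pred_intros_logic)
      show "Measurable.pred (perm_borel X) (\<lambda>\<sigma>. \<sigma> x = y)" using pred_eval[of "\<lambda>u. u = y" x] .
      have "(\<lambda>\<sigma>. \<Sum>z\<in>Box k. if ?P z (\<sigma> z) then 1 else (0::real)) \<in> borel_measurable (perm_borel X)"
        by (intro borel_measurable_sum borel_eval)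
      thus "Measurable.pred (perm_borel X) (\<lambda>\<sigma>. real m \<le> (\<Sum>z\<in>Box k. if ?P z (\<sigma> z) then 1 else 0))" by measurable
    qed auto
    moreover have "(\<Sum>z\<in>Box k. if ?P z (\<sigma> z) then 1 else 0) = real (card {z\<in>Box k. z \<in> enclosing s a x y \<sigma> \<and> \<sigma> z \<in> Box k})" for \<sigma>
      using Box(1)[of k] by (simp add: sum.If_cases enclosing_def Int_def conj_ac)
    ultimately show ?thesis unfolding E_def pred_def by simp
  qed
  have le: "emeasure \<mu> (E m k) \<le> ennreal (1 / real m)" if "m > 0" for m k
  proof -
    have "emeasure \<mu> (E m k) = (\<integral>\<^sup>+\<eta>. ennreal (gibbs_prob (Box k) \<eta> (E m k)) \<partial>\<mu>)"
      using G(4)[OF Em Box(1,2)] by simp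
    also have "\<dots> \<le> (\<integral>\<^sup>+\<eta>. ennreal (1 / real m) \<partial>\<mu>)"
    proof (rule nn_integral_mono)
      fix \<eta> assume "\<eta> \<in> space \<mu>"
      hence c: "admissible (Box k) \<eta>" using G(3) Box by (simp add: admissible_def)
      show "ennreal (gibbs_prob (Box k) \<eta> (E m k)) \<le> ennreal (1 / real m)"
      proof (cases "x \<in> Box k \<and> y \<in> Box k")
        case True
        have "gibbs_prob (Box k) \<eta> (E m k) \<le> gibbs_prob (Box k) \<eta> {\<sigma>. \<sigma> x = y \<and> m \<le> card {z\<in>Box k. z \<in> enclosing s a x y \<sigma> \<and> \<sigma> z \<in> Box k}}"
          by (rule gibbs_prob_mono[OF c]) (auto simp: E_def)
        also have "\<dots> \<le> 1 / real m" by (rule gibbs_prob_enclosing_le[OF c assms(2) _ _ that]) (use True in auto)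
        finally show ?thesis by (rule ennreal_leI)
      next
        case False
        hence "E m k = {}" by (auto simp: E_def)
        thus ?thesis by (simp add: gibbs_prob_def)
      qed
    qed
    also have "\<dots> = ennreal (1 / real m)" using emeasure_space_1 by simp
    finally show ?thesis .
  qed
  have mono: "incseq (E m)" for m
  proof (rule monoI)
    fix k l :: nat assume "k \<le> l"
    hence B: "Box k \<subseteq> Box l" using Box(3) by (auto simp: incseq_def)
    show "E m k \<subseteq> E m l"
    proof
      fix \<sigma> assume s: "\<sigma> \<in> E m k"
      have "card {z\<in>Box k. z \<in> enclosing s a x y \<sigma> \<and> \<sigma> z \<in> Box k} \<le> card {z\<in>Box l. z \<in> enclosing s a x y \<sigma> \<and> \<sigma> z \<in> Box l}"
        by (rule card_mono) (use Box(1)[of l] B in auto)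
      thus "\<sigma> \<in> E m l" using s B unfolding E_def by auto
    qed
  qed
  define U where "U m = (\<Union>k. E m k)" for m
  have U: "U m \<in> sets \<mu>" for m unfolding U_def G(1) using Em by auto
  have leU: "emeasure \<mu> (U m) \<le> ennreal (1 / real m)" if "m > 0" for m
  proof -
    have "(\<lambda>k. emeasure \<mu> (E m k)) \<longlonglongrightarrow> emeasure \<mu> (U m)"
      unfolding U_def by (rule Lim_emeasure_incseq) (use Em G(1) mono in auto)
    thus ?thesis by (rule LIMSEQ_le_const2) (use le[OF that] in blast)
  qed
  define N where "N = (\<Inter>m. U (Suc m))"
  have N: "N \<in> sets \<mu>" unfolding N_def using U by auto
  have "emeasure \<mu> N \<le> 0"
  proof (rule LIMSEQ_le_const)
    have "(\<lambda>m. ennreal (1 / real (Suc m))) \<longlonglongrightarrow> ennreal 0"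
      using LIMSEQ_inverse_real_of_nat by (intro tendsto_ennrealI) (simp add: inverse_eq_divide)
    thus "(\<lambda>m. ennreal (1 / real (Suc m))) \<longlonglongrightarrow> 0" by simp
    show "\<exists>M. \<forall>m\<ge>M. emeasure \<mu> N \<le> ennreal (1 / real (Suc m))"
    proof (intro exI allI impI)
      fix m
      have "emeasure \<mu> N \<le> emeasure \<mu> (U (Suc m))" by (rule emeasure_mono) (use U in \<open>auto simp: N_def\<close>)
      also have "\<dots> \<le> ennreal (1 / real (Suc m))" by (rule leU) simp
      finally show "emeasure \<mu> N \<le> ennreal (1 / real (Suc m))" .
    qed
  qed
  hence Nn: "N \<in> null_sets \<mu>" using N by auto
  have sub: "\<sigma> \<in> N" if s: "\<sigma> \<in> Perms X" "\<sigma> x = y" "infinite (enclosing s a x y \<sigma>)" for \<sigma>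
  proof -
    have "\<sigma> \<in> U m" for m
    proof -
      obtain F where F: "F \<subseteq> enclosing s a x y \<sigma>" "finite F" "card F = m" using infinite_arbitrarily_large[OF s(3)] by metis
      have FX: "F \<subseteq> X" using F by (auto simp: enclosing_def)
      have "eventually (\<lambda>k. insert x (insert y (F \<union> \<sigma> ` F)) \<subseteq> Box k) sequentially"
        by (rule eventually_superset[OF Box(3)]) (use F FX Box(4) assms(3,4) Perms_mem[OF s(1)] in auto)
      then obtain k where k: "insert x (insert y (F \<union> \<sigma> ` F)) \<subseteq> Box k" using eventually_happens' sequentially_bot by blast
      have "m \<le> card {z\<in>Box k. z \<in> enclosing s a x y \<sigma> \<and> \<sigma> z \<in> Box k}"
        unfolding F(3)[symmetric] by (rule card_mono) (use Box(1)[of k] F k in auto)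
      hence "\<sigma> \<in> E m k" using s k by (auto simp: E_def)
      thus ?thesis by (auto simp: U_def)
    qed
    thus ?thesis by (auto simp: N_def)
  qed
  show ?thesis by (rule AE_I[OF _ null_setsD1[OF Nn] null_setsD2[OF Nn]]) (use sub G(3) in auto)
qed

text \<open>Fix one point \<open>x\<close>. All but finitely many of the jumps across \<open>a\<close> enclose
  the jump from \<open>x\<close>, in one of the two directions.\<close>

lemma gibbs_flow_finite:
  assumes "\<mu> \<in> gibbs X V" shows "AE \<sigma> in \<mu>. \<exists>n. flow X \<sigma> = Fin n"
proof -
  note G = gibbsD[OF assms(1)]
  obtain a where a: "a \<in> midpoints X" using ex_midpoint by blast
  have an: "a \<notin> X" using midpoint_notin[OF a] .
  obtain x where x: "x \<in> X" using ex_gt by blast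
  have "AE \<sigma> in \<mu>. \<forall>y\<in>X. \<sigma> x = y \<longrightarrow> finite (enclosing s a x y \<sigma>)" if "s = 1 \<or> s = -1" for s
    unfolding AE_ball_countable[OF countable_X] using enclosing_null[OF assms that x] by blast
  from this[of 1] this[of "-1"]
  have "AE \<sigma> in \<mu>. (\<forall>y\<in>X. \<sigma> x = y \<longrightarrow> finite (enclosing 1 a x y \<sigma>)) \<and> (\<forall>y\<in>X. \<sigma> x = y \<longrightarrow> finite (enclosing (-1) a x y \<sigma>)) \<and> \<sigma> \<in> Perms X"
    using AE_space[of \<mu>] unfolding G(3) by auto
  thus ?thesis
  proof eventually_elim
    case (elim \<sigma>)
    hence s: "\<sigma> \<in> Perms X" by (elim conjE)
    define y where "y = \<sigma> x"
    have yX: "y \<in> X" using Perms_mem[OF s] x by (simp add: y_def)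
    have f: "finite (enclosing 1 a x y \<sigma>)" "finite (enclosing (-1) a x y \<sigma>)" using elim yX by (auto simp: y_def)
    define l r where "l = min a (min x y)" and "r = max a (max x y)"
    \<comment> \<open>A jump across \<open>a\<close> with no end between \<open>l\<close> and \<open>r\<close> passes over
      the whole interval, hence over \<open>x\<close> and \<open>y\<close>.\<close>
    have lr: "l \<le> a" "l \<le> x" "l \<le> y" "a \<le> r" "x \<le> r" "y \<le> r" by (auto simp: l_def r_def)
    define B where "B = X \<inter> {l..r}"
    have B: "finite B" unfolding B_def by (rule finite_Icc)
    have vB: "finite (\<sigma> -` B)" using B Perms_inj[OF s] by (rule finite_vimageI)
    have "crossers X a \<sigma> \<subseteq> enclosing 1 a x y \<sigma> \<union> enclosing (-1) a x y \<sigma> \<union> B \<union> \<sigma> -` B"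
    proof
      fix z assume z: "z \<in> crossers X a \<sigma>"
      hence zX: "z \<in> X" "\<sigma> z \<in> X" using Perms_mem[OF s] by (auto simp: crossers_def)
      show "z \<in> enclosing 1 a x y \<sigma> \<union> enclosing (-1) a x y \<sigma> \<union> B \<union> \<sigma> -` B"
      proof (cases "z \<in> B \<or> \<sigma> z \<in> B")
        case False
        hence "z < l \<or> r < z" "\<sigma> z < l \<or> r < \<sigma> z" using zX by (auto simp: B_def)
        moreover have "z < a \<and> a < \<sigma> z \<or> \<sigma> z < a \<and> a < z" using z by (simp add: crossers_def crosses_def)
        ultimately have "z < l \<and> r < \<sigma> z \<or> \<sigma> z < l \<and> r < z" using lr by linarith
        hence "z \<in> enclosing 1 a x y \<sigma> \<or> z \<in> enclosing (-1) a x y \<sigma>"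
        proof (elim disjE conjE)
          assume "z < l" "r < \<sigma> z"
          thus ?thesis unfolding enclosing_def using zX lr by (intro disjI1) simp
        next
          assume "\<sigma> z < l" "r < z"
          thus ?thesis unfolding enclosing_def using zX lr by (intro disjI2) simp
        qed
        thus ?thesis by blast
      qed auto
    qed
    hence "finite (crossers X a \<sigma>)" using f B vB by (meson finite_UnI finite_subset)
    thus ?case using flow_cases[OF s a] by simp
  qed
qed

end

section \<open>Infinite cycles\<close>

context point_set
begin

text \<open>Iteration with integer exponents, which turns the cycles of \<open>\<sigma>\<close> into the orbits
  of an action of the integers.\<close>

definition ipow :: "(real \<Rightarrow> real) \<Rightarrow> int \<Rightarrow> real \<Rightarrow> real" where
  "ipow \<sigma> k x = (if k \<ge> 0 then (\<sigma> ^^ nat k) x else (inv \<sigma> ^^ nat (- k)) x)"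

lemma full_orbit_ipow: "full_orbit \<sigma> x = range (\<lambda>k. ipow \<sigma> k x)"
proof (intro equalityI subsetI)
  fix y assume "y \<in> full_orbit \<sigma> x"
  then consider k where "y = (\<sigma> ^^ k) x" | k where "y = (inv \<sigma> ^^ k) x" by (auto simp: full_orbit_def)
  thus "y \<in> range (\<lambda>k. ipow \<sigma> k x)"
  proof cases
    case (1 k)
    thus ?thesis by (intro range_eqI[of _ _ "int k"]) (simp add: ipow_def)
  next
    case (2 k)
    thus ?thesis by (intro range_eqI[of _ _ "- int k"]) (auto simp: ipow_def)
  qed
next
  fix y assume "y \<in> range (\<lambda>k. ipow \<sigma> k x)"
  thus "y \<in> full_orbit \<sigma> x" by (auto simp: full_orbit_def ipow_def)
qed

lemma ipow_0 [simp]: "ipow \<sigma> 0 x = x" by (simp add: ipow_def)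

lemma ipow_Suc: assumes "\<sigma> \<in> Perms X" shows "ipow \<sigma> (k + 1) x = \<sigma> (ipow \<sigma> k x)"
proof (cases "k \<ge> 0")
  case True
  hence "nat (k + 1) = Suc (nat k)" by simp
  thus ?thesis using True by (simp add: ipow_def)
next
  case False
  then obtain m where m: "k = - int (Suc m)" by (metis int_cases3 neg_0_le_iff_le nat_int not_le of_nat_0_le_iff negD add.commute of_nat_Suc)
  have "\<sigma> ((inv \<sigma> ^^ Suc m) x) = (inv \<sigma> ^^ m) x" by (simp add: Perms_inv_r[OF assms])
  thus ?thesis unfolding m by (cases m) (simp_all add: ipow_def nat_add_distrib)
qed

lemma ipow_add: assumes "\<sigma> \<in> Perms X" shows "ipow \<sigma> (j + k) x = ipow \<sigma> j (ipow \<sigma> k x)"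
proof (induction j rule: int_induct[where k=0])
  case base thus ?case by simp
next
  case (step1 i)
  thus ?case using ipow_Suc[OF assms, of "i + k"] ipow_Suc[OF assms, of i] by (simp add: algebra_simps)
next
  case (step2 i)
  have "\<sigma> (ipow \<sigma> (i - 1 + k) x) = ipow \<sigma> (i + k) x" using ipow_Suc[OF assms, of "i - 1 + k"] by (simp add: algebra_simps)
  also have "\<dots> = \<sigma> (ipow \<sigma> (i - 1) (ipow \<sigma> k x))" using step2 ipow_Suc[OF assms, of "i - 1"] by simp
  finally show ?case using Perms_inj[OF assms] by (simp add: inj_eq)
qed

lemma ipow_mem: assumes "\<sigma> \<in> Perms X" "x \<in> X" shows "ipow \<sigma> k x \<in> X"
proof (induction k rule: int_induct[where k=0])
  case base thus ?case using assms by simp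
next
  case (step1 i) thus ?case using ipow_Suc[OF assms(1)] Perms_mem[OF assms(1)] by simp
next
  case (step2 i)
  thus ?case using ipow_Suc[OF assms(1), of "i - 1"] Perms_mem[OF assms(1)] by simp
qed

lemma full_orbit_eq:
  assumes "\<sigma> \<in> Perms X" "y \<in> full_orbit \<sigma> x" shows "full_orbit \<sigma> y = full_orbit \<sigma> x"
proof -
  obtain k where k: "y = ipow \<sigma> k x" using assms(2) unfolding full_orbit_ipow by auto
  have e: "ipow \<sigma> j y = ipow \<sigma> (j + k) x" for j unfolding k ipow_add[OF assms(1)] ..
  show ?thesis unfolding full_orbit_ipow
  proof (intro equalityI subsetI)
    fix z assume "z \<in> range (\<lambda>j. ipow \<sigma> j y)"
    thus "z \<in> range (\<lambda>j. ipow \<sigma> j x)" using e by auto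
  next
    fix z assume "z \<in> range (\<lambda>j. ipow \<sigma> j x)"
    then obtain j where "z = ipow \<sigma> j x" by auto
    hence "z = ipow \<sigma> (j - k) y" using e[of "j - k"] by simp
    thus "z \<in> range (\<lambda>j. ipow \<sigma> j y)" by simp
  qed
qed

lemma full_orbit_inv: "\<sigma> \<in> Perms X \<Longrightarrow> full_orbit (inv \<sigma>) x = full_orbit \<sigma> x"
  by (auto simp: full_orbit_def Perms_inv_inv)

lemma infinite_cycles_inv: "\<sigma> \<in> Perms X \<Longrightarrow> infinite_cycles X (inv \<sigma>) = infinite_cycles X \<sigma>"
  by (simp add: infinite_cycles_def full_orbit_inv)

text \<open>No jump crosses a point of \<open>S\<close> from right to left, so an orbit that has passed such a
  point never returns. Hence a cycle that uses a crossing jump at \<open>a\<close> is infinite and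
  uses no other one. Conversely an infinite orbit stays right of some point of \<open>S\<close> in
  the future and left of some point of \<open>S\<close> in the past; by local finiteness it is
  unbounded in both directions and must cross \<open>a\<close>.\<close>

lemma cycles_through_cut:
  assumes s: "\<sigma> \<in> Perms X" and n0: "\<And>b x. b \<in> S \<Longrightarrow> x \<in> X \<Longrightarrow> b < x \<Longrightarrow> b < \<sigma> x"
    and S: "\<not> bdd_above S" "\<not> bdd_below S" "S \<inter> X = {}" and a: "a \<in> S"
  shows "bij_betw (full_orbit \<sigma>) {x \<in> X. x < a \<and> a < \<sigma> x} (infinite_cycles X \<sigma>)"
proof -
  have fwd: "b < ipow \<sigma> (k + int j) x" if "b \<in> S" "x \<in> X" "b < ipow \<sigma> k x" for b x k j
  proof (induction j)
    case (Suc j)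
    have "b < \<sigma> (ipow \<sigma> (k + int j) x)" by (rule n0[OF that(1) ipow_mem[OF s that(2)] Suc])
    thus ?case using ipow_Suc[OF s, of "k + int j" x] by (simp add: algebra_simps)
  qed (use that in simp)
  have fwd': "b < ipow \<sigma> l x" if "b \<in> S" "x \<in> X" "b < ipow \<sigma> k x" "k \<le> l" for b x k l
    using fwd[OF that(1-3), of "nat (l - k)"] that(4) by simp
  have nS: "ipow \<sigma> k x \<noteq> b" if "b \<in> S" "x \<in> X" for b x k using ipow_mem[OF s that(2), of k] S(3) that(1) by auto
  let ?A = "{x \<in> X. x < a \<and> a < \<sigma> x}"
  \<comment> \<open>An orbit uses at most one crossing jump at \<open>a\<close>, since after it the orbit stays on the
    right.\<close>
  have crossing_unique: "k = 0" if x: "x \<in> ?A" "ipow \<sigma> k x \<in> ?A" for x k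
  proof (rule ccontr)
    assume "k \<noteq> 0"
    have xX: "x \<in> X" using x by simp
    have 1: "a < ipow \<sigma> 1 x" using x ipow_Suc[OF s, of 0 x] by simp
    have 2: "a < ipow \<sigma> (k + 1) x" using x ipow_Suc[OF s, of k x] by simp
    show False
    proof (cases "k > 0")
      case True thus False using fwd'[OF a xX 1, of k] x by simp
    next
      case False thus False using fwd'[OF a xX 2, of 0] x \<open>k \<noteq> 0\<close> by simp
    qed
  qed
  have inf: "infinite (full_orbit \<sigma> x)" if x: "x \<in> ?A" for x
  proof
    assume "finite (full_orbit \<sigma> x)"
    hence "\<not> inj (\<lambda>k. ipow \<sigma> k x)" unfolding full_orbit_ipow using finite_imageD infinite_UNIV_int by blast
    then obtain i j where ij: "ipow \<sigma> i x = ipow \<sigma> j x" "i < j" by (metis injI linorder_neqE)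
    have "ipow \<sigma> (j - i) x = ipow \<sigma> (- i) (ipow \<sigma> j x)" using ipow_add[OF s, of "- i" j x] by simp
    also have "\<dots> = x" unfolding ij(1)[symmetric] ipow_add[OF s, symmetric] by simp
    finally show False using crossing_unique[OF x, of "j - i"] x ij(2) by simp
  qed
  have through: "\<exists>y\<in>?A. y \<in> full_orbit \<sigma> x" if x: "x \<in> X" "infinite (full_orbit \<sigma> x)" for x
  proof -
    have inj: "inj (\<lambda>k. ipow \<sigma> k x)"
    proof (rule ccontr)
      assume "\<not> ?thesis"
      then obtain i j where ij: "ipow \<sigma> i x = ipow \<sigma> j x" "i < j" by (metis injI linorder_neqE)
      define p where "p = j - i"
      have p: "p > 0" "ipow \<sigma> (k + p) x = ipow \<sigma> k x" for k
      proof -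
        show "p > 0" using ij by (simp add: p_def)
        have "ipow \<sigma> (k + p) x = ipow \<sigma> (k - i) (ipow \<sigma> j x)" 
          unfolding ipow_add[OF s, symmetric] by (simp add: p_def algebra_simps)
        also have "\<dots> = ipow \<sigma> k x" unfolding ij(1)[symmetric] ipow_add[OF s, symmetric] by simp
        finally show "ipow \<sigma> (k + p) x = ipow \<sigma> k x" .
      qed
      have pm: "ipow \<sigma> (k + p * m) x = ipow \<sigma> k x" for k m
      proof (induction m rule: int_induct[where k=0])
        case (step1 m) thus ?case using p(2)[of "k + p * m"] by (simp add: algebra_simps)
      next
        case (step2 m) thus ?case using p(2)[of "k + p * (m - 1)"] by (simp add: algebra_simps)
      qed simp
      have "full_orbit \<sigma> x \<subseteq> (\<lambda>k. ipow \<sigma> k x) ` {0..<p}"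
      proof
        fix y assume "y \<in> full_orbit \<sigma> x"
        then obtain k where k: "y = ipow \<sigma> k x" unfolding full_orbit_ipow by auto
        have "y = ipow \<sigma> (k mod p) x" using pm[of "k mod p" "k div p"] unfolding k by simp
        thus "y \<in> (\<lambda>k. ipow \<sigma> k x) ` {0..<p}" using p(1) by auto
      qed
      hence "finite (full_orbit \<sigma> x)" by (rule finite_subset) simp
      thus False using x(2) by simp
    qed
    obtain b where b: "b \<in> S" "b < x" using S(2) unfolding bdd_below_def by (metis not_le)
    obtain d where d: "d \<in> S" "x < d" using S(1) unfolding bdd_above_def by (metis not_le)
    \<comment> \<open>The future of the orbit never falls below \<open>b\<close>, so it would be finite if it stayed below
      \<open>a\<close>.\<close>
    have "\<exists>k\<ge>0. a < ipow \<sigma> k x"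
    proof (rule ccontr)
      assume n: "\<not> ?thesis"
      have "(\<lambda>k. ipow \<sigma> k x) ` {0..} \<subseteq> X \<inter> {b..a}"
        using fwd'[OF b(1) x(1), of 0] b(2) n ipow_mem[OF s x(1)] by (force simp: not_less)
      hence "finite ((\<lambda>k. ipow \<sigma> k x) ` {0..})" using finite_Icc finite_subset by blast
      hence "finite {0::int..}" using inj by (meson finite_imageD inj_on_subset subset_UNIV)
      thus False using infinite_Ici by blast
    qed
    then obtain k where k: "a < ipow \<sigma> k x" by blast
    \<comment> \<open>The past of the orbit never exceeds \<open>d\<close>, since otherwise \<open>x\<close> would also
      lie beyond \<open>d\<close>.\<close>
    have "\<exists>l\<le>0. ipow \<sigma> l x < a"
    proof (rule ccontr)
      assume n: "\<not> ?thesis"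
      have "(\<lambda>k. ipow \<sigma> k x) ` {..0} \<subseteq> X \<inter> {a..d}"
      proof
        fix y assume "y \<in> (\<lambda>k. ipow \<sigma> k x) ` {..0}"
        then obtain l where l: "y = ipow \<sigma> l x" "l \<le> 0" by auto
        have "\<not> d < ipow \<sigma> l x" using fwd'[OF d(1) x(1) _ l(2)] d(2) by fastforce
        thus "y \<in> X \<inter> {a..d}" using n l ipow_mem[OF s x(1)] by (auto simp: not_less)
      qed
      hence "finite ((\<lambda>k. ipow \<sigma> k x) ` {..0})" using finite_Icc finite_subset by blast
      hence "finite {..0::int}" using inj by (meson finite_imageD inj_on_subset subset_UNIV)
      thus False using infinite_Iic by blast
    qed
    then obtain l where l: "ipow \<sigma> l x < a" by blast
    have lk: "l < k"
    proof (rule ccontr)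
      assume "\<not> l < k"
      thus False using fwd'[OF a x(1) k, of l] l by simp
    qed
    have "\<exists>m. ipow \<sigma> m x < a \<and> a < ipow \<sigma> (m + 1) x"
    proof (rule ccontr)
      assume n: "\<not> ?thesis"
      have "ipow \<sigma> m x < a" if "l \<le> m" for m
        using that
      proof (induction m rule: int_ge_induct)
        case (step i)
        thus ?case using n nS[OF a x(1), of "i + 1"] by (metis linorder_neqE)
      qed (use l in simp)
      from this[of k] k lk show False by simp
    qed
    then obtain m where m: "ipow \<sigma> m x < a" "a < ipow \<sigma> (m + 1) x" by blast
    have "ipow \<sigma> m x \<in> ?A" using m ipow_Suc[OF s] ipow_mem[OF s x(1)] by simp
    thus ?thesis unfolding full_orbit_ipow by blast
  qed
  have refl: "x \<in> full_orbit \<sigma> x" for x by (auto simp: full_orbit_def intro!: exI[of _ 0])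
  show ?thesis unfolding bij_betw_def
  proof (intro conjI inj_onI equalityI subsetI)
    fix x y assume xy: "x \<in> ?A" "y \<in> ?A" "full_orbit \<sigma> x = full_orbit \<sigma> y"
    then obtain k where k: "y = ipow \<sigma> k x" using refl[of y] unfolding full_orbit_ipow by auto
    have "k = 0" using crossing_unique[OF xy(1), of k] xy(2) k by simp
    thus "x = y" using k by simp
  next
    fix C assume "C \<in> full_orbit \<sigma> ` ?A"
    thus "C \<in> infinite_cycles X \<sigma>" using inf by (auto simp: infinite_cycles_def)
  next
    fix C assume "C \<in> infinite_cycles X \<sigma>"
    then obtain x where x: "x \<in> X" "C = full_orbit \<sigma> x" "infinite (full_orbit \<sigma> x)" by (auto simp: infinite_cycles_def)
    obtain y where "y \<in> ?A" "y \<in> full_orbit \<sigma> x" using through[OF x(1,3)] by blast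
    thus "C \<in> full_orbit \<sigma> ` ?A" using full_orbit_eq[OF s] x(2) by blast
  qed
qed

lemma theta_crossing:
  assumes "n \<ge> 0" shows "{x \<in> X. x < mid i \<and> mid i < theta n x} = pt ` {i - n + 1..i}"
    "\<And>x. x \<in> X \<Longrightarrow> mid i < x \<Longrightarrow> mid i < theta n x"
proof -
  show "{x \<in> X. x < mid i \<and> mid i < theta n x} = pt ` {i - n + 1..i}"
    by (auto simp: in_X_iff pt_less_mid_iff mid_less_pt_iff)
  fix x assume "x \<in> X" "mid i < x"
  thus "mid i < theta n x" using assms by (auto simp: in_X_iff mid_less_pt_iff)
qed

lemma cut_crossing:
  assumes "cut n (mid i) \<sigma>" "n \<ge> 0" "\<sigma> \<in> Perms X"
  shows "{x \<in> X. x < mid i \<and> mid i < \<sigma> x} = pt ` {i - n + 1..i}"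
    "\<And>x. x \<in> X \<Longrightarrow> mid i < x \<Longrightarrow> mid i < \<sigma> x"
proof -
  have c: "\<sigma> x = theta n x" if "x \<in> X" "crosses (mid i) x (\<sigma> x) \<or> crosses (mid i) x (theta n x)" for x
    using assms(1) that unfolding cut_def by blast
  have "{x \<in> X. x < mid i \<and> mid i < \<sigma> x} = {x \<in> X. x < mid i \<and> mid i < theta n x}"
  proof (rule Collect_cong, rule conj_cong[OF refl], rule conj_cong[OF refl])
    fix x assume "x \<in> X" "x < mid i"
    thus "mid i < \<sigma> x \<longleftrightarrow> mid i < theta n x" using c[of x] unfolding crosses_def by auto
  qed
  thus "{x \<in> X. x < mid i \<and> mid i < \<sigma> x} = pt ` {i - n + 1..i}" using theta_crossing[OF assms(2)] by simp
  fix x assume x: "x \<in> X" "mid i < x"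
  show "mid i < \<sigma> x"
  proof (rule ccontr)
    assume n: "\<not> mid i < \<sigma> x"
    have "\<sigma> x \<noteq> mid i" 
    proof
      assume "\<sigma> x = mid i"
      moreover have "\<sigma> x \<in> X" using Perms_mem[OF assms(3)] x(1) by simp
      ultimately show False using midpoint_notin[of "mid i"] by (simp add: midpoints_eq)
    qed
    hence "\<sigma> x < mid i" using n by simp
    hence "\<sigma> x = theta n x" using c[OF x(1)] x by (simp add: crosses_def)
    thus False using theta_crossing(2)[OF assms(2) x] n by simp
  qed
qed

lemma cut_inv:
  assumes "\<sigma> \<in> Perms X" "cut n a \<sigma>" shows "cut (- n) a (inv \<sigma>)"
  unfolding cut_def
proof (intro ballI impI)
  fix y assume y: "y \<in> X" "crosses a y (inv \<sigma> y) \<or> crosses a y (theta (- n) y)"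
  have t: "theta n (theta (- n) y) = y" "theta (- n) (theta n x) = x" for x
    using Perms_inv_r[OF theta_Perms[of n]] Perms_inv_l[OF theta_Perms[of n]] unfolding inv_theta by auto
  show "inv \<sigma> y = theta (- n) y"
  proof (cases "crosses a y (inv \<sigma> y)")
    case True
    have "inv \<sigma> y \<in> X" using y Perms_mem[OF Perms_inv[OF assms(1)]] by simp
    moreover have "crosses a (inv \<sigma> y) (\<sigma> (inv \<sigma> y))" using True crosses_sym Perms_inv_r[OF assms(1)] by simp
    ultimately have "\<sigma> (inv \<sigma> y) = theta n (inv \<sigma> y)" using assms(2) unfolding cut_def by blast
    hence "y = theta n (inv \<sigma> y)" by (simp add: Perms_inv_r[OF assms(1)])
    thus ?thesis using t(2)[of "inv \<sigma> y"] by simp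
  next
    case False
    hence c: "crosses a (theta (- n) y) (theta n (theta (- n) y))" using y crosses_sym t(1) by simp
    have "theta (- n) y \<in> X" using y(1) Perms_mem[OF theta_Perms] by simp
    hence "\<sigma> (theta (- n) y) = y" using c assms(2) t(1) unfolding cut_def by metis
    thus ?thesis using Perms_inv_eq_iff[OF assms(1)] by simp
  qed
qed

text \<open>For \<open>n < 0\<close> pass to the inverse permutation, which has the same cycles.\<close>

lemma card_infinite_cycles:
  assumes "\<sigma> \<in> Perms X" "S \<subseteq> midpoints X" "\<not> bdd_above S" "\<not> bdd_below S" "\<And>a. a \<in> S \<Longrightarrow> cut n a \<sigma>"
  shows "finite (infinite_cycles X \<sigma>) \<and> card (infinite_cycles X \<sigma>) = nat \<bar>n\<bar>"
proof -
  have pos: "finite (infinite_cycles X \<sigma>) \<and> card (infinite_cycles X \<sigma>) = nat n"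
    if h: "\<sigma> \<in> Perms X" "\<And>a. a \<in> S \<Longrightarrow> cut n a \<sigma>" "n \<ge> 0" for \<sigma> n
  proof -
    obtain a where a: "a \<in> S" using assms(3) by (metis bdd_above_empty ex_in_conv)
    obtain i where i: "a = mid i" using a assms(2) unfolding midpoints_eq by auto
    have "bij_betw (full_orbit \<sigma>) {x \<in> X. x < a \<and> a < \<sigma> x} (infinite_cycles X \<sigma>)"
    proof (rule cycles_through_cut[OF h(1) _ assms(3,4) _ a])
      fix b x assume b: "b \<in> S" "x \<in> X" "b < x"
      obtain j where j: "b = mid j" using b(1) assms(2) unfolding midpoints_eq by auto
      show "b < \<sigma> x" using cut_crossing(2)[OF h(2)[OF b(1), unfolded j] h(3,1) b(2) b(3)[unfolded j]] j by simp
    qed (use assms(2) midpoint_notin in auto)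
    moreover have "{x \<in> X. x < a \<and> a < \<sigma> x} = pt ` {i - n + 1..i}"
      unfolding i by (rule cut_crossing(1)[OF h(2)[OF a, unfolded i] h(3,1)])
    ultimately have "bij_betw (full_orbit \<sigma>) (pt ` {i - n + 1..i}) (infinite_cycles X \<sigma>)" by simp
    from bij_betw_finite[OF this] bij_betw_same_card[OF this] show ?thesis unfolding card_pt_image by simp
  qed
  show ?thesis
  proof (cases "n \<ge> 0")
    case True thus ?thesis using pos[OF assms(1,5)] by simp
  next
    case False
    have "finite (infinite_cycles X (inv \<sigma>)) \<and> card (infinite_cycles X (inv \<sigma>)) = nat (- n)"
      by (rule pos[OF Perms_inv[OF assms(1)] cut_inv[OF assms(1,5)]]) (use False in auto)
    thus ?thesis using False infinite_cycles_inv[OF assms(1)] by simp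
  qed
qed

end

context permutation_gas
begin

lemma infinite_halves:
  assumes "bi_infinite {a. good_pt c n a}"
  shows "infinite {a. good_pt c n a \<and> a < M}" "infinite {a. good_pt c n a \<and> M < a}"
proof -
  show "infinite {a. good_pt c n a \<and> a < M}"
  proof
    assume "finite {a. good_pt c n a \<and> a < M}"
    hence "bdd_below ({a. good_pt c n a \<and> a < M} \<union> {M..})" by (intro bdd_below_finite[THEN bdd_below_Un[THEN iffD2, OF conjI]]) auto
    hence "bdd_below {a. good_pt c n a}" by (rule bdd_below_mono) auto
    thus False using assms by (simp add: bi_infinite_def)
  qed
  show "infinite {a. good_pt c n a \<and> M < a}"
  proof
    assume "finite {a. good_pt c n a \<and> M < a}"
    hence "bdd_above ({a. good_pt c n a \<and> M < a} \<union> {..M})" by (intro bdd_above_finite[THEN bdd_above_Un[THEN iffD2, OF conjI]]) auto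
    hence "bdd_above {a. good_pt c n a}" by (rule bdd_above_mono) auto
    thus False using assms by (simp add: bi_infinite_def)
  qed
qed

lemma unbounded_of_infinite:
  assumes "S \<subseteq> midpoints X" "infinite {a\<in>S. a < 0}" "infinite {a\<in>S. 0 < a}"
  shows "\<not> bdd_above S" "\<not> bdd_below S"
proof -
  show "\<not> bdd_above S"
  proof
    assume "bdd_above S"
    then obtain M where "\<And>a. a \<in> S \<Longrightarrow> a \<le> M" by (auto simp: bdd_above_def)
    hence "{a\<in>S. 0 < a} \<subseteq> {a \<in> midpoints X. 0 \<le> a \<and> a \<le> M}" using assms(1) by auto
    thus False using assms(3) finite_midpoints finite_subset by blast
  qed
  show "\<not> bdd_below S"
  proof
    assume "bdd_below S"
    then obtain M where "\<And>a. a \<in> S \<Longrightarrow> M \<le> a" by (auto simp: bdd_below_def)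
    hence "{a\<in>S. a < 0} \<subseteq> {a \<in> midpoints X. M \<le> a \<and> a \<le> 0}" using assms(1) by auto
    thus False using assms(2) finite_midpoints finite_subset by blast
  qed
qed

lemma AE_infinite_cycles:
  assumes "\<mu> \<in> gibbs X V" "AE \<sigma> in \<mu>. flow X \<sigma> = Fin n" "c \<ge> 1" "bi_infinite {a. good_pt c n a}"
  shows "AE \<sigma> in \<mu>. finite (infinite_cycles X \<sigma>) \<and> card (infinite_cycles X \<sigma>) = nat \<bar>n\<bar>"
proof -
  note G = gibbsD[OF assms(1)]
  have "AE \<sigma> in \<mu>. flow X \<sigma> = Fin n \<longrightarrow> infinite {a\<in>{a. good_pt c n a \<and> a < 0}. cut n a \<sigma>}"
    by (rule infinitely_many_cuts[OF assms(1,3) _ infinite_halves(1)[OF assms(4)]]) auto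
  moreover have "AE \<sigma> in \<mu>. flow X \<sigma> = Fin n \<longrightarrow> infinite {a\<in>{a. good_pt c n a \<and> 0 < a}. cut n a \<sigma>}"
    by (rule infinitely_many_cuts[OF assms(1,3) _ infinite_halves(2)[OF assms(4)]]) auto
  ultimately show ?thesis using assms(2) AE_space
  proof eventually_elim
    case (elim \<sigma>)
    define S where "S = {a. good_pt c n a \<and> cut n a \<sigma>}"
    have s: "\<sigma> \<in> Perms X" using elim(4) unfolding G(3) .
    have e: "{a\<in>S. a < 0} = {a\<in>{a. good_pt c n a \<and> a < 0}. cut n a \<sigma>}"
      "{a\<in>S. 0 < a} = {a\<in>{a. good_pt c n a \<and> 0 < a}. cut n a \<sigma>}" by (auto simp: S_def)
    have Sm: "S \<subseteq> midpoints X" using good_ptD(1) by (auto simp: S_def)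
    have i: "infinite {a\<in>S. a < 0}" "infinite {a\<in>S. 0 < a}" unfolding e using elim(1-3) by blast+
    show ?case
      by (rule card_infinite_cycles[OF s Sm unbounded_of_infinite[OF Sm i]]) (simp add: S_def)
  qed
qed

section \<open>The law between two cuts\<close>

definition glue :: "real set \<Rightarrow> (real \<Rightarrow> real) \<Rightarrow> (real \<Rightarrow> real) \<Rightarrow> real \<Rightarrow> real" where
  "glue A \<sigma> \<eta> x = (if x \<in> A then \<sigma> x else \<eta> x)"

lemma glue_resample:
  assumes "admissible \<Lambda> \<eta>" "admissible \<Lambda> \<eta>'" "movable \<Lambda> \<eta>' = movable \<Lambda> \<eta>" "\<eta>' ` movable \<Lambda> \<eta> = \<eta> ` movable \<Lambda> \<eta>" "\<sigma> \<in> resample X \<Lambda> \<eta>"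
  shows "glue (movable \<Lambda> \<eta>) \<sigma> \<eta>' \<in> resample X \<Lambda> \<eta>'"
proof -
  let ?A = "movable \<Lambda> \<eta>"
  have C: "\<eta> \<in> Perms X" "\<eta>' \<in> Perms X" "\<Lambda> \<subseteq> X" using assms by (auto simp: admissible_def)
  have s: "\<sigma> \<in> Perms X" using assms(5) by (rule resample_Perms)
  define q where "q x = (if x \<in> ?A then inv \<eta>' (\<sigma> x) else x)" for x
  have "q permutes ?A"
  proof (rule bij_imp_permutes)
    have "bij_betw \<sigma> ?A (\<eta>' ` ?A)"
      using resample_movable_image[OF assms(5) C(1,3)] assms(4) Perms_inj[OF s]
      by (metis bij_betw_def inj_on_subset subset_UNIV)
    moreover have "bij_betw (inv \<eta>') (\<eta>' ` ?A) ?A"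
      using Perms_inv_l[OF C(2)] by (intro bij_betw_byWitness[where f'=\<eta>']) auto
    ultimately have "bij_betw (inv \<eta>' \<circ> \<sigma>) ?A ?A" by (rule bij_betw_trans)
    thus "bij_betw q ?A ?A" by (rule bij_betw_cong[THEN iffD1, rotated]) (simp add: q_def)
  qed (simp add: q_def)
  hence "\<eta>' \<circ> q \<in> resample X \<Lambda> \<eta>'" using resample_swap[OF resample_refl[OF C(2)] C(2,3)] assms(3) by simp
  moreover have "\<eta>' \<circ> q = glue ?A \<sigma> \<eta>'" by (auto simp: fun_eq_iff glue_def q_def Perms_inv_r[OF C(2)])
  ultimately show ?thesis by simp
qed

text \<open>Replacing the fixed part \<open>\<eta>\<close> of a configuration by \<open>\<eta>'\<close> is a
  bijection between the two sets of resamplings that preserves the weights, provided the movable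
  points and their targets are the same for \<open>\<eta>\<close> and \<open>\<eta>'\<close>.\<close>

lemma gibbs_prob_glue:
  assumes "admissible \<Lambda> \<eta>" "admissible \<Lambda> \<eta>'" "movable \<Lambda> \<eta>' = movable \<Lambda> \<eta>" "\<eta>' ` movable \<Lambda> \<eta> = \<eta> ` movable \<Lambda> \<eta>"
    "\<And>\<sigma> \<tau>. \<sigma> \<in> resample X \<Lambda> \<eta> \<Longrightarrow> \<tau> \<in> resample X \<Lambda> \<eta>' \<Longrightarrow> (\<And>x. x \<in> movable \<Lambda> \<eta> \<Longrightarrow> \<sigma> x = \<tau> x) \<Longrightarrow> \<sigma> \<in> E \<longleftrightarrow> \<tau> \<in> E"
  shows "gibbs_prob \<Lambda> \<eta> E = gibbs_prob \<Lambda> \<eta>' E"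
proof -
  let ?A = "movable \<Lambda> \<eta>"
  have C: "\<eta> \<in> Perms X" "\<eta>' \<in> Perms X" "\<Lambda> \<subseteq> X" using assms by (auto simp: admissible_def)
  have g1: "glue ?A \<sigma> \<eta>' \<in> resample X \<Lambda> \<eta>'" if "\<sigma> \<in> resample X \<Lambda> \<eta>" for \<sigma> by (rule glue_resample[OF assms(1-4) that])
  have g2: "glue ?A \<tau> \<eta> \<in> resample X \<Lambda> \<eta>" if "\<tau> \<in> resample X \<Lambda> \<eta>'" for \<tau>
    using glue_resample[OF assms(2,1) assms(3)[symmetric] _ that] assms(3,4) by simp
  have gg: "glue ?A (glue ?A \<sigma> \<eta>') \<eta> = \<sigma>" if "\<sigma> \<in> resample X \<Lambda> \<eta>" for \<sigma>
    using resample_iff[OF C(1,3)] that by (auto simp: glue_def fun_eq_iff)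
  have gg': "glue ?A (glue ?A \<tau> \<eta>) \<eta>' = \<tau>" if "\<tau> \<in> resample X \<Lambda> \<eta>'" for \<tau>
    using resample_iff[OF C(2,3)] that assms(3) by (auto simp: glue_def fun_eq_iff)
  have w: "weight \<Lambda> (glue ?A \<sigma> \<eta>') = weight \<Lambda> \<sigma>" if "\<sigma> \<in> resample X \<Lambda> \<eta>" for \<sigma>
    unfolding weight_def hamiltonian_movable resample_movable[OF that C(1,3)] resample_movable[OF g1[OF that] C(2,3)] assms(3)
    by (simp add: glue_def)
  have S: "(\<Sum>\<sigma>\<in>resample X \<Lambda> \<eta> \<inter> F. weight \<Lambda> \<sigma>) = (\<Sum>\<tau>\<in>resample X \<Lambda> \<eta>' \<inter> F. weight \<Lambda> \<tau>)"
    if F: "\<And>\<sigma> \<tau>. \<sigma> \<in> resample X \<Lambda> \<eta> \<Longrightarrow> \<tau> \<in> resample X \<Lambda> \<eta>' \<Longrightarrow> (\<And>x. x \<in> movable \<Lambda> \<eta> \<Longrightarrow> \<sigma> x = \<tau> x) \<Longrightarrow> \<sigma> \<in> F \<longleftrightarrow> \<tau> \<in> F" for F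
  proof (rule sum.reindex_bij_witness[where j="\<lambda>\<sigma>. glue ?A \<sigma> \<eta>'" and i="\<lambda>\<tau>. glue ?A \<tau> \<eta>"])
    fix \<sigma> assume s: "\<sigma> \<in> resample X \<Lambda> \<eta> \<inter> F"
    show "glue ?A (glue ?A \<sigma> \<eta>') \<eta> = \<sigma>" "weight \<Lambda> (glue ?A \<sigma> \<eta>') = weight \<Lambda> \<sigma>" using gg w s by auto
    show "glue ?A \<sigma> \<eta>' \<in> resample X \<Lambda> \<eta>' \<inter> F" using F[of \<sigma> "glue ?A \<sigma> \<eta>'"] g1 s by (auto simp: glue_def)
  next
    fix \<tau> assume t: "\<tau> \<in> resample X \<Lambda> \<eta>' \<inter> F"
    show "glue ?A (glue ?A \<tau> \<eta>) \<eta>' = \<tau>" using gg' t by auto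
    show "glue ?A \<tau> \<eta> \<in> resample X \<Lambda> \<eta> \<inter> F" using F[of "glue ?A \<tau> \<eta>" \<tau>] g2 t by (auto simp: glue_def)
  qed
  have a: "(\<Sum>\<sigma>\<in>resample X \<Lambda> \<eta> \<inter> E. weight \<Lambda> \<sigma>) = (\<Sum>\<tau>\<in>resample X \<Lambda> \<eta>' \<inter> E. weight \<Lambda> \<tau>)" by (rule S[OF assms(5)])
  have b: "(\<Sum>\<sigma>\<in>resample X \<Lambda> \<eta>. weight \<Lambda> \<sigma>) = (\<Sum>\<tau>\<in>resample X \<Lambda> \<eta>'. weight \<Lambda> \<tau>)"
    by (rule S[of UNIV, unfolded Int_UNIV_right]) simp
  show ?thesis unfolding gibbs_prob_def a b ..
qed

text \<open>A jump with exactly one end between \<open>a\<close> and \<open>b\<close> crosses one of these cuts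
  and is therefore the same for \<open>\<eta>\<close> as for the shift. Consequently the same points
  are movable, with the same targets.\<close>

lemma gibbs_prob_between_cuts:
  assumes "\<eta> \<in> Perms X" "a \<in> midpoints X" "b \<in> midpoints X" "cut n a \<eta>" "cut n b \<eta>"
    "determined Q E" "fst ` Q \<subseteq> {a..b}" "Q \<subseteq> X \<times> X"
  shows "gibbs_prob (X \<inter> {a..b}) \<eta> E = gibbs_prob (X \<inter> {a..b}) (theta n) E"
proof -
  let ?L = "X \<inter> {a..b}"
  have ab: "a \<notin> X" "b \<notin> X" using midpoint_notin assms(2,3) by auto
  have c: "admissible ?L \<eta>" "admissible ?L (theta n)" using assms(1) finite_Icc theta_Perms by (auto simp: admissible_def)
  have T: "theta n \<in> Perms X" by (rule theta_Perms)
  have ex: "\<eta> x = theta n x" if "x \<in> X" "(x \<in> ?L) \<noteq> (\<eta> x \<in> ?L) \<or> (x \<in> ?L) \<noteq> (theta n x \<in> ?L)" for x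
  proof -
    have X: "\<eta> x \<in> X" "theta n x \<in> X" using that Perms_mem[OF assms(1)] Perms_mem[OF T] by auto
    hence ne: "x \<noteq> a" "x \<noteq> b" "\<eta> x \<noteq> a" "\<eta> x \<noteq> b" "theta n x \<noteq> a" "theta n x \<noteq> b" using ab that(1) by auto
    have "(crosses a x (\<eta> x) \<or> crosses a x (theta n x)) \<or> (crosses b x (\<eta> x) \<or> crosses b x (theta n x))"
    proof -
      have 1: "crosses a x y \<or> crosses b x y" if "y \<in> X" "(x \<in> ?L) \<noteq> (y \<in> ?L)" for y
      proof -
        have "y \<noteq> a" "y \<noteq> b" using that(1) ab by auto
        moreover have "(a \<le> x \<and> x \<le> b) \<noteq> (a \<le> y \<and> y \<le> b)" using that \<open>x \<in> X\<close> by simp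
        ultimately show ?thesis using ne(1,2) unfolding crosses_def by linarith
      qed
      from that(2) show ?thesis using 1[OF X(1)] 1[OF X(2)] by blast
    qed
    thus ?thesis using assms(4,5) that(1) unfolding cut_def by blast
  qed
  have fl: "movable ?L (theta n) = movable ?L \<eta>"
  proof (intro set_eqI iffI)
    fix x assume "x \<in> movable ?L (theta n)"
    hence x: "x \<in> ?L" "theta n x \<in> ?L" by (auto simp: movable_def)
    have "\<eta> x \<in> ?L"
    proof (rule ccontr)
      assume "\<eta> x \<notin> ?L"
      hence "\<eta> x = theta n x" using ex[of x] x by blast
      thus False using x \<open>\<eta> x \<notin> ?L\<close> by simp
    qed
    thus "x \<in> movable ?L \<eta>" using x by (simp add: movable_def)
  next
    fix x assume "x \<in> movable ?L \<eta>"
    hence x: "x \<in> ?L" "\<eta> x \<in> ?L" by (auto simp: movable_def)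
    have "theta n x \<in> ?L"
    proof (rule ccontr)
      assume "theta n x \<notin> ?L"
      hence "\<eta> x = theta n x" using ex[of x] x by blast
      thus False using x \<open>theta n x \<notin> ?L\<close> by simp
    qed
    thus "x \<in> movable ?L (theta n)" using x by (simp add: movable_def)
  qed
  have im: "\<tau> ` movable ?L \<tau> = {y \<in> ?L. inv \<tau> y \<in> ?L}" if "\<tau> \<in> Perms X" for \<tau>
  proof (intro set_eqI iffI)
    fix y assume "y \<in> \<tau> ` movable ?L \<tau>"
    thus "y \<in> {y \<in> ?L. inv \<tau> y \<in> ?L}" using Perms_inv_l[OF that] by (auto simp: movable_def)
  next
    fix y assume "y \<in> {y \<in> ?L. inv \<tau> y \<in> ?L}"
    thus "y \<in> \<tau> ` movable ?L \<tau>" using Perms_inv_r[OF that]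
      by (intro image_eqI[of _ _ "inv \<tau> y"]) (auto simp: movable_def)
  qed
  have iex: "inv \<eta> y \<in> ?L \<longleftrightarrow> inv (theta n) y \<in> ?L" if y: "y \<in> ?L" for y
  proof (rule ccontr)
    assume n: "\<not> ?thesis"
    show False
    proof (cases "inv \<eta> y \<in> ?L")
      case True
      hence nt: "inv (theta n) y \<notin> ?L" using n by simp
      have r: "theta n (inv (theta n) y) = y" by (rule Perms_inv_r[OF T])
      have "inv (theta n) y \<in> X" using y Perms_mem[OF Perms_inv[OF T]] by auto
      hence "\<eta> (inv (theta n) y) = theta n (inv (theta n) y)" using ex[of "inv (theta n) y"] nt r y by simp
      hence "inv \<eta> y = inv (theta n) y" using r Perms_inv_eq_iff[OF assms(1)] by simp
      thus False using True nt by simp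
    next
      case False
      have r: "\<eta> (inv \<eta> y) = y" by (rule Perms_inv_r[OF assms(1)])
      have "inv \<eta> y \<in> X" using y Perms_mem[OF Perms_inv[OF assms(1)]] by auto
      hence "\<eta> (inv \<eta> y) = theta n (inv \<eta> y)" using ex[of "inv \<eta> y"] False r y by simp
      hence "inv (theta n) y = inv \<eta> y" using r Perms_inv_eq_iff[OF T] by simp
      thus False using n by simp
    qed
  qed
  have im2: "theta n ` movable ?L \<eta> = \<eta> ` movable ?L \<eta>"
    unfolding im[OF T, unfolded fl] im[OF assms(1)] using iex by blast
  show ?thesis
  proof (rule gibbs_prob_glue[OF c fl im2])
    fix \<sigma> \<tau> assume s: "\<sigma> \<in> resample X ?L \<eta>" and t: "\<tau> \<in> resample X ?L (theta n)" and st: "\<And>x. x \<in> movable ?L \<eta> \<Longrightarrow> \<sigma> x = \<tau> x"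
    have "\<sigma> x = \<tau> x" if x: "x \<in> ?L" for x
    proof (cases "x \<in> movable ?L \<eta>")
      case False
      hence "\<eta> x \<notin> ?L" using x by (auto simp: movable_def)
      hence "\<eta> x = theta n x" using ex[of x] x by blast
      moreover have "\<sigma> x = \<eta> x" "\<tau> x = theta n x"
        using s t False resample_iff[OF assms(1), of ?L] resample_iff[OF T, of ?L] unfolding fl by auto
      ultimately show ?thesis by simp
    qed (rule st)
    moreover have "x \<in> ?L" if "(x,y) \<in> Q" for x y
    proof -
      have "x \<in> fst ` Q" using image_eqI[of x fst "(x,y)" Q] that by simp
      thus ?thesis using assms(7,8) that by auto
    qed
    ultimately have "hits Q \<sigma> = hits Q \<tau>" unfolding hits_def by auto
    thus "\<sigma> \<in> E \<longleftrightarrow> \<tau> \<in> E" using assms(6) resample_Perms[OF s] resample_Perms[OF t] unfolding determined_def by blast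
  qed
qed

end

section \<open>Gibbs measures with the same flow are proportional\<close>

context point_set
begin

definition flow_set :: "int \<Rightarrow> (real \<Rightarrow> real) set" where
  "flow_set n = {\<sigma> \<in> Perms X. flow X \<sigma> = Fin n}"

definition cut_set :: "int \<Rightarrow> real \<Rightarrow> (real \<Rightarrow> real) set" where
  "cut_set n a = {\<sigma> \<in> Perms X. flow X \<sigma> = Fin n \<and> cut n a \<sigma>}"

lemma flow_set_sets: "flow_set n \<in> sets (perm_borel X)"
  unfolding flow_set_def by (rule flow_sets)

lemma cut_set_sets: "cut_set n a \<in> sets (perm_borel X)"
proof -
  have "cut_set n a = flow_set n \<inter> {\<sigma> \<in> Perms X. cut n a \<sigma>}" by (auto simp: cut_set_def flow_set_def)
  thus ?thesis using flow_set_sets cut_sets by auto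
qed

lemma cut_set_resample:
  assumes "\<eta> \<in> Perms X" "\<Lambda> \<subseteq> X" "finite \<Lambda>" "\<sigma> \<in> resample X \<Lambda> \<eta>" "(\<forall>x\<in>\<Lambda>. x < a) \<or> (\<forall>x\<in>\<Lambda>. a < x)"
  shows "\<sigma> \<in> cut_set n a \<longleftrightarrow> \<eta> \<in> cut_set n a"
  unfolding cut_set_def using cut_resample[OF assms(1,2,4,5)] flow_resample[OF assms(1-4)] resample_Perms[OF assms(4)] assms(1) by simp

end

context permutation_gas
begin

definition joint_cut :: "int \<Rightarrow> real \<Rightarrow> ((real \<Rightarrow> real) \<times> (real \<Rightarrow> real)) set" where
  "joint_cut n a = cut_set n a \<times> cut_set n a"

text \<open>Among the common cuts of two permutations, \<open>a\<close> is the leftmost one in \<open>L\<close>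
  and \<open>b\<close> the rightmost one in \<open>R\<close>. Choosing the outermost and not the
  innermost ones makes the choice independent of what happens between \<open>a\<close> and
  \<open>b\<close>.\<close>

definition outermost :: "int \<Rightarrow> real set \<Rightarrow> real set \<Rightarrow> real \<Rightarrow> real \<Rightarrow> ((real \<Rightarrow> real) \<times> (real \<Rightarrow> real)) set" where
  "outermost n L R a b = joint_cut n a \<inter> joint_cut n b - (\<Union>a'\<in>{a'\<in>L. a' < a}. joint_cut n a') - (\<Union>b'\<in>{b'\<in>R. b < b'}. joint_cut n b')"

lemma outermost_sym: "(\<sigma>, \<tau>) \<in> outermost n L R a b \<longleftrightarrow> (\<tau>, \<sigma>) \<in> outermost n L R a b"
  by (auto simp: outermost_def joint_cut_def)

lemma outermost_resample:
  assumes "\<eta> \<in> Perms X" "a \<notin> X" "b \<notin> X" "\<sigma> \<in> resample X (X \<inter> {a..b}) \<eta>"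
  shows "(\<sigma>, \<tau>) \<in> outermost n L R a b \<longleftrightarrow> (\<eta>, \<tau>) \<in> outermost n L R a b"
proof -
  have 1: "\<sigma> \<in> cut_set n c \<longleftrightarrow> \<eta> \<in> cut_set n c" if "c \<le> a \<or> b \<le> c" for c
  proof (rule cut_set_resample[OF assms(1) _ finite_Icc assms(4)])
    have "a < x \<and> x < b" if "x \<in> X \<inter> {a..b}" for x using that assms(2,3) by (cases "x = a \<or> x = b") auto
    thus "(\<forall>x\<in>X \<inter> {a..b}. x < c) \<or> (\<forall>x\<in>X \<inter> {a..b}. c < x)" using that by force
  qed simp
  have 2: "\<sigma> \<in> cut_set n a \<longleftrightarrow> \<eta> \<in> cut_set n a" "\<sigma> \<in> cut_set n b \<longleftrightarrow> \<eta> \<in> cut_set n b" by (rule 1, simp)+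
  have 3: "\<sigma> \<in> cut_set n c \<longleftrightarrow> \<eta> \<in> cut_set n c" if "c \<in> {a'\<in>L. a' < a} \<or> c \<in> {b'\<in>R. b < b'}" for c
    using that by (intro 1) auto
  show ?thesis unfolding outermost_def joint_cut_def using 2 3 by auto
qed

text \<open>For a fixed second permutation \<open>\<tau>\<close> the event that \<open>(a, b)\<close> is the
  outermost pair is decided outside \<open>[a, b]\<close>, and given it the inside has the law of
  \<open>gibbs_prob_between_cuts\<close>.\<close>

lemma outermost_section:
  assumes "\<rho> \<in> gibbs X V" "a \<in> midpoints X" "b \<in> midpoints X" "finite L" "finite R"
    "E \<in> local_events" "determined Q E" "fst ` Q \<subseteq> {a..b}" "Q \<subseteq> X \<times> X"
  shows "emeasure \<rho> (E \<inter> {\<sigma> \<in> Perms X. (\<sigma>, \<tau>) \<in> outermost n L R a b}) =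
    ennreal (gibbs_prob (X \<inter> {a..b}) (theta n) E) * emeasure \<rho> {\<sigma> \<in> Perms X. (\<sigma>, \<tau>) \<in> outermost n L R a b}"
proof -
  note G = gibbsD[OF assms(1)]
  let ?T = "{\<sigma> \<in> Perms X. (\<sigma>, \<tau>) \<in> outermost n L R a b}"
  have ab: "a \<notin> X" "b \<notin> X" using midpoint_notin assms(2,3) by auto
  have c: "Measurable.pred (perm_borel X) (\<lambda>\<sigma>. \<sigma> \<in> cut_set n a)" for a
    using cut_set_sets[of n a] by simp
  have "Measurable.pred (perm_borel X) (\<lambda>\<sigma>. (\<sigma>, \<tau>) \<in> outermost n L R a b)"
  proof -
    have "(\<sigma>, \<tau>) \<in> outermost n L R a b \<longleftrightarrow> (\<sigma> \<in> cut_set n a \<and> \<tau> \<in> cut_set n a) \<and> (\<sigma> \<in> cut_set n b \<and> \<tau> \<in> cut_set n b) \<and>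
      (\<forall>a'\<in>{a'\<in>L. a' < a}. \<not> (\<sigma> \<in> cut_set n a' \<and> \<tau> \<in> cut_set n a')) \<and>
      (\<forall>b'\<in>{b'\<in>R. b < b'}. \<not> (\<sigma> \<in> cut_set n b' \<and> \<tau> \<in> cut_set n b'))" for \<sigma>
      unfolding outermost_def joint_cut_def by auto
    moreover have "Measurable.pred (perm_borel X) (\<lambda>\<sigma>. (\<sigma> \<in> cut_set n a \<and> \<tau> \<in> cut_set n a) \<and> (\<sigma> \<in> cut_set n b \<and> \<tau> \<in> cut_set n b) \<and>
      (\<forall>a'\<in>{a'\<in>L. a' < a}. \<not> (\<sigma> \<in> cut_set n a' \<and> \<tau> \<in> cut_set n a')) \<and>
      (\<forall>b'\<in>{b'\<in>R. b < b'}. \<not> (\<sigma> \<in> cut_set n b' \<and> \<tau> \<in> cut_set n b')))"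
      by (intro pred_intros_logic c pred_Ball_countable countable_finite) (use assms(4,5) in auto)
    ultimately show ?thesis by simp
  qed
  hence T: "?T \<in> sets (perm_borel X)" by (simp add: pred_def)
  have inv: "invariant (X \<inter> {a..b}) ?T"
    unfolding invariant_def using outermost_resample[OF _ ab] resample_Perms by auto
  have "emeasure \<rho> (E \<inter> ?T) = (\<integral>\<^sup>+\<eta>. ennreal (gibbs_prob (X \<inter> {a..b}) \<eta> E) * indicator ?T \<eta> \<partial>\<rho>)"
    by (rule gibbs_inter[OF assms(1) local_events_sets[OF assms(6)] T finite_Icc _ inv]) simp
  also have "\<dots> = (\<integral>\<^sup>+\<eta>. ennreal (gibbs_prob (X \<inter> {a..b}) (theta n) E) * indicator ?T \<eta> \<partial>\<rho>)"
  proof (rule nn_integral_cong)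
    fix \<eta>
    show "ennreal (gibbs_prob (X \<inter> {a..b}) \<eta> E) * indicator ?T \<eta> = ennreal (gibbs_prob (X \<inter> {a..b}) (theta n) E) * indicator ?T \<eta>"
    proof (cases "\<eta> \<in> ?T")
      case True
      hence "\<eta> \<in> Perms X" "cut n a \<eta>" "cut n b \<eta>" by (auto simp: outermost_def joint_cut_def cut_set_def)
      from gibbs_prob_between_cuts[OF this(1) assms(2,3) this(2,3) assms(7-9)] show ?thesis by simp
    qed simp
  qed
  also have "\<dots> = ennreal (gibbs_prob (X \<inter> {a..b}) (theta n) E) * emeasure \<rho> ?T"
    using T G(1) by (subst nn_integral_cmult_indicator) auto
  finally show ?thesis .
qed

text \<open>Apply \<open>infinitely_many_cuts\<close> twice: first \<open>\<tau>\<close> has infinitely many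
  cuts in \<open>S\<close>, then \<open>\<sigma>\<close> has infinitely many cuts among those of
  \<open>\<tau>\<close>.\<close>

lemma joint_cut_infinite:
  assumes "\<mu> \<in> gibbs X V" "\<nu> \<in> gibbs X V" "c \<ge> 1" "S \<subseteq> {a. good_pt c n a}" "infinite S"
  shows "AE \<tau> in \<nu>. AE \<sigma> in \<mu>. \<sigma> \<in> flow_set n \<longrightarrow> \<tau> \<in> flow_set n \<longrightarrow> (\<exists>a\<in>S. (\<sigma>, \<tau>) \<in> joint_cut n a)"
  using infinitely_many_cuts[OF assms(2-5)] 
proof eventually_elim
  case (elim \<tau>)
  show ?case
  proof (cases "\<tau> \<in> flow_set n")
    case True
    hence i: "infinite {a\<in>S. cut n a \<tau>}" using elim by (simp add: flow_set_def)
    have "AE \<sigma> in \<mu>. flow X \<sigma> = Fin n \<longrightarrow> infinite {a\<in>{a\<in>S. cut n a \<tau>}. cut n a \<sigma>}"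
      by (rule infinitely_many_cuts[OF assms(1,3) _ i]) (use assms(4) in auto)
    thus ?thesis
    proof eventually_elim
      case (elim \<sigma>)
      show ?case
      proof (intro impI)
        assume h: "\<sigma> \<in> flow_set n" "\<tau> \<in> flow_set n"
        hence "infinite {a\<in>{a\<in>S. cut n a \<tau>}. cut n a \<sigma>}" using elim by (simp add: flow_set_def)
        from infinite_imp_nonempty[OF this] obtain a where "a \<in> S" "cut n a \<tau>" "cut n a \<sigma>" by blast
        thus "\<exists>a\<in>S. (\<sigma>, \<tau>) \<in> joint_cut n a" using h by (intro bexI[of _ a]) (auto simp: joint_cut_def cut_set_def flow_set_def)
      qed
    qed
  qed simp
qed

text \<open>Sample from the product of \<open>\<mu>\<close> and \<open>\<nu>\<close>. Split according to the
  outermost common cuts \<open>a\<close> and \<open>b\<close> on either side of the points that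
  \<open>E\<close> looks at. On each part, \<open>E\<close> has the same conditional probability for
  the first and for the second coordinate. The parts exhaust the event that both flows are
  \<open>n\<close>, up to a null set.\<close>

lemma gibbs_proportional:
  assumes "\<mu> \<in> gibbs X V" "\<nu> \<in> gibbs X V" "c \<ge> 1" "bi_infinite {a. good_pt c n a}" "E \<in> local_events"
  shows "emeasure \<mu> (E \<inter> flow_set n) * emeasure \<nu> (flow_set n) = emeasure \<mu> (flow_set n) * emeasure \<nu> (E \<inter> flow_set n)"
proof -
  note G = gibbsD[OF assms(1)] and H = gibbsD[OF assms(2)]
  interpret M: prob_space \<mu> by (rule G(2))
  interpret N: prob_space \<nu> by (rule H(2))
  interpret pair_sigma_finite \<mu> \<nu> ..
  obtain Q where Q: "finite Q" "Q \<subseteq> X \<times> X" "determined Q E" and EP: "E \<subseteq> Perms X" using assms(5) by (auto simp: local_events_def)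
  obtain M where M: "\<And>x. x \<in> fst ` Q \<Longrightarrow> \<bar>x\<bar> \<le> M"
    using finite_imp_bounded[of "fst ` Q"] Q(1) by (auto simp: bounded_iff)
  define L where "L j = {a. good_pt c n a \<and> - real j \<le> a \<and> a < - M}" for j :: nat
  define R where "R j = {a. good_pt c n a \<and> M < a \<and> a \<le> real j}" for j :: nat
  have gm: "good_pt c n a \<Longrightarrow> a \<in> midpoints X" for a by (rule good_ptD(1))
  have fL: "finite (L j)" "finite (R j)" for j
  proof -
    show "finite (L j)" by (rule finite_subset[OF _ finite_midpoints[of "- real j" "-M"]]) (auto simp: L_def gm)
    show "finite (R j)" by (rule finite_subset[OF _ finite_midpoints[of M "real j"]]) (auto simp: R_def gm)
  qed
  let ?P = "\<mu> \<Otimes>\<^sub>M \<nu>" and ?F = "flow_set n"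
  have Es: "E \<in> sets \<mu>" "E \<in> sets \<nu>" using local_events_sets[OF assms(5)] G(1) H(1) by auto
  have Fs: "?F \<in> sets \<mu>" "?F \<in> sets \<nu>" using flow_set_sets G(1) H(1) by auto
  have Js: "joint_cut n a \<in> sets ?P" for a unfolding joint_cut_def using cut_set_sets G(1) H(1) by auto
  have Os: "outermost n (L j) (R j) a b \<in> sets ?P" for a b j
    unfolding outermost_def using Js fL by (intro sets.Diff sets.Int sets.finite_UN) auto
  have Ps: "Perms X \<in> sets \<mu>" "Perms X \<in> sets \<nu>" using sets.top[of \<mu>] sets.top[of \<nu>] G(3) H(3) by auto
  have E1: "E \<times> Perms X \<in> sets ?P" and E2: "Perms X \<times> E \<in> sets ?P" using Es Ps by auto
  have OP: "outermost n L R a b \<subseteq> Perms X \<times> Perms X" for L R a b by (auto simp: outermost_def joint_cut_def cut_set_def)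
  have O: "emeasure ?P (outermost n (L j) (R j) a b \<inter> (E \<times> Perms X)) = emeasure ?P (outermost n (L j) (R j) a b \<inter> (Perms X \<times> E))"
    if ab: "a \<in> L j" "b \<in> R j" for a b j
  proof -
    let ?O = "outermost n (L j) (R j) a b"
    let ?g = "ennreal (gibbs_prob (X \<inter> {a..b}) (theta n) E)"
    have m: "a \<in> midpoints X" "b \<in> midpoints X" using ab gm by (auto simp: L_def R_def)
    have "fst ` Q \<subseteq> {a..b}"
    proof
      fix x assume "x \<in> fst ` Q"
      hence "\<bar>x\<bar> \<le> M" by (rule M)
      thus "x \<in> {a..b}" using ab by (auto simp: L_def R_def)
    qed
    note sec = outermost_section[OF _ m fL(1) fL(2) assms(5) Q(3) this Q(2)]
    have "emeasure ?P (?O \<inter> (E \<times> Perms X)) = (\<integral>\<^sup>+\<tau>. emeasure \<mu> ((\<lambda>\<sigma>. (\<sigma>,\<tau>)) -` (?O \<inter> (E \<times> Perms X))) \<partial>\<nu>)"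
      by (rule emeasure_pair_measure_alt2) (use Os E1 in auto)
    also have "\<dots> = (\<integral>\<^sup>+\<tau>. ?g * emeasure \<mu> ((\<lambda>\<sigma>. (\<sigma>,\<tau>)) -` ?O) \<partial>\<nu>)"
    proof (rule nn_integral_cong)
      fix \<tau>
      have "(\<lambda>\<sigma>. (\<sigma>,\<tau>)) -` (?O \<inter> (E \<times> Perms X)) = E \<inter> {\<sigma> \<in> Perms X. (\<sigma>, \<tau>) \<in> ?O}"
        using EP OP[of "L j" "R j" a b] by blast
      moreover have "(\<lambda>\<sigma>. (\<sigma>,\<tau>)) -` ?O = {\<sigma> \<in> Perms X. (\<sigma>, \<tau>) \<in> ?O}"
        using OP[of "L j" "R j" a b] by blast
      ultimately show "emeasure \<mu> ((\<lambda>\<sigma>. (\<sigma>,\<tau>)) -` (?O \<inter> (E \<times> Perms X))) = ?g * emeasure \<mu> ((\<lambda>\<sigma>. (\<sigma>,\<tau>)) -` ?O)"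
        using sec[OF assms(1)] by simp
    qed
    also have "\<dots> = ?g * (\<integral>\<^sup>+\<tau>. emeasure \<mu> ((\<lambda>\<sigma>. (\<sigma>,\<tau>)) -` ?O) \<partial>\<nu>)"
      by (rule nn_integral_cmult) (rule measurable_emeasure_Pair2[OF Os])
    also have "\<dots> = ?g * emeasure ?P ?O" by (subst emeasure_pair_measure_alt2[OF Os]) simp
    finally have 1: "emeasure ?P (?O \<inter> (E \<times> Perms X)) = ?g * emeasure ?P ?O" .
    have "emeasure ?P (?O \<inter> (Perms X \<times> E)) = (\<integral>\<^sup>+\<sigma>. emeasure \<nu> (Pair \<sigma> -` (?O \<inter> (Perms X \<times> E))) \<partial>\<mu>)"
      by (rule N.emeasure_pair_measure_alt) (use Os E2 in auto)
    also have "\<dots> = (\<integral>\<^sup>+\<sigma>. ?g * emeasure \<nu> (Pair \<sigma> -` ?O) \<partial>\<mu>)"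
    proof (rule nn_integral_cong)
      fix \<sigma>
      have 2: "Pair \<sigma> -` ?O = {\<tau> \<in> Perms X. (\<tau>, \<sigma>) \<in> ?O}"
      proof (intro set_eqI)
        fix \<tau>
        show "\<tau> \<in> Pair \<sigma> -` ?O \<longleftrightarrow> \<tau> \<in> {\<tau> \<in> Perms X. (\<tau>, \<sigma>) \<in> ?O}"
          using OP[of "L j" "R j" a b] outermost_sym[of \<sigma> \<tau> n "L j" "R j" a b] by auto
      qed
      have "Pair \<sigma> -` (?O \<inter> (Perms X \<times> E)) = E \<inter> Pair \<sigma> -` ?O" using OP[of "L j" "R j" a b] by blast
      hence "Pair \<sigma> -` (?O \<inter> (Perms X \<times> E)) = E \<inter> {\<tau> \<in> Perms X. (\<tau>, \<sigma>) \<in> ?O}" unfolding 2 .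
      thus "emeasure \<nu> (Pair \<sigma> -` (?O \<inter> (Perms X \<times> E))) = ?g * emeasure \<nu> (Pair \<sigma> -` ?O)"
        using sec[OF assms(2)] 2 by simp
    qed
    also have "\<dots> = ?g * (\<integral>\<^sup>+\<sigma>. emeasure \<nu> (Pair \<sigma> -` ?O) \<partial>\<mu>)"
      by (rule nn_integral_cmult) (rule N.measurable_emeasure_Pair[OF Os])
    also have "\<dots> = ?g * emeasure ?P ?O" by (subst N.emeasure_pair_measure_alt[OF Os]) simp
    finally show ?thesis using 1 by simp
  qed
  define U where "U j = (\<Union>a\<in>L j. joint_cut n a) \<inter> (\<Union>b\<in>R j. joint_cut n b)" for j
  have Us: "U j \<in> sets ?P" for j unfolding U_def using Js fL by (intro sets.Int sets.finite_UN) auto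
  have Udec: "U j = (\<Union>p\<in>L j \<times> R j. outermost n (L j) (R j) (fst p) (snd p))" for j
  proof (intro equalityI subsetI)
    fix p assume p: "p \<in> U j"
    let ?A = "{a\<in>L j. p \<in> joint_cut n a}" and ?B = "{b\<in>R j. p \<in> joint_cut n b}"
    have A: "finite ?A" "?A \<noteq> {}" and B: "finite ?B" "?B \<noteq> {}" using p fL by (auto simp: U_def)
    have a: "Min ?A \<in> ?A" and b: "Max ?B \<in> ?B" using Min_in[OF A] Max_in[OF B] by blast+
    have "p \<notin> joint_cut n a'" if "a' \<in> L j" "a' < Min ?A" for a' using Min_le[OF A(1), of a'] that by auto
    moreover have "p \<notin> joint_cut n b'" if "b' \<in> R j" "Max ?B < b'" for b' using Max_ge[OF B(1), of b'] that by auto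
    ultimately have "p \<in> outermost n (L j) (R j) (Min ?A) (Max ?B)" using a b unfolding outermost_def by auto
    thus "p \<in> (\<Union>p\<in>L j \<times> R j. outermost n (L j) (R j) (fst p) (snd p))" using a b
      by (intro UN_I[of "(Min ?A, Max ?B)"]) auto
  qed (auto simp: U_def outermost_def)
  have disj: "disjoint_family_on (\<lambda>p. outermost n (L j) (R j) (fst p) (snd p) \<inter> D) (L j \<times> R j)" for j D
    unfolding disjoint_family_on_def
  proof (intro ballI impI)
    fix p q assume pq: "p \<in> L j \<times> R j" "q \<in> L j \<times> R j" "p \<noteq> q"
    have "outermost n (L j) (R j) (fst p) (snd p) \<inter> outermost n (L j) (R j) (fst q) (snd q) = {}"
    proof (cases "fst p = fst q")
      case True
      hence "snd p \<noteq> snd q" using pq(3) by (simp add: prod_eq_iff)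
      hence "snd p < snd q \<or> snd q < snd p" by auto
      thus ?thesis unfolding outermost_def using pq(1,2) by (auto simp: mem_Times_iff)
    next
      case False
      hence "fst p < fst q \<or> fst q < fst p" by auto
      thus ?thesis unfolding outermost_def using pq(1,2) by (auto simp: mem_Times_iff)
    qed
    thus "outermost n (L j) (R j) (fst p) (snd p) \<inter> D \<inter> (outermost n (L j) (R j) (fst q) (snd q) \<inter> D) = {}" by blast
  qed
  have split: "emeasure ?P (U j \<inter> D) = (\<Sum>p\<in>L j \<times> R j. emeasure ?P (outermost n (L j) (R j) (fst p) (snd p) \<inter> D))"
    if "D \<in> sets ?P" for j D
  proof -
    have e: "U j \<inter> D = (\<Union>p\<in>L j \<times> R j. outermost n (L j) (R j) (fst p) (snd p) \<inter> D)" unfolding Udec by blast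
    show ?thesis unfolding e
    proof (rule sum_emeasure[OF _ disj, symmetric])
      show "(\<lambda>p. outermost n (L j) (R j) (fst p) (snd p) \<inter> D) ` (L j \<times> R j) \<subseteq> sets ?P"
        using Os that by (intro image_subsetI sets.Int)
    qed (use fL in simp)
  qed
  have eqU: "emeasure ?P (U j \<inter> (E \<times> Perms X)) = emeasure ?P (U j \<inter> (Perms X \<times> E))" for j
    unfolding split[OF E1] split[OF E2] by (rule sum.cong) (use O in auto)
  \<comment> \<open>Enlarging \<open>L j\<close> and \<open>R j\<close> moves the outermost cuts but only increases the
    event that there are any.\<close>
  have incU: "incseq U"
  proof (rule monoI)
    fix i j :: nat assume "i \<le> j"
    hence "L i \<subseteq> L j" "R i \<subseteq> R j" by (auto simp: L_def R_def)
    thus "U i \<subseteq> U j" unfolding U_def by blast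
  qed
  let ?U = "\<Union>j. U j"
  have UUs: "?U \<in> sets ?P" using Us by auto
  have lim: "(\<lambda>j. emeasure ?P (U j \<inter> D)) \<longlonglongrightarrow> emeasure ?P (?U \<inter> D)" if "D \<in> sets ?P" for D
  proof -
    have "incseq (\<lambda>j. U j \<inter> D)" using incU unfolding incseq_def by blast
    hence "(\<lambda>j. emeasure ?P (U j \<inter> D)) \<longlonglongrightarrow> emeasure ?P (\<Union>j. U j \<inter> D)"
      using Us that by (intro Lim_emeasure_incseq) auto
    thus ?thesis by simp
  qed
  have eqUU: "emeasure ?P (?U \<inter> (E \<times> Perms X)) = emeasure ?P (?U \<inter> (Perms X \<times> E))"
    using LIMSEQ_unique[OF lim[OF E1]] lim[OF E2] unfolding eqU by blast
  have FF: "?F \<times> ?F \<in> sets ?P" using Fs by auto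
  have null: "emeasure ?P (?F \<times> ?F - ?U) = 0"
  proof -
    have sets: "?F \<times> ?F - ?U \<in> sets ?P" using FF UUs by auto
    have "AE \<tau> in \<nu>. emeasure \<mu> ((\<lambda>\<sigma>. (\<sigma>,\<tau>)) -` (?F \<times> ?F - ?U)) = 0"
    proof -
      have "AE \<tau> in \<nu>. AE \<sigma> in \<mu>. \<sigma> \<in> ?F \<longrightarrow> \<tau> \<in> ?F \<longrightarrow> (\<exists>a\<in>{a. good_pt c n a \<and> a < - M}. (\<sigma>, \<tau>) \<in> joint_cut n a)"
        by (rule joint_cut_infinite[OF assms(1-3) _ infinite_halves(1)[OF assms(4)]]) auto
      moreover have "AE \<tau> in \<nu>. AE \<sigma> in \<mu>. \<sigma> \<in> ?F \<longrightarrow> \<tau> \<in> ?F \<longrightarrow> (\<exists>a\<in>{a. good_pt c n a \<and> M < a}. (\<sigma>, \<tau>) \<in> joint_cut n a)"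
        by (rule joint_cut_infinite[OF assms(1-3) _ infinite_halves(2)[OF assms(4)]]) auto
      ultimately show ?thesis
      proof eventually_elim
        case (elim \<tau>)
        have "AE \<sigma> in \<mu>. (\<sigma>, \<tau>) \<notin> ?F \<times> ?F - ?U"
          using elim
        proof eventually_elim
          case (elim \<sigma>)
          show ?case
          proof
            assume c: "(\<sigma>, \<tau>) \<in> ?F \<times> ?F - ?U"
            hence f: "\<sigma> \<in> ?F" "\<tau> \<in> ?F" by auto
            obtain a where a: "good_pt c n a" "a < - M" "(\<sigma>, \<tau>) \<in> joint_cut n a" using elim(1) f by auto
            obtain b where b: "good_pt c n b" "M < b" "(\<sigma>, \<tau>) \<in> joint_cut n b" using elim(2) f by auto
            obtain j :: nat where j: "max (- a) b \<le> real j" using real_arch_simple by blast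
            have "a \<in> L j" "b \<in> R j" using a b j by (auto simp: L_def R_def)
            hence "(\<sigma>, \<tau>) \<in> U j" using a(3) b(3) unfolding U_def by blast
            thus False using c by blast
          qed
        qed
        moreover have "(\<lambda>\<sigma>. (\<sigma>,\<tau>)) -` (?F \<times> ?F - ?U) \<in> sets \<mu>" by (rule sets_Pair2[OF sets])
        ultimately have "(\<lambda>\<sigma>. (\<sigma>,\<tau>)) -` (?F \<times> ?F - ?U) \<in> null_sets \<mu>"
          by (subst AE_iff_null_sets) auto
        thus ?case by (rule null_setsD1)
      qed
    qed
    hence "(\<integral>\<^sup>+\<tau>. emeasure \<mu> ((\<lambda>\<sigma>. (\<sigma>,\<tau>)) -` (?F \<times> ?F - ?U)) \<partial>\<nu>) = (\<integral>\<^sup>+\<tau>. 0 \<partial>\<nu>)" by (rule nn_integral_cong_AE)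
    thus ?thesis unfolding emeasure_pair_measure_alt2[OF sets] by simp
  qed
  hence ns: "?F \<times> ?F - ?U \<in> null_sets ?P" using FF UUs by auto
  have UF: "?U \<subseteq> ?F \<times> ?F" by (auto simp: U_def joint_cut_def cut_set_def flow_set_def)
  have FP: "?F \<subseteq> Perms X" by (auto simp: flow_set_def)
  have ae: "emeasure ?P ((?F \<times> ?F) \<inter> D) = emeasure ?P (?U \<inter> D)" if "D \<in> sets ?P" for D
  proof (rule emeasure_eq_AE)
    show "AE p in ?P. p \<in> (?F \<times> ?F) \<inter> D \<longleftrightarrow> p \<in> ?U \<inter> D"
      using AE_not_in[OF ns] by eventually_elim (use UF in blast)
  qed (use that FF UUs in auto)
  have "emeasure \<mu> (E \<inter> ?F) * emeasure \<nu> ?F = emeasure ?P ((E \<inter> ?F) \<times> ?F)"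
    using Es Fs by (subst N.emeasure_pair_measure_Times) auto
  also have "(E \<inter> ?F) \<times> ?F = (?F \<times> ?F) \<inter> (E \<times> Perms X)" using FP by auto
  also have "emeasure ?P ((?F \<times> ?F) \<inter> (E \<times> Perms X)) = emeasure ?P ((?F \<times> ?F) \<inter> (Perms X \<times> E))"
    unfolding ae[OF E1] ae[OF E2] by (rule eqUU)
  also have "(?F \<times> ?F) \<inter> (Perms X \<times> E) = ?F \<times> (E \<inter> ?F)" using FP by auto
  also have "emeasure ?P (?F \<times> (E \<inter> ?F)) = emeasure \<mu> ?F * emeasure \<nu> (E \<inter> ?F)"
    using Es Fs by (subst N.emeasure_pair_measure_Times) auto
  finally show ?thesis .
qed

end

section \<open>Compactness\<close>

context point_set
begin

lemma eventually_comp_strict_mono: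
  "eventually P sequentially \<Longrightarrow> strict_mono r \<Longrightarrow> eventually (\<lambda>k. P (r k)) sequentially"
  using filterlim_subseq filterlim_iff by fast

text \<open>If every coordinate eventually stays in a finite set, a diagonal subsequence makes every coordinate
  eventually constant.\<close>

lemma pointwise_subsequence:
  fixes u :: "nat \<Rightarrow> nat \<Rightarrow> 'a"
  assumes "\<And>j. \<exists>Y. finite Y \<and> eventually (\<lambda>k. u k j \<in> Y) sequentially"
  shows "\<exists>r v. strict_mono r \<and> (\<forall>j. eventually (\<lambda>k. u (r k) j = v j) sequentially)"
proof -
  define P where "P j s \<longleftrightarrow> (\<exists>v. eventually (\<lambda>k. u (s k) j = v) sequentially)" for j and s :: "nat \<Rightarrow> nat"
  interpret subseqs P
  proof
    fix j and s :: "nat \<Rightarrow> nat" assume s: "strict_mono s"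
    obtain Y where Y: "finite Y" "eventually (\<lambda>k. u k j \<in> Y) sequentially" using assms by blast
    have "eventually (\<lambda>k. u (s k) j \<in> Y) sequentially" using eventually_comp_strict_mono[OF Y(2) s] .
    then obtain N where N: "\<And>k. k \<ge> N \<Longrightarrow> u (s k) j \<in> Y" by (auto simp: eventually_sequentially)
    have "finite ((\<lambda>k. u (s k) j) ` {N..})" by (rule finite_subset[OF _ Y(1)]) (use N in auto)
    from pigeonhole_infinite[OF infinite_Ici this] obtain k0 where "infinite {k\<in>{N..}. u (s k) j = u (s k0) j}" by blast
    then obtain v where v: "infinite {k\<in>{N..}. u (s k) j = v}" by blast
    obtain r :: "nat \<Rightarrow> nat" where r: "strict_mono r" "\<And>k. r k \<in> {k\<in>{N..}. u (s k) j = v}"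
      using infinite_enumerate[OF v] by blast
    show "\<exists>r'. strict_mono r' \<and> P j (s \<circ> r')" unfolding P_def
      using r by (intro exI[of _ r] conjI exI[of _ v]) auto
  qed
  have "P j (diagseq \<circ> (+) (Suc j))" for j
  proof (rule diagseq_holds)
    fix r s :: "nat \<Rightarrow> nat" and n assume r: "strict_mono r" and "P n s"
    then obtain v where "eventually (\<lambda>k. u (s k) n = v) sequentially" by (auto simp: P_def)
    from eventually_comp_strict_mono[OF this r] show "P n (s \<circ> r)" by (auto simp: P_def)
  qed
  hence "\<forall>j. \<exists>v. eventually (\<lambda>k. u (diagseq (Suc j + k)) j = v) sequentially"
    unfolding P_def comp_def ..
  from choice[OF this] obtain v where v: "\<forall>j. eventually (\<lambda>k. u (diagseq (Suc j + k)) j = v j) sequentially" ..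
  have "eventually (\<lambda>k. u (diagseq k) j = v j) sequentially" for j
  proof -
    obtain N where N: "\<And>k. k \<ge> N \<Longrightarrow> u (diagseq (Suc j + k)) j = v j" 
      using v[rule_format, of j] by (auto simp: eventually_sequentially)
    have "u (diagseq k) j = v j" if "k \<ge> Suc j + N" for k using N[of "k - Suc j"] that by simp
    thus ?thesis by (auto simp: eventually_sequentially)
  qed
  thus ?thesis using subseq_diagseq by blast
qed

text \<open>Permutations whose values, forward and backward, stay in finite sets have a pointwise convergent
  subsequence, and its limit is again a permutation since this is a statement about pairs of values.
  Control of the inverses is what keeps points from being lost to infinity.\<close>

lemma compact_intersection:
  assumes A: "\<And>i. A i \<in> local_events" "decseq A"
    and s: "\<And>i. \<sigma> i \<in> A i"
    and t: "\<And>x. x \<in> X \<Longrightarrow> \<exists>Y. finite Y \<and> eventually (\<lambda>i. \<sigma> i x \<in> Y \<and> inv (\<sigma> i) x \<in> Y) sequentially"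
  shows "(\<Inter>i. A i) \<noteq> {}"
proof -
  have sP: "\<sigma> i \<in> Perms X" for i using s[of i] A(1)[of i] by (auto simp: local_events_def)
  define x where "x j = pt (int_decode j)" for j
  have xX: "x j \<in> X" for j by (simp add: x_def pt)
  have surj: "\<exists>j. z = x j" if z: "z \<in> X" for z
  proof -
    obtain i where "z = pt i" using z unfolding in_X_iff by (elim exE)
    thus ?thesis by (intro exI[of _ "int_encode i"]) (simp add: x_def)
  qed
  obtain r v where r: "strict_mono r" and v: "\<forall>j. eventually (\<lambda>k. (\<sigma> (r k) (x j), inv (\<sigma> (r k)) (x j)) = v j) sequentially"
  proof (rule exE[OF pointwise_subsequence[of "\<lambda>k j. (\<sigma> k (x j), inv (\<sigma> k) (x j))"]])
    fix j
    obtain Y where Y: "finite Y" "eventually (\<lambda>i. \<sigma> i (x j) \<in> Y \<and> inv (\<sigma> i) (x j) \<in> Y) sequentially"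
      using t[OF xX] by blast
    have "eventually (\<lambda>k. (\<sigma> k (x j), inv (\<sigma> k) (x j)) \<in> Y \<times> Y) sequentially"
      using Y(2) by eventually_elim simp
    thus "\<exists>Y. finite Y \<and> eventually (\<lambda>k. (\<sigma> k (x j), inv (\<sigma> k) (x j)) \<in> Y) sequentially"
      using Y(1) by (intro exI[of _ "Y \<times> Y"] conjI finite_cartesian_product)
  qed (elim exE conjE, assumption)
  define jj where "jj z = (SOME j. z = x j)" for z
  have jj: "x (jj z) = z" if "z \<in> X" for z unfolding jj_def using someI_ex[OF surj[OF that]] by simp
  define f where "f z = (if z \<in> X then fst (v (jj z)) else z)" for z
  define g where "g z = (if z \<in> X then snd (v (jj z)) else z)" for z
  have ev: "eventually (\<lambda>k. \<sigma> (r k) z = f z \<and> inv (\<sigma> (r k)) z = g z) sequentially" for z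
  proof (cases "z \<in> X")
    case True
    have "eventually (\<lambda>k. (\<sigma> (r k) (x (jj z)), inv (\<sigma> (r k)) (x (jj z))) = v (jj z)) sequentially"
      using v by blast
    thus ?thesis by eventually_elim (use jj[OF True] True in \<open>auto simp: f_def g_def prod_eq_iff\<close>)
  next
    case False
    thus ?thesis using Perms_out[OF sP] Perms_out[OF Perms_inv[OF sP]] by (simp add: f_def g_def)
  qed
  have fg: "g (f z) = z" "f (g z) = z" for z
  proof -
    have "eventually (\<lambda>k. g (f z) = z) sequentially"
      using ev[of z] ev[of "f z"] by eventually_elim (metis Perms_inv_l[OF sP])
    thus "g (f z) = z" by simp
    have "eventually (\<lambda>k. f (g z) = z) sequentially"
      using ev[of z] ev[of "g z"] by eventually_elim (metis Perms_inv_r[OF sP])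
    thus "f (g z) = z" by simp
  qed
  have fX: "f z \<in> X" if "z \<in> X" for z
  proof -
    have "eventually (\<lambda>k. f z \<in> X) sequentially"
      using ev[of z] by eventually_elim (metis Perms_mem[OF sP] that)
    thus ?thesis by simp
  qed
  have gX: "g z \<in> X" if "z \<in> X" for z
  proof -
    have "eventually (\<lambda>k. g z \<in> X) sequentially"
      using ev[of z] by eventually_elim (metis Perms_mem[OF Perms_inv[OF sP]] that)
    thus ?thesis by simp
  qed
  have "bij_betw f X X" by (rule bij_betw_byWitness[where f'=g]) (use fg fX gX in auto)
  hence fP: "f \<in> Perms X" unfolding Perms_def by (auto intro!: bij_imp_permutes simp: f_def)
  have "f \<in> A m" for m
  proof -
    obtain Q where Q: "finite Q" "Q \<subseteq> X \<times> X" "determined Q (A m)" using A(1)[of m] by (auto simp: local_events_def)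
    have "eventually (\<lambda>k. \<forall>p\<in>Q. \<sigma> (r k) (fst p) = f (fst p)) sequentially"
    proof (rule eventually_ball_finite[OF Q(1)], rule ballI)
      fix p show "eventually (\<lambda>k. \<sigma> (r k) (fst p) = f (fst p)) sequentially"
        using ev[of "fst p"] by eventually_elim simp
    qed
    moreover have "eventually (\<lambda>k. k \<ge> m) sequentially" by (rule eventually_ge_at_top)
    ultimately have "eventually (\<lambda>k. f \<in> A m) sequentially"
    proof eventually_elim
      case (elim k)
      have "m \<le> r k" using elim(2) seq_suble[OF r, of k] by simp
      hence "\<sigma> (r k) \<in> A m" using s[of "r k"] A(2) unfolding decseq_def by blast
      moreover have "hits Q (\<sigma> (r k)) = hits Q f" using elim(1) unfolding hits_def by auto
      ultimately show ?case using Q(3) fP sP unfolding determined_def by blast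
    qed
    thus ?thesis by simp
  qed
  thus ?thesis by blast
qed

lemma convergent_subsequence_local_events:
  fixes M :: "nat \<Rightarrow> (real \<Rightarrow> real) measure"
  assumes "\<And>k. prob_space (M k)"
  shows "\<exists>r. strict_mono r \<and> (\<forall>E\<in>local_events. convergent (\<lambda>k. measure (M (r k)) E))"
proof -
  define En where "En = from_nat_into local_events"
  define P where "P j s \<longleftrightarrow> convergent (\<lambda>k. measure (M (s k)) (En j))" for j and s :: "nat \<Rightarrow> nat"
  interpret subseqs P
  proof
    fix j and s :: "nat \<Rightarrow> nat"
    have m: "\<forall>k. measure (M (s k)) (En j) \<in> {0..1}" using prob_space.prob_le_1[OF assms] by simp
    have "seq_compact {0..1::real}" by (simp add: compact_imp_seq_compact)
    from seq_compactE[OF this m] obtain l r where "strict_mono r" "((\<lambda>k. measure (M (s k)) (En j)) \<circ> r) \<longlonglongrightarrow> l" .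
    thus "\<exists>r'. strict_mono r' \<and> P j (s \<circ> r')" unfolding P_def convergent_def comp_def by blast
  qed
  have "P j (diagseq \<circ> (+) (Suc j))" for j
  proof (rule diagseq_holds)
    fix r s :: "nat \<Rightarrow> nat" and n assume r: "strict_mono r" and "P n s"
    thus "P n (s \<circ> r)" unfolding P_def using convergent_subseq_convergent[OF _ r] by (fastforce simp: comp_def)
  qed
  hence c: "convergent (\<lambda>k. measure (M (diagseq k)) (En j))" for j
  proof -
    have "convergent (\<lambda>k. measure (M (diagseq (k + Suc j))) (En j))"
      using \<open>P j (diagseq \<circ> (+) (Suc j))\<close> by (simp add: P_def comp_def add.commute)
    thus ?thesis by (subst (asm) convergent_ignore_initial_segment[where f="\<lambda>k. measure (M (diagseq k)) (En j)"])
  qed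
  show ?thesis
  proof (intro exI[of _ diagseq] conjI subseq_diagseq ballI)
    fix E assume E: "E \<in> local_events"
    obtain j where "E = En j" unfolding En_def using from_nat_into_surj[OF countable_local_events E] by metis
    thus "convergent (\<lambda>k. measure (M (diagseq k)) E)" using c by simp
  qed
qed

lemma escape_local_events:
  assumes "x \<in> X" "finite Y" "Y \<subseteq> X"
  shows "{\<sigma> \<in> Perms X. \<sigma> x \<notin> Y \<or> inv \<sigma> x \<notin> Y} \<in> local_events"
proof -
  define Q where "Q = {x} \<times> Y \<union> Y \<times> {x}"
  have "\<sigma> x \<in> Y \<longleftrightarrow> hits Q \<sigma> \<inter> {x} \<times> Y \<noteq> {}" "inv \<sigma> x \<in> Y \<longleftrightarrow> hits Q \<sigma> \<inter> Y \<times> {x} \<noteq> {}" if "\<sigma> \<in> Perms X" for \<sigma>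
  proof -
    show "\<sigma> x \<in> Y \<longleftrightarrow> hits Q \<sigma> \<inter> {x} \<times> Y \<noteq> {}" by (auto simp: hits_def Q_def)
    have "inv \<sigma> x \<in> Y \<longleftrightarrow> (\<exists>y\<in>Y. \<sigma> y = x)" using Perms_inv_eq_iff[OF that, of x] by metis
    thus "inv \<sigma> x \<in> Y \<longleftrightarrow> hits Q \<sigma> \<inter> Y \<times> {x} \<noteq> {}" by (auto simp: hits_def Q_def)
  qed
  hence "determined Q {\<sigma> \<in> Perms X. \<sigma> x \<notin> Y \<or> inv \<sigma> x \<notin> Y}" unfolding determined_def by auto
  thus ?thesis unfolding local_events_def using assms by (intro CollectI conjI exI[of _ Q]) (auto simp: Q_def)
qed

text \<open>Along a diagonal subsequence the probabilities of the countably many local events converge. Their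
  limits form a finitely additive set function. By tightness, a decreasing sequence of local events
  whose limiting probabilities stay above \<open>\<epsilon>\<close> contains configurations to which
  \<open>compact_intersection\<close> applies, so it has nonempty intersection. Thus the set
  function is continuous at the empty set and extends to a measure.\<close>

lemma tight_limit_measure:
  fixes M :: "nat \<Rightarrow> (real \<Rightarrow> real) measure"
  assumes p: "\<And>k. prob_space (M k)" and sets: "\<And>k. sets (M k) = sets (perm_borel X)"
    and tight: "\<And>x \<epsilon>. x \<in> X \<Longrightarrow> \<epsilon> > 0 \<Longrightarrow> \<exists>Y. finite Y \<and> Y \<subseteq> X \<and>
      eventually (\<lambda>k. measure (M k) {\<sigma> \<in> Perms X. \<sigma> x \<notin> Y \<or> inv \<sigma> x \<notin> Y} \<le> \<epsilon>) sequentially"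
  shows "\<exists>r \<mu>. strict_mono r \<and> sets \<mu> = sets (perm_borel X) \<and> prob_space \<mu> \<and>
    (\<forall>E\<in>local_events. (\<lambda>k. measure (M (r k)) E) \<longlonglongrightarrow> measure \<mu> E)"
proof -
  obtain r where r: "strict_mono r" "\<forall>E\<in>local_events. convergent (\<lambda>k. measure (M (r k)) E)"
    using convergent_subsequence_local_events[of M, OF p] by (elim exE conjE)
  define f where "f E = lim (\<lambda>k. measure (M (r k)) E)" for E
  have f: "(\<lambda>k. measure (M (r k)) E) \<longlonglongrightarrow> f E" if "E \<in> local_events" for E
    using r(2) that unfolding f_def convergent_LIMSEQ_iff by blast
  have sp: "space (M k) = Perms X" for k using sets_eq_imp_space_eq[OF sets] by simp
  have Ls: "E \<in> local_events \<Longrightarrow> E \<in> sets (M k)" for E k using local_events_sets sets by simp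
  interpret alg: algebra "Perms X" local_events by (rule algebra_local_events)
  have f0: "f E \<ge> 0" if "E \<in> local_events" for E by (rule LIMSEQ_le_const[OF f[OF that]]) simp
  have f1: "f (Perms X) = 1"
  proof -
    have "measure (M (r k)) (Perms X) = 1" for k using prob_space.prob_space[OF p, of "r k"] unfolding sp .
    hence "(\<lambda>k. measure (M (r k)) (Perms X)) \<longlonglongrightarrow> 1" by simp
    thus ?thesis using f[OF local_events_Perms] LIMSEQ_unique by blast
  qed
  have fe: "f {} = 0" using LIMSEQ_unique[OF f[OF alg.empty_sets]] by simp
  have add: "f (A \<union> B) = f A + f B" if "A \<in> local_events" "B \<in> local_events" "A \<inter> B = {}" for A B
  proof -
    have m: "measure (M (r k)) (A \<union> B) = measure (M (r k)) A + measure (M (r k)) B" for k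
      using finite_measure.finite_measure_Union[OF prob_space.finite_measure[OF p] Ls Ls] that by blast
    have "(\<lambda>k. measure (M (r k)) (A \<union> B)) \<longlonglongrightarrow> f A + f B"
      unfolding m using that f by (intro tendsto_add) auto
    thus ?thesis using f[OF alg.Un[OF that(1,2)]] LIMSEQ_unique by blast
  qed
  have cont: "(\<lambda>i. f (A i)) \<longlonglongrightarrow> 0" if A: "range A \<subseteq> local_events" "decseq A" "(\<Inter>i. A i) = {}" for A
  proof (rule ccontr)
    assume nz: "\<not> (\<lambda>i. f (A i)) \<longlonglongrightarrow> 0"
    have AL: "A i \<in> local_events" for i using A(1) by auto
    have fmono: "f (A j) \<le> f (A i)" if "i \<le> j" for i j
    proof (rule LIMSEQ_le[OF f[OF AL] f[OF AL]])
      have "A j \<subseteq> A i" using decseqD[OF A(2) that] .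
      from finite_measure.finite_measure_mono[OF prob_space.finite_measure[OF p] this Ls[OF AL]]
      show "\<exists>N. \<forall>k\<ge>N. measure (M (r k)) (A j) \<le> measure (M (r k)) (A i)"
        by blast
    qed
    have "\<exists>\<epsilon>>0. \<forall>i. \<epsilon> \<le> f (A i)"
    proof (rule ccontr)
      assume n: "\<not> ?thesis"
      have "(\<lambda>i. f (A i)) \<longlonglongrightarrow> 0"
      proof (rule LIMSEQ_I)
        fix \<epsilon> :: real assume "\<epsilon> > 0"
        then obtain i where "f (A i) < \<epsilon>" using n by (meson not_le)
        hence "norm (f (A j) - 0) < \<epsilon>" if "j \<ge> i" for j using fmono[OF that] f0[OF AL, of j] by simp
        thus "\<exists>no. \<forall>n\<ge>no. norm (f (A n) - 0) < \<epsilon>" by blast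
      qed
      thus False using nz by simp
    qed
    then obtain \<epsilon> where \<epsilon>: "\<epsilon> > 0" "\<And>i. \<epsilon> \<le> f (A i)" by blast
    define x where "x j = pt (int_decode j)" for j
    have xX: "x j \<in> X" for j by (simp add: x_def pt)
    have "\<exists>Y. finite Y \<and> Y \<subseteq> X \<and>
      eventually (\<lambda>k. measure (M k) {\<sigma> \<in> Perms X. \<sigma> (x j) \<notin> Y \<or> inv \<sigma> (x j) \<notin> Y} \<le> \<epsilon> / 4 * (1/2) ^ j) sequentially" for j
      by (rule tight[OF xX]) (use \<epsilon> in simp)
    hence "\<forall>j. \<exists>Y. finite Y \<and> Y \<subseteq> X \<and>
      eventually (\<lambda>k. measure (M k) {\<sigma> \<in> Perms X. \<sigma> (x j) \<notin> Y \<or> inv \<sigma> (x j) \<notin> Y} \<le> \<epsilon> / 4 * (1/2) ^ j) sequentially" ..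
    from choice[OF this] obtain Y where YY: "\<forall>j. finite (Y j) \<and> Y j \<subseteq> X \<and>
      eventually (\<lambda>k. measure (M k) {\<sigma> \<in> Perms X. \<sigma> (x j) \<notin> Y j \<or> inv \<sigma> (x j) \<notin> Y j} \<le> \<epsilon> / 4 * (1/2) ^ j) sequentially" ..
    have Y: "finite (Y j)" "Y j \<subseteq> X"
      "eventually (\<lambda>k. measure (M k) {\<sigma> \<in> Perms X. \<sigma> (x j) \<notin> Y j \<or> inv \<sigma> (x j) \<notin> Y j} \<le> \<epsilon> / 4 * (1/2) ^ j) sequentially" for j
      using YY[rule_format, of j] by simp_all
    define bad where "bad j = {\<sigma> \<in> Perms X. \<sigma> (x j) \<notin> Y j \<or> inv \<sigma> (x j) \<notin> Y j}" for j
    have bL: "bad j \<in> local_events" for j unfolding bad_def by (rule escape_local_events[OF xX Y(1,2)])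
    have ev: "eventually (\<lambda>k. measure (M (r k)) (bad j) \<le> \<epsilon> / 4 * (1/2) ^ j) sequentially" for j
      unfolding bad_def by (rule eventually_comp_strict_mono[OF Y(3) r(1)])
    \<comment> \<open>The bad events have total probability at most \<open>\<epsilon> / 2\<close>, less than that of
      \<open>A i\<close>.\<close>
    have "\<exists>\<sigma>. \<sigma> \<in> A i \<and> \<sigma> \<notin> (\<Union>j<i. bad j)" for i
    proof (rule ccontr)
      assume "\<not> ?thesis"
      hence sub: "A i \<subseteq> (\<Union>j<i. bad j)" by blast
      have "eventually (\<lambda>k. \<forall>j\<in>{..<i}. measure (M (r k)) (bad j) \<le> \<epsilon> / 4 * (1/2) ^ j) sequentially"
        by (rule eventually_ball_finite) (use ev in auto)
      hence "eventually (\<lambda>k. measure (M (r k)) (A i) \<le> \<epsilon> / 2) sequentially"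
      proof eventually_elim
        case (elim k)
        interpret Mk: prob_space "M (r k)" by (rule p)
        have "measure (M (r k)) (A i) \<le> measure (M (r k)) (\<Union>j<i. bad j)"
          by (rule Mk.finite_measure_mono[OF sub]) (use Ls[OF bL] in auto)
        also have "\<dots> \<le> (\<Sum>j<i. measure (M (r k)) (bad j))"
          by (rule Mk.finite_measure_subadditive_finite) (use Ls[OF bL] in auto)
        also have "\<dots> \<le> (\<Sum>j<i. \<epsilon> / 4 * (1/2) ^ j)" by (rule sum_mono) (use elim in auto)
        also have "\<dots> = \<epsilon> / 4 * (\<Sum>j<i. (1/2) ^ j)" by (simp add: sum_distrib_left)
        also have "\<dots> \<le> \<epsilon> / 4 * 2"
        proof (rule mult_left_mono)
          have "(\<Sum>j<i. (1/2::real) ^ j) = 2 - 2 * (1/2) ^ i" by (induction i) auto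
          thus "(\<Sum>j<i. (1/2::real) ^ j) \<le> 2" by simp
        qed (use \<epsilon>(1) in simp)
        finally show ?case by simp
      qed
      then obtain N where N: "\<forall>k\<ge>N. measure (M (r k)) (A i) \<le> \<epsilon> / 2" by (auto simp: eventually_sequentially)
      have "f (A i) \<le> \<epsilon> / 2" by (rule LIMSEQ_le_const2[OF f[OF AL]]) (use N in blast)
      thus False using \<epsilon>(1) \<epsilon>(2)[of i] by simp
    qed
    then obtain \<sigma> where s: "\<And>i. \<sigma> i \<in> A i" "\<And>i. \<sigma> i \<notin> (\<Union>j<i. bad j)" by metis
    have "(\<Inter>i. A i) \<noteq> {}"
    proof (rule compact_intersection[OF AL A(2) s(1)])
      fix z assume "z \<in> X"
      then obtain i where "z = pt i" unfolding in_X_iff by (elim exE)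
      hence z: "z = x (int_encode i)" by (simp add: x_def)
      show "\<exists>Y. finite Y \<and> eventually (\<lambda>i. \<sigma> i z \<in> Y \<and> inv (\<sigma> i) z \<in> Y) sequentially"
      proof (intro exI[of _ "Y (int_encode i)"] conjI Y(1))
        have "\<sigma> k z \<in> Y (int_encode i) \<and> inv (\<sigma> k) z \<in> Y (int_encode i)" if "k \<ge> Suc (int_encode i)" for k
        proof -
          have "\<sigma> k \<in> Perms X" using s(1)[of k] AL[of k] by (auto simp: local_events_def)
          moreover have "\<sigma> k \<notin> bad (int_encode i)" using s(2)[of k] that by auto
          ultimately show ?thesis unfolding z bad_def by blast
        qed
        thus "eventually (\<lambda>k. \<sigma> k z \<in> Y (int_encode i) \<and> inv (\<sigma> k) z \<in> Y (int_encode i)) sequentially"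
          by (auto simp: eventually_sequentially)
      qed
    qed
    thus False using A(3) by simp
  qed
  have "\<exists>\<mu>0 :: (real \<Rightarrow> real) set \<Rightarrow> ennreal. (\<forall>s\<in>local_events. \<mu>0 s = ennreal (f s)) \<and> measure_space (Perms X) (sigma_sets (Perms X) local_events) \<mu>0"
  proof (rule alg.caratheodory_empty_continuous)
    show "positive local_events (\<lambda>E. ennreal (f E))" using fe by (simp add: positive_def)
    show "additive local_events (\<lambda>E. ennreal (f E))"
      unfolding additive_def using add f0 by (auto simp: ennreal_plus[symmetric] simp del: ennreal_plus)
    fix A :: "nat \<Rightarrow> (real \<Rightarrow> real) set" assume "range A \<subseteq> local_events" "decseq A" "(\<Inter>i. A i) = {}"
    from tendsto_ennrealI[OF cont[OF this]] show "(\<lambda>i. ennreal (f (A i))) \<longlonglongrightarrow> 0" by simp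
  qed simp
  then obtain \<mu>0 where m0: "\<forall>s\<in>local_events. \<mu>0 s = ennreal (f s)" "measure_space (Perms X) (sigma_sets (Perms X) local_events) \<mu>0" by blast
  define \<mu> where "\<mu> = measure_of (Perms X) (sigma_sets (Perms X) local_events) \<mu>0"
  have LP: "local_events \<subseteq> Pow (Perms X)" by (auto simp: local_events_def)
  interpret sa: sigma_algebra "Perms X" "sigma_sets (Perms X) local_events" by (rule sigma_algebra_sigma_sets[OF LP])
  have sm: "sets \<mu> = sets (perm_borel X)" unfolding \<mu>_def sets_perm by (rule sa.sets_measure_of_eq)
  have em: "emeasure \<mu> E = \<mu>0 E" if "E \<in> sigma_sets (Perms X) local_events" for E
    unfolding \<mu>_def by (rule emeasure_measure_of_sigma) (use m0(2) that in \<open>auto simp: measure_space_def\<close>)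
  have eL: "emeasure \<mu> E = ennreal (f E)" if "E \<in> local_events" for E using em[of E] m0(1) that by auto
  have "prob_space \<mu>"
  proof
    have "space \<mu> = Perms X" using sets_eq_imp_space_eq[OF sm] by simp
    thus "emeasure \<mu> (space \<mu>) = 1" using eL[OF local_events_Perms] f1 by simp
  qed
  moreover have "(\<lambda>k. measure (M (r k)) E) \<longlonglongrightarrow> measure \<mu> E" if "E \<in> local_events" for E
    using f[OF that] eL[OF that] f0[OF that] by (simp add: measure_def)
  ultimately show ?thesis using r(1) sm by blast
qed

end

section \<open>Limits of specifications\<close>

context permutation_gas
begin

text \<open>Put \<open>x\<close> between two good midpoints \<open>a\<close> and \<open>b\<close>. A long jump
  from or to \<open>x\<close> crosses one of them and leaves its window.\<close>

lemma spec_tight: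
  assumes "\<eta> \<in> Perms X" "flow X \<eta> = Fin n" "incseq \<Lambda>" "\<And>k. finite (\<Lambda> k)" "(\<Union>k. \<Lambda> k) = X"
    "c \<ge> 1" "bi_infinite {a. good_pt c n a}" "x \<in> X" "\<epsilon> > 0"
  shows "\<exists>Y. finite Y \<and> Y \<subseteq> X \<and>
    eventually (\<lambda>k. measure (spec X V (\<Lambda> k) \<eta>) {\<sigma> \<in> Perms X. \<sigma> x \<notin> Y \<or> inv \<sigma> x \<notin> Y} \<le> \<epsilon>) sequentially"
proof -
  have cfg: "admissible (\<Lambda> k) \<eta>" for k using assms(1,4,5) unfolding admissible_def by blast
  obtain T where T: "T \<ge> reach c n" and Tp: "\<forall>a \<Lambda> \<eta>. admissible \<Lambda> \<eta> \<longrightarrow> good_pt c n a \<longrightarrow> flow X \<eta> = Fin n \<longrightarrow>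
    suitable a (reach c n) \<Lambda> \<eta> \<longrightarrow> gibbs_prob \<Lambda> \<eta> {\<sigma>. \<not> tight a T \<sigma>} \<le> \<epsilon> / 2"
    using gibbs_prob_not_tight_le[OF assms(6), of "\<epsilon>/2" n] assms(9) by auto
  have T0: "T \<ge> 0" using T assms(6) by (auto simp: reach_def intro: order_trans[rotated])
  obtain a where a: "good_pt c n a" "a < x"
    using infinite_imp_nonempty[OF infinite_halves(1)[OF assms(7), of x]] by blast
  obtain b where b: "good_pt c n b" "x < b"
    using infinite_imp_nonempty[OF infinite_halves(2)[OF assms(7), of x]] by blast
  define Y where "Y = X \<inter> {a - T..b + T}"
  have Y: "finite Y" "Y \<subseteq> X" unfolding Y_def using finite_Icc by auto
  have inY: "\<sigma> x \<in> Y" if s: "\<sigma> \<in> Perms X" "tight a T \<sigma>" "tight b T \<sigma>" for \<sigma>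
  proof -
    have X: "\<sigma> x \<in> X" using Perms_mem[OF s(1)] assms(8) by simp
    have "\<sigma> x \<le> b + T"
    proof (cases "b < \<sigma> x")
      case True
      hence "crosses b x (\<sigma> x)" using b by (simp add: crosses_def)
      from tightD(2)[OF s(3) assms(8) this] show ?thesis by simp
    qed (use T0 in simp)
    moreover have "a - T \<le> \<sigma> x"
    proof (cases "\<sigma> x < a")
      case True
      hence "crosses a x (\<sigma> x)" using a by (simp add: crosses_def)
      from tightD(2)[OF s(2) assms(8) this] show ?thesis by simp
    qed (use T0 in simp)
    ultimately show ?thesis using X by (simp add: Y_def)
  qed
  have ev: "eventually (\<lambda>k. suitable a (reach c n) (\<Lambda> k) \<eta>) sequentially" if "good_pt c n a" for a
    by (rule eventually_suitable[OF assms(3,5,1,2) good_ptD(1)[OF that]])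
  have "eventually (\<lambda>k. measure (spec X V (\<Lambda> k) \<eta>) {\<sigma> \<in> Perms X. \<sigma> x \<notin> Y \<or> inv \<sigma> x \<notin> Y} \<le> \<epsilon>) sequentially"
    using ev[OF a(1)] ev[OF b(1)]
  proof eventually_elim
    case (elim k)
    have "measure (spec X V (\<Lambda> k) \<eta>) {\<sigma> \<in> Perms X. \<sigma> x \<notin> Y \<or> inv \<sigma> x \<notin> Y}
      = gibbs_prob (\<Lambda> k) \<eta> {\<sigma> \<in> Perms X. \<sigma> x \<notin> Y \<or> inv \<sigma> x \<notin> Y}"
      by (rule measure_spec[OF cfg local_events_sets[OF escape_local_events[OF assms(8) Y]]])
    also have "\<dots> \<le> gibbs_prob (\<Lambda> k) \<eta> ({\<sigma>. \<not> tight a T \<sigma>} \<union> {\<sigma>. \<not> tight b T \<sigma>})"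
      by (rule gibbs_prob_mono[OF cfg]) (use inY inY[OF Perms_inv tight_inv tight_inv] in auto)
    also have "\<dots> \<le> gibbs_prob (\<Lambda> k) \<eta> {\<sigma>. \<not> tight a T \<sigma>} + gibbs_prob (\<Lambda> k) \<eta> {\<sigma>. \<not> tight b T \<sigma>}" by (rule gibbs_prob_Un[OF cfg])
    also have "\<dots> \<le> \<epsilon> / 2 + \<epsilon> / 2"
      by (intro add_mono Tp[rule_format] cfg a(1) b(1) assms(2) elim)
    finally show ?case by simp
  qed
  thus ?thesis using Y by blast
qed

text \<open>The jumps that the smaller volume does not control are the same in \<open>\<sigma>\<close> and
  \<open>\<tau>\<close>.\<close>

lemma hamiltonian_local:
  assumes "\<tau> \<in> Perms X" "\<Lambda> \<subseteq> X" "finite \<Lambda>" "\<Lambda>0 \<subseteq> \<Lambda>" "\<sigma> \<in> resample X \<Lambda>0 \<tau>"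
  shows "hamiltonian V \<Lambda> \<sigma> + hamiltonian V \<Lambda>0 \<tau> = hamiltonian V \<Lambda> \<tau> + hamiltonian V \<Lambda>0 \<sigma>"
proof -
  let ?A = "movable \<Lambda>0 \<tau>" and ?B = "movable \<Lambda> \<tau>"
  have L0: "\<Lambda>0 \<subseteq> X" using assms by blast
  have AB: "?A \<subseteq> ?B" using assms(4) by (auto simp: movable_def)
  have f: "finite ?B" using assms(3) by (simp add: movable_def)
  have d: "(\<Sum>x\<in>?B. g x) = (\<Sum>x\<in>?B - ?A. g x) + (\<Sum>x\<in>?A. g x)" for g :: "real \<Rightarrow> real"
    by (rule sum.subset_diff[OF AB f])
  have "(\<Sum>x\<in>?B - ?A. V (\<sigma> x - x)) = (\<Sum>x\<in>?B - ?A. V (\<tau> x - x))"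
    using assms(5) resample_iff[OF assms(1) L0] by (intro sum.cong) auto
  thus ?thesis
    unfolding hamiltonian_movable resample_movable[OF assms(5,1) L0] resample_movable[OF resample_mono[OF assms(4,5)] assms(1,2)] d
    by simp
qed

text \<open>Interchange the two sums: \<open>\<tau>\<close> is a resampling of \<open>\<sigma>\<close> in
  \<open>\<Lambda>0\<close> if and only if \<open>\<sigma>\<close> is one of \<open>\<tau>\<close>,
  the two then have the same partition function in \<open>\<Lambda>0\<close>, and by
  \<open>hamiltonian_local\<close> the weights may be traded.\<close>

lemma gibbs_prob_consistent:
  assumes "admissible \<Lambda> \<eta>" "\<Lambda>0 \<subseteq> \<Lambda>"
  shows "(\<Sum>\<sigma>\<in>resample X \<Lambda> \<eta>. weight \<Lambda> \<sigma> * gibbs_prob \<Lambda>0 \<sigma> A) = (\<Sum>\<sigma>\<in>resample X \<Lambda> \<eta> \<inter> A. weight \<Lambda> \<sigma>)"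
proof -
  have C: "\<eta> \<in> Perms X" "\<Lambda> \<subseteq> X" "finite \<Lambda>" using assms(1) by (auto simp: admissible_def)
  let ?S = "resample X \<Lambda> \<eta>"
  define Z where "Z \<sigma> = (\<Sum>\<rho>\<in>resample X \<Lambda>0 \<sigma>. weight \<Lambda>0 \<rho>)" for \<sigma>
  have c0: "admissible \<Lambda>0 \<sigma>" if "\<sigma> \<in> ?S" for \<sigma> 
    using C assms(2) finite_subset resample_Perms[OF that] unfolding admissible_def by blast
  have sub: "resample X \<Lambda>0 \<sigma> \<subseteq> ?S" if "\<sigma> \<in> ?S" for \<sigma>
    using resample_mono[OF assms(2)] resample_eq[OF that] by blast
  have fS: "finite ?S" by (rule fin_resample[OF assms(1)])
  have p: "gibbs_prob \<Lambda>0 \<sigma> A = (\<Sum>\<tau>\<in>?S \<inter> A. if \<tau> \<in> resample X \<Lambda>0 \<sigma> then weight \<Lambda>0 \<tau> / Z \<sigma> else 0)" if "\<sigma> \<in> ?S" for \<sigma>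
  proof -
    have "?S \<inter> A \<inter> resample X \<Lambda>0 \<sigma> = resample X \<Lambda>0 \<sigma> \<inter> A" using sub[OF that] by blast
    thus ?thesis unfolding gibbs_prob_def Z_def[symmetric] using fS
      by (simp add: sum.If_cases sum_divide_distrib)
  qed
  have key: "weight \<Lambda> \<sigma> * (weight \<Lambda>0 \<tau> / Z \<sigma>) = weight \<Lambda> \<tau> * (weight \<Lambda>0 \<sigma> / Z \<tau>)" if "\<sigma> \<in> ?S" "\<tau> \<in> resample X \<Lambda>0 \<sigma>" for \<sigma> \<tau>
  proof -
    have "Z \<sigma> = Z \<tau>" unfolding Z_def using resample_eq[OF that(2)] by simp
    moreover have "hamiltonian V \<Lambda> \<tau> + hamiltonian V \<Lambda>0 \<sigma> = hamiltonian V \<Lambda> \<sigma> + hamiltonian V \<Lambda>0 \<tau>"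
      by (rule hamiltonian_local[OF resample_Perms[OF that(1)] C(2,3) assms(2) that(2)])
    hence "weight \<Lambda> \<sigma> * weight \<Lambda>0 \<tau> = weight \<Lambda> \<tau> * weight \<Lambda>0 \<sigma>" unfolding weight_def exp_add[symmetric] by simp
    ultimately show ?thesis by simp
  qed
  have "(\<Sum>\<sigma>\<in>?S. weight \<Lambda> \<sigma> * gibbs_prob \<Lambda>0 \<sigma> A) = (\<Sum>\<sigma>\<in>?S. \<Sum>\<tau>\<in>?S \<inter> A. if \<tau> \<in> resample X \<Lambda>0 \<sigma> then weight \<Lambda> \<sigma> * (weight \<Lambda>0 \<tau> / Z \<sigma>) else 0)"
    by (rule sum.cong) (auto simp: p sum_distrib_left intro!: sum.cong)
  also have "\<dots> = (\<Sum>\<tau>\<in>?S \<inter> A. \<Sum>\<sigma>\<in>?S. if \<tau> \<in> resample X \<Lambda>0 \<sigma> then weight \<Lambda> \<sigma> * (weight \<Lambda>0 \<tau> / Z \<sigma>) else 0)"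
    by (rule sum.swap)
  also have "\<dots> = (\<Sum>\<tau>\<in>?S \<inter> A. weight \<Lambda> \<tau>)"
  proof (rule sum.cong[OF refl])
    fix \<tau> assume t: "\<tau> \<in> ?S \<inter> A"
    have "(\<Sum>\<sigma>\<in>?S. if \<tau> \<in> resample X \<Lambda>0 \<sigma> then weight \<Lambda> \<sigma> * (weight \<Lambda>0 \<tau> / Z \<sigma>) else 0)
      = (\<Sum>\<sigma>\<in>?S. if \<sigma> \<in> resample X \<Lambda>0 \<tau> then weight \<Lambda> \<tau> * (weight \<Lambda>0 \<sigma> / Z \<tau>) else 0)"
    proof (rule sum.cong[OF refl])
      fix \<sigma> assume s: "\<sigma> \<in> ?S"
      have "\<tau> \<in> resample X \<Lambda>0 \<sigma> \<longleftrightarrow> \<sigma> \<in> resample X \<Lambda>0 \<tau>" using resample_sym resample_Perms s t by blast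
      thus "(if \<tau> \<in> resample X \<Lambda>0 \<sigma> then weight \<Lambda> \<sigma> * (weight \<Lambda>0 \<tau> / Z \<sigma>) else 0) =
        (if \<sigma> \<in> resample X \<Lambda>0 \<tau> then weight \<Lambda> \<tau> * (weight \<Lambda>0 \<sigma> / Z \<tau>) else 0)" using key[OF s] by (intro if_cong) auto
    qed
    also have "\<dots> = (\<Sum>\<sigma>\<in>resample X \<Lambda>0 \<tau>. weight \<Lambda> \<tau> * (weight \<Lambda>0 \<sigma> / Z \<tau>))"
    proof -
      have "?S \<inter> resample X \<Lambda>0 \<tau> = resample X \<Lambda>0 \<tau>" using sub t by blast
      thus ?thesis using fS by (simp add: sum.If_cases)
    qed
    also have "\<dots> = weight \<Lambda> \<tau> * (Z \<tau> / Z \<tau>)"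
      by (simp only: sum_distrib_left[symmetric] sum_divide_distrib[symmetric] Z_def)
    also have "\<dots> = weight \<Lambda> \<tau>" using Z_pos[OF c0, of \<tau>] t unfolding Z_def by simp
    finally show "(\<Sum>\<sigma>\<in>?S. if \<tau> \<in> resample X \<Lambda>0 \<sigma> then weight \<Lambda> \<sigma> * (weight \<Lambda>0 \<tau> / Z \<sigma>) else 0) = weight \<Lambda> \<tau>" .
  qed
  finally show ?thesis .
qed

lemma gibbs_prob_cells:
  assumes "admissible \<Lambda> \<eta>" "finite Q"
    "\<And>\<sigma> \<tau>. \<sigma> \<in> Perms X \<Longrightarrow> \<tau> \<in> Perms X \<Longrightarrow> hits Q \<sigma> = hits Q \<tau> \<Longrightarrow> h \<sigma> = h \<tau>"
  shows "(\<Sum>R\<in>Pow Q. h (SOME \<sigma>. \<sigma> \<in> cell Q R) * gibbs_prob \<Lambda> \<eta> (cell Q R)) =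
    (\<Sum>\<sigma>\<in>resample X \<Lambda> \<eta>. weight \<Lambda> \<sigma> * h \<sigma>) / (\<Sum>\<sigma>\<in>resample X \<Lambda> \<eta>. weight \<Lambda> \<sigma>)"
proof -
  let ?S = "resample X \<Lambda> \<eta>"
  define Z where "Z = (\<Sum>\<sigma>\<in>?S. weight \<Lambda> \<sigma>)"
  have fS: "finite ?S" by (rule fin_resample[OF assms(1)])
  have rep: "h (SOME \<tau>. \<tau> \<in> cell Q R) = h \<sigma>" if "\<sigma> \<in> cell Q R" "R \<subseteq> Q" for \<sigma> R
  proof (rule assms(3))
    have s: "(SOME \<tau>. \<tau> \<in> cell Q R) \<in> cell Q R"
      using that(1) by (rule someI[where P="\<lambda>\<tau>. \<tau> \<in> cell Q R"])
    show "(SOME \<tau>. \<tau> \<in> cell Q R) \<in> Perms X" "\<sigma> \<in> Perms X" using s that by (auto simp: cell_def)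
    show "hits Q (SOME \<tau>. \<tau> \<in> cell Q R) = hits Q \<sigma>" using hits_cell[OF s that(2)] hits_cell[OF that] by simp
  qed
  have "(\<Sum>R\<in>Pow Q. h (SOME \<sigma>. \<sigma> \<in> cell Q R) * gibbs_prob \<Lambda> \<eta> (cell Q R)) =
    (\<Sum>R\<in>Pow Q. \<Sum>\<sigma>\<in>{\<sigma>\<in>?S. hits Q \<sigma> = R}. weight \<Lambda> \<sigma> * h \<sigma> / Z)"
  proof (rule sum.cong[OF refl])
    fix R assume "R \<in> Pow Q"
    hence R: "R \<subseteq> Q" by simp
    have e: "?S \<inter> cell Q R = {\<sigma>\<in>?S. hits Q \<sigma> = R}"
      using hits_cell[OF _ R] cell_eq[of Q] resample_Perms by blast
    have "h (SOME \<sigma>. \<sigma> \<in> cell Q R) * gibbs_prob \<Lambda> \<eta> (cell Q R) = (\<Sum>\<sigma>\<in>?S \<inter> cell Q R. h (SOME \<sigma>. \<sigma> \<in> cell Q R) * (weight \<Lambda> \<sigma> / Z))"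
      unfolding gibbs_prob_def Z_def[symmetric] sum_divide_distrib sum_distrib_left ..
    also have "\<dots> = (\<Sum>\<sigma>\<in>?S \<inter> cell Q R. weight \<Lambda> \<sigma> * h \<sigma> / Z)" by (rule sum.cong) (auto simp: rep[OF _ R])
    finally show "h (SOME \<sigma>. \<sigma> \<in> cell Q R) * gibbs_prob \<Lambda> \<eta> (cell Q R) = (\<Sum>\<sigma>\<in>{\<sigma>\<in>?S. hits Q \<sigma> = R}. weight \<Lambda> \<sigma> * h \<sigma> / Z)" unfolding e .
  qed
  also have "\<dots> = (\<Sum>\<sigma>\<in>?S. weight \<Lambda> \<sigma> * h \<sigma> / Z)"
    by (rule sum.group[OF fS]) (use assms(2) in \<open>auto simp: hits_def\<close>)
  finally show ?thesis by (simp add: sum_divide_distrib Z_def)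
qed

text \<open>A function of finitely many local questions takes one value on each of the finitely many cells, so
  its integral is a combination of probabilities of local events and passes to limits.\<close>

lemma nn_integral_cells:
  fixes h :: "(real \<Rightarrow> real) \<Rightarrow> real"
  assumes "sets \<mu> = sets (perm_borel X)" "finite Q" "Q \<subseteq> X \<times> X"
    "\<And>\<sigma> \<tau>. \<sigma> \<in> Perms X \<Longrightarrow> \<tau> \<in> Perms X \<Longrightarrow> hits Q \<sigma> = hits Q \<tau> \<Longrightarrow> h \<sigma> = h \<tau>"
  shows "(\<integral>\<^sup>+\<sigma>. ennreal (h \<sigma>) \<partial>\<mu>) = (\<Sum>R\<in>Pow Q. ennreal (h (SOME \<sigma>. \<sigma> \<in> cell Q R)) * emeasure \<mu> (cell Q R))"
proof -
  have sp: "space \<mu> = Perms X" using sets_eq_imp_space_eq[OF assms(1)] by simp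
  have cs: "cell Q R \<in> sets \<mu>" for R using local_events_sets[OF cell_local_events[OF assms(2,3)]] assms(1) by simp
  have "(\<integral>\<^sup>+\<sigma>. ennreal (h \<sigma>) \<partial>\<mu>) = (\<integral>\<^sup>+\<sigma>. (\<Sum>R\<in>Pow Q. ennreal (h (SOME \<sigma>. \<sigma> \<in> cell Q R)) * indicator (cell Q R) \<sigma>) \<partial>\<mu>)"
  proof (rule nn_integral_cong)
    fix \<sigma> assume "\<sigma> \<in> space \<mu>"
    hence s: "\<sigma> \<in> Perms X" using sp by simp
    have c: "\<sigma> \<in> cell Q (hits Q \<sigma>)" using s unfolding cell_eq by simp
    have "(\<Sum>R\<in>Pow Q. ennreal (h (SOME \<sigma>. \<sigma> \<in> cell Q R)) * indicator (cell Q R) \<sigma>)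
      = (\<Sum>R\<in>{hits Q \<sigma>}. ennreal (h (SOME \<sigma>. \<sigma> \<in> cell Q R)) * indicator (cell Q R) \<sigma>)"
    proof (rule sum.mono_neutral_right)
      show "\<forall>R\<in>Pow Q - {hits Q \<sigma>}. ennreal (h (SOME \<sigma>. \<sigma> \<in> cell Q R)) * indicator (cell Q R) \<sigma> = 0"
        using hits_cell[of \<sigma> Q] by (auto simp: indicator_def)
    qed (use assms(2) in \<open>auto simp: hits_def\<close>)
    also have "\<dots> = ennreal (h (SOME \<tau>. \<tau> \<in> cell Q (hits Q \<sigma>)))" using c by simp
    also have "h (SOME \<tau>. \<tau> \<in> cell Q (hits Q \<sigma>)) = h \<sigma>"
    proof (rule assms(4)[OF _ s])
      have "(SOME \<tau>. \<tau> \<in> cell Q (hits Q \<sigma>)) \<in> cell Q (hits Q \<sigma>)"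
        using c by (rule someI[where P="\<lambda>\<tau>. \<tau> \<in> cell Q (hits Q \<sigma>)"])
      thus "(SOME \<tau>. \<tau> \<in> cell Q (hits Q \<sigma>)) \<in> Perms X" "hits Q (SOME \<tau>. \<tau> \<in> cell Q (hits Q \<sigma>)) = hits Q \<sigma>"
        unfolding cell_eq by auto
    qed
    finally show "ennreal (h \<sigma>) = (\<Sum>R\<in>Pow Q. ennreal (h (SOME \<sigma>. \<sigma> \<in> cell Q R)) * indicator (cell Q R) \<sigma>)" by simp
  qed
  also have "\<dots> = (\<Sum>R\<in>Pow Q. ennreal (h (SOME \<sigma>. \<sigma> \<in> cell Q R)) * emeasure \<mu> (cell Q R))"
    using cs by (subst nn_integral_sum) (auto intro!: sum.cong nn_integral_cmult_indicator)
  finally show ?thesis .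
qed

lemma spec_kernel:
  assumes "finite \<Lambda>" "\<Lambda> \<subseteq> X" shows "spec X V \<Lambda> \<in> perm_borel X \<rightarrow>\<^sub>M subprob_algebra (perm_borel X)"
proof (rule measurable_subprob_algebra)
  fix \<eta> assume "\<eta> \<in> space (perm_borel X)"
  hence c: "admissible \<Lambda> \<eta>" using assms by (simp add: admissible_def)
  show "subprob_space (spec X V \<Lambda> \<eta>)" using prob_space_spec[OF c] by (rule prob_space_imp_subprob_space)
  show "sets (spec X V \<Lambda> \<eta>) = sets (perm_borel X)" by simp
next
  fix A assume A: "A \<in> sets (perm_borel X)"
  have "(\<lambda>\<eta>. ennreal (gibbs_prob \<Lambda> \<eta> A)) \<in> borel_measurable (perm_borel X)"
    using measurable_gibbs_prob[OF assms A] by simp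
  thus "(\<lambda>\<eta>. emeasure (spec X V \<Lambda> \<eta>) A) \<in> borel_measurable (perm_borel X)"
    by (rule measurable_cong[THEN iffD1, rotated]) (use emeasure_spec[OF _ A] assms in \<open>auto simp: admissible_def\<close>)
qed

text \<open>Applying the kernel of the specification to \<open>\<mu>\<close> gives a measure that agrees with
  \<open>\<mu>\<close> on the local events, hence everywhere.\<close>

lemma gibbsI:
  assumes "sets \<mu> = sets (perm_borel X)" "prob_space \<mu>"
    "\<And>A \<Lambda>. A \<in> local_events \<Longrightarrow> finite \<Lambda> \<Longrightarrow> \<Lambda> \<subseteq> X \<Longrightarrow> (\<integral>\<^sup>+\<eta>. ennreal (gibbs_prob \<Lambda> \<eta> A) \<partial>\<mu>) = emeasure \<mu> A"
  shows "\<mu> \<in> gibbs X V"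
proof -
  have sp: "space \<mu> = Perms X" using sets_eq_imp_space_eq[OF assms(1)] by simp
  have ne: "space \<mu> \<noteq> {}" using theta_Perms sp by auto
  have "(\<integral>\<^sup>+\<eta>. emeasure (spec X V \<Lambda> \<eta>) A \<partial>\<mu>) = emeasure \<mu> A"
    if A: "A \<in> sets (perm_borel X)" and L: "finite \<Lambda>" "\<Lambda> \<subseteq> X" for A \<Lambda>
  proof -
    have K: "spec X V \<Lambda> \<in> \<mu> \<rightarrow>\<^sub>M subprob_algebra (perm_borel X)"
      using spec_kernel[OF L] measurable_cong_sets[OF assms(1) refl] by blast
    have em: "emeasure (\<mu> \<bind> spec X V \<Lambda>) B = (\<integral>\<^sup>+\<eta>. emeasure (spec X V \<Lambda> \<eta>) B \<partial>\<mu>)" if "B \<in> sets (perm_borel X)" for B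
      by (rule emeasure_bind[OF ne K that])
    have "\<mu> = \<mu> \<bind> spec X V \<Lambda>"
    proof (rule perm_measure_eqI[OF assms(1)])
      show "sets (\<mu> \<bind> spec X V \<Lambda>) = sets (perm_borel X)" by (rule sets_bind) (use ne in auto)
      show "emeasure \<mu> (Perms X) \<noteq> \<infinity>" using prob_space.emeasure_space_1[OF assms(2)] sp by simp
      fix E assume E: "E \<in> local_events"
      have "emeasure \<mu> E = (\<integral>\<^sup>+\<eta>. ennreal (gibbs_prob \<Lambda> \<eta> E) \<partial>\<mu>)" using assms(3)[OF E L] by simp
      also have "\<dots> = (\<integral>\<^sup>+\<eta>. emeasure (spec X V \<Lambda> \<eta>) E \<partial>\<mu>)"
        by (rule nn_integral_cong) (use emeasure_spec[OF _ local_events_sets[OF E]] L sp in \<open>auto simp: admissible_def\<close>)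
      finally show "emeasure \<mu> E = emeasure (\<mu> \<bind> spec X V \<Lambda>) E" using em[OF local_events_sets[OF E]] by simp
    qed
    thus ?thesis using em[OF A] by simp
  qed
  thus ?thesis unfolding gibbs_def using assms(1,2) by blast
qed

text \<open>For large \<open>k\<close> the specification in \<open>\<Lambda> k\<close> is consistent with the
  one in the fixed volume \<open>\<Lambda>0\<close>, and both sides of the consistency equation are
  finite combinations of probabilities of local events.\<close>

lemma limit_gibbs:
  assumes "\<eta> \<in> Perms X" "incseq \<Lambda>" "\<And>k. finite (\<Lambda> k)" "(\<Union>k. \<Lambda> k) = X"
    "sets \<mu> = sets (perm_borel X)" "prob_space \<mu>"
    "\<And>E. E \<in> local_events \<Longrightarrow> (\<lambda>k. gibbs_prob (\<Lambda> k) \<eta> E) \<longlonglongrightarrow> measure \<mu> E"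
  shows "\<mu> \<in> gibbs X V"
proof (rule gibbsI[OF assms(5,6)])
  fix A \<Lambda>0 assume A: "A \<in> local_events" and L: "finite \<Lambda>0" "\<Lambda>0 \<subseteq> X"
  interpret prob_space \<mu> by (rule assms(6))
  have cfg: "admissible (\<Lambda> k) \<eta>" for k using assms(1,3,4) unfolding admissible_def by blast
  obtain Q where Q: "finite Q" "Q \<subseteq> X \<times> X" and h: "\<forall>\<sigma>\<in>Perms X. \<forall>\<tau>\<in>Perms X. hits Q \<sigma> = hits Q \<tau> \<longrightarrow> gibbs_prob \<Lambda>0 \<sigma> A = gibbs_prob \<Lambda>0 \<tau> A"
    using gibbs_prob_local[OF L A] by (elim exE conjE)
  define H where "H \<sigma> = (if \<sigma> \<in> Perms X then gibbs_prob \<Lambda>0 \<sigma> A else 0)" for \<sigma>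
  have H0: "H \<sigma> \<ge> 0" for \<sigma> unfolding H_def using gibbs_prob_nonneg L by (simp add: admissible_def)
  have HQ: "H \<sigma> = H \<tau>" if "\<sigma> \<in> Perms X" "\<tau> \<in> Perms X" "hits Q \<sigma> = hits Q \<tau>" for \<sigma> \<tau>
    unfolding H_def using h[rule_format, OF that] that(1,2) by simp
  let ?r = "\<lambda>R. H (SOME \<sigma>. \<sigma> \<in> cell Q R)"
  have "eventually (\<lambda>k. \<Lambda>0 \<subseteq> \<Lambda> k) sequentially"
    by (rule eventually_superset[OF assms(2) L(1)]) (use L(2) assms(4) in simp)
  hence ev: "eventually (\<lambda>k. (\<Sum>R\<in>Pow Q. ?r R * gibbs_prob (\<Lambda> k) \<eta> (cell Q R)) = gibbs_prob (\<Lambda> k) \<eta> A) sequentially"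
  proof eventually_elim
    case (elim k)
    have "(\<Sum>R\<in>Pow Q. ?r R * gibbs_prob (\<Lambda> k) \<eta> (cell Q R)) =
      (\<Sum>\<sigma>\<in>resample X (\<Lambda> k) \<eta>. weight (\<Lambda> k) \<sigma> * H \<sigma>) / (\<Sum>\<sigma>\<in>resample X (\<Lambda> k) \<eta>. weight (\<Lambda> k) \<sigma>)"
      by (rule gibbs_prob_cells[OF cfg Q(1) HQ])
    also have "(\<Sum>\<sigma>\<in>resample X (\<Lambda> k) \<eta>. weight (\<Lambda> k) \<sigma> * H \<sigma>) = (\<Sum>\<sigma>\<in>resample X (\<Lambda> k) \<eta>. weight (\<Lambda> k) \<sigma> * gibbs_prob \<Lambda>0 \<sigma> A)"
      by (rule sum.cong) (auto simp: H_def resample_Perms)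
    also have "\<dots> = (\<Sum>\<sigma>\<in>resample X (\<Lambda> k) \<eta> \<inter> A. weight (\<Lambda> k) \<sigma>)" by (rule gibbs_prob_consistent[OF cfg elim])
    finally show ?case by (simp add: gibbs_prob_def)
  qed
  have "(\<lambda>k. \<Sum>R\<in>Pow Q. ?r R * gibbs_prob (\<Lambda> k) \<eta> (cell Q R)) \<longlonglongrightarrow> (\<Sum>R\<in>Pow Q. ?r R * measure \<mu> (cell Q R))"
    by (intro tendsto_sum tendsto_mult tendsto_const assms(7) cell_local_events Q)
  hence "(\<lambda>k. gibbs_prob (\<Lambda> k) \<eta> A) \<longlonglongrightarrow> (\<Sum>R\<in>Pow Q. ?r R * measure \<mu> (cell Q R))"
    using tendsto_cong[OF ev] by blast
  hence eq: "(\<Sum>R\<in>Pow Q. ?r R * measure \<mu> (cell Q R)) = measure \<mu> A" using assms(7)[OF A] LIMSEQ_unique by blast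
  have sp: "space \<mu> = Perms X" using sets_eq_imp_space_eq[OF assms(5)] by simp
  have "(\<integral>\<^sup>+\<eta>. ennreal (gibbs_prob \<Lambda>0 \<eta> A) \<partial>\<mu>) = (\<integral>\<^sup>+\<eta>. ennreal (H \<eta>) \<partial>\<mu>)"
    by (rule nn_integral_cong) (simp add: H_def sp)
  also have "\<dots> = (\<Sum>R\<in>Pow Q. ennreal (?r R) * emeasure \<mu> (cell Q R))"
    by (rule nn_integral_cells[OF assms(5) Q HQ])
  also have "\<dots> = (\<Sum>R\<in>Pow Q. ennreal (?r R * measure \<mu> (cell Q R)))"
    by (rule sum.cong) (auto simp: emeasure_eq_measure ennreal_mult H0)
  also have "\<dots> = ennreal (\<Sum>R\<in>Pow Q. ?r R * measure \<mu> (cell Q R))" by (rule sum_ennreal) (simp add: H0)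
  also have "\<dots> = emeasure \<mu> A" unfolding eq by (simp add: emeasure_eq_measure)
  finally show "(\<integral>\<^sup>+\<eta>. ennreal (gibbs_prob \<Lambda>0 \<eta> A) \<partial>\<mu>) = emeasure \<mu> A" .
qed

text \<open>The flow itself is not local. But except with probability \<open>\<epsilon>\<close>, uniformly in
  \<open>k\<close>, it is carried by jumps inside a window \<open>near a T\<close>, and both this
  and the value of the flow inside the window are seen by local events.\<close>

lemma limit_flow:
  assumes "\<eta> \<in> Perms X" "flow X \<eta> = Fin n" "incseq \<Lambda>" "\<And>k. finite (\<Lambda> k)" "(\<Union>k. \<Lambda> k) = X"
    "sets \<mu> = sets (perm_borel X)" "prob_space \<mu>" "c \<ge> 1" "good_pt c n a"
    "\<And>E. E \<in> local_events \<Longrightarrow> (\<lambda>k. gibbs_prob (\<Lambda> k) \<eta> E) \<longlonglongrightarrow> measure \<mu> E"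
  shows "measure \<mu> (flow_set n) = 1"
proof (rule antisym)
  interpret prob_space \<mu> by (rule assms(7))
  have sp: "space \<mu> = Perms X" using sets_eq_imp_space_eq[OF assms(6)] by simp
  have C: "\<Lambda> k \<subseteq> X" for k using assms(5) by blast
  have cfg: "admissible (\<Lambda> k) \<eta>" for k using assms(1,4) C unfolding admissible_def by blast
  have am: "a \<in> midpoints X" by (rule good_ptD(1)[OF assms(9)])
  have Fs: "flow_set n \<in> sets \<mu>" using flow_set_sets assms(6) by simp
  show "measure \<mu> (flow_set n) \<le> 1" by (rule prob_le_1)
  show "1 \<le> measure \<mu> (flow_set n)"
  proof (rule field_le_epsilon)
    fix \<epsilon> :: real assume e: "\<epsilon> > 0"
    obtain T where T: "T \<ge> reach c n" and Tp: "\<forall>a \<Lambda> \<eta>. admissible \<Lambda> \<eta> \<longrightarrow> good_pt c n a \<longrightarrow> flow X \<eta> = Fin n \<longrightarrow>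
      suitable a (reach c n) \<Lambda> \<eta> \<longrightarrow> gibbs_prob \<Lambda> \<eta> {\<sigma>. \<not> tight a T \<sigma>} \<le> \<epsilon> / 2"
      using gibbs_prob_not_tight_le[OF assms(8), of "\<epsilon>/2" n] e by auto
    have ev: "eventually (\<lambda>k. gibbs_prob (\<Lambda> k) \<eta> {\<sigma>. \<not> tight a T \<sigma>} \<le> \<epsilon> / 2) sequentially"
      using eventually_suitable[OF assms(3,5,1,2) am, of "reach c n"]
      by eventually_elim (intro Tp[rule_format] cfg assms(2,9))
    have lim: "measure \<mu> E \<le> \<epsilon> / 2" if E: "E \<in> local_events" and sub: "\<And>\<sigma>. \<sigma> \<in> E \<Longrightarrow> flow X \<sigma> = Fin n \<Longrightarrow> \<not> tight a T \<sigma>" for E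
    proof (rule tendsto_upperbound[OF assms(10)[OF E]])
      show "eventually (\<lambda>k. gibbs_prob (\<Lambda> k) \<eta> E \<le> \<epsilon> / 2) sequentially"
        using ev
      proof eventually_elim
        case (elim k)
        have "gibbs_prob (\<Lambda> k) \<eta> E \<le> gibbs_prob (\<Lambda> k) \<eta> {\<sigma>. \<not> tight a T \<sigma>}"
          by (rule gibbs_prob_mono[OF cfg]) (use flow_resample[OF assms(1) C assms(4)] assms(2) sub in auto)
        thus ?case using elim by simp
      qed
    qed simp
    let ?W = "near a T"
    define g where "g x u = (if u \<in> ?W then left_of a x - left_of a u else 0)" for x u
    define B where "B = {\<sigma> \<in> Perms X. (\<Sum>x\<in>?W. g x (\<sigma> x)) \<noteq> n}"
    have near_sum: "(\<Sum>x\<in>?W. g x (\<sigma> x)) = (\<Sum>x\<in>?W. left_of a x - left_of a (\<sigma> x))"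
      if s: "\<sigma> \<in> Perms X" "tight a T \<sigma>" for \<sigma>
    proof (rule sum.cong[OF refl])
      fix x assume x: "x \<in> ?W"
      hence xX: "x \<in> X" "\<sigma> x \<in> X" using Perms_mem[OF s(1)] by (auto simp: near_def)
      show "g x (\<sigma> x) = left_of a x - left_of a (\<sigma> x)"
      proof (cases "\<sigma> x \<in> ?W")
        case False
        hence "\<not> crosses a x (\<sigma> x)" using tightD(2)[OF s(2) xX(1)] xX(2) by (auto simp: near_def)
        moreover have "a \<noteq> x" "a \<noteq> \<sigma> x" using midpoint_notin[OF am] xX by auto
        ultimately have "left_of a x - left_of a (\<sigma> x) = 0" 
          using left_of_diff_eq_0[of a x "\<sigma> x"] by blast
        thus ?thesis using False by (simp add: g_def)
      qed (simp add: g_def)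
    qed
    have cr: "crossers X a \<sigma> \<subseteq> ?W" if "tight a T \<sigma>" for \<sigma>
      using that by (auto simp: tight_def crossers_def near_def)
    have BL: "B \<in> local_events"
    proof -
      \<comment> \<open>A jump out of the window is given the value \<open>0\<close> by \<open>g\<close>, so only questions
        about pairs in the window matter.\<close>
      have gs: "(\<Sum>x\<in>?W. g x (\<sigma> x)) = (\<Sum>x\<in>?W. g x (\<tau> x))" if "hits (?W \<times> ?W) \<sigma> = hits (?W \<times> ?W) \<tau>" for \<sigma> \<tau>
      proof (rule sum.cong[OF refl])
        fix x assume x: "x \<in> ?W"
        have e: "\<sigma> x = u \<longleftrightarrow> \<tau> x = u" if "u \<in> ?W" for u
          using \<open>hits (?W \<times> ?W) \<sigma> = hits (?W \<times> ?W) \<tau>\<close> x that unfolding hits_def by (auto simp: set_eq_iff)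
        show "g x (\<sigma> x) = g x (\<tau> x)"
        proof (cases "\<sigma> x \<in> ?W")
          case True thus ?thesis using e[of "\<sigma> x"] by simp
        next
          case False
          hence "\<tau> x \<notin> ?W" using e[of "\<tau> x"] by auto
          thus ?thesis using False by (simp add: g_def)
        qed
      qed
      have "determined (?W \<times> ?W) B" unfolding determined_def
      proof (intro ballI impI)
        fix \<sigma> \<tau> assume p: "\<sigma> \<in> Perms X" "\<tau> \<in> Perms X" "hits (?W \<times> ?W) \<sigma> = hits (?W \<times> ?W) \<tau>"
        show "\<sigma> \<in> B \<longleftrightarrow> \<tau> \<in> B" unfolding B_def mem_Collect_eq gs[OF p(3)] using p(1,2) by blast
      qed
      thus ?thesis unfolding local_events_def using finite_near[of a T]
        by (intro CollectI conjI exI[of _ "?W \<times> ?W"]) (auto simp: B_def near_def)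
    qed
    have mB: "measure \<mu> B \<le> \<epsilon> / 2"
    proof (rule lim[OF BL])
      fix \<sigma> assume s: "\<sigma> \<in> B" "flow X \<sigma> = Fin n"
      hence sP: "\<sigma> \<in> Perms X" by (simp add: B_def)
      show "\<not> tight a T \<sigma>"
      proof
        assume t: "tight a T \<sigma>"
        have "(\<Sum>x\<in>?W. left_of a x - left_of a (\<sigma> x)) = n"
          by (rule flow_Fin_sum[OF sP am s(2) finite_near cr[OF t]]) (auto simp: near_def)
        thus False using near_sum[OF sP t] s(1) by (simp add: B_def)
      qed
    qed
    \<comment> \<open>The failure of tightness, restricted to jumps inside a box to make it a local event.\<close>
    define N where "N m = {\<sigma> \<in> Perms X. \<exists>x\<in>Box m. \<exists>u\<in>Box m. \<sigma> x = u \<and> crosses a x u \<and> \<not> (\<bar>x - a\<bar> \<le> T \<and> \<bar>u - a\<bar> \<le> T)}" for m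
    have NL: "N m \<in> local_events" for m
    proof -
      have "determined (Box m \<times> Box m) (N m)"
      proof -
        have "\<sigma> \<in> N m \<longleftrightarrow> \<sigma> \<in> Perms X \<and> (\<exists>p\<in>hits (Box m \<times> Box m) \<sigma>. crosses a (fst p) (snd p) \<and> \<not> (\<bar>fst p - a\<bar> \<le> T \<and> \<bar>snd p - a\<bar> \<le> T))" for \<sigma>
          by (auto simp: N_def hits_def)
        thus ?thesis unfolding determined_def by simp
      qed
      thus ?thesis unfolding local_events_def using Box(1,2)
        by (intro CollectI conjI exI[of _ "Box m \<times> Box m"]) (auto simp: N_def)
    qed
    have mN: "measure \<mu> (N m) \<le> \<epsilon> / 2" for m
    proof (rule lim[OF NL])
      fix \<sigma> assume "\<sigma> \<in> N m"
      then obtain x u where h: "x \<in> Box m" "u \<in> Box m" "\<sigma> x = u" "crosses a x u" "\<not> (\<bar>x - a\<bar> \<le> T \<and> \<bar>u - a\<bar> \<le> T)"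
        unfolding N_def by blast
      show "\<not> tight a T \<sigma>"
      proof
        assume t: "tight a T \<sigma>"
        have "x \<in> X" using h(1) Box(2) by blast
        thus False using tightD[OF t, of x] h by auto
      qed
    qed
    have Ns: "N m \<in> sets \<mu>" for m using local_events_sets[OF NL] assms(6) by simp
    have Bs: "B \<in> sets \<mu>" using local_events_sets[OF BL] assms(6) by simp
    have "incseq N"
    proof (rule monoI)
      fix k l :: nat assume "k \<le> l"
      hence "Box k \<subseteq> Box l" using Box(3) by (auto simp: incseq_def)
      thus "N k \<subseteq> N l" unfolding N_def by blast
    qed
    hence "(\<lambda>m. measure \<mu> (N m)) \<longlonglongrightarrow> measure \<mu> (\<Union>m. N m)"
      using Ns by (intro finite_Lim_measure_incseq) auto
    hence mU: "measure \<mu> (\<Union>m. N m) \<le> \<epsilon> / 2" by (rule LIMSEQ_le_const2) (use mN in blast)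
    have sub: "space \<mu> \<subseteq> flow_set n \<union> (B \<union> (\<Union>m. N m))"
    proof
      fix \<sigma> assume "\<sigma> \<in> space \<mu>"
      hence sP: "\<sigma> \<in> Perms X" using sp by simp
      show "\<sigma> \<in> flow_set n \<union> (B \<union> (\<Union>m. N m))"
      proof (cases "tight a T \<sigma>")
        case True
        show ?thesis
        proof (cases "\<sigma> \<in> B")
          case False
          hence "(\<Sum>x\<in>?W. left_of a x - left_of a (\<sigma> x)) = n" using near_sum[OF sP True] sP by (simp add: B_def)
          hence "flow X \<sigma> = Fin n"
            by (intro flow_FinI[OF sP am _ finite_near cr[OF True]]) (auto simp: near_def)
          thus ?thesis using sP by (simp add: flow_set_def)
        qed simp
      next
        case False
        then obtain x where x: "x \<in> X" "crosses a x (\<sigma> x)" "\<not> (\<bar>x - a\<bar> \<le> T \<and> \<bar>\<sigma> x - a\<bar> \<le> T)"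
          unfolding tight_def crossers_def by blast
        have "\<sigma> x \<in> X" using Perms_mem[OF sP] x(1) by simp
        hence "eventually (\<lambda>k. {x, \<sigma> x} \<subseteq> Box k) sequentially"
          using x(1) Box(4) by (intro eventually_superset[OF Box(3)]) auto
        then obtain m where "{x, \<sigma> x} \<subseteq> Box m" using eventually_happens' sequentially_bot by blast
        hence "\<sigma> \<in> N m" using x sP unfolding N_def by blast
        thus ?thesis by blast
      qed
    qed
    have Us: "(\<Union>m. N m) \<in> sets \<mu>" using Ns by auto
    have "1 = measure \<mu> (space \<mu>)" by (rule prob_space[symmetric])
    also have "\<dots> \<le> measure \<mu> (flow_set n \<union> (B \<union> (\<Union>m. N m)))"
      by (rule finite_measure_mono[OF sub]) (use Fs Bs Us in auto)
    also have "\<dots> \<le> measure \<mu> (flow_set n) + measure \<mu> (B \<union> (\<Union>m. N m))"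
      by (rule measure_Un_le) (use Fs Bs Us in auto)
    also have "measure \<mu> (B \<union> (\<Union>m. N m)) \<le> measure \<mu> B + measure \<mu> (\<Union>m. N m)"
      by (rule measure_Un_le) (use Fs Bs Us in auto)
    finally show "1 \<le> measure \<mu> (flow_set n) + \<epsilon>" using mB mU by simp
  qed
qed

lemma spec_subsequence_limit:
  assumes "\<eta> \<in> Perms X" "flow X \<eta> = Fin n" "incseq \<Lambda>" "\<And>k. finite (\<Lambda> k)" "(\<Union>k. \<Lambda> k) = X"
    "c \<ge> 1" "bi_infinite {a. good_pt c n a}"
  shows "\<exists>r \<mu>. strict_mono r \<and> \<mu> \<in> gibbs_flow X V n \<and>
    (\<forall>E\<in>local_events. (\<lambda>k. measure (spec X V (\<Lambda> (r k)) \<eta>) E) \<longlonglongrightarrow> measure \<mu> E)"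
proof -
  have C: "\<Lambda> k \<subseteq> X" for k using assms(5) by blast
  have cfg: "admissible (\<Lambda> k) \<eta>" for k using assms(1,4) C unfolding admissible_def by blast
  have "\<exists>r \<mu>. strict_mono r \<and> sets \<mu> = sets (perm_borel X) \<and> prob_space \<mu> \<and>
    (\<forall>E\<in>local_events. (\<lambda>k. measure (spec X V (\<Lambda> (r k)) \<eta>) E) \<longlonglongrightarrow> measure \<mu> E)"
    by (rule tight_limit_measure[of "\<lambda>k. spec X V (\<Lambda> k) \<eta>", OF prob_space_spec[OF cfg] spec_sets spec_tight[OF assms]])
  then obtain r \<mu> where r: "strict_mono r" and m: "sets \<mu> = sets (perm_borel X)" "prob_space \<mu>"
    and l: "\<forall>E\<in>local_events. (\<lambda>k. measure (spec X V (\<Lambda> (r k)) \<eta>) E) \<longlonglongrightarrow> measure \<mu> E" by (elim exE conjE)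
  have l': "(\<lambda>k. gibbs_prob (\<Lambda> (r k)) \<eta> E) \<longlonglongrightarrow> measure \<mu> E" if "E \<in> local_events" for E
    using bspec[OF l that] unfolding measure_spec[OF cfg local_events_sets[OF that]] .
  have inc: "incseq (\<lambda>k. \<Lambda> (r k))"
    using assms(3) r by (simp add: incseq_def strict_mono_leD)
  have U: "(\<Union>k. \<Lambda> (r k)) = X"
  proof (intro equalityI subsetI)
    fix x assume "x \<in> X"
    then obtain k where k: "x \<in> \<Lambda> k" using assms(5) by blast
    have "\<Lambda> k \<subseteq> \<Lambda> (r k)" using assms(3) seq_suble[OF r] by (simp add: incseq_def)
    thus "x \<in> (\<Union>k. \<Lambda> (r k))" using k by blast
  qed (use C in blast)
  obtain a where a: "good_pt c n a"
    using infinite_imp_nonempty[OF infinite_halves(1)[OF assms(7), of 0]] by blast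
  have "\<mu> \<in> gibbs X V" by (rule limit_gibbs[OF assms(1) inc assms(4) U m l'])
  moreover have "measure \<mu> (flow_set n) = 1" by (rule limit_flow[OF assms(1,2) inc assms(4) U m assms(6) a l'])
  hence "emeasure \<mu> {\<sigma> \<in> Perms X. flow X \<sigma> = Fin n} = 1"
    using finite_measure.emeasure_eq_measure[OF prob_space.finite_measure[OF m(2)]] by (simp add: flow_set_def)
  ultimately have "\<mu> \<in> gibbs_flow X V n" by (simp add: gibbs_flow_def)
  thus ?thesis using r l by blast
qed

end

section \<open>Weak convergence from local events\<close>

lemma (in prob_space) integral_step_approx:
  fixes f :: "'a \<Rightarrow> real" and v :: "nat \<Rightarrow> real"
  assumes f: "f \<in> borel_measurable M" "\<And>x. x \<in> space M \<Longrightarrow> \<bar>f x\<bar> \<le> B" "B \<ge> 0" "\<epsilon> \<ge> 0"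
    and D: "\<And>i. i < m \<Longrightarrow> D i \<in> events" "disjoint_family_on D {..<m}"
    and v: "\<And>i x. i < m \<Longrightarrow> x \<in> D i \<Longrightarrow> \<bar>f x - v i\<bar> \<le> \<epsilon>"
  shows "\<bar>expectation f - (\<Sum>i<m. v i * prob (D i))\<bar> \<le> \<epsilon> + B * prob (space M - (\<Union>i<m. D i))"
proof -
  let ?R = "space M - (\<Union>i<m. D i)"
  have R: "?R \<in> events" using D(1) by auto
  define g where "g x = (\<Sum>i<m. v i * indicator (D i) x)" for x
  have int_f: "integrable M f"
    by (rule integrable_const_bound[where B=B]) (use f in auto)
  have int_D: "integrable M (\<lambda>x. v i * indicator (D i) x :: real)" if "i < m" for i
    using D(1)[OF that] by (intro integrable_mult_right integrable_real_indicator) (auto simp: emeasure_eq_measure)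
  have int_g: "integrable M g" unfolding g_def by (intro Bochner_Integration.integrable_sum int_D) auto
  have eg: "expectation g = (\<Sum>i<m. v i * prob (D i))"
    unfolding g_def using int_D D(1) by (subst Bochner_Integration.integral_sum) auto
  have int_b: "integrable M (\<lambda>x. \<epsilon> + B * indicator ?R x)"
    using R by (intro Bochner_Integration.integrable_add integrable_mult_right integrable_real_indicator)
      (auto simp: emeasure_eq_measure)
  have pt: "\<bar>f x - g x\<bar> \<le> \<epsilon> + B * indicator ?R x" if x: "x \<in> space M" for x
  proof (cases "x \<in> ?R")
    case True
    hence "g x = 0" unfolding g_def by (intro sum.neutral) auto
    thus ?thesis using f(2)[OF x] f(4) True by simp
  next
    case False
    then obtain i where i: "i < m" "x \<in> D i" using x by auto
    have "g x = (\<Sum>j\<in>{i}. v j * indicator (D j) x)"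
      unfolding g_def
    proof (rule sum.mono_neutral_right)
      show "\<forall>j\<in>{..<m} - {i}. v j * indicator (D j) x = 0"
        using D(2) i unfolding disjoint_family_on_def by (auto simp: indicator_def)
    qed (use i in auto)
    hence "g x = v i" using i by simp
    thus ?thesis using v[OF i] False by simp
  qed
  have "\<bar>expectation f - expectation g\<bar> = \<bar>expectation (\<lambda>x. f x - g x)\<bar>" using int_f int_g by simp
  also have "\<dots> \<le> expectation (\<lambda>x. \<bar>f x - g x\<bar>)" by (rule integral_abs_bound)
  also have "\<dots> \<le> expectation (\<lambda>x. \<epsilon> + B * indicator ?R x)"
    by (rule integral_mono) (use int_f int_g int_b pt in auto)
  also have "\<dots> = \<epsilon> + B * prob ?R"
    using R int_b by (subst Bochner_Integration.integral_add)
      (auto simp: emeasure_eq_measure prob_space intro!: integrable_mult_right integrable_real_indicator)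
  finally show ?thesis unfolding eg .
qed

context point_set
begin

lemma continuous_borel:
  assumes "continuous_map (perm_topology X) euclideanreal f" shows "f \<in> borel_measurable (perm_borel X)"
proof (rule borel_measurableI)
  fix S :: "real set" assume S: "open S"
  have "openin (perm_topology X) {\<sigma> \<in> topspace (perm_topology X). f \<sigma> \<in> S}"
    by (rule openin_continuous_map_preimage[OF assms]) (use S in simp)
  hence "{\<sigma> \<in> Perms X. f \<sigma> \<in> S} \<in> sets (perm_borel X)" unfolding topspace_perm by (rule open_sets)
  moreover have "f -` S \<inter> space (perm_borel X) = {\<sigma> \<in> Perms X. f \<sigma> \<in> S}" by auto
  ultimately show "f -` S \<inter> space (perm_borel X) \<in> sets (perm_borel X)" by simp
qed

text \<open>A continuous function is nearly constant on small local events. Countably many of these cover the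
  space, and finitely many of them cover it up to a small probability under the limit and, by
  convergence on the complement, eventually under every \<open>M k\<close>. So the integral is
  nearly a finite sum of probabilities of local events.\<close>

lemma weak_limit_local_events:
  assumes M: "\<And>k. prob_space (M k)" "\<And>k. sets (M k) = sets (perm_borel X)"
    and \<mu>: "prob_space \<mu>" "sets \<mu> = sets (perm_borel X)"
    and lim: "\<And>E. E \<in> local_events \<Longrightarrow> (\<lambda>k. measure (M k) E) \<longlonglongrightarrow> measure \<mu> E"
  shows "weak_limit (perm_topology X) M \<mu>"
  unfolding weak_limit_def
proof (intro allI impI)
  fix f :: "(real \<Rightarrow> real) \<Rightarrow> real"
  assume f: "continuous_map (perm_topology X) euclideanreal f" "bounded (f ` topspace (perm_topology X))"
  interpret N: prob_space \<mu> by (rule \<mu>(1))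
  interpret alg: algebra "Perms X" local_events by (rule algebra_local_events)
  have sp: "space (M k) = Perms X" "space \<mu> = Perms X" for k
    using sets_eq_imp_space_eq[OF M(2)[of k]] sets_eq_imp_space_eq[OF \<mu>(2)] by simp_all
  obtain B where B: "B \<ge> 0" "\<And>\<sigma>. \<sigma> \<in> Perms X \<Longrightarrow> \<bar>f \<sigma>\<bar> \<le> B"
  proof -
    obtain b where b: "b > 0" "\<forall>y\<in>f ` Perms X. norm y \<le> b" using f(2) unfolding bounded_pos topspace_perm by auto
    show ?thesis by (rule that[of b]) (use b in auto)
  qed
  have fm: "f \<in> borel_measurable (perm_borel X)" by (rule continuous_borel[OF f(1)])
  have fmM: "f \<in> borel_measurable (M k)" "f \<in> borel_measurable \<mu>" for k
    using fm measurable_cong_sets[OF M(2) refl] measurable_cong_sets[OF \<mu>(2) refl] by blast+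
  show "(\<lambda>k. integral\<^sup>L (M k) f) \<longlonglongrightarrow> integral\<^sup>L \<mu> f"
  proof (rule LIMSEQ_I)
    fix \<delta> :: real assume \<delta>: "\<delta> > 0"
    define \<epsilon> where "\<epsilon> = \<delta> / (2 * (3 + 2 * B))"
    have \<epsilon>: "\<epsilon> > 0" "(3 + 2 * B) * \<epsilon> < \<delta>"
    proof -
      show "\<epsilon> > 0" unfolding \<epsilon>_def using \<delta> B(1) by simp
      have "(3 + 2 * B) * \<epsilon> = \<delta> / 2" unfolding \<epsilon>_def using B(1) by (simp add: field_simps)
      thus "(3 + 2 * B) * \<epsilon> < \<delta>" using \<delta> by simp
    qed
    define \<E> where "\<E> = {E \<in> local_events. \<exists>v. \<forall>\<sigma>\<in>E. \<bar>f \<sigma> - v\<bar> \<le> \<epsilon>}"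
    have cE: "countable \<E>" using countable_local_events by (rule countable_subset[rotated]) (auto simp: \<E>_def)
    have neE: "\<E> \<noteq> {}" using alg.empty_sets by (auto simp: \<E>_def)
    have cover: "\<exists>E\<in>\<E>. \<sigma> \<in> E" if s: "\<sigma> \<in> Perms X" for \<sigma>
    proof -
      let ?U = "{\<tau> \<in> topspace (perm_topology X). f \<tau> \<in> ball (f \<sigma>) \<epsilon>}"
      have "openin (perm_topology X) ?U" by (rule openin_continuous_map_preimage[OF f(1)]) simp
      moreover have "\<sigma> \<in> ?U" using s \<epsilon>(1) by (simp add: topspace_perm)
      ultimately obtain E where E: "E \<in> local_events" "\<sigma> \<in> E" "E \<subseteq> ?U" using open_basis by (elim bexE[OF open_basis] conjE)
      have "\<forall>\<tau>\<in>E. \<bar>f \<tau> - f \<sigma>\<bar> \<le> \<epsilon>" using E(3) by (auto simp: dist_real_def)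
      hence "E \<in> \<E>" using E(1) unfolding \<E>_def by blast
      thus ?thesis using E(2) by blast
    qed
    define A where "A = from_nat_into \<E>"
    have A: "A i \<in> \<E>" for i unfolding A_def by (rule from_nat_into[OF neE])
    have AL: "A i \<in> local_events" for i using A by (auto simp: \<E>_def)
    have Asurj: "\<exists>i. E = A i" if "E \<in> \<E>" for E unfolding A_def using from_nat_into_surj[OF cE that] by metis
    have "\<exists>v. \<forall>\<sigma>\<in>A i. \<bar>f \<sigma> - v\<bar> \<le> \<epsilon>" for i using A[of i] by (simp add: \<E>_def)
    hence "\<forall>i. \<exists>v. \<forall>\<sigma>\<in>A i. \<bar>f \<sigma> - v\<bar> \<le> \<epsilon>" ..
    from choice[OF this] obtain v where v: "\<forall>i. \<forall>\<sigma>\<in>A i. \<bar>f \<sigma> - v i\<bar> \<le> \<epsilon>" ..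
    define D where "D = disjointed A"
    have DA: "D i \<subseteq> A i" for i unfolding D_def by (rule disjointed_subset)
    have DL: "D i \<in> local_events" for i unfolding D_def disjointed_def using AL by (intro alg.Diff alg.finite_UN) auto
    have DU: "(\<Union>i<m. D i) = (\<Union>i<m. A i)" for m
      unfolding D_def lessThan_atLeast0 by (rule finite_UN_disjointed_eq)
    have dd: "disjoint_family_on D {..<m}" for m
      using disjoint_family_disjointed[of A] unfolding D_def disjoint_family_on_def by auto
    define R where "R m = Perms X - (\<Union>i<m. D i)" for m
    have RL: "R m \<in> local_events" for m unfolding R_def using DL by (intro alg.Diff alg.finite_UN alg.top) auto
    have "decseq R" unfolding R_def decseq_def by fastforce
    moreover have "(\<Inter>m. R m) = {}"
    proof (rule ccontr)
      assume "(\<Inter>m. R m) \<noteq> {}"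
      then obtain \<sigma> where s: "\<And>m. \<sigma> \<in> R m" by blast
      obtain i where "\<sigma> \<in> A i" using cover[of \<sigma>] s[of 0] Asurj by (auto simp: R_def)
      thus False using s[of "Suc i"] unfolding R_def DU by auto
    qed
    moreover have RE: "R m \<in> N.events" for m using local_events_sets[OF RL] \<mu>(2) by simp
    ultimately have "(\<lambda>m. N.prob (R m)) \<longlonglongrightarrow> 0"
      using N.finite_Lim_measure_decseq[of R] by auto
    then obtain m where m: "N.prob (R m) < \<epsilon>" using \<epsilon>(1) by (metis LIMSEQ_D abs_less_iff diff_0_right order_refl real_norm_def)
    let ?s = "\<lambda>\<nu>. \<Sum>i<m. v i * measure \<nu> (D i)"
    have ap: "\<bar>integral\<^sup>L \<nu> f - ?s \<nu>\<bar> \<le> \<epsilon> + B * measure \<nu> (R m)"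
      if "prob_space \<nu>" "sets \<nu> = sets (perm_borel X)" "f \<in> borel_measurable \<nu>" "space \<nu> = Perms X" for \<nu>
    proof -
      interpret prob_space \<nu> by (rule that(1))
      show ?thesis
        using integral_step_approx[of f B \<epsilon> m D v] that B \<epsilon>(1) local_events_sets[OF DL] dd v DA unfolding R_def by force
    qed
    have "(\<lambda>k. ?s (M k)) \<longlonglongrightarrow> ?s \<mu>" by (intro tendsto_sum tendsto_mult tendsto_const lim DL)
    hence "eventually (\<lambda>k. \<bar>?s (M k) - ?s \<mu>\<bar> < \<epsilon>) sequentially"
      using \<epsilon>(1) unfolding tendsto_iff dist_real_def by blast
    moreover have "eventually (\<lambda>k. measure (M k) (R m) < \<epsilon>) sequentially"
      by (rule order_tendstoD(2)[OF lim[OF RL] m])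
    ultimately have "eventually (\<lambda>k. norm (integral\<^sup>L (M k) f - integral\<^sup>L \<mu> f) < \<delta>) sequentially"
    proof eventually_elim
      case (elim k)
      have "\<bar>integral\<^sup>L (M k) f - ?s (M k)\<bar> \<le> \<epsilon> + B * measure (M k) (R m)" by (rule ap[OF M fmM(1) sp(1)])
      also have "\<dots> \<le> \<epsilon> + B * \<epsilon>" using elim(2) B(1) by (intro add_left_mono mult_left_mono) auto
      finally have 1: "\<bar>integral\<^sup>L (M k) f - ?s (M k)\<bar> \<le> \<epsilon> + B * \<epsilon>" .
      have "\<bar>integral\<^sup>L \<mu> f - ?s \<mu>\<bar> \<le> \<epsilon> + B * measure \<mu> (R m)" by (rule ap[OF \<mu> fmM(2) sp(2)])
      also have "\<dots> \<le> \<epsilon> + B * \<epsilon>" using m B(1) by (intro add_left_mono mult_left_mono) auto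
      finally have 2: "\<bar>integral\<^sup>L \<mu> f - ?s \<mu>\<bar> \<le> \<epsilon> + B * \<epsilon>" .
      have "\<bar>integral\<^sup>L (M k) f - integral\<^sup>L \<mu> f\<bar> \<le> (3 + 2 * B) * \<epsilon>"
        using 1 2 elim(1) by (simp add: algebra_simps)
      thus ?case using \<epsilon>(2) by simp
    qed
    thus "\<exists>no. \<forall>k\<ge>no. norm (integral\<^sup>L (M k) f - integral\<^sup>L \<mu> f) < \<delta>" by (simp add: eventually_sequentially)
  qed
qed

end

section \<open>Mixtures\<close>

lemma nn_integral_count_space_infsum:
  fixes f :: "'a :: countable \<Rightarrow> ennreal"
  shows "(\<integral>\<^sup>+x. f x \<partial>count_space UNIV) = infsum f UNIV"
proof -
  let ?A = "\<lambda>k. {x :: 'a. to_nat x \<le> k}"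
  have fin: "finite F \<Longrightarrow> (\<integral>\<^sup>+x. f x * indicator F x \<partial>count_space UNIV) = sum f F" for F
    by (subst nn_integral_indicator_finite) auto
  have fA: "finite (?A k)" for k
  proof -
    have "finite (to_nat -` {..k} :: 'a set)" by (rule finite_vimageI) auto
    thus ?thesis by (simp add: vimage_def)
  qed
  have isum: "infsum f UNIV = (SUP F\<in>{F. finite F \<and> F \<subseteq> UNIV}. sum f F)" by (rule nonneg_infsum_complete) simp
  have sup: "(SUP k. f x * indicator (?A k) x) = f x" for x
  proof (rule antisym)
    show "(SUP k. f x * indicator (?A k) x) \<le> f x" by (rule SUP_least) (simp add: indicator_def)
    have "f x = f x * indicator (?A (to_nat x)) x" by simp
    also have "\<dots> \<le> (SUP k. f x * indicator (?A k) x)" by (rule SUP_upper) simp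
    finally show "f x \<le> (SUP k. f x * indicator (?A k) x)" .
  qed
  have "(\<integral>\<^sup>+x. f x \<partial>count_space UNIV) = (\<integral>\<^sup>+x. (SUP k. f x * indicator (?A k) x) \<partial>count_space UNIV)"
    unfolding sup ..
  also have "\<dots> = (SUP k. \<integral>\<^sup>+x. f x * indicator (?A k) x \<partial>count_space UNIV)"
    by (rule nn_integral_monotone_convergence_SUP) (auto simp: incseq_def le_fun_def indicator_def)
  also have "\<dots> = (SUP k. sum f (?A k))" unfolding fin[OF fA] ..
  also have "\<dots> \<le> (SUP F\<in>{F. finite F \<and> F \<subseteq> UNIV}. sum f F)"
    by (rule SUP_least, rule SUP_upper) (use fA in simp)
  finally have 1: "(\<integral>\<^sup>+x. f x \<partial>count_space UNIV) \<le> infsum f UNIV" unfolding isum .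
  have "sum f F \<le> (\<integral>\<^sup>+x. f x \<partial>count_space UNIV)" if "finite F" for F
    unfolding fin[OF that, symmetric] by (rule nn_integral_mono) (simp add: indicator_def)
  hence "infsum f UNIV \<le> (\<integral>\<^sup>+x. f x \<partial>count_space UNIV)" unfolding isum by (intro SUP_least) auto
  thus ?thesis using 1 by simp
qed

lemma has_sum_one_iff:
  fixes c :: "int \<Rightarrow> real"
  assumes "\<And>n. c n \<ge> 0"
  shows "(c has_sum 1) UNIV \<longleftrightarrow> (\<integral>\<^sup>+n. ennreal (c n) \<partial>count_space UNIV) = 1"
proof -
  have se: "(\<Sum>n\<in>F. ennreal (c n)) = ennreal (sum c F)" for F by (rule sum_ennreal) (use assms in auto)
  have e: "(\<integral>\<^sup>+n. ennreal (c n) \<partial>count_space UNIV) = (SUP F\<in>{F. finite F \<and> F \<subseteq> UNIV}. ennreal (sum c F))"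
    unfolding nn_integral_count_space_infsum by (subst nonneg_infsum_complete) (auto simp: se)
  have k: "(\<integral>\<^sup>+n. ennreal (c n) \<partial>count_space UNIV) = ennreal (infsum c UNIV)" if "c summable_on UNIV"
    unfolding e using infsum_nonneg_is_SUPREMUM_ennreal[OF that] assms by simp
  show ?thesis
  proof
    assume "(c has_sum 1) UNIV"
    thus "(\<integral>\<^sup>+n. ennreal (c n) \<partial>count_space UNIV) = 1" using k infsumI has_sum_imp_summable by fastforce
  next
    assume o: "(\<integral>\<^sup>+n. ennreal (c n) \<partial>count_space UNIV) = 1"
    have "sum c F \<le> 1" if "finite F" for F
    proof -
      have "ennreal (sum c F) \<le> 1" unfolding o[symmetric] e by (rule SUP_upper) (use that in simp)
      thus ?thesis by (metis ennreal_le_1)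
    qed
    hence s: "c summable_on UNIV" by (intro nonneg_bdd_above_summable_on assms bdd_aboveI2[where M=1]) auto
    hence "infsum c UNIV = 1" using k o by (simp add: ennreal_eq_1)
    thus "(c has_sum 1) UNIV" using has_sum_infsum[OF s] by simp
  qed
qed

context permutation_gas
begin

text \<open>Written as a monadic bind over a discrete distribution, a mixture is visibly a measure, and
  integrals against it can be computed.\<close>

lemma mixture_eq_bind:
  assumes "\<And>n. 0 \<le> c n" "(c has_sum 1) UNIV" "\<And>n. prob_space (M n)" "\<And>n. sets (M n) = sets (perm_borel X)"
  shows "\<exists>p :: int pmf. (\<forall>n. pmf p n = c n) \<and> mixture X c M = measure_pmf p \<bind> M \<and>
    M \<in> measure_pmf p \<rightarrow>\<^sub>M subprob_algebra (perm_borel X) \<and> sets (measure_pmf p \<bind> M) = sets (perm_borel X)"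
proof -
  define p where "p = embed_pmf c"
  have o: "(\<integral>\<^sup>+n. ennreal (c n) \<partial>count_space UNIV) = 1" using has_sum_one_iff[OF assms(1)] assms(2) by simp
  have p: "pmf p n = c n" for n unfolding p_def by (rule pmf_embed_pmf[OF assms(1) o])
  have K: "M \<in> measure_pmf p \<rightarrow>\<^sub>M subprob_algebra (perm_borel X)"
    by (rule measurable_subprob_algebra) (use assms(3,4) prob_space_imp_subprob_space in auto)
  have s: "sets (measure_pmf p \<bind> M) = sets (perm_borel X)" by (rule sets_bind) (use assms(4) in auto)
  have spc: "space (measure_pmf p \<bind> M) = Perms X" using sets_eq_imp_space_eq[OF s] by simp
  have em: "emeasure (measure_pmf p \<bind> M) A = (\<Sum>\<^sub>\<infinity>n\<in>UNIV. ennreal (c n) * emeasure (M n) A)"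
    if A: "A \<in> sets (perm_borel X)" for A
  proof -
    have "emeasure (measure_pmf p \<bind> M) A = (\<integral>\<^sup>+n. emeasure (M n) A \<partial>measure_pmf p)"
      by (rule emeasure_bind[OF _ K A]) simp
    also have "\<dots> = (\<integral>\<^sup>+n. ennreal (c n) * emeasure (M n) A \<partial>count_space UNIV)"
      by (simp add: nn_integral_measure_pmf p)
    finally show ?thesis by (simp add: nn_integral_count_space_infsum)
  qed
  have "measure_pmf p \<bind> M = measure_of (Perms X) (sets (perm_borel X)) (emeasure (measure_pmf p \<bind> M))"
    using measure_of_of_measure[of "measure_pmf p \<bind> M"] unfolding s spc by simp
  also have "\<dots> = mixture X c M" unfolding mixture_def
  proof (rule measure_of_eq)
    show "sets (perm_borel X) \<subseteq> Pow (Perms X)" using sets.space_closed[of "perm_borel X"] by simp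
    fix A assume "A \<in> sigma_sets (Perms X) (sets (perm_borel X))"
    hence "A \<in> sets (perm_borel X)" using sets.sigma_sets_eq[of "perm_borel X"] by simp
    thus "emeasure (measure_pmf p \<bind> M) A = (\<Sum>\<^sub>\<infinity>n\<in>UNIV. ennreal (c n) * emeasure (M n) A)" by (rule em)
  qed
  finally show ?thesis using p K s by (intro exI[of _ p]) simp
qed

lemma gibbs_flowD:
  assumes "\<mu> \<in> gibbs_flow X V n"
  shows "\<mu> \<in> gibbs X V" "emeasure \<mu> (flow_set n) = 1" "AE \<sigma> in \<mu>. \<sigma> \<in> flow_set n"
    "\<And>E. E \<in> sets (perm_borel X) \<Longrightarrow> emeasure \<mu> (E \<inter> flow_set n) = emeasure \<mu> E"
proof -
  show g: "\<mu> \<in> gibbs X V" using assms by (simp add: gibbs_flow_def)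
  interpret prob_space \<mu> by (rule gibbsD(2)[OF g])
  show e: "emeasure \<mu> (flow_set n) = 1" using assms by (simp add: gibbs_flow_def flow_set_def)
  have Fs: "flow_set n \<in> events" using flow_set_sets gibbsD(1)[OF g] by simp
  have "prob (flow_set n) = 1" using e by (simp add: emeasure_eq_measure)
  thus ae: "AE \<sigma> in \<mu>. \<sigma> \<in> flow_set n" by (subst prob_eq_1[OF Fs, symmetric])
  fix E assume E: "E \<in> sets (perm_borel X)"
  show "emeasure \<mu> (E \<inter> flow_set n) = emeasure \<mu> E"
  proof (rule emeasure_eq_AE)
    show "AE \<sigma> in \<mu>. \<sigma> \<in> E \<inter> flow_set n \<longleftrightarrow> \<sigma> \<in> E" using ae by eventually_elim simp
  qed (use E Fs gibbsD(1)[OF g] in auto)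
qed

text \<open>The factor of proportionality in \<open>gibbs_proportional\<close> is \<open>1\<close>, since both
  measures are carried by the permutations of flow \<open>n\<close>.\<close>

lemma gibbs_flow_unique:
  assumes "c \<ge> 1" "bi_infinite {a. good_pt c n a}" "\<mu> \<in> gibbs_flow X V n" "\<nu> \<in> gibbs_flow X V n"
  shows "\<mu> = \<nu>"
proof -
  note m = gibbs_flowD[OF assms(3)] and n = gibbs_flowD[OF assms(4)]
  show ?thesis
  proof (rule perm_measure_eqI)
    show "sets \<mu> = sets (perm_borel X)" "sets \<nu> = sets (perm_borel X)" using gibbsD(1) m(1) n(1) by auto
    show "emeasure \<mu> (Perms X) \<noteq> \<infinity>"
      using prob_space.emeasure_space_1[OF gibbsD(2)[OF m(1)]] gibbsD(3)[OF m(1)] by simp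
    fix E assume E: "E \<in> local_events"
    show "emeasure \<mu> E = emeasure \<nu> E"
      using gibbs_proportional[OF m(1) n(1) assms(1,2) E]
      unfolding m(2) n(2) m(4)[OF local_events_sets[OF E]] n(4)[OF local_events_sets[OF E]] by simp
  qed
qed

text \<open>For existence, take a subsequential limit of the specifications with the shift by \<open>n\<close>
  as boundary condition, which has flow \<open>n\<close>.\<close>

lemma gibbs_flow_mu:
  assumes "condX X n" shows "gibbs_flow X V n = {mu X V n}"
proof -
  obtain c where c: "c \<ge> 1" "bi_infinite {a. good_pt c n a}" using condX_good[OF assms] by blast
  have U: "(\<Union>k. Box k) = X" by (rule Box(4))
  obtain r \<mu> where m: "\<mu> \<in> gibbs_flow X V n"
    using spec_subsequence_limit[OF theta_Perms theta_flow Box(3) Box(1) U c] by (elim exE conjE)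
  have e: "gibbs_flow X V n = {\<mu>}" using m gibbs_flow_unique[OF c] by blast
  thus ?thesis unfolding mu_def by simp
qed

text \<open>If the probability of some local event did not converge, some subsequence would stay away from its
  value under \<open>mu X V n\<close>; but a further subsequence converges to a Gibbs measure with
  flow \<open>n\<close>, and this can only be \<open>mu X V n\<close>.\<close>

lemma spec_weak_limit:
  assumes "condX X n" "\<eta> \<in> Perms X" "flow X \<eta> = Fin n" "\<And>k. finite (\<Lambda> k)" "incseq \<Lambda>" "(\<Union>k. \<Lambda> k) = X"
  shows "weak_limit (perm_topology X) (\<lambda>k. spec X V (\<Lambda> k) \<eta>) (mu X V n)"
proof -
  obtain c where c: "c \<ge> 1" "bi_infinite {a. good_pt c n a}" using condX_good[OF assms(1)] by blast
  have C: "\<Lambda> k \<subseteq> X" for k using assms(6) by blast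
  have cfg: "admissible (\<Lambda> k) \<eta>" for k using assms(2,4) C unfolding admissible_def by blast
  have g: "mu X V n \<in> gibbs X V" using gibbs_flow_mu[OF assms(1)] gibbs_flowD(1) by blast
  show ?thesis
  proof (rule weak_limit_local_events[OF prob_space_spec[OF cfg] spec_sets gibbsD(2,1)[OF g]])
    fix E assume E: "E \<in> local_events"
    show "(\<lambda>k. measure (spec X V (\<Lambda> k) \<eta>) E) \<longlonglongrightarrow> measure (mu X V n) E"
    proof (rule ccontr)
      assume "\<not> ?thesis"
      then obtain \<epsilon> where e: "\<epsilon> > 0" "\<not> eventually (\<lambda>k. dist (measure (spec X V (\<Lambda> k) \<eta>) E) (measure (mu X V n) E) < \<epsilon>) sequentially"
        unfolding tendsto_iff by blast
      hence "infinite {k. \<not> dist (measure (spec X V (\<Lambda> k) \<eta>) E) (measure (mu X V n) E) < \<epsilon>}"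
        unfolding cofinite_eq_sequentially[symmetric] eventually_cofinite by simp
      from infinite_enumerate[OF this] obtain s :: "nat \<Rightarrow> nat" where s: "strict_mono s"
        "\<And>k. \<not> dist (measure (spec X V (\<Lambda> (s k)) \<eta>) E) (measure (mu X V n) E) < \<epsilon>" by blast
      have inc: "incseq (\<lambda>k. \<Lambda> (s k))" using assms(5) s(1) by (simp add: incseq_def strict_mono_leD)
      have U: "(\<Union>k. \<Lambda> (s k)) = X"
      proof (intro equalityI subsetI)
        fix x assume "x \<in> X"
        then obtain k where k: "x \<in> \<Lambda> k" using assms(6) by blast
        have "\<Lambda> k \<subseteq> \<Lambda> (s k)" using assms(5) seq_suble[OF s(1)] by (simp add: incseq_def)
        thus "x \<in> (\<Union>k. \<Lambda> (s k))" using k by blast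
      qed (use C in blast)
      obtain r \<mu> where r: "\<mu> \<in> gibbs_flow X V n"
        "\<forall>E\<in>local_events. (\<lambda>k. measure (spec X V (\<Lambda> (s (r k))) \<eta>) E) \<longlonglongrightarrow> measure \<mu> E"
        using spec_subsequence_limit[OF assms(2,3) inc assms(4) U c] by (elim exE conjE)
      have "\<mu> = mu X V n" using r(1) gibbs_flow_mu[OF assms(1)] by blast
      hence "(\<lambda>k. measure (spec X V (\<Lambda> (s (r k))) \<eta>) E) \<longlonglongrightarrow> measure (mu X V n) E" using r(2) E by blast
      hence "eventually (\<lambda>k. dist (measure (spec X V (\<Lambda> (s (r k))) \<eta>) E) (measure (mu X V n) E) < \<epsilon>) sequentially"
        using e(1) by (rule tendstoD)
      hence "eventually (\<lambda>k. False) sequentially" by eventually_elim (use s(2) in blast)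
      thus False by simp
    qed
  qed
qed

text \<open>By \<open>gibbs_proportional\<close> the restriction of \<open>\<mu>\<close> to the event of flow
  \<open>n\<close> is a multiple of \<open>mu X V n\<close>, and by \<open>gibbs_flow_finite\<close>
  these events exhaust the space up to a null set.\<close>

lemma gibbs_is_mixture:
  assumes "\<And>n. condX X n" "\<mu> \<in> gibbs X V"
  shows "\<exists>c. \<mu> = mixture X c (mu X V) \<and> (\<forall>n. 0 \<le> c n) \<and> (c has_sum 1) UNIV"
proof -
  note G = gibbsD[OF assms(2)]
  interpret prob_space \<mu> by (rule G(2))
  have mg: "mu X V n \<in> gibbs_flow X V n" for n using gibbs_flow_mu[OF assms(1)] by blast
  note D = gibbs_flowD[OF mg]
  define c where "c n = measure \<mu> (flow_set n)" for n
  have c0: "c n \<ge> 0" for n by (simp add: c_def)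
  have Fs: "flow_set n \<in> events" for n using flow_set_sets G(1) by simp
  have part: "emeasure \<mu> (E \<inter> flow_set n) = ennreal (c n) * emeasure (mu X V n) E" if E: "E \<in> local_events" for E n
  proof -
    obtain k where k: "k \<ge> 1" "bi_infinite {a. good_pt k n a}" using condX_good[OF assms(1)] by blast
    show ?thesis using gibbs_proportional[OF assms(2) D(1)[of n] k E]
      unfolding D(2)[of n] D(4)[OF local_events_sets[OF E], of n] by (simp add: c_def emeasure_eq_measure)
  qed
  have total: "emeasure \<mu> E = (\<integral>\<^sup>+n. ennreal (c n) * emeasure (mu X V n) E \<partial>count_space UNIV)" if E: "E \<in> local_events" for E
  proof -
    have Es: "E \<in> events" using local_events_sets[OF E] G(1) by simp
    have "emeasure \<mu> E = emeasure \<mu> (\<Union>n. E \<inter> flow_set n)"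
    proof (rule emeasure_eq_AE)
      show "AE \<sigma> in \<mu>. \<sigma> \<in> E \<longleftrightarrow> \<sigma> \<in> (\<Union>n. E \<inter> flow_set n)"
        using gibbs_flow_finite[OF assms(2)] AE_space by eventually_elim (auto simp: flow_set_def G(3))
    qed (use Es Fs in auto)
    also have "\<dots> = (\<integral>\<^sup>+n. emeasure \<mu> (E \<inter> flow_set n) \<partial>count_space UNIV)"
      by (rule emeasure_UN_countable) (use Es Fs in \<open>auto simp: disjoint_family_on_def flow_set_def\<close>)
    finally show ?thesis unfolding part[OF E] .
  qed
  have one: "emeasure (mu X V n) (Perms X) = 1" for n
    using prob_space.emeasure_space_1[OF gibbsD(2)[OF D(1)]] gibbsD(3)[OF D(1)] by metis
  have "(\<integral>\<^sup>+n. ennreal (c n) \<partial>count_space UNIV) = 1"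
    using total[OF local_events_Perms] emeasure_space_1 unfolding one G(3) by simp
  hence cs: "(c has_sum 1) UNIV" using has_sum_one_iff[OF c0] by simp
  obtain p :: "int pmf" where p1: "\<forall>n. pmf p n = c n" and p2: "mixture X c (mu X V) = measure_pmf p \<bind> mu X V"
    "mu X V \<in> measure_pmf p \<rightarrow>\<^sub>M subprob_algebra (perm_borel X)" "sets (measure_pmf p \<bind> mu X V) = sets (perm_borel X)"
    using mixture_eq_bind[of c "mu X V", OF c0 cs gibbsD(2)[OF D(1)] gibbsD(1)[OF D(1)]] by (elim exE conjE)
  note p = p1[rule_format] p2
  have "\<mu> = measure_pmf p \<bind> mu X V"
  proof (rule perm_measure_eqI[OF G(1) p(4)])
    show "emeasure \<mu> (Perms X) \<noteq> \<infinity>" using emeasure_space_1 unfolding G(3) by simp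
    fix E assume E: "E \<in> local_events"
    have "emeasure (measure_pmf p \<bind> mu X V) E = (\<integral>\<^sup>+n. emeasure (mu X V n) E \<partial>measure_pmf p)"
      by (rule emeasure_bind[OF _ p(3) local_events_sets[OF E]]) simp
    also have "\<dots> = emeasure \<mu> E" unfolding total[OF E] by (simp add: nn_integral_measure_pmf p(1))
    finally show "emeasure \<mu> E = emeasure (measure_pmf p \<bind> mu X V) E" ..
  qed
  thus ?thesis using p(2) c0 cs by (intro exI[of _ c]) simp
qed

lemma mixture_is_gibbs:
  assumes "\<And>n. condX X n" "\<And>n. 0 \<le> c n" "(c has_sum 1) UNIV"
  shows "mixture X c (mu X V) \<in> gibbs X V"
proof -
  have mg: "mu X V n \<in> gibbs X V" for n using gibbs_flow_mu[OF assms(1)] gibbs_flowD(1) by blast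
  note D = gibbsD[OF mg]
  obtain p :: "int pmf" where p1: "\<forall>n. pmf p n = c n" and p2: "mixture X c (mu X V) = measure_pmf p \<bind> mu X V"
    "mu X V \<in> measure_pmf p \<rightarrow>\<^sub>M subprob_algebra (perm_borel X)" "sets (measure_pmf p \<bind> mu X V) = sets (perm_borel X)"
    using mixture_eq_bind[of c "mu X V", OF assms(2,3) D(2) D(1)] by (elim exE conjE)
  note p = p1[rule_format] p2
  show ?thesis unfolding p(2)
  proof (rule gibbsI[OF p(4)])
    show "prob_space (measure_pmf p \<bind> mu X V)"
      by (rule measure_pmf.prob_space_bind[OF _ p(3)]) (simp add: D(2))
    fix A \<Lambda> assume A: "A \<in> local_events" and L: "finite \<Lambda>" "\<Lambda> \<subseteq> X"
    have "(\<integral>\<^sup>+\<eta>. ennreal (gibbs_prob \<Lambda> \<eta> A) \<partial>(measure_pmf p \<bind> mu X V)) =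
      (\<integral>\<^sup>+n. \<integral>\<^sup>+\<eta>. ennreal (gibbs_prob \<Lambda> \<eta> A) \<partial>mu X V n \<partial>measure_pmf p)"
      by (rule nn_integral_bind[OF _ p(3)]) (use measurable_gibbs_prob[OF L local_events_sets[OF A]] in simp)
    also have "\<dots> = (\<integral>\<^sup>+n. emeasure (mu X V n) A \<partial>measure_pmf p)"
      unfolding D(4)[OF local_events_sets[OF A] L] ..
    also have "\<dots> = emeasure (measure_pmf p \<bind> mu X V) A"
      by (rule emeasure_bind[OF _ p(3) local_events_sets[OF A], symmetric]) simp
    finally show "(\<integral>\<^sup>+\<eta>. ennreal (gibbs_prob \<Lambda> \<eta> A) \<partial>(measure_pmf p \<bind> mu X V)) = emeasure (measure_pmf p \<bind> mu X V) A" .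
  qed
qed

end

section \<open>Classification of the Gibbs measures\<close>

theorem theorem2p15:
  fixes X :: "real set" and V :: "real \<Rightarrow> real"
  assumes "locally_finite_set X" and "bi_infinite X"
    and "condV1 V" and "condV2 V"
  shows
    "(\<forall>n::int. condX X n \<longrightarrow>
        gibbs_flow X V n = {mu X V n} \<and>
        (AE \<sigma> in mu X V n. finite (infinite_cycles X \<sigma>) \<and>
                           card (infinite_cycles X \<sigma>) = nat \<bar>n\<bar>) \<and>
        (\<forall>\<eta> \<Lambda>. \<eta> \<in> Perms X \<longrightarrow> flow X \<eta> = Fin n \<longrightarrow>
           (\<forall>k::nat. finite (\<Lambda> k)) \<longrightarrow> incseq \<Lambda> \<longrightarrow> (\<Union>k. \<Lambda> k) = X \<longrightarrow>
           weak_limit (perm_topology X) (\<lambda>k. spec X V (\<Lambda> k) \<eta>) (mu X V n)))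
     \<and>
     ((\<forall>n::int. condX X n) \<longrightarrow>
        gibbs X V = {mixture X c (mu X V) | c. (\<forall>n. 0 \<le> c n) \<and> (c has_sum 1) UNIV})"
proof -
  interpret permutation_gas X V by unfold_locales (rule assms)+
  show ?thesis
  proof (intro conjI allI impI)
    fix n :: int assume n: "condX X n"
    show "gibbs_flow X V n = {mu X V n}" by (rule gibbs_flow_mu[OF n])
    obtain c where c: "c \<ge> 1" "bi_infinite {a. good_pt c n a}" using condX_good[OF n] by blast
    have m: "mu X V n \<in> gibbs_flow X V n" using gibbs_flow_mu[OF n] by blast
    have "AE \<sigma> in mu X V n. flow X \<sigma> = Fin n"
      using gibbs_flowD(3)[OF m] by eventually_elim (simp add: flow_set_def)
    thus "AE \<sigma> in mu X V n. finite (infinite_cycles X \<sigma>) \<and> card (infinite_cycles X \<sigma>) = nat \<bar>n\<bar>"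
      by (rule AE_infinite_cycles[OF gibbs_flowD(1)[OF m] _ c])
    fix \<eta> and \<Lambda> :: "nat \<Rightarrow> real set"
    assume h: "\<eta> \<in> Perms X" "flow X \<eta> = Fin n" "\<forall>k. finite (\<Lambda> k)" "incseq \<Lambda>" "(\<Union>k. \<Lambda> k) = X"
    show "weak_limit (perm_topology X) (\<lambda>k. spec X V (\<Lambda> k) \<eta>) (mu X V n)"
      by (rule spec_weak_limit[OF n h(1,2) h(3)[rule_format] h(4,5)])
  next
    assume "\<forall>n. condX X n"
    hence n: "condX X n" for n by blast
    show "gibbs X V = {mixture X c (mu X V) | c. (\<forall>n. 0 \<le> c n) \<and> (c has_sum 1) UNIV}"
    proof (intro equalityI subsetI)
      fix \<mu> assume "\<mu> \<in> gibbs X V"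
      from gibbs_is_mixture[OF n this] show "\<mu> \<in> {mixture X c (mu X V) | c. (\<forall>n. 0 \<le> c n) \<and> (c has_sum 1) UNIV}" by blast
    next
      fix \<mu> assume "\<mu> \<in> {mixture X c (mu X V) | c. (\<forall>n. 0 \<le> c n) \<and> (c has_sum 1) UNIV}"
      then obtain c where "\<mu> = mixture X c (mu X V)" "\<forall>n. 0 \<le> c n" "(c has_sum 1) UNIV" by blast
      thus "\<mu> \<in> gibbs X V" using mixture_is_gibbs[OF n] by simp
    qed
  qed
qed

end
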